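(* Let $m\ge2$, $n\ge1$ and $i\ge 1$ be integers, and let $\boldsymbol\alpha$ be a real $m\times n$ matrix which is not $\phi_i$-approximable, where \[ \phi_i(q)=h_i(q)\log\log q,\qquad h_i(q)=\frac{1}{\big(q^n\log(q)\log\log(q)\cdots\log^{(i)}(q)\big)^{1/m}} \] ($\log^{(i)}$ denoting the $i$-fold iterated logarithm). Then for every Hardy $L$-function $\psi$ such that $\sum_{q} q^{n-1}\psi^m(q)$ diverges, the set $\mathcal T_\psi(\boldsymbol\alpha)$ has full measure on every nondegenerate analytic submanifold $\mathcal M$ of $\mathbb R^m$, i.e. $\mathcal M\setminus\mathcal T_\psi(\boldsymbol\alpha)$ is null with respect to the induced Lebesgue measure on $\mathcal M$.
   Context: $\|\cdot\|$ is the Euclidean norm. For a real $a\times b$ matrix $A$ and a function $\psi$ (defined at least for large arguments), $A$ is $\psi$-approximable if there are infinitely many $(\mathbf p,\mathbf q)\in\mathbb Z^a\times(\mathbb Z^b\setminus\{\mathbf 0\})$ with $\|A\mathbf q+\mathbf p\|\le\psi(\|\mathbf q\|)$. $\mathcal T_\psi(\boldsymbol\alpha)$ is the set of $\boldsymbol\beta\in\mathbb R^m$ such that there are infinitely many $(\mathbf p,\mathbf q)\in\mathbb Z^m\times(\mathbb Z^n\setminus\{\mathbf 0\})$ with $\|\boldsymbol\alpha\mathbf q+\boldsymbol\beta+\mathbf p\|\le\psi(\|\mathbf q\|)$. A Hardy $L$-function is a function expressible using only $+,-,\times,\div$, exponentials, logarithms and real constants, and well defined on some interval $(t_0,\infty)$.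 A manifold $\mathcal M\subset\mathbb R^m$ with local parametrization $\mathbf f$ is nondegenerate at $\mathbf f(\mathbf x)$ if for some $k$, $\mathbf f$ is $C^k$ and its partial derivatives at $\mathbf x$ of orders $1,\dots,k$ span $\mathbb R^m$; it is nondegenerate if it is nondegenerate at almost every point (for connected analytic $\mathcal M$ this means $\mathcal M$ is not contained in an affine hyperplane). Measure on $\mathcal M$ is the induced Lebesgue measure.
   Formalization: The Hardy L-function ψ is additionally assumed to be nonnegative for all large arguments; without this the claim fails, e.g. for ψ = −1 with m even the sum diverges but T_ψ(α) is empty. *)

theory Defs
  imports "HOL-Analysis.Analysis"
begin

section \<open>Diophantine approximation\<close>

definition int_vecs :: "(real^'a) set" where
  "int_vecs = {x. \<forall>i. x $ i \<in> \<int>}"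

text \<open>
  In the next two definitions the values of \<open>\<psi>\<close> on a bounded set are immaterial: only finitely
  many \<open>q\<close> have norm below a given bound, and each of them admits only finitely many \<open>p\<close>.
  Hence \<open>\<psi>\<close> may be any total function that has the intended values for large arguments.
\<close>

definition approximable :: "(real \<Rightarrow> real) \<Rightarrow> real^'b^'a \<Rightarrow> bool" where
  "approximable \<psi> A \<longleftrightarrow>
     infinite {(p, q). p \<in> int_vecs \<and> q \<in> int_vecs - {0} \<and> norm (A *v q + p) \<le> \<psi> (norm q)}"

definition approx_targets :: "(real \<Rightarrow> real) \<Rightarrow> real^'n^'m \<Rightarrow> (real^'m) set" where
  "approx_targets \<psi> \<alpha> =
     {\<beta>. infinite {(p, q). p \<in> int_vecs \<and> q \<in> int_vecs - {0} \<and>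
                           norm (\<alpha> *v q + \<beta> + p) \<le> \<psi> (norm q)}}"

definition h_fun :: "nat \<Rightarrow> nat \<Rightarrow> nat \<Rightarrow> real \<Rightarrow> real" where
  "h_fun m n i q = 1 / (q ^ n * (\<Prod>j=1..i. (ln ^^ j) q)) powr (1 / real m)"

definition phi_fun :: "nat \<Rightarrow> nat \<Rightarrow> nat \<Rightarrow> real \<Rightarrow> real" where
  "phi_fun m n i q = h_fun m n i q * ln (ln q)"


section \<open>Hardy L-functions\<close>

datatype L_expr =
    L_Var
  | L_Const real
  | L_Add L_expr L_expr
  | L_Sub L_expr L_expr
  | L_Mul L_expr L_expr
  | L_Div L_expr L_expr
  | L_Exp L_expr
  | L_Log L_expr

primrec L_val :: "L_expr \<Rightarrow> real \<Rightarrow> real" where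
  "L_val L_Var t = t"
| "L_val (L_Const c) t = c"
| "L_val (L_Add a b) t = L_val a t + L_val b t"
| "L_val (L_Sub a b) t = L_val a t - L_val b t"
| "L_val (L_Mul a b) t = L_val a t * L_val b t"
| "L_val (L_Div a b) t = L_val a t / L_val b t"
| "L_val (L_Exp a) t = exp (L_val a t)"
| "L_val (L_Log a) t = ln (L_val a t)"

text \<open>
  Division and \<^const>\<open>ln\<close> are total in HOL, so genuine well-definedness is a separate predicate.
\<close>

primrec L_defined :: "L_expr \<Rightarrow> real \<Rightarrow> bool" where
  "L_defined L_Var t \<longleftrightarrow> True"
| "L_defined (L_Const c) t \<longleftrightarrow> True"
| "L_defined (L_Add a b) t \<longleftrightarrow> L_defined a t \<and> L_defined b t"
| "L_defined (L_Sub a b) t \<longleftrightarrow> L_defined a t \<and> L_defined b t"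
| "L_defined (L_Mul a b) t \<longleftrightarrow> L_defined a t \<and> L_defined b t"
| "L_defined (L_Div a b) t \<longleftrightarrow> L_defined a t \<and> L_defined b t \<and> L_val b t \<noteq> 0"
| "L_defined (L_Exp a) t \<longleftrightarrow> L_defined a t"
| "L_defined (L_Log a) t \<longleftrightarrow> L_defined a t \<and> L_val a t > 0"

definition Hardy_L :: "(real \<Rightarrow> real) \<Rightarrow> bool" where
  "Hardy_L \<psi> \<longleftrightarrow> (\<exists>e t0. \<forall>t>t0. L_defined e t \<and> \<psi> t = L_val e t)"


section \<open>Analytic submanifolds of Euclidean space\<close>

text \<open>
  Real analyticity in several variables: local expansion in an (unconditionally, hence
  absolutely) convergent power series. The summation index \<open>k\<close> ranges over all multi-indices.
\<close>

definition real_analytic_on :: "(real^'d \<Rightarrow> real^'m) \<Rightarrow> (real^'d) set \<Rightarrow> bool" where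
  "real_analytic_on f U \<longleftrightarrow>
     (\<forall>x\<in>U. \<exists>c :: ('d \<Rightarrow> nat) \<Rightarrow> real^'m. \<exists>e>0. \<forall>y\<in>ball x e.
        ((\<lambda>k. (\<Prod>j\<in>UNIV. (y $ j - x $ j) ^ k j) *\<^sub>R c k) has_sum f y) UNIV)"

definition local_param :: "(real^'m) set \<Rightarrow> (real^'d) set \<Rightarrow> (real^'d \<Rightarrow> real^'m) \<Rightarrow> bool" where
  "local_param M U f \<longleftrightarrow>
     open U \<and> real_analytic_on f U \<and>
     (\<forall>x\<in>U. inj (frechet_derivative f (at x))) \<and>
     openin (top_of_set M) (f ` U) \<and>
     (\<exists>g. homeomorphism U (f ` U) f g)"

text \<open>
  The dimension of a submanifold is \<open>CARD('d)\<close>. It is at least 1; zero-dimensional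
  submanifolds are excluded, but these are never nondegenerate (unless empty) in positive
  ambient dimension.
\<close>

definition analytic_submanifold :: "'d::finite itself \<Rightarrow> (real^'m) set \<Rightarrow> bool" where
  "analytic_submanifold _ M \<longleftrightarrow>
     (\<forall>y\<in>M. \<exists>(U :: (real^'d) set) f. local_param M U f \<and> y \<in> f ` U)"

text \<open>
  The volume measure of a parametrized patch, as a Borel measure on the ambient space carried
  by \<open>f ` U\<close>: the push-forward of \<open>sqrt (det (J\<^sup>T J)) dx\<close>, where \<open>J\<close> is the Jacobian of \<open>f\<close>.
\<close>

definition patch_measure :: "(real^'d) set \<Rightarrow> (real^'d \<Rightarrow> real^'m) \<Rightarrow> (real^'m) measure" where
  "patch_measure U f =
     distr (density (restrict_space lborel U)
              (\<lambda>x. ennreal (sqrt (det (transpose (jacobian f (at x)) ** jacobian f (at x))))))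
       borel f"

text \<open>
  The induced Lebesgue measure on \<open>M\<close>, as a Borel measure on the ambient space carried by \<open>M\<close>.
  By the change of variables formula the patch measures of two local parametrizations agree
  on the overlap of their images, so their supremum in the lattice of measures (the least
  measure above all of them, not the pointwise supremum of set functions) is the measure that
  restricts to the patch measure on the image of each local parametrization.
\<close>

definition induced_measure :: "'d::finite itself \<Rightarrow> (real^'m) set \<Rightarrow> (real^'m) measure" where
  "induced_measure _ M =
     (SUP (U, f) \<in> {(U :: (real^'d) set, f). local_param M U f}. patch_measure U f)"


section \<open>Nondegeneracy\<close>

definition partial_deriv :: "'d::finite \<Rightarrow> (real^'d \<Rightarrow> real^'m) \<Rightarrow> real^'d \<Rightarrow> real^'m" where
  "partial_deriv j f x = vector_derivative (\<lambda>t. f (x + t *\<^sub>R axis j 1)) (at 0)"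

text \<open>\<open>iter_partial js f\<close> is a partial derivative of \<open>f\<close> of order \<open>length js\<close>.\<close>

definition iter_partial :: "'d::finite list \<Rightarrow> (real^'d \<Rightarrow> real^'m) \<Rightarrow> real^'d \<Rightarrow> real^'m" where
  "iter_partial js f = foldr partial_deriv js f"

definition C_k_on :: "nat \<Rightarrow> (real^'d \<Rightarrow> real^'m) \<Rightarrow> (real^'d) set \<Rightarrow> bool" where
  "C_k_on k f V \<longleftrightarrow>
     (\<forall>js. length js \<le> k \<longrightarrow> continuous_on V (iter_partial js f)) \<and>
     (\<forall>js. length js < k \<longrightarrow>
        (\<forall>x\<in>V. \<forall>j. (\<lambda>t. iter_partial js f (x + t *\<^sub>R axis j 1)) differentiable (at 0)))"

definition nondegenerate_param :: "(real^'d \<Rightarrow> real^'m) \<Rightarrow> real^'d \<Rightarrow> bool" where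
  "nondegenerate_param f x \<longleftrightarrow>
     (\<exists>k. (\<exists>V. open V \<and> x \<in> V \<and> C_k_on k f V) \<and>
          span {iter_partial js f x | js. 1 \<le> length js \<and> length js \<le> k} = UNIV)"

text \<open>By the chain rule this does not depend on the choice of the local parametrization.\<close>

definition nondegenerate_at :: "'d::finite itself \<Rightarrow> (real^'m) set \<Rightarrow> real^'m \<Rightarrow> bool" where
  "nondegenerate_at _ M y \<longleftrightarrow>
     (\<exists>(U :: (real^'d) set) f x. local_param M U f \<and> x \<in> U \<and> f x = y \<and> nondegenerate_param f x)"

definition nondegenerate :: "'d::finite itself \<Rightarrow> (real^'m) set \<Rightarrow> bool" where
  "nondegenerate D M \<longleftrightarrow> (AE y in induced_measure D M. y \<in> M \<longrightarrow> nondegenerate_at D M y)"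

end

theory Submission
  imports Defs "HOL-Complex_Analysis.Cauchy_Integral_Formula" "HOL-Real_Asymp.Real_Asymp"
begin

text \<open>
  A divergence hypothesis on a Hardy \<open>L\<close>-function \<open>\<psi>\<close> forces \<open>\<psi> \<ge> h\<^sub>j\<close> eventually for some \<open>j \<ge> i\<close>: the
  germs involved lie in a Hardy field of finite transcendence degree, so the primitive of
  \<open>t\<^sup>n\<^sup>-\<^sup>1 \<psi>\<^sup>m\<close> cannot grow more slowly than every iterated logarithm. It remains to treat \<open>h\<^sub>j\<close>.

  Locally, the image measure of a nondegenerate analytic patch has a power Fourier decay, by van
  der Corput's lemma. Let \<open>G\<^sub>k(\<beta>)\<close> count, with smooth nonnegative weights, the \<open>q\<close> with
  \<open>\<bar>q\<bar> \<le> 2\<^sup>k\<close> for which \<open>\<alpha>q + \<beta>\<close> is within \<open>h\<^sub>j(2\<^sup>k)\<close> of an integer vector. The hypothesis on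
  \<open>\<alpha>\<close> separates the points \<open>\<alpha>q\<close> modulo 1, and by transference it separates the
  dual forms; so the Fourier coefficients of \<open>G\<^sub>k\<close> are nonnegative with bounded sum, and Fourier
  decay makes the \<open>G\<^sub>k\<close> quasi-independent. As the sum of their means diverges, the second moment method
  shows that almost surely infinitely many \<open>G\<^sub>k\<close> are nonzero.
\<close>

text \<open>The delicate point is the correlation of neighbouring scales. For a scale
  \<open>l\<close> there are about \<open>ln l\<close> scales \<open>k <= l\<close> for which
  \<open>2 ^ (l - k)\<close> is below a fixed power of \<open>l\<close>. For these the transference
  bounds give no gain: each could contribute a constant multiple of the mean of the
  \<open>l\<close>-th count, while the second moment method tolerates only a bounded total. The
  factor \<open>log log q\<close> in \<open>phi_fun\<close> buys separation in boxes larger by a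
  factor \<open>t\<close> with \<open>t ^ n >= ln k\<close>, and this lowers each such contribution
  by \<open>1 / ln k\<close>, just enough. The enlargement costs about \<open>ln k\<close> in volume
  while \<open>(log log q) ^ m\<close> is available, so \<open>m >= 2\<close> leaves room for all
  constants. Scales further apart gain \<open>1 / l ^ 2\<close> from the dual forms, and distinct
  frequencies gain a power of \<open>2 ^ l\<close>. Nonnegative Fourier coefficients serve
  throughout: their sum is the value of the count at 0, hence bounded by the number of near returns
  of \<open>\<alpha> q\<close> to the integer lattice.\<close>

abbreviation ev_at_top :: "(real => bool) => bool" (binder "evt " 10) where
 "ev_at_top P \<equiv> eventually P at_top"

section \<open>Characters and the Fejer kernel\<close>

definition ee :: "real => complex" where "ee x = cis (2 * pi * x)"

lemma ee_add: "ee (x + y) = ee x * ee y"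
 by (simp add: ee_def cis_mult ring_distribs)

lemma ee_0 [simp]: "ee 0 = 1"
 by (simp add: ee_def)

lemma norm_ee [simp]: "norm (ee x) = 1"
 by (simp add: ee_def)

lemma ee_of_int [simp]: "ee (of_int k) = 1"
proof -
 have "cis (2 * pi * of_int k) = 1"
  by (simp add: cis.ctr cos_int_2pin sin_int_2pin complex_eq_iff)
 then show ?thesis by (simp add: ee_def)
qed

lemma ee_minus: "ee (- x) = cnj (ee x)"
 by (simp add: ee_def cis_cnj)

lemma ee_sum: "ee (sum f A) = (\<Prod>i\<in>A. ee (f i))"
 by (induction A rule: infinite_finite_induct) (auto simp: ee_add)

lemma ee_power: "ee (of_nat n * x) = ee x ^ n"
 by (induction n) (auto simp: ee_add ring_distribs)

lemma continuous_on_ee [continuous_intros]: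
 assumes "continuous_on S f" shows "continuous_on S (%x. ee (f x))"
 unfolding ee_def by (intro continuous_intros assms)

lemma borel_measurable_ee [measurable]: "ee \<in> borel_measurable borel"
 by (rule borel_measurable_continuous_onI) (intro continuous_intros)

text \<open>Fejer kernel normalised to have peak \<open>N\<close> at the integers. As a normalised
  square it is visibly nonnegative; its coefficients \<open>1 - |q| / N\<close> reappear as the
  weights \<open>wq\<close>.\<close>

definition fejer :: "nat => real => real" where
 "fejer N t = (norm (\<Sum>q<N. ee (of_nat q * t)))\<^sup>2 / N"

lemma fejer_nonneg: "0 <= fejer N t"
 by (simp add: fejer_def)

text \<open>Passing from \<open>N\<close> to \<open>Suc N\<close> raises every coefficient by 1,
  that is, adds the Dirichlet sum over \<open>|q| <= N\<close>. With \<open>D\<close> the old sum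
  and \<open>z\<close> the new term this is \<open>D * cnj z + cnj D * z + 1\<close>, which is
  exactly the growth of \<open>|D|^2\<close> when \<open>D\<close> becomes
  \<open>D + z\<close>.\<close>

lemma fejer_expand_aux:
 "of_real ((norm (\<Sum>q<N. ee (of_nat q * t)))\<^sup>2) =
  (\<Sum>q\<in>{-int N..int N}. of_real (of_nat N - \<bar>of_int q\<bar>) * ee (of_int q * t))"
proof (induction N)
 case 0
 then show ?case by simp
next
 case (Suc N)
 define D where "D = (\<Sum>q<N. ee (of_nat q * t))"
 define z where "z = ee (of_nat N * t)"
 have zz: "z * cnj z = 1"
  by (metis complex_norm_square mult_1 norm_ee of_real_1 power_one z_def)
 have split: "{-int (Suc N)..int (Suc N)} = insert (-int (Suc N)) (insert (int (Suc N)) {-int N..int N})"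
  by auto
 have "(\<Sum>q\<in>{-int (Suc N)..int (Suc N)}. of_real (of_nat (Suc N) - \<bar>of_int q\<bar>) * ee (of_int q * t))
   = (\<Sum>q\<in>{-int N..int N}. of_real (of_nat (Suc N) - \<bar>of_int q\<bar>) * ee (of_int q * t))"
  unfolding split by (subst sum.insert; simp)+
 also have "... = (\<Sum>q\<in>{-int N..int N}. of_real (of_nat N - \<bar>of_int q\<bar>) * ee (of_int q * t)) +
   (\<Sum>q\<in>{-int N..int N}. ee (of_int q * t))"
  unfolding sum.distrib[symmetric] by (rule sum.cong) (auto simp: algebra_simps)
 also have "(\<Sum>q\<in>{-int N..int N}. ee (of_int q * t)) = cnj D * z + D * cnj z + 1"
 proof -
  have "{-int N..int N} = {-int N..-1} \<union> ({1..int N} \<union> {0})" by auto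
  then have "(\<Sum>q\<in>{-int N..int N}. ee (of_int q * t)) =
   (\<Sum>q\<in>{-int N..-1}. ee (of_int q * t)) + ((\<Sum>q\<in>{1..int N}. ee (of_int q * t)) + (\<Sum>q\<in>{0::int}. ee (of_int q * t)))"
   by (simp only:) (subst sum.union_disjoint; auto)+
  also have "(\<Sum>q\<in>{-int N..-1}. ee (of_int q * t)) = D * cnj z"
   unfolding D_def sum_distrib_right
   by (rule sum.reindex_bij_witness[of _ "%q. int q - int N" "%q. nat (q + int N)"])
     (auto simp: z_def ee_add[symmetric] ee_minus[symmetric] algebra_simps)
  also have "(\<Sum>q\<in>{1..int N}. ee (of_int q * t)) = cnj D * z"
   unfolding D_def cnj_sum sum_distrib_right
   by (rule sum.reindex_bij_witness[of _ "%q. int N - int q" "%q. nat (int N - q)"])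
     (auto simp: z_def ee_add[symmetric] ee_minus[symmetric] algebra_simps)
  finally show ?thesis by simp
 qed
 also have "(\<Sum>q\<in>{-int N..int N}. of_real (of_nat N - \<bar>of_int q\<bar>) * ee (of_int q * t)) = D * cnj D"
  using Suc.IH unfolding D_def[symmetric] complex_norm_square by simp
 also have "D * cnj D + (cnj D * z + D * cnj z + 1) = (D + z) * cnj (D + z)"
  using zz by (simp add: algebra_simps)
 also have "... = of_real ((norm (\<Sum>q<Suc N. ee (of_nat q * t)))\<^sup>2)"
  unfolding complex_norm_square D_def z_def by simp
 finally show ?case by simp
qed

lemma fejer_expand:
 assumes "N > 0"
 shows "of_real (fejer N t) =
  (\<Sum>q\<in>{-int N..int N}. of_real (1 - \<bar>of_int q\<bar> / of_nat N) * ee (of_int q * t))"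
proof -
 have "of_real (fejer N t) = of_real ((norm (\<Sum>q<N. ee (of_nat q * t)))\<^sup>2) / (of_nat N :: complex)"
  by (simp add: fejer_def)
 also have "... = (\<Sum>q\<in>{-int N..int N}. of_real (of_nat N - \<bar>of_int q\<bar>) * ee (of_int q * t)) / of_nat N"
  by (simp only: fejer_expand_aux)
 also have "... = (\<Sum>q\<in>{-int N..int N}. of_real (1 - \<bar>of_int q\<bar> / of_nat N) * ee (of_int q * t))"
  unfolding sum_divide_distrib by (rule sum.cong) (use assms in \<open>auto simp: field_simps\<close>)
 finally show ?thesis .
qed

lemma fejer_le: "fejer N t <= N"
proof -
 have "norm (\<Sum>q<N. ee (of_nat q * t)) <= (\<Sum>q<N. norm (ee (of_nat q * t)))"
  by (rule norm_sum)
 then have "norm (\<Sum>q<N. ee (of_nat q * t)) <= N" by simp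
 then have "(norm (\<Sum>q<N. ee (of_nat q * t)))\<^sup>2 <= (real N)\<^sup>2" by (intro power_mono) auto
 then show ?thesis unfolding fejer_def
  by (cases "N = 0") (auto simp: divide_le_eq power2_eq_square)
qed

lemma fejer_0 [simp]: "fejer N 0 = N"
 by (simp add: fejer_def power2_eq_square)

text \<open>The slope \<open>1/2\<close> is \<open>cos (pi/3)\<close>: up to \<open>pi/3\<close> the
  difference has nonnegative derivative, and from there on \<open>sqrt 3 / 2\<close> already exceeds
  \<open>pi / 4\<close>.\<close>

lemma sin_ge_half:
 fixes x :: real assumes "0 <= x" "x <= pi / 2" shows "x / 2 <= sin x"
proof (cases "x <= pi / 3")
 case True
 have "0 <= sin x - x / 2"
 proof -
  have "sin 0 - 0 / 2 <= sin x - x / 2"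
  proof (rule DERIV_nonneg_imp_nondecreasing[OF assms(1)])
   fix y :: real assume y: "0 <= y" "y <= x"
   have "cos (pi / 3) <= cos y" using y True by (intro cos_monotone_0_pi_le) auto
   then have "0 <= cos y - 1 / 2" by (simp add: cos_60)
   moreover have "((%y. sin y - y / 2) has_real_derivative (cos y - 1 / 2)) (at y)"
    by (auto intro!: derivative_eq_intros)
   ultimately show "EX d. ((%y. sin y - y / 2) has_real_derivative d) (at y) & 0 <= d" by blast
  qed
  then show ?thesis by simp
 qed
 then show ?thesis by simp
next
 case False
 have "sin (pi / 3) <= sin x" using False assms by (intro sin_monotone_2pi_le) auto
 moreover have "sin (pi / 3) = sqrt 3 / 2" by (simp add: sin_60)
 moreover have "1.7 <= sqrt 3" by (rule real_le_rsqrt) (simp add: power2_eq_square)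
 moreover have "pi <= 3.4" using pi_less_4 pi_approx by simp
 ultimately show ?thesis using assms by simp
qed

lemma abs_sin_pi_ge:
 assumes "!!v::int. \<tau> <= \<bar>t - of_int v\<bar>"
 shows "\<tau> <= \<bar>sin (pi * t)\<bar>"
proof -
 define y where "y = \<bar>t - of_int (round t)\<bar>"
 have y: "\<tau> <= y" "y <= 1/2" "0 <= y"
  unfolding y_def using assms of_int_round_abs_le[of t] by (auto simp: abs_minus_commute)
 have "sin (pi * t) = sin (pi * (t - of_int (round t)) + pi * of_int (round t))"
  by (simp add: algebra_simps)
 also have "\<bar>...\<bar> = \<bar>sin (pi * (t - of_int (round t)))\<bar>"
  using cos_npi_int[of "round t"] sin_npi_int[of "round t"]
  by (simp add: sin_add abs_mult)
 also have "... = \<bar>sin (pi * y)\<bar>"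
 proof (cases "t - of_int (round t) \<ge> 0")
  case False
  then have "y = - (t - of_int (round t))" by (simp add: y_def)
  then have e: "pi * y = - (pi * (t - of_int (round t)))" by (simp only: mult_minus_right)
  show ?thesis unfolding e sin_minus abs_minus_cancel ..
 qed (simp add: y_def)
 also have "... \<ge> pi * y / 2"
  using sin_ge_half[of "pi * y"] y by simp
 finally have "pi * y / 2 <= \<bar>sin (pi * t)\<bar>" .
 moreover have "y * 2 <= y * pi" using y pi_ge_two by (intro mult_left_mono) auto
 ultimately show ?thesis using y by (simp add: mult.commute)
qed

lemma norm_ee_minus_1: "norm (ee t - 1) = 2 * \<bar>sin (pi * t)\<bar>"
proof -
 have "ee t - 1 = cis (pi * t) * (cis (pi * t) - cis (- (pi * t)))"
  by (simp add: ee_def cis_mult algebra_simps)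
 also have "norm ... = norm (cis (pi * t) - cis (- (pi * t)))" by (simp add: norm_mult)
 also have "cis (pi * t) - cis (- (pi * t)) = 2 * \<i> * of_real (sin (pi * t))"
  by (simp add: complex_eq_iff)
 finally show ?thesis by (simp add: norm_mult)
qed

text \<open>Geometric series: at distance at least \<open>\<tau>\<close> from the integers the
  exponential sum is at most \<open>1 / \<tau>\<close>, so the kernel falls below its peak by the
  factor \<open>(N * \<tau>)^2\<close>.\<close>

lemma fejer_le_far:
 assumes "!!v::int. \<tau> <= \<bar>t - of_int v\<bar>" "\<tau> > 0" "N > 0"
 shows "fejer N t <= 1 / (N * \<tau>\<^sup>2)"
proof -
 have s: "\<tau> <= \<bar>sin (pi * t)\<bar>" by (rule abs_sin_pi_ge[OF assms(1)])
 then have n: "2 * \<tau> <= norm (ee t - 1)" by (simp add: norm_ee_minus_1)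
 then have ne: "ee t ~= 1" using assms by auto
 have "(\<Sum>q<N. ee (of_nat q * t)) = (ee t ^ N - 1) / (ee t - 1)"
  using geometric_sum[OF ne] by (simp add: ee_power)
 then have "norm (\<Sum>q<N. ee (of_nat q * t)) = norm (ee t ^ N - 1) / norm (ee t - 1)"
  by (simp add: norm_divide)
 also have "... <= 2 / (2 * \<tau>)"
 proof (rule frac_le)
  have "norm (ee t ^ N - 1) <= norm (ee t ^ N) + norm (1::complex)" by (rule norm_triangle_ineq4)
  then show "norm (ee t ^ N - 1) <= 2" by (simp add: norm_power)
 qed (use n assms in auto)
 finally have "norm (\<Sum>q<N. ee (of_nat q * t)) <= 1 / \<tau>" using assms by simp
 then have "(norm (\<Sum>q<N. ee (of_nat q * t)))\<^sup>2 <= (1 / \<tau>)\<^sup>2" by (intro power_mono) auto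
 then show ?thesis unfolding fejer_def using assms(3)
  by (simp add: field_simps power_divide)
qed

section \<open>Fourier series of the periodic tent, through cosines on the half period\<close>

lemma integral_cos_half_period:
 fixes k :: int
 shows "((%x. cos (2 * pi * of_int k * x)) has_integral (if k = 0 then 1/2 else 0)) {0..1/2::real}"
proof (cases "k = 0")
 case True
 then show ?thesis using has_integral_const_real[of "1::real" 0 "1/2"] by simp
next
 case False
 have "((%x. cos (2 * pi * of_int k * x)) has_integral
   (sin (2 * pi * of_int k * (1/2)) / (2 * pi * of_int k) - sin (2 * pi * of_int k * 0) / (2 * pi * of_int k))) {0..1/2::real}"
  by (rule fundamental_theorem_of_calculus)
    (use False in \<open>auto intro!: derivative_eq_intros simp: has_real_derivative_iff_has_vector_derivative[symmetric]\<close>)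
 moreover have "sin (2 * pi * of_int k * (1/2)) = 0"
  using sin_npi_int[of k] by (simp add: mult.commute)
 ultimately show ?thesis using False by simp
qed

lemma integral_cos_cos:
 fixes k j :: nat
 shows "((%x. cos (2 * pi * k * x) * cos (2 * pi * j * x)) has_integral
   (if k = j then (if k = 0 then 1/2 else 1/4) else 0)) {0..1/2::real}"
proof -
 have "((%x. (cos (2 * pi * of_int (int k - int j) * x) + cos (2 * pi * of_int (int k + int j) * x)) / 2) has_integral
   ((if int k - int j = 0 then 1/2 else 0) + (if int k + int j = 0 then 1/2 else 0)) / 2) {0..1/2::real}"
  by (intro has_integral_divide has_integral_add integral_cos_half_period)
 moreover have "((if int k - int j = 0 then 1/2 else 0) + (if int k + int j = 0 then 1/2 else 0)) / 2
   = (if k = j then (if k = 0 then 1/2 else 1/4) else (0::real))" by auto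
 moreover have "(%x. (cos (2 * pi * of_int (int k - int j) * x) + cos (2 * pi * of_int (int k + int j) * x)) / 2)
   = (%x::real. cos (2 * pi * k * x) * cos (2 * pi * j * x))"
 proof
  fix x :: real
  have e: "2 * pi * of_int (int k - int j) * x = 2 * pi * k * x - 2 * pi * j * x"
   "2 * pi * of_int (int k + int j) * x = 2 * pi * k * x + 2 * pi * j * x"
   by (simp_all add: algebra_simps)
  show "(cos (2 * pi * of_int (int k - int j) * x) + cos (2 * pi * of_int (int k + int j) * x)) / 2
   = cos (2 * pi * k * x) * cos (2 * pi * j * x)"
   unfolding e by (simp only: cos_times_cos)
 qed
 ultimately show ?thesis by simp
qed

text \<open>Products of cosines are sums of cosines, so \<open>d\<close> is orthogonal to every
  polynomial in \<open>cos (2 * pi * x)\<close>. Under the substitution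
  \<open>c = cos (2 * pi * x)\<close> these polynomials approximate \<open>d\<close> uniformly by
  Weierstrass on \<open>[-1, 1]\<close>, which forces the integral of \<open>d^2\<close> to
  vanish.\<close>

lemma cos_coeffs_zero_imp_zero:
 fixes d :: "real => real"
 assumes cont: "continuous_on {0..1/2} d"
  and z: "!!j::nat. integral {0..1/2} (%x. d x * cos (2 * pi * j * x)) = 0"
  and x: "x \<in> {0..1/2}"
 shows "d x = 0"
proof -
 have int: "(%x. d x * h x) integrable_on {0..1/2}" if "continuous_on {0..1/2} h" for h
  by (intro integrable_continuous_real continuous_intros cont that)
 have pw: "integral {0..1/2} (%x. d x * cos (2 * pi * x) ^ n * cos (2 * pi * j * x)) = 0" for n j :: nat
 proof (induction n arbitrary: j)
  case 0
  then show ?case using z by simp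
 next
  case (Suc n)
  have c: "(%x. d x * cos (2 * pi * x) ^ n * cos (2 * pi * i * x)) integrable_on {0..1/2}" for i :: nat
   by (intro integrable_continuous_real continuous_intros cont)
  show ?case
  proof (cases j)
   case 0
   then show ?thesis using Suc.IH[of 1] by (simp add: mult.commute mult.left_commute mult.assoc)
  next
   case (Suc i)
   have cc: "cos (2 * pi * x) * cos (2 * pi * j * x) = (cos (2 * pi * i * x) + cos (2 * pi * (Suc j) * x)) / 2" for x
    unfolding cos_times_cos Suc
    using cos_minus[of "2 * pi * x - 2 * pi * (real (Suc i)) * x"]
    by (simp add: algebra_simps)
   have "(%x. d x * cos (2 * pi * x) ^ Suc n * cos (2 * pi * j * x)) =
     (%x. (d x * cos (2 * pi * x) ^ n * cos (2 * pi * i * x) + d x * cos (2 * pi * x) ^ n * cos (2 * pi * (Suc j) * x)) / 2)"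
   proof
    fix x
    have "d x * cos (2 * pi * x) ^ Suc n * cos (2 * pi * j * x) =
      (d x * cos (2 * pi * x) ^ n) * (cos (2 * pi * x) * cos (2 * pi * j * x))" by (simp only: power_Suc mult_ac)
    then show "d x * cos (2 * pi * x) ^ Suc n * cos (2 * pi * j * x) =
     (d x * cos (2 * pi * x) ^ n * cos (2 * pi * i * x) + d x * cos (2 * pi * x) ^ n * cos (2 * pi * (Suc j) * x)) / 2"
     unfolding cc by (simp only: distrib_left times_divide_eq_right)
   qed
   then have "integral {0..1/2} (%x. d x * cos (2 * pi * x) ^ Suc n * cos (2 * pi * j * x)) =
    (integral {0..1/2} (%x. d x * cos (2 * pi * x) ^ n * cos (2 * pi * i * x)) +
     integral {0..1/2} (%x. d x * cos (2 * pi * x) ^ n * cos (2 * pi * (Suc j) * x))) / 2"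
    using Henstock_Kurzweil_Integration.integral_add[OF c[of i] c[of "Suc j"]] by simp
   also have "integral {0..1/2} (%x. d x * cos (2 * pi * x) ^ n * cos (2 * pi * i * x)) = 0"
    by (rule Suc.IH)
   also have "integral {0..1/2} (%x. d x * cos (2 * pi * x) ^ n * cos (2 * pi * (Suc j) * x)) = 0"
    by (rule Suc.IH)
   finally show ?thesis by simp
  qed
 qed
 have poly: "integral {0..1/2} (%x. d x * p (cos (2 * pi * x))) = 0"
  if "real_polynomial_function p" for p
 proof -
  from that obtain a n where p: "p = (%x. \<Sum>i\<le>n. a i * x ^ i)"
   by (auto simp: real_polynomial_function_iff_sum)
  have "integral {0..1/2} (%x. d x * p (cos (2 * pi * x))) =
    integral {0..1/2} (%x. \<Sum>i\<le>n. a i * (d x * cos (2 * pi * x) ^ i))"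
   unfolding p by (simp add: sum_distrib_left mult_ac)
  also have "... = (\<Sum>i\<le>n. integral {0..1/2} (%x. a i * (d x * cos (2 * pi * x) ^ i)))"
   by (rule integral_sum) (auto intro!: integrable_continuous_real continuous_intros cont)
  also have "... = 0" using pw[of _ 0] by simp
  finally show ?thesis .
 qed
 define D where "D c = d (arccos c / (2 * pi))" for c
 have contD: "continuous_on {-1..1} D"
  unfolding D_def
 proof (rule continuous_on_compose2[OF cont])
  show "continuous_on {-1..1} (%c. arccos c / (2 * pi))"
   by (intro continuous_intros) auto
  show "(%c. arccos c / (2 * pi)) ` {-1..1} \<subseteq> {0..1/2}"
   using arccos_bounded by (auto simp: field_simps arccos_lbound arccos_ubound)
 qed
 have Dc: "D (cos (2 * pi * x)) = d x" if "x \<in> {0..1/2}" for x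
 proof -
  have "arccos (cos (2 * pi * x)) = 2 * pi * x" using that by (intro arccos_cos) auto
  then show ?thesis by (simp add: D_def)
 qed
 define B where "B = integral {0..1/2} (%x. \<bar>d x\<bar>)"
 have B: "0 <= B" unfolding B_def by (rule integral_nonneg) (auto intro!: integrable_continuous_real continuous_intros cont)
 have le: "integral {0..1/2} (%x. d x * d x) <= e * B" if "e > 0" for e
 proof -
  obtain p where p: "real_polynomial_function p" "!!c. c \<in> {-1..1} ==> \<bar>D c - p c\<bar> < e"
   using Stone_Weierstrass_real_polynomial_function[OF compact_Icc contD \<open>e > 0\<close>] by metis
  have pc: "continuous_on S p" for S
   using p(1) by (auto simp: real_polynomial_function_iff_sum intro!: continuous_intros)
  have "integral {0..1/2} (%x. d x * d x) = integral {0..1/2} (%x. d x * d x - d x * p (cos (2 * pi * x)))"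
   using poly[OF p(1)]
   by (subst integral_diff) (auto intro!: integrable_continuous_real continuous_intros cont
     continuous_on_compose2[OF pc[of UNIV]])
  also have "... <= integral {0..1/2} (%x. e * \<bar>d x\<bar>)"
  proof (rule integral_le)
   show "(%x. d x * d x - d x * p (cos (2 * pi * x))) integrable_on {0..1 / 2}"
    by (auto intro!: integrable_continuous_real continuous_intros cont
     continuous_on_compose2[OF pc[of UNIV]])
   show "(%x. e * \<bar>d x\<bar>) integrable_on {0..1 / 2}"
    by (auto intro!: integrable_continuous_real continuous_intros cont)
   fix x :: real assume x: "x \<in> {0..1/2}"
   have "\<bar>D (cos (2 * pi * x)) - p (cos (2 * pi * x))\<bar> < e" by (rule p(2)) auto
   then have "\<bar>d x\<bar> * \<bar>d x - p (cos (2 * pi * x))\<bar> <= \<bar>d x\<bar> * e"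
    using Dc[OF x] by (intro mult_left_mono) auto
   then have "\<bar>d x * (d x - p (cos (2 * pi * x)))\<bar> <= \<bar>d x\<bar> * e" by (simp add: abs_mult)
   then show "d x * d x - d x * p (cos (2 * pi * x)) <= e * \<bar>d x\<bar>"
    by (simp add: algebra_simps)
  qed
  finally show ?thesis by (simp add: B_def)
 qed
 have "integral {0..1/2} (%x. d x * d x) <= 0"
 proof (rule field_le_epsilon)
  fix e :: real assume e: "e > 0"
  have "integral {0..1/2} (%x. d x * d x) <= e / (B + 1) * B" by (rule le) (use e B in simp)
  also have "... <= e" using e B by (simp add: field_simps)
  finally show "integral {0..1/2} (%x. d x * d x) <= 0 + e" by simp
 qed
 moreover have "0 <= integral {0..1/2} (%x. d x * d x)"
  by (rule integral_nonneg) (auto intro!: integrable_continuous_real continuous_intros cont)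
 ultimately have "integral {0..1/2} (%x. d x * d x) = 0" by simp
 then have "\<forall>x\<in>{0..1/2}. d x * d x = 0"
  by (subst (asm) integral_eq_0_iff) (auto intro!: continuous_intros cont)
 then show ?thesis using x by simp
qed

text \<open>\<open>arccos (cos (2 * pi * x))\<close> is \<open>2 * pi\<close> times the distance
  from \<open>x\<close> to the nearest integer, so this is the tent of half-width \<open>s\<close>
  repeated with period 1; periodicity, evenness and continuity come for free.\<close>

definition tent :: "real => real => real" where
 "tent s x = max 0 (1 - arccos (cos (2 * pi * x)) / (2 * pi * s))"

text \<open>For \<open>s <= 1/2\<close> the Fourier coefficients of \<open>tent s\<close>: a tent is
  a self-convolution of an interval, so they are squares and hence nonnegative.\<close>

definition tcoef :: "real => int => real" where
 "tcoef s j = (if j = 0 then s else (sin (pi * of_int j * s))\<^sup>2 / (pi\<^sup>2 * (of_int j)\<^sup>2 * s))"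

lemma tcoef_minus [simp]: "tcoef s (- j) = tcoef s j"
 by (simp add: tcoef_def)

lemma tcoef_nonneg: "0 <= s ==> 0 <= tcoef s j"
 by (simp add: tcoef_def)

lemma tcoef_le:
 assumes "0 < s" shows "tcoef s j <= s"
proof (cases "j = 0")
 case False
 have "\<bar>sin (pi * of_int j * s)\<bar> <= \<bar>pi * of_int j * s\<bar>" by (rule abs_sin_x_le_abs_x)
 then have "(sin (pi * of_int j * s))\<^sup>2 <= (pi * of_int j * s)\<^sup>2" by (rule abs_le_square_iff[THEN iffD1])
 then show ?thesis using assms False
  by (simp add: tcoef_def divide_le_eq power_mult_distrib power2_eq_square[of s] mult_ac)
qed (use assms in \<open>simp add: tcoef_def\<close>)

lemma tcoef_decay:
 assumes "0 < s" shows "tcoef s j * (s * (pi * of_int j)\<^sup>2) <= 1"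
 using assms abs_square_le_1[of "sin (pi * of_int j * s)"] by (auto simp: tcoef_def power_mult_distrib)

lemma tent_bounds:
 assumes "0 < s" shows "0 <= tent s x" "tent s x <= 1"
 using assms arccos_lbound[of "cos (2 * pi * x)"] by (auto simp: tent_def)

lemma tent_minus [simp]: "tent s (- x) = tent s x"
 by (simp add: tent_def)

lemma continuous_on_tent [continuous_intros]:
 fixes S :: "real set"
 assumes "continuous_on S f" "0 < s" shows "continuous_on S (%x. tent s (f x))"
 unfolding tent_def using assms(2) by (intro continuous_intros assms(1)) auto

lemma tent_eq:
 assumes "0 <= x" "x <= 1/2" "0 < s"
 shows "tent s x = max 0 (1 - x / s)"
proof -
 have "arccos (cos (2 * pi * x)) = 2 * pi * x" using assms by (intro arccos_cos) auto
 then show ?thesis using assms by (simp add: tent_def)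
qed

lemma arccos_cos_reduce:
 obtains k :: int where "arccos (cos (2 * pi * x)) = 2 * pi * \<bar>x - of_int k\<bar>"
proof -
 obtain k :: int where "arccos (cos (2 * pi * x)) = \<bar>2 * pi * x - of_int k * (2 * pi)\<bar>"
  by (rule arccos_cos_eq_abs_2pi)
 also have "... = \<bar>2 * pi * (x - of_int k)\<bar>" by (simp add: algebra_simps)
 also have "... = 2 * pi * \<bar>x - of_int k\<bar>" by (simp add: abs_mult)
 finally show ?thesis using that by blast
qed

lemma tent_support:
 assumes "tent s x ~= 0" "0 < s"
 shows "\<exists>v::int. \<bar>x - of_int v\<bar> < s"
proof -
 obtain k :: int where k: "arccos (cos (2 * pi * x)) = 2 * pi * \<bar>x - of_int k\<bar>"
  by (rule arccos_cos_reduce)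
 have "1 - arccos (cos (2 * pi * x)) / (2 * pi * s) > 0"
  using assms by (auto simp: tent_def max_def split: if_splits)
 then have "\<bar>x - of_int k\<bar> / s < 1" unfolding k using assms by simp
 then have "\<bar>x - of_int k\<bar> < s" using assms by (simp add: divide_less_eq)
 then show ?thesis by blast
qed

lemma cos_reduce: "cos (2 * pi * of_nat j * \<bar>x - of_int k\<bar>) = cos (2 * pi * of_nat j * x)"
proof -
 have "cos (2 * pi * of_nat j * \<bar>x - of_int k\<bar>) = cos (2 * pi * of_nat j * (x - of_int k))"
  by (cases "x - of_int k \<ge> 0") (auto simp: abs_if right_diff_distrib cos_diff sin_diff)
 also have "... = cos (2 * pi * of_nat j * x - 2 * pi * of_int (int j * k))"
  by (simp add: algebra_simps)
 also have "... = cos (2 * pi * of_nat j * x)"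
  unfolding cos_diff using cos_int_2pin[of "int j * k"] sin_int_2pin[of "int j * k"]
  by simp
 finally show ?thesis .
qed

definition cosum :: "(int => real) => nat => real => real" where
 "cosum c J x = c 0 + (\<Sum>j<J. 2 * c (int (Suc j)) * cos (2 * pi * of_nat (Suc j) * x))"

lemma cosum_reduce: "cosum c J \<bar>x - of_int k\<bar> = cosum c J x"
 unfolding cosum_def cos_reduce ..

lemma cosum_ee:
 assumes "!!j. c (- j) = c j"
 shows "of_real (cosum c J x) = (\<Sum>j\<in>{-int J..int J}. of_real (c j) * ee (of_int j * x))"
proof (induction J)
 case 0
 then show ?case by (simp add: cosum_def)
next
 case (Suc J)
 have split: "{-int (Suc J)..int (Suc J)} = insert (-int (Suc J)) (insert (int (Suc J)) {-int J..int J})"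
  by auto
 define y where "y = of_int (int (Suc J)) * x"
 have "ee y + ee (- y) = of_real (2 * cos (2 * pi * y))"
  by (simp add: ee_def complex_eq_iff)
 then have e: "ee (of_int (int (Suc J)) * x) + ee (of_int (- int (Suc J)) * x) = of_real (2 * cos (2 * pi * of_nat (Suc J) * x))"
  unfolding y_def by (simp only: of_int_minus minus_mult_left mult.assoc of_int_of_nat_eq)
 have "(\<Sum>j\<in>{-int (Suc J)..int (Suc J)}. of_real (c j) * ee (of_int j * x)) =
  of_real (c (int (Suc J))) * (ee (of_int (int (Suc J)) * x) + ee (of_int (- int (Suc J)) * x)) +
  (\<Sum>j\<in>{-int J..int J}. of_real (c j) * ee (of_int j * x))"
  unfolding split using assms[of "int (Suc J)"] by (subst sum.insert; simp)+ (simp add: algebra_simps)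
 also have "... = of_real (cosum c (Suc J) x)"
  unfolding e Suc.IH[symmetric] by (simp add: cosum_def)
 finally show ?case ..
qed

lemma tent_coeff:
 assumes "0 < s" "s <= 1/2"
 shows "((%x. tent s x * cos (2 * pi * of_nat j * x)) has_integral tcoef s (int j) / 2) {0..1/2}"
proof -
 have "((%x. (1 - x / s) * cos (2 * pi * of_nat j * x)) has_integral tcoef s (int j) / 2) {0..s}"
 proof (cases "j = 0")
  case True
  have "((%x. 1 - x / s) has_integral ((s - s\<^sup>2 / (2 * s)) - (0 - 0\<^sup>2 / (2 * s)))) {0..s}"
   by (rule fundamental_theorem_of_calculus)
     (use assms in \<open>auto intro!: derivative_eq_intros simp: has_real_derivative_iff_has_vector_derivative[symmetric] field_simps\<close>)
  moreover have "(s - s\<^sup>2 / (2 * s)) - (0 - 0\<^sup>2 / (2 * s)) = s / 2"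
   using assms by (simp add: power2_eq_square)
  ultimately have "((%x. 1 - x / s) has_integral s / 2) {0..s}" by (simp only:)
  then show ?thesis using True by (simp add: tcoef_def)
 next
  case False
  define w where "w = 2 * pi * of_nat j"
  have w: "w > 0" using False by (simp add: w_def)
  define P where "P x = (1 - x / s) * sin (w * x) / w - cos (w * x) / (s * w\<^sup>2)" for x
  have "((%x. (1 - x / s) * cos (w * x)) has_integral (P s - P 0)) {0..s}"
  proof (rule fundamental_theorem_of_calculus)
   fix x
   have "(P has_real_derivative ((1 - x / s) * (cos (w * x) * w) + (- (1 / s)) * sin (w * x)) / w - (- sin (w * x) * w) / (s * w\<^sup>2)) (at x within {0..s})"
    unfolding P_def using w assms by (auto intro!: derivative_eq_intros)
   also have "((1 - x / s) * (cos (w * x) * w) + (- (1 / s)) * sin (w * x)) / w - (- sin (w * x) * w) / (s * w\<^sup>2) = (1 - x / s) * cos (w * x)"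
    using w assms by (simp add: field_simps power2_eq_square)
   finally show "(P has_vector_derivative (1 - x / s) * cos (w * x)) (at x within {0..s})"
    by (simp add: has_real_derivative_iff_has_vector_derivative)
  qed (use assms in auto)
  moreover have "P s - P 0 = tcoef s (int j) / 2"
  proof -
   have "P s - P 0 = (1 - cos (w * s)) / (s * w\<^sup>2)" using assms by (simp add: P_def diff_divide_distrib)
   also have "cos (w * s) = 1 - 2 * (sin (pi * of_nat j * s))\<^sup>2"
    using cos_double_sin[of "pi * of_nat j * s"] by (simp add: w_def mult_ac)
   finally show ?thesis using False by (simp add: tcoef_def w_def power_mult_distrib mult_ac)
  qed
  ultimately show ?thesis by (simp add: w_def)
 qed
 then have 1: "((%x. tent s x * cos (2 * pi * of_nat j * x)) has_integral tcoef s (int j) / 2) {0..s}"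
  by (rule has_integral_eq[rotated]) (use assms in \<open>auto simp: tent_eq max_def field_simps\<close>)
 have 2: "((%x. tent s x * cos (2 * pi * of_nat j * x)) has_integral 0) {s..1/2}"
  by (rule has_integral_is_0) (use assms in \<open>auto simp: tent_eq max_def field_simps\<close>)
 show ?thesis
  using has_integral_combine[OF _ _ 1 2] assms by simp
qed

lemma cosum_coeff:
 assumes "i <= J"
 shows "((%x. cosum c J x * cos (2 * pi * of_nat i * x)) has_integral c (int i) / 2) {0..1/2}"
proof -
 have "((%x. c 0 * (cos (2 * pi * of_nat 0 * x) * cos (2 * pi * of_nat i * x)) +
   (\<Sum>j<J. 2 * c (int (Suc j)) * (cos (2 * pi * of_nat (Suc j) * x) * cos (2 * pi * of_nat i * x)))) has_integral
   c 0 * (if 0 = i then (if 0 = (0::nat) then 1/2 else 1/4) else 0) +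
   (\<Sum>j<J. 2 * c (int (Suc j)) * (if Suc j = i then (if Suc j = 0 then 1/2 else 1/4) else 0))) {0..1/2}"
  by (intro has_integral_add has_integral_mult_right has_integral_sum integral_cos_cos) auto
 moreover have "c 0 * (if 0 = i then (if 0 = (0::nat) then 1/2 else 1/4) else 0) +
   (\<Sum>j<J. 2 * c (int (Suc j)) * (if Suc j = i then (if Suc j = 0 then 1/2 else 1/4) else 0)) = c (int i) / 2"
 proof (cases i)
  case (Suc k)
  have "(\<Sum>j<J. 2 * c (int (Suc j)) * (if Suc j = i then (if Suc j = 0 then 1/2 else 1/4) else 0)) =
    (\<Sum>j<J. if j = k then c (int (Suc k)) / 2 else 0)"
   by (rule sum.cong) (auto simp: Suc)
  also have "... = c (int i) / 2" using assms Suc by simp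
  finally show ?thesis using Suc by simp
 qed simp
 moreover have "(%x. c 0 * (cos (2 * pi * of_nat 0 * x) * cos (2 * pi * of_nat i * x)) +
   (\<Sum>j<J. 2 * c (int (Suc j)) * (cos (2 * pi * of_nat (Suc j) * x) * cos (2 * pi * of_nat i * x)))) =
   (%x. cosum c J x * cos (2 * pi * of_nat i * x))"
  unfolding cosum_def distrib_right sum_distrib_right by (simp add: mult_ac)
 ultimately show ?thesis by (simp only:)
qed

lemma cosum_uniform_limit:
 assumes "0 < s" "!!j. 0 <= c j" "!!j. c j * (s * (pi * of_int j)\<^sup>2) <= 1"
 obtains S where "uniform_limit UNIV (cosum c) S sequentially"
proof -
 define f where "f j x = 2 * c (int (Suc j)) * cos (2 * pi * of_nat (Suc j) * x)" for j x
 have "uniform_limit UNIV (%n x. \<Sum>i<n. f i x) (%x. \<Sum>i. f i x) sequentially"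
 proof (rule Weierstrass_m_test)
  have "summable (%n. inverse (real n ^ 2))" by (rule inverse_power_summable) simp
  then have "summable (%n. inverse (real (Suc n) ^ 2))" by (subst summable_Suc_iff)
  then show "summable (%n. (2 / (s * pi\<^sup>2)) * inverse (real (Suc n) ^ 2))" by (rule summable_mult)
  fix n x
  have "\<bar>f n x\<bar> <= 2 * c (int (Suc n)) * 1"
   unfolding f_def abs_mult using assms(2)[of "int (Suc n)"] by (intro mult_mono) auto
  also have "c (int (Suc n)) * (s * pi\<^sup>2 * real (Suc n) ^ 2) <= 1"
   using assms(3)[of "int (Suc n)"] by (simp add: power_mult_distrib mult_ac)
  then have "c (int (Suc n)) <= 1 / (s * pi\<^sup>2 * real (Suc n) ^ 2)"
   using assms(1) by (subst pos_le_divide_eq) auto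
  finally show "norm (f n x) <= (2 / (s * pi\<^sup>2)) * inverse (real (Suc n) ^ 2)"
   by (simp add: field_simps)
 qed
 then have "uniform_limit UNIV (%n x. c 0 + (\<Sum>i<n. f i x)) (%x. c 0 + (\<Sum>i. f i x)) sequentially"
  by (intro uniform_limit_add uniform_limit_const)
 then have "uniform_limit UNIV (cosum c) (%x. c 0 + (\<Sum>i. f i x)) sequentially"
  unfolding cosum_def[abs_def] f_def .
 then show ?thesis using that by blast
qed

lemma continuous_on_cosum [continuous_intros]:
 fixes S :: "real set"
 assumes "continuous_on S f" shows "continuous_on S (%x. cosum c J (f x))"
 unfolding cosum_def by (intro continuous_intros assms)

text \<open>The coefficients are summable, so the cosine series converges uniformly to a continuous
  function with the same coefficients as the tent. Uniqueness identifies the two on the half period,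
  and evenness with period 1 extends this to the line.\<close>

lemma tent_series:
 assumes s: "0 < s" "s <= 1/2"
 shows "uniform_limit UNIV (cosum (tcoef s)) (tent s) sequentially"
proof -
 obtain S where S: "uniform_limit UNIV (cosum (tcoef s)) S sequentially"
  using cosum_uniform_limit[of s "tcoef s"] tcoef_nonneg tcoef_decay s by (metis less_imp_le)
 have contS: "continuous_on UNIV S"
  by (rule uniform_limit_theorem[OF _ S]) (auto intro!: always_eventually continuous_intros)
 have coeffS: "integral {0..1/2} (%x. S x * cos (2 * pi * of_nat i * x)) = tcoef s (int i) / 2" for i :: nat
 proof -
  have "uniform_limit {0..1/2} (%J x. cosum (tcoef s) J x * cos (2 * pi * of_nat i * x))
    (%x. S x * cos (2 * pi * of_nat i * x)) sequentially"
  proof (rule uniform_limitI)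
   fix e :: real assume "e > 0"
   have "\<forall>\<^sub>F J in sequentially. \<forall>x\<in>UNIV. dist (cosum (tcoef s) J x) (S x) < e"
    using uniform_limitD[OF S \<open>e > 0\<close>] .
   then show "\<forall>\<^sub>F J in sequentially. \<forall>x\<in>{0..1/2}. dist (cosum (tcoef s) J x * cos (2 * pi * of_nat i * x))
      (S x * cos (2 * pi * of_nat i * x)) < e"
   proof eventually_elim
    case (elim J)
    show ?case
    proof
     fix x :: real
     have "dist (cosum (tcoef s) J x * cos (2 * pi * of_nat i * x)) (S x * cos (2 * pi * of_nat i * x)) =
      \<bar>cosum (tcoef s) J x - S x\<bar> * \<bar>cos (2 * pi * of_nat i * x)\<bar>"
      by (simp add: dist_real_def abs_mult[symmetric] left_diff_distrib)
     also have "... <= \<bar>cosum (tcoef s) J x - S x\<bar> * 1" by (intro mult_left_mono) auto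
     also have "... < e" using elim by (auto simp: dist_real_def)
     finally show "dist (cosum (tcoef s) J x * cos (2 * pi * of_nat i * x))
      (S x * cos (2 * pi * of_nat i * x)) < e" .
    qed
   qed
  qed
  then obtain I K where I: "!!J. ((%x. cosum (tcoef s) J x * cos (2 * pi * of_nat i * x)) has_integral I J) {0..1/2}"
   and K: "((%x. S x * cos (2 * pi * of_nat i * x)) has_integral K) {0..1/2}" and IK: "I \<longlonglongrightarrow> K"
   by (rule uniform_limit_integral[where a="0" and b="1/2::real"]) (auto intro!: continuous_intros)
  have "\<forall>\<^sub>F J in sequentially. I J = tcoef s (int i) / 2"
   using eventually_ge_at_top[of i]
  proof eventually_elim
   case (elim J)
   then show ?case using has_integral_unique[OF I cosum_coeff[OF elim]] by simp
  qed
  then have "K = tcoef s (int i) / 2"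
   using IK LIMSEQ_unique tendsto_eventually by blast
  then show ?thesis using K by (simp add: integral_unique)
 qed
 have half: "tent s x = S x" if "x \<in> {0..1/2}" for x
 proof -
  have cS: "continuous_on {0..1/2} S" using contS continuous_on_subset by blast
  have "tent s x - S x = 0"
  proof (rule cos_coeffs_zero_imp_zero[OF _ _ that])
   show "continuous_on {0..1/2} (%x. tent s x - S x)" using s by (intro continuous_intros cS)
   fix j :: nat
   have "integral {0..1/2} (%x. (tent s x - S x) * cos (2 * pi * real j * x)) =
    integral {0..1/2} (%x. tent s x * cos (2 * pi * real j * x)) - integral {0..1/2} (%x. S x * cos (2 * pi * real j * x))"
    unfolding left_diff_distrib using s
    by (intro integral_diff integrable_continuous_real continuous_intros cS)
   also have "... = 0" using tent_coeff[OF s, of j] by (simp add: coeffS integral_unique)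
   finally show "integral {0..1/2} (%x. (tent s x - S x) * cos (2 * pi * real j * x)) = 0" .
  qed
  then show ?thesis by simp
 qed
 have "tent s x = S x" for x
 proof -
  obtain k :: int where k: "arccos (cos (2 * pi * x)) = 2 * pi * \<bar>x - of_int k\<bar>"
   by (rule arccos_cos_reduce)
  have "2 * pi * \<bar>x - of_int k\<bar> <= pi" using arccos_ubound[of "cos (2 * pi * x)"] by (simp add: k)
  then have in01: "\<bar>x - of_int k\<bar> \<in> {0..1/2}" by simp
  have lim: "(%J. cosum (tcoef s) J y) \<longlonglongrightarrow> S y" for y
   using tendsto_uniform_limitI[OF S] by auto
  have "S \<bar>x - of_int k\<bar> = S x"
   using lim[of "\<bar>x - of_int k\<bar>"] lim[of x] unfolding cosum_reduce by (rule LIMSEQ_unique)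
  moreover have "tent s \<bar>x - of_int k\<bar> = tent s x"
   using cos_reduce[of 1 x k] by (simp add: tent_def)
  ultimately show ?thesis using half[OF in01] by simp
 qed
 then have "tent s = S" by blast
 then show ?thesis using S by simp
qed

section \<open>Periodic bumps with nonnegative Fourier coefficients\<close>

text \<open>Normalisation \<open>g 0 = 1\<close> together with nonnegative coefficients makes the
  coefficients sum to 1, which bounds \<open>g\<close> and all its partial sums by 1. Support is
  measured modulo 1.\<close>

definition kern :: "real => (real => real) => (int => real) => bool" where
 "kern r g a \<longleftrightarrow> (ALL x. g x ~= 0 --> (\<exists>v::int. \<bar>x - of_int v\<bar> < r)) & (ALL j. 0 <= a j) & g 0 = 1 &
  uniform_limit UNIV (%J x. \<Sum>j\<in>{-int J..int J}. of_real (a j) * ee (of_int j * x))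
   (%x. of_real (g x)) sequentially"

lemma kern_of_cosum:
 assumes "uniform_limit UNIV (cosum c) g sequentially" "!!j. c (- j) = c j" "!!j. 0 <= c j" "g 0 = 1"
  "!!x. g x ~= 0 ==> \<exists>v::int. \<bar>x - of_int v\<bar> < r"
 shows "kern r g c"
 unfolding kern_def
proof (intro conjI allI impI)
 have "uniform_limit UNIV (%J x. of_real (cosum c J x)) (%x. of_real (g x) :: complex) sequentially"
  using assms(1) by (simp add: uniform_limit_iff dist_of_real)
 then show "uniform_limit UNIV (%J x. \<Sum>j\<in>{-int J..int J}. of_real (c j) * ee (of_int j * x))
   (%x. of_real (g x)) sequentially"
  by (simp only: cosum_ee[of c, OF assms(2)])
qed (use assms in auto)

lemma kern_tent:
 assumes "0 < s" "s <= 1/2" "s <= r"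
 shows "kern r (tent s) (tcoef s)"
proof (rule kern_of_cosum)
 show "tent s 0 = 1" using assms by (simp add: tent_eq)
 fix x assume "tent s x ~= 0"
 then obtain v :: int where "\<bar>x - of_int v\<bar> < s" using tent_support assms by blast
 then show "\<exists>v::int. \<bar>x - of_int v\<bar> < r" using assms by (intro exI[of _ v]) simp
qed (use assms tent_series tcoef_nonneg in auto)

lemma integral_symmetric:
 fixes h :: "real => real"
 assumes "continuous_on {-1/2..1/2} h"
 shows "integral {-1/2..1/2} h = integral {0..1/2} (%y. h y + h (- y))"
proof -
 have i: "h integrable_on {-1/2..1/2}" using assms by (rule integrable_continuous_real)
 have c: "continuous_on {0..1/2} h" "continuous_on {0..1/2} (%y. h (- y))"
  by (auto intro!: continuous_on_compose2[OF assms] continuous_intros)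
 have "integral {-1/2..1/2} h = integral {-1/2..0} h + integral {0..1/2} h"
  using Henstock_Kurzweil_Integration.integral_combine[OF _ _ i, of 0] by simp
 also have "integral {-1/2..0} h = integral {0..1/2} (%y. h (- y))"
  using Henstock_Kurzweil_Integration.integral_reflect_real[of "1/2" 0 "%y. h (- y)"] by simp
 also have "... + integral {0..1/2} h = integral {0..1/2} (%y. h y + h (- y))"
  using c by (subst integral_add) (auto intro!: integrable_continuous_real)
 finally show ?thesis .
qed

lemma tent_conv_coeff:
 assumes s: "0 < s" "s <= 1/2"
 shows "((%y. tent s y * cos (2 * pi * of_nat j * (x - y))) has_integral
   tcoef s (int j) * cos (2 * pi * of_nat j * x)) {-1/2..1/2}"
proof -
 have c: "continuous_on A (%y. tent s y * cos (2 * pi * of_nat j * (x - y)))" for A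
  using s by (intro continuous_intros)
 have "integral {-1/2..1/2} (%y. tent s y * cos (2 * pi * of_nat j * (x - y))) =
   integral {0..1/2} (%y. (2 * cos (2 * pi * of_nat j * x)) * (tent s y * cos (2 * pi * of_nat j * y)))"
  unfolding integral_symmetric[OF c]
  by (rule arg_cong[where f = "integral _"], rule ext)
    (simp add: right_diff_distrib ring_distribs cos_diff cos_add)
 also have "... = (2 * cos (2 * pi * of_nat j * x)) * (tcoef s (int j) / 2)"
  using tent_coeff[OF s, of j] by (simp add: integral_unique)
 finally show ?thesis
  using c[of "{-1/2..1/2}"] by (simp add: has_integral_integral_real integrable_continuous_real has_integral_iff)
qed

text \<open>Convolution over one period, with \<open>2 * s / 3\<close> being the integral of the
  square of the tent. Convolving squares the coefficients and thereby doubles their rate of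
  decay.\<close>

definition tent2 :: "real => real => real" where
 "tent2 s x = integral {-1/2..1/2} (%y. tent s y * tent s (x - y)) / (2 * s / 3)"

lemma tent2_0:
 assumes s: "0 < s" "s <= 1/2" shows "tent2 s 0 = 1"
proof -
 have c: "continuous_on A (%y. tent s y * tent s (0 - y))" for A
  using s by (intro continuous_intros)
 have "integral {-1/2..1/2} (%y. tent s y * tent s (0 - y)) = integral {0..1/2} (%y. 2 * (tent s y)\<^sup>2)"
  unfolding integral_symmetric[OF c]
  by (rule arg_cong[where f = "integral _"], rule ext) (simp add: power2_eq_square)
 also have "... = 2 * s / 3"
 proof -
  have d: "((%y. - 2 * s / 3 * (1 - y / s)^3) has_real_derivative 2 * (1 - y / s)\<^sup>2) (at y within {0..s})" for y
  proof -
   have "((%y. - 2 * s / 3 * (1 - y / s)^3) has_real_derivative - 2 * s / 3 * (3 * (1 - y / s)\<^sup>2 * (- (1 / s)))) (at y within {0..s})"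
    by (auto intro!: derivative_eq_intros)
   then show ?thesis using s by simp
  qed
  have "((%y. 2 * (1 - y / s)\<^sup>2) has_integral ((- 2 * s / 3 * (1 - s / s)^3) - (- 2 * s / 3 * (1 - 0 / s)^3))) {0..s}"
   by (rule fundamental_theorem_of_calculus)
     (use s d in \<open>auto simp: has_real_derivative_iff_has_vector_derivative[symmetric]\<close>)
  then have "((%y. 2 * (1 - y / s)\<^sup>2) has_integral 2 * s / 3) {0..s}" using s by simp
  then have 1: "((%y. 2 * (tent s y)\<^sup>2) has_integral 2 * s / 3) {0..s}"
   by (rule has_integral_eq[rotated]) (use s in \<open>auto simp: tent_eq max_def field_simps\<close>)
  have 2: "((%y. 2 * (tent s y)\<^sup>2) has_integral 0) {s..1/2}"
   by (rule has_integral_is_0) (use s in \<open>auto simp: tent_eq max_def field_simps\<close>)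
  have "((%y. 2 * (tent s y)\<^sup>2) has_integral 2 * s / 3) {0..1/2}"
   using has_integral_combine[OF _ _ 1 2] s by simp
  then show ?thesis by (rule integral_unique)
 qed
 finally show ?thesis using s by (simp add: tent2_def)
qed

lemma tent2_support:
 assumes "tent2 s x ~= 0" "0 < s"
 shows "\<exists>v::int. \<bar>x - of_int v\<bar> < 2 * s"
proof -
 have "EX y. tent s y * tent s (x - y) ~= 0"
 proof (rule ccontr)
  assume "\<nexists>y. tent s y * tent s (x - y) ~= 0"
  then have "(%y. tent s y * tent s (x - y)) = (%y. 0)" by auto
  then show False using assms by (simp add: tent2_def)
 qed
 then obtain y where y: "tent s y ~= 0" "tent s (x - y) ~= 0" by auto
 obtain u v :: int where "\<bar>y - of_int u\<bar> < s" "\<bar>x - y - of_int v\<bar> < s"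
  using tent_support[OF y(1)] tent_support[OF y(2)] assms by auto
 then have "\<bar>x - of_int (u + v)\<bar> < 2 * s" by (simp add: abs_if split: if_splits)
 then show ?thesis by blast
qed

lemma kern_tent2:
 assumes s: "0 < s" "s <= 1/2"
 shows "kern (2 * s) (tent2 s) (%j. 3 / (2 * s) * (tcoef s j)\<^sup>2)"
proof (rule kern_of_cosum)
 have eq: "cosum (%j. 3 / (2 * s) * (tcoef s j)\<^sup>2) J x =
   integral {-1/2..1/2} (%y. tent s y * cosum (tcoef s) J (x - y)) / (2 * s / 3)" for J x
 proof -
  have "((%y. tcoef s 0 * (tent s y * cos (2 * pi * of_nat 0 * (x - y))) +
    (\<Sum>j<J. 2 * tcoef s (int (Suc j)) * (tent s y * cos (2 * pi * of_nat (Suc j) * (x - y)))))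
    has_integral tcoef s 0 * (tcoef s (int 0) * cos (2 * pi * of_nat 0 * x)) +
    (\<Sum>j<J. 2 * tcoef s (int (Suc j)) * (tcoef s (int (Suc j)) * cos (2 * pi * of_nat (Suc j) * x)))) {-1/2..1/2}"
   by (intro has_integral_add has_integral_mult_right has_integral_sum tent_conv_coeff s) auto
  moreover have "(%y. tcoef s 0 * (tent s y * cos (2 * pi * of_nat 0 * (x - y))) +
    (\<Sum>j<J. 2 * tcoef s (int (Suc j)) * (tent s y * cos (2 * pi * of_nat (Suc j) * (x - y))))) =
    (%y. tent s y * cosum (tcoef s) J (x - y))"
   unfolding cosum_def distrib_left sum_distrib_left by (simp add: mult_ac)
  ultimately have "integral {-1/2..1/2} (%y. tent s y * cosum (tcoef s) J (x - y)) =
    tcoef s 0 * (tcoef s (int 0) * cos (2 * pi * of_nat 0 * x)) +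
    (\<Sum>j<J. 2 * tcoef s (int (Suc j)) * (tcoef s (int (Suc j)) * cos (2 * pi * of_nat (Suc j) * x)))"
   by (simp add: integral_unique)
  then show ?thesis using s
   by (simp add: cosum_def add_divide_distrib sum_divide_distrib sum_distrib_left power2_eq_square mult_ac)
 qed
 show "uniform_limit UNIV (cosum (%j. 3 / (2 * s) * (tcoef s j)\<^sup>2)) (tent2 s) sequentially"
 proof (rule uniform_limitI)
  fix e :: real assume "e > 0"
  then have e: "e * s / 3 > 0" using s by simp
  have ab: "\<bar>A / (2 * s / 3) - B / (2 * s / 3)\<bar> = \<bar>A - B\<bar> / (2 * s / 3)" for A B
  proof -
   have "A / (2 * s / 3) - B / (2 * s / 3) = (A - B) / (2 * s / 3)" by (simp only: diff_divide_distrib)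
   then show ?thesis using s by (simp only: abs_divide abs_of_pos)
  qed
  show "\<forall>\<^sub>F J in sequentially. \<forall>x\<in>UNIV. dist (cosum (%j. 3 / (2 * s) * (tcoef s j)\<^sup>2) J x) (tent2 s x) < e"
   using uniform_limitD[OF tent_series[OF s] e]
  proof eventually_elim
   case (elim J)
   show ?case
   proof
    fix x :: real
    have c: "continuous_on A (%y. tent s y * cosum (tcoef s) J (x - y))"
      "continuous_on A (%y. tent s y * tent s (x - y))" for A
     by (intro continuous_intros s(1))+
    have "\<bar>integral {-1/2..1/2} (%y. tent s y * cosum (tcoef s) J (x - y)) - integral {-1/2..1/2} (%y. tent s y * tent s (x - y))\<bar>
     = norm (integral {-1/2..1/2} (%y. tent s y * cosum (tcoef s) J (x - y) - tent s y * tent s (x - y)))"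
     using c by (subst integral_diff) (auto intro!: integrable_continuous_real)
    also have "... <= integral {-1/2..1/2} (%y::real. e * s / 3)"
    proof (rule integral_norm_bound_integral)
     show "(%y. tent s y * cosum (tcoef s) J (x - y) - tent s y * tent s (x - y)) integrable_on {- 1 / 2..1 / 2}"
      using c by (intro integrable_continuous_real continuous_on_diff)
     fix y
     have "norm (tent s y * cosum (tcoef s) J (x - y) - tent s y * tent s (x - y)) =
       \<bar>tent s y\<bar> * \<bar>cosum (tcoef s) J (x - y) - tent s (x - y)\<bar>"
      by (simp add: abs_mult[symmetric] right_diff_distrib)
     also have "... <= 1 * (e * s / 3)"
      using tent_bounds[OF s(1), of y] elim by (intro mult_mono) (auto simp: dist_real_def less_imp_le)
     finally show "norm (tent s y * cosum (tcoef s) J (x - y) - tent s y * tent s (x - y)) <= e * s / 3" by simp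
    qed auto
    finally have "\<bar>integral {-1/2..1/2} (%y. tent s y * cosum (tcoef s) J (x - y)) - integral {-1/2..1/2} (%y. tent s y * tent s (x - y))\<bar> <= e * s / 3"
     by simp
    then have "\<bar>integral {-1/2..1/2} (%y. tent s y * cosum (tcoef s) J (x - y)) - integral {-1/2..1/2} (%y. tent s y * tent s (x - y))\<bar> / (2 * s / 3) <= (e * s / 3) / (2 * s / 3)"
     using s by (intro divide_right_mono) auto
    also have "... < e" using s \<open>e > 0\<close> by simp
    finally show "dist (cosum (%j. 3 / (2 * s) * (tcoef s j)\<^sup>2) J x) (tent2 s x) < e"
     by (simp only: eq tent2_def dist_real_def ab)
   qed
  qed
 qed
qed (use s tent2_0 tent2_support tcoef_nonneg in auto)

text \<open>With \<open>s = r / 2\<close>, \<open>g\<close> is the convolved tent and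
  \<open>h\<close> the plain one. Since the coefficients of \<open>g\<close> are
  \<open>3 / (2 * s)\<close> times the squares of those of \<open>h\<close>, the ratio
  \<open>a j / b j\<close> decays like \<open>(r * j)^(-2)\<close>. A frequency tail of
  \<open>g\<close> is thus a small multiple of a sum over \<open>h\<close>, and that sum is again
  controlled by a kernel of the same radius. The constant 4 covers both \<open>3/2\<close> and
  \<open>6 / pi^2\<close>.\<close>

lemma kernel_pair:
 assumes r: "0 < r" "r < 1"
 obtains g a h b where "kern r g a" "kern r h b" "a 0 = 3 * r / 4" "!!j. a j <= a 0"
  "!!j. a j <= 4 * b j" "!!j. a j * (r * of_int j)\<^sup>2 <= 4 * b j"
proof
 define s where "s = r / 2"
 have s: "0 < s" "s <= 1/2" "s <= r" "2 * s = r" using r by (auto simp: s_def)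
 show "kern r (tent2 s) (%j. 3 / (2 * s) * (tcoef s j)\<^sup>2)" using kern_tent2[OF s(1,2)] s by simp
 show "kern r (tent s) (tcoef s)" by (rule kern_tent[OF s(1-3)])
 show "3 / (2 * s) * (tcoef s 0)\<^sup>2 = 3 * r / 4" using s by (simp add: tcoef_def power2_eq_square s_def)
 fix j
 have t: "0 <= tcoef s j" "tcoef s j <= s" using s tcoef_le tcoef_nonneg by auto
 show "3 / (2 * s) * (tcoef s j)\<^sup>2 <= 3 / (2 * s) * (tcoef s 0)\<^sup>2"
  using t s by (intro mult_left_mono power_mono) (auto simp: tcoef_def[of s 0])
 have "3 / (2 * s) * (tcoef s j)\<^sup>2 = 3 / 2 * tcoef s j * (tcoef s j / s)" by (simp add: power2_eq_square)
 also have "... <= 3 / 2 * tcoef s j * 1" using t s by (intro mult_left_mono) auto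
 finally show "3 / (2 * s) * (tcoef s j)\<^sup>2 <= 4 * tcoef s j" using t by simp
 have "3 / (2 * s) * (tcoef s j)\<^sup>2 * (r * of_int j)\<^sup>2 = 6 / pi\<^sup>2 * tcoef s j * (tcoef s j * (s * (pi * of_int j)\<^sup>2))"
  using s by (simp add: s_def power2_eq_square field_simps)
 also have "... <= 6 / pi\<^sup>2 * tcoef s j * 1"
  using t by (intro mult_left_mono tcoef_decay s) auto
 also have "... <= 4 * tcoef s j"
 proof -
  have "2\<^sup>2 <= pi\<^sup>2" using pi_ge_two by (intro power_mono) auto
  then have "6 / pi\<^sup>2 <= 4" by (simp add: field_simps)
  then show ?thesis using t mult_right_mono[of "6 / pi\<^sup>2" 4 "tcoef s j"] by simp
 qed
 finally show "3 / (2 * s) * (tcoef s j)\<^sup>2 * (r * of_int j)\<^sup>2 <= 4 * tcoef s j" .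
qed

section \<open>The weighted counting function and its Fourier coefficients\<close>

definition ibox :: "nat => ('a::finite => int) set" where
 "ibox J = PiE UNIV (%_. {-int J..int J})"

lemma ibox_iff: "f \<in> ibox J \<longleftrightarrow> (ALL i. \<bar>f i\<bar> <= int J)"
 by (auto simp: ibox_def PiE_iff abs_le_iff minus_le_iff)

lemma finite_ibox [simp]: "finite (ibox J)"
 by (simp add: ibox_def finite_PiE)

lemma ibox_mono: "J <= K ==> ibox J \<subseteq> ibox K"
proof
 fix f :: "'a => int" assume "J <= K" "f \<in> ibox J"
 then have "\<bar>f i\<bar> <= int K" for i unfolding ibox_iff by (metis of_nat_mono order_trans)
 then show "f \<in> ibox K" by (simp add: ibox_iff)
qed

lemma finite_subset_ibox:
 assumes "finite F" obtains J where "F \<subseteq> ibox J"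
 using assms
proof (induction F arbitrary: thesis rule: finite_induct)
 case empty
 then show ?case by simp
next
 case (insert f F)
 obtain J where J: "F \<subseteq> ibox J" using insert.IH by blast
 define K where "K = nat (\<Sum>i\<in>UNIV. \<bar>f i\<bar>)"
 have "\<bar>f i\<bar> <= int K" for i
  unfolding K_def by (auto intro!: member_le_sum simp: sum_nonneg)
 then have "f \<in> ibox K" by (simp add: ibox_iff)
 then have "insert f F \<subseteq> ibox (max J K)"
  using J ibox_mono[of J "max J K"] ibox_mono[of K "max J K"] by auto
 then show ?case using insert.prems by blast
qed

definition lin :: "real^'n^'m => ('n => int) => 'm => real" where
 "lin \<alpha> q i = (\<Sum>j\<in>UNIV. \<alpha> $ i $ j * of_int (q j))"

definition dual :: "real^'n^'m => ('m => int) => 'n => real" where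
 "dual \<alpha> xi j = (\<Sum>i\<in>UNIV. of_int (xi i) * \<alpha> $ i $ j)"

definition idot :: "('m::finite => int) => real^'m => real" where
 "idot xi \<beta> = (\<Sum>i\<in>UNIV. of_int (xi i) * \<beta> $ i)"

definition cprod :: "(int => real) => ('m::finite => int) => real" where
 "cprod a xi = (\<Prod>i\<in>UNIV. a (xi i))"

text \<open>By \<open>Wt_expand\<close> this is the weighted exponential sum over \<open>q\<close>
  at the frequency \<open>xi\<close>. The product form shows that it is nonnegative, and large only
  if all dual forms at \<open>xi\<close> are close to integers.\<close>

definition Wt :: "nat => real^'n^'m => ('m => int) => real" where
 "Wt N \<alpha> xi = (\<Prod>j\<in>UNIV. fejer N (dual \<alpha> xi j))"

definition wq :: "nat => ('n::finite => int) => real" where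
 "wq N q = (\<Prod>j\<in>UNIV. (1 - \<bar>of_int (q j)\<bar> / of_nat N))"

text \<open>Counts the \<open>q\<close> in a box for which \<open>\<alpha> q + \<beta>\<close> is
  close to an integer vector. The triangular weights \<open>wq\<close>, in place of a sharp cutoff,
  are what makes the Fourier coefficients nonnegative; they vanish on the boundary of the
  box.\<close>

definition Gf :: "nat => (real => real) => real^'n^'m => real^'m => real" where
 "Gf N g \<alpha> \<beta> = (\<Sum>q\<in>ibox N. wq N q * (\<Prod>i\<in>UNIV. g (lin \<alpha> q i + \<beta> $ i)))"

lemma lin_dual: "(\<Sum>i\<in>UNIV. of_int (xi i) * lin \<alpha> q i) = (\<Sum>j\<in>UNIV. of_int (q j) * dual \<alpha> xi j)"
 unfolding lin_def dual_def sum_distrib_left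
 by (subst sum.swap) (simp add: mult_ac)

lemma Wt_nonneg: "0 <= Wt N \<alpha> xi"
 unfolding Wt_def by (intro prod_nonneg ballI fejer_nonneg)

lemma Wt_le: "Wt N (\<alpha> :: real^'n^'m) xi <= real N ^ CARD('n)"
proof -
 have "Wt N \<alpha> xi <= (\<Prod>j\<in>(UNIV::'n set). real N)"
  unfolding Wt_def by (intro prod_mono) (auto simp: fejer_nonneg fejer_le)
 then show ?thesis by simp
qed

lemma dual_0 [simp]: "dual \<alpha> (%_. 0) j = 0"
 by (simp add: dual_def)

lemma Wt_0: "Wt N (\<alpha> :: real^'n^'m) (%_. 0) = real N ^ CARD('n)"
 by (simp add: Wt_def)

lemma Wt_far:
 fixes \<alpha> :: "real^'n^'m"
 assumes "!!v::int. \<tau> <= \<bar>dual \<alpha> xi j - of_int v\<bar>" "\<tau> > 0" "N > 0"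
 shows "Wt N \<alpha> xi <= real N ^ CARD('n) / (real N * \<tau>)\<^sup>2"
proof -
 have "Wt N \<alpha> xi = fejer N (dual \<alpha> xi j) * (\<Prod>j\<in>UNIV - {j}. fejer N (dual \<alpha> xi j))"
  unfolding Wt_def by (rule prod.remove) auto
 also have "... <= (1 / (N * \<tau>\<^sup>2)) * (\<Prod>j\<in>UNIV - {j}. real N)"
  by (intro mult_mono prod_mono fejer_le_far[OF assms] prod_nonneg)
    (auto simp: fejer_nonneg fejer_le)
 also have "... = (1 / (N * \<tau>\<^sup>2)) * real N ^ (CARD('n) - 1)" by (simp add: card_Diff_singleton)
 also have "... = real N ^ CARD('n) / (real N * \<tau>)\<^sup>2"
 proof -
  have "CARD('n) = Suc (CARD('n) - 1)" by simp
  then have "real N ^ CARD('n) = real N * real N ^ (CARD('n) - 1)" by (metis power_Suc)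
  then show ?thesis using assms by (simp add: power2_eq_square field_simps)
 qed
 finally show ?thesis .
qed

lemma wq_bounds:
 assumes "q \<in> ibox N" shows "0 <= wq N q" "wq N q <= 1"
proof -
 have "0 <= 1 - \<bar>real_of_int (q j)\<bar> / of_nat N & 1 - \<bar>real_of_int (q j)\<bar> / of_nat N <= 1" for j
 proof -
  have "\<bar>q j\<bar> <= int N" using assms by (simp add: ibox_iff)
  then have "\<bar>real_of_int (q j)\<bar> <= real N" by linarith
  then show ?thesis by (cases "N = 0") (auto simp: field_simps)
 qed
 then show "0 <= wq N q" "wq N q <= 1"
  unfolding wq_def by (auto intro!: prod_nonneg prod_le_1)
qed

lemma wq_0 [simp]: "wq N (%_. 0) = 1"
 by (simp add: wq_def)

lemma Wt_expand:
 assumes "N > 0"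
 shows "of_real (Wt N \<alpha> xi) = (\<Sum>q\<in>ibox N. of_real (wq N q) * ee (\<Sum>i\<in>UNIV. of_int (xi i) * lin \<alpha> q i))"
proof -
 have "(of_real (Wt N \<alpha> xi) :: complex) = (\<Prod>j\<in>UNIV. \<Sum>q\<in>{-int N..int N}.
   of_real (1 - \<bar>of_int q\<bar> / of_nat N) * ee (of_int q * dual \<alpha> xi j))"
  unfolding Wt_def of_real_prod by (simp only: fejer_expand[OF assms])
 also have "... = (\<Sum>q\<in>ibox N. \<Prod>j\<in>UNIV. of_real (1 - \<bar>of_int (q j)\<bar> / of_nat N) * ee (of_int (q j) * dual \<alpha> xi j))"
  unfolding ibox_def by (rule prod_sum_PiE) auto
 also have "... = (\<Sum>q\<in>ibox N. of_real (wq N q) * ee (\<Sum>i\<in>UNIV. of_int (xi i) * lin \<alpha> q i))"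
  unfolding prod.distrib lin_dual ee_sum wq_def of_real_prod ..
 finally show ?thesis .
qed

lemma partial_sum_expand:
 fixes \<alpha> :: "real^'n^'m"
 assumes "N > 0"
 shows "(\<Sum>xi\<in>ibox J. of_real (cprod a xi * Wt N \<alpha> xi) * ee (idot xi \<beta>)) =
  (\<Sum>q\<in>ibox N. of_real (wq N q) *
    (\<Prod>i\<in>UNIV. \<Sum>j\<in>{-int J..int J}. of_real (a j) * ee (of_int j * (lin \<alpha> q i + \<beta> $ i))))"
proof -
 have "(\<Prod>i\<in>UNIV. \<Sum>j\<in>{-int J..int J}. of_real (a j) * ee (of_int j * (lin \<alpha> q i + \<beta> $ i))) =
   (\<Sum>xi\<in>ibox J. of_real (cprod a xi) * ee (\<Sum>i\<in>UNIV. of_int (xi i) * lin \<alpha> q i) * ee (idot xi \<beta>))" for q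
 proof -
  have "(\<Prod>i\<in>UNIV. \<Sum>j\<in>{-int J..int J}. of_real (a j) * ee (of_int j * (lin \<alpha> q i + \<beta> $ i))) =
   (\<Sum>xi\<in>ibox J. \<Prod>i\<in>UNIV. of_real (a (xi i)) * ee (of_int (xi i) * (lin \<alpha> q i + \<beta> $ i)))"
   unfolding ibox_def by (rule prod_sum_PiE) auto
  also have "... = (\<Sum>xi\<in>ibox J. of_real (cprod a xi) * ee (\<Sum>i\<in>UNIV. of_int (xi i) * lin \<alpha> q i) * ee (idot xi \<beta>))"
   unfolding distrib_left ee_add idot_def prod.distrib ee_sum cprod_def of_real_prod by (simp add: mult_ac)
  finally show ?thesis .
 qed
 then have "(\<Sum>q\<in>ibox N. of_real (wq N q) *
    (\<Prod>i\<in>UNIV. \<Sum>j\<in>{-int J..int J}. of_real (a j) * ee (of_int j * (lin \<alpha> q i + \<beta> $ i)))) =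
  (\<Sum>q\<in>ibox N. \<Sum>xi\<in>ibox J. of_real (wq N q) *
    (of_real (cprod a xi) * ee (\<Sum>i\<in>UNIV. of_int (xi i) * lin \<alpha> q i) * ee (idot xi \<beta>)))"
  by (simp add: sum_distrib_left)
 also have "... = (\<Sum>xi\<in>ibox J. \<Sum>q\<in>ibox N. of_real (wq N q) *
    (of_real (cprod a xi) * ee (\<Sum>i\<in>UNIV. of_int (xi i) * lin \<alpha> q i) * ee (idot xi \<beta>)))"
  by (rule sum.swap)
 also have "... = (\<Sum>xi\<in>ibox J. of_real (cprod a xi * Wt N \<alpha> xi) * ee (idot xi \<beta>))"
  unfolding of_real_mult Wt_expand[OF assms] sum_distrib_left sum_distrib_right
  by (simp add: mult_ac)
 finally show ?thesis ..
qed

lemma kern_nonneg: "kern r g a ==> 0 <= a j"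
 by (simp add: kern_def)

lemma kern_sum_le_1:
 assumes "kern r g a" shows "(\<Sum>j\<in>{-int J..int J}. a j) <= 1"
proof -
 have "(%J. \<Sum>j\<in>{-int J..int J}. of_real (a j) * ee (of_int j * 0)) \<longlonglongrightarrow> of_real (g 0)"
  using assms unfolding kern_def by (intro tendsto_uniform_limitI[where S = UNIV]) auto
 then have "(%J. of_real (\<Sum>j\<in>{-int J..int J}. a j) :: complex) \<longlonglongrightarrow> of_real (g 0)"
  by simp
 then have lim: "(%J. \<Sum>j\<in>{-int J..int J}. a j) \<longlonglongrightarrow> g 0"
  by (simp only: tendsto_of_real_iff)
 have "incseq (%J. \<Sum>j\<in>{-int J..int J}. a j)"
  using kern_nonneg[OF assms] by (intro incseq_SucI sum_mono2) auto
 then have "(\<Sum>j\<in>{-int J..int J}. a j) <= g 0" using lim by (rule incseq_le)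
 then show ?thesis using assms by (simp add: kern_def)
qed

lemma kern_abs_le_1:
 assumes "kern r g a" shows "\<bar>g x\<bar> <= 1"
  and "norm (\<Sum>j\<in>{-int J..int J}. of_real (a j) * ee (of_int j * x)) <= 1"
proof -
 have *: "norm (\<Sum>j\<in>{-int J..int J}. of_real (a j) * ee (of_int j * x)) <= 1" for J
 proof -
  have "norm (\<Sum>j\<in>{-int J..int J}. of_real (a j) * ee (of_int j * x)) <=
    (\<Sum>j\<in>{-int J..int J}. norm (of_real (a j) * ee (of_int j * x)))" by (rule norm_sum)
  also have "... = (\<Sum>j\<in>{-int J..int J}. a j)"
   using kern_nonneg[OF assms] by (simp add: norm_mult)
  finally show ?thesis using kern_sum_le_1[OF assms, of J] by simp
 qed
 show "norm (\<Sum>j\<in>{-int J..int J}. of_real (a j) * ee (of_int j * x)) <= 1" by (rule *)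
 have "(%J. \<Sum>j\<in>{-int J..int J}. of_real (a j) * ee (of_int j * x)) \<longlonglongrightarrow> of_real (g x)"
  using assms unfolding kern_def by (intro tendsto_uniform_limitI[where S = UNIV]) auto
 then have "norm (of_real (g x) :: complex) <= 1"
  using * by (intro LIMSEQ_le_const2[OF tendsto_norm]) auto
 then show "\<bar>g x\<bar> <= 1" by simp
qed

text \<open>Over boxes of frequencies the partial sums factor over the coordinates. All factors have
  modulus at most 1, so a difference of products is at most the sum of the differences, and uniform
  convergence of the one-dimensional series suffices.\<close>

lemma Gf_uniform_limit:
 fixes \<alpha> :: "real^'n^'m"
 assumes k: "kern r g a" and N: "N > 0"
 shows "uniform_limit UNIV (%J \<beta>. \<Sum>xi\<in>ibox J. of_real (cprod a xi * Wt N \<alpha> xi) * ee (idot xi \<beta>))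
   (%\<beta>. of_real (Gf N g \<alpha> \<beta>)) sequentially"
proof (rule uniform_limitI)
 fix e :: real assume e: "e > 0"
 define C where "C = real (card (ibox N :: ('n => int) set)) * CARD('m)"
 have C: "0 <= C" by (simp add: C_def)
 define T where "T J x = (\<Sum>j\<in>{-int J..int J}. of_real (a j) * ee (of_int j * x))" for J x
 have ul: "uniform_limit UNIV T (%x. of_real (g x)) sequentially"
  using k by (simp add: kern_def T_def[abs_def])
 have "e / (C + 1) > 0" using e C by simp
 from uniform_limitD[OF ul this]
 show "\<forall>\<^sub>F J in sequentially. \<forall>\<beta>\<in>UNIV. dist (\<Sum>xi\<in>ibox J. of_real (cprod a xi * Wt N \<alpha> xi) * ee (idot xi \<beta>)) (of_real (Gf N g \<alpha> \<beta>)) < e"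
 proof eventually_elim
  case (elim J)
  show ?case
  proof
   fix \<beta> :: "real^'m"
   have "dist (\<Sum>xi\<in>ibox J. of_real (cprod a xi * Wt N \<alpha> xi) * ee (idot xi \<beta>)) (of_real (Gf N g \<alpha> \<beta>)) =
     norm (\<Sum>q\<in>ibox N. of_real (wq N q) * ((\<Prod>i\<in>UNIV. T J (lin \<alpha> q i + \<beta> $ i)) - (\<Prod>i\<in>UNIV. of_real (g (lin \<alpha> q i + \<beta> $ i)))))"
    unfolding partial_sum_expand[OF N] dist_norm Gf_def T_def
    by (simp add: sum_subtractf right_diff_distrib)
   also have "... <= (\<Sum>q\<in>(ibox N :: ('n => int) set). 1 * (\<Sum>i\<in>(UNIV::'m set). e / (C + 1)))"
   proof (rule sum_norm_le)
    fix q :: "'n => int" assume q: "q \<in> ibox N"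
    have "norm ((\<Prod>i\<in>UNIV. T J (lin \<alpha> q i + \<beta> $ i)) - (\<Prod>i\<in>UNIV. of_real (g (lin \<alpha> q i + \<beta> $ i)))) <=
      (\<Sum>i\<in>(UNIV::'m set). norm (T J (lin \<alpha> q i + \<beta> $ i) - of_real (g (lin \<alpha> q i + \<beta> $ i))))"
     using kern_abs_le_1[OF k] by (intro norm_prod_diff) (auto simp: T_def)
    also have "... <= (\<Sum>i\<in>(UNIV::'m set). e / (C + 1))"
     using elim by (intro sum_mono less_imp_le) (auto simp: dist_norm)
    finally show "norm (of_real (wq N q) * ((\<Prod>i\<in>UNIV. T J (lin \<alpha> q i + \<beta> $ i)) - (\<Prod>i\<in>UNIV. of_real (g (lin \<alpha> q i + \<beta> $ i))))) <= 1 * (\<Sum>i\<in>(UNIV::'m set). e / (C + 1))"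
     unfolding norm_mult using wq_bounds[OF q] by (intro mult_mono) auto
   qed
   also have "... = C * (e / (C + 1))" by (simp add: C_def)
   also have "... < e" using e C by (simp add: field_simps)
   finally show "dist (\<Sum>xi\<in>ibox J. of_real (cprod a xi * Wt N \<alpha> xi) * ee (idot xi \<beta>)) (of_real (Gf N g \<alpha> \<beta>)) < e" .
  qed
 qed
qed

lemma cprod_nonneg: "kern r g a ==> 0 <= cprod a xi"
 unfolding cprod_def by (intro prod_nonneg ballI) (simp add: kern_nonneg)

text \<open>At \<open>\<beta> = 0\<close> all characters equal 1, so the nonnegative partial sums
  increase to the value of the count there.\<close>

lemma sum_le_Gf_0:
 fixes \<alpha> :: "real^'n^'m"
 assumes k: "kern r g a" and N: "N > 0" and F: "finite F"
 shows "(\<Sum>xi\<in>F. cprod a xi * Wt N \<alpha> xi) <= Gf N g \<alpha> 0"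
proof -
 have "(%J. \<Sum>xi\<in>ibox J. of_real (cprod a xi * Wt N \<alpha> xi) * ee (idot xi 0)) \<longlonglongrightarrow> of_real (Gf N g \<alpha> 0)"
  by (rule tendsto_uniform_limitI[OF Gf_uniform_limit[OF k N]]) auto
 then have "(%J. of_real (\<Sum>xi\<in>ibox J. cprod a xi * Wt N \<alpha> xi) :: complex) \<longlonglongrightarrow> of_real (Gf N g \<alpha> 0)"
  by (simp add: idot_def)
 then have lim: "(%J. \<Sum>xi\<in>ibox J. cprod a xi * Wt N \<alpha> xi) \<longlonglongrightarrow> Gf N g \<alpha> 0"
  by (simp only: tendsto_of_real_iff)
 obtain J0 where J0: "F \<subseteq> ibox J0" using finite_subset_ibox[OF F] .
 show ?thesis
 proof (rule LIMSEQ_le_const[OF lim], intro exI allI impI)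
  fix J assume "J0 <= J"
  then have "F \<subseteq> ibox J" using J0 ibox_mono by blast
  then show "(\<Sum>xi\<in>F. cprod a xi * Wt N \<alpha> xi) <= (\<Sum>xi\<in>ibox J. cprod a xi * Wt N \<alpha> xi)"
   by (intro sum_mono2) (auto simp: cprod_nonneg[OF k] Wt_nonneg)
 qed
qed

text \<open>Every summand is at most 1 and vanishes unless \<open>\<alpha> q\<close> returns to
  within \<open>r\<close> of the lattice; with \<open>sum_le_Gf_0\<close>, sums of Fourier
  coefficients are bounded by a number of near returns.\<close>

lemma Gf_0_le_card:
 fixes \<alpha> :: "real^'n^'m"
 assumes k: "kern r g a"
 shows "Gf N g \<alpha> 0 <= card {q \<in> ibox N. ALL i. \<exists>v::int. \<bar>lin \<alpha> q i - of_int v\<bar> < r}"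
proof -
 define Q where "Q = {q \<in> ibox N. ALL i. \<exists>v::int. \<bar>lin \<alpha> q i - of_int v\<bar> < r}"
 have "Gf N g \<alpha> 0 = (\<Sum>q\<in>Q. wq N q * (\<Prod>i\<in>UNIV. g (lin \<alpha> q i)))"
  unfolding Gf_def Q_def
  by (rule sum.mono_neutral_cong_right) (use k in \<open>force simp: kern_def\<close>)+
 also have "... <= (\<Sum>q\<in>Q. 1)"
 proof (rule sum_mono)
  fix q assume q: "q \<in> Q"
  have "\<bar>\<Prod>i\<in>UNIV. g (lin \<alpha> q i)\<bar> <= 1"
   unfolding abs_prod using kern_abs_le_1[OF k] by (intro prod_le_1) auto
  then have "\<bar>wq N q\<bar> * \<bar>\<Prod>i\<in>UNIV. g (lin \<alpha> q i)\<bar> <= 1 * 1"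
   using wq_bounds[of q N] q by (intro mult_mono) (auto simp: Q_def)
  then have "\<bar>wq N q * (\<Prod>i\<in>UNIV. g (lin \<alpha> q i))\<bar> <= 1" by (simp add: abs_mult)
  then show "wq N q * (\<Prod>i\<in>UNIV. g (lin \<alpha> q i)) <= 1" by simp
 qed
 finally show ?thesis by (simp add: Q_def)
qed

lemma borel_measurable_idot [measurable]: "(%\<beta>. idot xi \<beta>) \<in> borel_measurable borel"
 unfolding idot_def by measurable

lemma idot_diff: "idot (%i. xi i - xi' i) \<beta> = idot xi \<beta> - idot xi' \<beta>"
 by (simp add: idot_def left_diff_distrib sum_subtractf)

lemma idot_0 [simp]: "idot (%_. 0) \<beta> = 0"
 by (simp add: idot_def)

section \<open>The second moment method\<close>

lemma nonneg_partial_sums_unbounded: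
 fixes f :: "nat => real"
 assumes "\<not> summable f" "!!k. K <= k ==> 0 <= f k"
 shows "\<exists>L\<ge>K. B <= (\<Sum>k=K..L. f k)"
proof (rule ccontr)
 assume "\<not> ?thesis"
 then have lt: "(\<Sum>k=K..L. f k) < B" if "L \<ge> K" for L using that by force
 have "summable (%i. f (i + K))"
 proof (rule summableI_nonneg_bounded)
  show "0 <= f (n + K)" for n using assms(2) by simp
  fix n
  show "(\<Sum>i<n. f (i + K)) <= \<bar>B\<bar>"
  proof (cases n)
   case (Suc m)
   have "(\<Sum>i<n. f (i + K)) = (\<Sum>k=K..K + m. f k)"
    by (rule sum.reindex_bij_witness[of _ "%k. k - K" "%i. i + K"]) (auto simp: Suc)
   also have "... < B" by (rule lt) simp
   finally show ?thesis by simp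
  qed simp
 qed
 then show False using assms(1) by (simp add: summable_iff_shift)
qed

text \<open>The role of the mean of \<open>G k\<close> is played by its zero coefficient, so
  \<open>\<nu>\<close> may have any finite mass. If all \<open>G k\<close> with
  \<open>k >= K\<close> vanish at a point, the fluctuating part of their sum up to \<open>L\<close>
  must nearly cancel the sum \<open>S\<close> of the means. The hypothesis \<open>cov\<close> bounds
  the second moment of the fluctuation by a multiple of \<open>S\<close>, not of \<open>S^2\<close>;
  Chebyshev's inequality then gives measure tending to 0, hence full measure without a zero-one
  law.\<close>

lemma second_moment:
 fixes \<nu> :: "'w measure" and F :: "'w => real^'m" and u :: "nat => ('m => int) => real"
  and G :: "nat => real^'m => real"
 assumes fin: "finite_measure \<nu>" and F [measurable]: "F \<in> borel_measurable \<nu>"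
  and u0: "!!k xi. kb <= k ==> 0 <= u k xi"
  and lim: "!!k. kb <= k ==> uniform_limit UNIV (%J \<beta>. \<Sum>xi\<in>ibox J. of_real (u k xi) * ee (idot xi \<beta>))
     (%\<beta>. of_real (G k \<beta>)) sequentially"
  and C: "0 <= C"
  and cov: "!!l X. kb <= l ==> finite X ==> (%_. 0) \<notin> X ==>
    (\<Sum>k=kb..l. \<Sum>xi\<in>X. \<Sum>xi'\<in>X. u k xi * u l xi' * norm (\<integral>om. ee (idot (%i. xi i - xi' i) (F om)) \<partial>\<nu>)) <= C * u l (%_. 0)"
  and div: "\<not> summable (%k. u k (%_. 0))"
 shows "AE om in \<nu>. ALL K. \<exists>k\<ge>K. G k (F om) ~= 0"
proof -
 interpret finite_measure \<nu> by (rule fin)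
 define H where "H X k l = (\<Sum>xi\<in>X. \<Sum>xi'\<in>X. u k xi * u l xi' * norm (\<integral>om. ee (idot (%i. xi i - xi' i) (F om)) \<partial>\<nu>))"
  for X k l
 have int_ee: "integrable \<nu> (%om. ee (idot xi (F om)))" for xi
  by (rule integrable_const_bound[of _ 1]) auto
 have Hsym: "H X k l = H X l k" for X k l
 proof -
  have "norm (\<integral>om. ee (idot (%i. xi i - xi' i) (F om)) \<partial>\<nu>) = norm (\<integral>om. ee (idot (%i. xi' i - xi i) (F om)) \<partial>\<nu>)"
   for xi xi' :: "'m => int"
  proof -
   have "ee (idot (%i. xi i - xi' i) (F om)) = cnj (ee (idot (%i. xi' i - xi i) (F om)))" for om
    by (simp add: idot_diff ee_minus[symmetric])
   then show ?thesis by (simp add: integral_cnj)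
  qed
  note sym = this
  show ?thesis unfolding H_def
   by (subst sum.swap, intro sum.cong refl, subst sym) (simp add: mult_ac)
 qed
 have Hnn: "0 <= H X k l" if "kb <= k" "kb <= l" for X k l
  unfolding H_def using that u0 by (intro sum_nonneg mult_nonneg_nonneg) auto
 have main: "\<exists>D\<in>sets \<nu>. {om\<in>space \<nu>. \<forall>k\<ge>K. G k (F om) = 0} \<subseteq> D & measure \<nu> D <= 1 / Suc j"
  if K: "kb <= K" for K j
 proof -
  \<comment> \<open>With \<open>S >= 2\<close> one has \<open>S - 1 >= S / 2\<close>, and
    Chebyshev's quotient becomes \<open>2 * C * S / (S / 2)^2 = 8 * C / S\<close>, at most
    \<open>1 / Suc j\<close> by this choice.\<close>
  obtain L where L: "L \<ge> K" "max 2 (8 * C * Suc j) <= (\<Sum>k=K..L. u k (%_. 0))"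
   using nonneg_partial_sums_unbounded[OF div, of K "max 2 (8 * C * Suc j)"] u0 K by auto
  define S where "S = (\<Sum>k=K..L. u k (%_. 0))"
  have S: "2 <= S" "8 * C * Suc j <= S" using L(2) by (auto simp: S_def)
  have "\<forall>\<^sub>F J in sequentially. \<forall>k\<in>{K..L}. \<forall>\<beta>\<in>UNIV.
    dist (\<Sum>xi\<in>ibox J. of_real (u k xi) * ee (idot xi \<beta>)) (of_real (G k \<beta>)) < 1 / Suc L"
   using K by (intro eventually_ball_finite ballI uniform_limitD[OF lim]) auto
  then obtain J where J: "!!k \<beta>. k \<in> {K..L} ==>
    dist (\<Sum>xi\<in>ibox J. of_real (u k xi) * ee (idot xi \<beta>)) (of_real (G k \<beta>)) < 1 / Suc L"
   unfolding eventually_sequentially by blast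
  define X where "X = (ibox J - {%_. 0} :: ('m => int) set)"
  have X: "finite X" "(%_. 0) \<notin> X" by (auto simp: X_def)
  \<comment> \<open>The zero frequency has been split off. The box \<open>J\<close> leaves a
    truncation error below \<open>1 / Suc L\<close> at each of the at most \<open>Suc L\<close>
    scales, so the total error is at most 1.\<close>
  define Z where "Z om = (\<Sum>p\<in>{K..L} \<times> X. of_real (u (fst p) (snd p)) * ee (idot (snd p) (F om)))" for om
  define D where "D = {om\<in>space \<nu>. (S - 1)\<^sup>2 <= (norm (Z om))\<^sup>2}"
  have Zmeas [measurable]: "Z \<in> borel_measurable \<nu>"
   unfolding Z_def by measurable
  have sub: "{om\<in>space \<nu>. \<forall>k\<ge>K. G k (F om) = 0} \<subseteq> D"
  proof
   fix om assume "om \<in> {om\<in>space \<nu>. \<forall>k\<ge>K. G k (F om) = 0}"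
   then have om: "om \<in> space \<nu>" "!!k. k \<ge> K ==> G k (F om) = 0" by auto
   have ib: "(%_. 0) \<in> (ibox J :: ('m => int) set)" by (simp add: ibox_iff)
   have "of_real S + Z om = (\<Sum>k=K..L. \<Sum>xi\<in>ibox J. of_real (u k xi) * ee (idot xi (F om)))"
    unfolding sum.remove[OF finite_ibox ib] sum.distrib Z_def S_def X_def
    by (simp add: sum.cartesian_product case_prod_unfold)
   also have "norm ... <= (\<Sum>k=K..L. 1 / Suc L)"
   proof (rule sum_norm_le)
    fix k assume "k \<in> {K..L}"
    then show "norm (\<Sum>xi\<in>ibox J. of_real (u k xi) * ee (idot xi (F om))) <= 1 / Suc L"
     using J[of k "F om"] om(2)[of k] by simp
   qed
   also have "... <= 1" using L(1) by (simp add: field_simps)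
   finally have "norm (of_real S + Z om) <= 1" .
   moreover have "norm (of_real S :: complex) - norm (Z om) <= norm (of_real S + Z om)"
    by (metis norm_diff_ineq)
   ultimately have "S - 1 <= norm (Z om)" using S by simp
   then show "om \<in> D" using S om(1) by (auto simp: D_def intro!: power_mono)
  qed
  have ZZ: "of_real ((norm (Z om))\<^sup>2) = (\<Sum>p\<in>{K..L} \<times> X. \<Sum>p'\<in>{K..L} \<times> X.
    of_real (u (fst p) (snd p) * u (fst p') (snd p')) * ee (idot (%i. snd p i - snd p' i) (F om)))" for om
   unfolding complex_norm_square Z_def cnj_sum sum_product idot_diff
   by (intro sum.cong refl) (simp add: ee_minus[symmetric] ee_add[symmetric] algebra_simps)
  have "of_real (\<integral>om. (norm (Z om))\<^sup>2 \<partial>\<nu>) = (\<integral>om. (\<Sum>p\<in>{K..L} \<times> X. \<Sum>p'\<in>{K..L} \<times> X.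
    of_real (u (fst p) (snd p) * u (fst p') (snd p')) * ee (idot (%i. snd p i - snd p' i) (F om))) \<partial>\<nu>)"
   unfolding integral_complex_of_real[symmetric] ZZ ..
  also have "... = (\<Sum>p\<in>{K..L} \<times> X. \<Sum>p'\<in>{K..L} \<times> X.
    of_real (u (fst p) (snd p) * u (fst p') (snd p')) * (\<integral>om. ee (idot (%i. snd p i - snd p' i) (F om)) \<partial>\<nu>))"
   by (simp add: Bochner_Integration.integral_sum int_ee)
  finally have eq: "of_real (\<integral>om. (norm (Z om))\<^sup>2 \<partial>\<nu>) = (\<Sum>p\<in>{K..L} \<times> X. \<Sum>p'\<in>{K..L} \<times> X.
    of_real (u (fst p) (snd p) * u (fst p') (snd p')) * (\<integral>om. ee (idot (%i. snd p i - snd p' i) (F om)) \<partial>\<nu>))" .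
  have "(\<integral>om. (norm (Z om))\<^sup>2 \<partial>\<nu>) <= norm (of_real (\<integral>om. (norm (Z om))\<^sup>2 \<partial>\<nu>) :: complex)" by simp
  also have "... <= (\<Sum>p\<in>{K..L} \<times> X. \<Sum>p'\<in>{K..L} \<times> X.
    u (fst p) (snd p) * u (fst p') (snd p') * norm (\<integral>om. ee (idot (%i. snd p i - snd p' i) (F om)) \<partial>\<nu>))"
   unfolding eq using u0 K by (intro sum_norm_le) (auto simp: norm_mult)
  also have "... = (\<Sum>k=K..L. \<Sum>l=K..L. H X k l)"
   unfolding H_def sum.cartesian_product' by (simp add: sum.swap[of _ X "{K..L}"])
  \<comment> \<open>Each pair of scales is charged to the larger one, where \<open>cov\<close>
    applies; counting equal scales twice is harmless.\<close>
  also have "... <= (\<Sum>k=K..L. (\<Sum>l=K..L. if l <= k then H X l k else 0) + (\<Sum>l=K..L. if k <= l then H X k l else 0))"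
   unfolding sum.distrib[symmetric] using Hnn K by (intro sum_mono) (auto simp: Hsym)
  also have "... = (\<Sum>k=K..L. \<Sum>l=K..L. if l <= k then H X l k else 0) + (\<Sum>k=K..L. \<Sum>l=K..L. if k <= l then H X k l else 0)"
   by (rule sum.distrib)
  also have "(\<Sum>k=K..L. \<Sum>l=K..L. if k <= l then H X k l else 0) = (\<Sum>k=K..L. \<Sum>l=K..L. if l <= k then H X l k else 0)"
   by (rule sum.swap)
  also have "(\<Sum>k=K..L. \<Sum>l=K..L. if l <= k then H X l k else 0) <= (\<Sum>k=K..L. C * u k (%_. 0))"
  proof (rule sum_mono)
   fix k assume k: "k \<in> {K..L}"
   have "(\<Sum>l=K..L. if l <= k then H X l k else 0) = (\<Sum>l=K..k. H X l k)"
    using k by (intro sum.mono_neutral_cong_right) auto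
   also have "... <= (\<Sum>l=kb..k. H X l k)"
    using K k Hnn by (intro sum_mono2) auto
   also have "... <= C * u k (%_. 0)"
    unfolding H_def using cov[of k X] X K k by auto
   finally show "(\<Sum>l=K..L. if l <= k then H X l k else 0) <= C * u k (%_. 0)" .
  qed
  also have "(\<Sum>k=K..L. C * u k (%_. 0)) = C * S" by (simp add: S_def sum_distrib_left)
  finally have var: "(\<integral>om. (norm (Z om))\<^sup>2 \<partial>\<nu>) <= 2 * (C * S)" by simp
  have bZ: "norm (Z om) <= (\<Sum>p\<in>{K..L} \<times> X. \<bar>u (fst p) (snd p)\<bar>)" for om
   unfolding Z_def by (intro sum_norm_le) (simp add: norm_mult)
  have intZ: "integrable \<nu> (%om. (norm (Z om))\<^sup>2)"
  proof (rule integrable_const_bound)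
   show "AE om in \<nu>. norm ((norm (Z om))\<^sup>2) <= (\<Sum>p\<in>{K..L} \<times> X. \<bar>u (fst p) (snd p)\<bar>)\<^sup>2"
    using bZ by (auto intro!: AE_I2 power_mono)
  qed measurable
  have "measure \<nu> D <= (\<integral>om. (norm (Z om))\<^sup>2 \<partial>\<nu>) / (S - 1)\<^sup>2"
   unfolding D_def using S by (intro integral_Markov_inequality_measure[OF intZ, of "{}"]) auto
  also have "... <= 2 * (C * S) / (S - 1)\<^sup>2" using var by (intro divide_right_mono) auto
  also have "... <= 2 * (C * S) / (S / 2)\<^sup>2"
  proof (rule divide_left_mono)
   show "(S / 2)\<^sup>2 <= (S - 1)\<^sup>2" using S by (intro power_mono) auto
   show "0 <= 2 * (C * S)" using S C by auto
   show "0 < (S - 1)\<^sup>2 * (S / 2)\<^sup>2" using S by (intro mult_pos_pos) auto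
  qed
  also have "... = 8 * C / S" using S by (simp add: power2_eq_square)
  also have "... <= 1 / Suc j"
  proof -
   have "8 * C / S * real (Suc j) <= 1"
    unfolding times_divide_eq_left by (subst pos_divide_le_eq) (use S in auto)
   then show ?thesis by (subst pos_le_divide_eq) auto
  qed
  finally have "measure \<nu> D <= 1 / Suc j" .
  moreover have "D \<in> sets \<nu>" unfolding D_def by measurable
  ultimately show ?thesis using sub by blast
 qed
 have "AE om in \<nu>. \<exists>k\<ge>K. G k (F om) ~= 0" for K
 proof -
  define K' where "K' = max K kb"
  have "ALL j. EX D. D \<in> sets \<nu> & {om\<in>space \<nu>. \<forall>k\<ge>K'. G k (F om) = 0} \<subseteq> D & measure \<nu> D <= 1 / Suc j"
   using main[of K'] by (auto simp: K'_def)
  from choice[OF this] obtain D where D': "ALL j. D j \<in> sets \<nu> &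
    {om\<in>space \<nu>. \<forall>k\<ge>K'. G k (F om) = 0} \<subseteq> D j & measure \<nu> (D j) <= 1 / Suc j" by (elim exE)
  have D: "D j \<in> sets \<nu>" "{om\<in>space \<nu>. \<forall>k\<ge>K'. G k (F om) = 0} \<subseteq> D j"
   "measure \<nu> (D j) <= 1 / Suc j" for j using D' by blast+
  have meas: "(\<Inter>j. D j) \<in> sets \<nu>" using D(1) by auto
  have "measure \<nu> (\<Inter>j. D j) <= 1 / Suc j" for j
   by (rule order_trans[OF finite_measure_mono D(3)]) (use D(1) in auto)
  then have "measure \<nu> (\<Inter>j. D j) <= 0"
   by (intro LIMSEQ_le_const[OF LIMSEQ_inverse_real_of_nat]) (auto simp: field_simps)
  then have "measure \<nu> (\<Inter>j. D j) = 0" by (simp add: measure_le_0_iff)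
  then have "emeasure \<nu> (\<Inter>j. D j) = 0" by (simp add: emeasure_eq_measure)
  then show ?thesis
  proof (intro AE_I[OF _ _ meas])
   show "{om \<in> space \<nu>. \<not> (\<exists>k\<ge>K. G k (F om) ~= 0)} \<subseteq> (\<Inter>j. D j)"
   proof
    fix om assume "om \<in> {om \<in> space \<nu>. \<not> (\<exists>k\<ge>K. G k (F om) ~= 0)}"
    then have "om \<in> {om\<in>space \<nu>. \<forall>k\<ge>K'. G k (F om) = 0}" by (auto simp: K'_def)
    then show "om \<in> (\<Inter>j. D j)" using D(2) by blast
   qed
  qed
 qed
 then show ?thesis by (simp add: AE_all_countable)
qed

section \<open>Separation of the points \<open>\<alpha> q\<close> and transference to the dual
  forms\<close>

lemma lin_diff: "lin \<alpha> (%j. q j - q' j) i = lin \<alpha> q i - lin \<alpha> q' i"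
 by (simp add: lin_def right_diff_distrib sum_subtractf)

lemma dual_diff: "dual \<alpha> (%i. xi i - xi' i) j = dual \<alpha> xi j - dual \<alpha> xi' j"
 by (simp add: dual_def left_diff_distrib sum_subtractf)

text \<open>Abstract form of the hypothesis on \<open>\<alpha>\<close> at the scales
  \<open>2 ^ k\<close>, with \<open>\<rho> k\<close> the radius of the target. The assumption
  \<open>\<rho>_low\<close> says that the expected count \<open>\<rho>^m * 2^(k n)\<close> is no
  smaller than a negative power of \<open>k\<close>. Separation by \<open>2 * \<rho> k\<close>
  allows differences of two near returns; it is required in boxes dilated by \<open>t k\<close>, and
  \<open>t_ge_ln\<close> measures the resulting gain.\<close>

locale twisted =
 fixes \<alpha> :: "real^'n^'m" and \<rho> :: "nat => real" and t :: "nat => nat" and k0 A :: nat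
 assumes \<rho>_pos: "k0 <= k ==> 0 < \<rho> k" and \<rho>_lt_1: "k0 <= k ==> \<rho> k < 1"
  and \<rho>_low: "k0 <= k ==> 1 <= (\<rho> k) ^ CARD('m) * 2 ^ (k * CARD('n)) * real k ^ A"
  and sep: "k0 <= k ==> q ~= (%_. 0) ==> (!!j. \<bar>q j\<bar> <= 2 ^ k * int (t k)) ==>
    EX i. \<forall>v::int. 2 * \<rho> k <= \<bar>lin \<alpha> q i - of_int v\<bar>"
  and t_ge_1: "k0 <= k ==> 1 <= t k" and t_ge_ln: "k0 <= k ==> ln (real k) <= real (t k) ^ CARD('n)"
  and k0_ge_2: "2 <= k0"
begin

lemma sep':
 assumes "k0 <= k" "q ~= (%_. 0)" "!!j. \<bar>q j\<bar> <= 2 ^ k"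
 shows "EX i. \<forall>v::int. 2 * \<rho> k <= \<bar>lin \<alpha> q i - of_int v\<bar>"
proof (rule sep[OF assms(1,2)])
 fix j
 have "\<bar>q j\<bar> <= (2::int) ^ k * 1" using assms(3)[of j] by simp
 also have "... <= 2 ^ k * int (t k)" using t_ge_1[OF assms(1)] by (intro mult_left_mono) auto
 finally show "\<bar>q j\<bar> <= 2 ^ k * int (t k)" .
qed

text \<open>If all dual forms at \<open>xi\<close> were close to integers, then \<open>xi\<close>
  paired with the fractional parts of \<open>\<alpha> q\<close> would be nearly an integer for every
  \<open>q\<close> in the box. This relation replaces the coordinate \<open>i0\<close> of largest
  \<open>|xi i|\<close>, so pigeonholing needs cells in only \<open>m - 1\<close> coordinates. Two
  \<open>q\<close> in the same cell with the same integer have a difference contradicting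
  separation. The condition \<open>big\<close> says that there are fewer cells than points.\<close>

lemma dual_raw:
 fixes xi :: "'m => int"
 assumes K: "k0 <= K" and i0: "xi i0 ~= 0" and X: "!!i. \<bar>xi i\<bar> <= \<bar>xi i0\<bar>"
  and big: "(2 * CARD('m) + 3) * \<bar>real_of_int (xi i0)\<bar> * (2 * CARD('m) / \<rho> K) ^ (CARD('m) - 1) <= 2 ^ (K * CARD('n))"
 shows "EX j. \<forall>v::int. \<bar>real_of_int (xi i0)\<bar> * \<rho> K / (real CARD('n) * 2 ^ K) <= \<bar>dual \<alpha> xi j - of_int v\<bar>"
proof (rule ccontr)
 define m where "m = CARD('m)"
 define n where "n = CARD('n)"
 define X where "X = \<bar>real_of_int (xi i0)\<bar>"
 define U where "U = X * \<rho> K / (real n * 2 ^ K)"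
 define r where "r = \<rho> K"
 have r: "0 < r" "r < 1" using \<rho>_pos[OF K] \<rho>_lt_1[OF K] by (auto simp: r_def)
 have X1: "1 <= X" using i0 by (simp add: X_def)
 have Xi: "\<bar>real_of_int (xi i)\<bar> <= X" for i using X[of i] by (simp add: X_def)
 have m1: "1 <= m" "1 <= n" by (simp_all add: m_def n_def Suc_leI)
 assume "\<not> ?thesis"
 then have "ALL j. \<exists>v::int. \<bar>dual \<alpha> xi j - of_int v\<bar> < U"
  by (auto simp: U_def X_def n_def not_le)
 then obtain v :: "'n => int" where v: "!!j. \<bar>dual \<alpha> xi j - of_int (v j)\<bar> < U" by metis
 define \<epsilon> where "\<epsilon> j = dual \<alpha> xi j - of_int (v j)" for j
 have \<epsilon>: "\<bar>\<epsilon> j\<bar> < U" for j using v by (simp add: \<epsilon>_def)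
 have nU: "n * (2 ^ K * U) = X * r" using m1 by (simp add: U_def r_def)
 \<comment> \<open>Cells of side at most \<open>\<rho> / m\<close>, so that the errors of the
   \<open>m - 1\<close> other coordinates add up to less than \<open>\<rho>\<close>.\<close>
 define H where "H = nat \<lceil>m / r\<rceil>"
 have H: "m / r <= H" "H <= 2 * m / r" "H > 0"
 proof -
  have mr: "1 <= m / r" using m1 r by (simp add: field_simps) 
  show "m / r <= H" unfolding H_def by (simp add: real_nat_ceiling_ge)
  then show "H > 0" using mr by (cases H) auto
  have "real H <= m / r + 1" unfolding H_def using mr by (simp add: of_nat_ceiling)
  then show "H <= 2 * m / r" using mr by simp
 qed
 define y where "y q i = frac (lin \<alpha> q i)" for q i
 \<comment> \<open>An integer by construction; \<open>s_eq\<close> shows that it differs from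
   \<open>xi\<close> paired with the fractional parts only by the small sum of
   \<open>q j * \<epsilon> j\<close>.\<close>
 define s where "s q = (\<Sum>j\<in>UNIV. v j * q j) - (\<Sum>i\<in>UNIV. xi i * \<lfloor>lin \<alpha> q i\<rfloor>)" for q
 have s_eq: "of_int (s q) = (\<Sum>i\<in>UNIV. of_int (xi i) * y q i) - (\<Sum>j\<in>UNIV. of_int (q j) * \<epsilon> j)" for q
  unfolding s_def y_def frac_def \<epsilon>_def right_diff_distrib sum_subtractf lin_dual by (simp add: mult_ac)
 define S where "S = (int m + 1) * \<bar>xi i0\<bar>"
 define QS where "QS = (PiE UNIV (%_. {0..2 ^ K}) :: ('n => int) set)"
 \<comment> \<open>The slot \<open>i0\<close> carries the integer \<open>s q\<close>, which has only
   about \<open>2 * (m + 1) * |xi i0|\<close> possible values, instead of one of \<open>H\<close>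
   cells.\<close>
 define \<Phi> where "\<Phi> q = (%i. if i = i0 then s q else \<lfloor>H * y q i\<rfloor>)" for q
 define T where "T = PiE UNIV (%i. if i = i0 then {-S..S} else {0..<int H})"
 have QSb: "0 <= q j & q j <= 2 ^ K" if "q \<in> QS" for q j using that by (auto simp: QS_def PiE_iff)
 have \<epsilon>sum: "\<bar>\<Sum>j\<in>UNIV. of_int (q j) * \<epsilon> j\<bar> <= X * r" if "!!j. \<bar>q j\<bar> <= 2 ^ K" for q
 proof -
  have "\<bar>\<Sum>j\<in>UNIV. of_int (q j) * \<epsilon> j\<bar> <= (\<Sum>j\<in>(UNIV::'n set). 2 ^ K * U)"
  proof (rule order_trans[OF sum_abs], rule sum_mono)
   fix j
   have "\<bar>real_of_int (q j)\<bar> <= 2 ^ K" using that[of j] by (metis of_int_abs of_int_le_numeral_power_cancel_iff)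
   then show "\<bar>of_int (q j) * \<epsilon> j\<bar> <= 2 ^ K * U" unfolding abs_mult
    using \<epsilon>[of j] by (intro mult_mono) auto
  qed
  then show ?thesis using nU by (simp add: n_def)
 qed
 have "\<Phi> ` QS \<subseteq> T"
 proof
  fix z assume "z \<in> \<Phi> ` QS"
  then obtain q where q: "q \<in> QS" "z = \<Phi> q" by auto
  have y: "0 <= y q i" "y q i < 1" for i by (simp_all add: y_def frac_lt_1)
  have "\<bar>\<Sum>i\<in>UNIV. of_int (xi i) * y q i\<bar> <= (\<Sum>i\<in>(UNIV::'m set). X * 1)"
  proof (rule order_trans[OF sum_abs], rule sum_mono)
   fix i
   show "\<bar>of_int (xi i) * y q i\<bar> <= X * 1"
    unfolding abs_mult using y[of i] X1 Xi[of i] by (intro mult_mono) auto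
  qed
  moreover have "\<bar>\<Sum>j\<in>UNIV. of_int (q j) * \<epsilon> j\<bar> <= X * r"
   using QSb[OF q(1)] by (intro \<epsilon>sum) auto
  moreover have "X * r <= X * 1" using r X1 by (intro mult_left_mono) auto
  ultimately have "\<bar>real_of_int (s q)\<bar> <= m * X + X" unfolding s_eq by (simp add: m_def)
  also have "... = real_of_int S" by (simp add: S_def X_def algebra_simps)
  finally have "\<bar>s q\<bar> <= S" by linarith
  moreover have "0 <= \<lfloor>H * y q i\<rfloor> & \<lfloor>H * y q i\<rfloor> < int H" for i
  proof -
   have "real H * y q i < real H * 1" using y H(3) by (intro mult_strict_left_mono) auto
   then show ?thesis using y by (simp add: floor_less_iff)
  qed
  ultimately show "z \<in> T" by (auto simp: q T_def \<Phi>_def PiE_iff)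
 qed
 moreover have "finite T" by (auto simp: T_def intro!: finite_PiE)
 ultimately have "card (\<Phi> ` QS) <= card T" by (rule card_mono[rotated])
 also have "card T < card QS"
 proof -
  have "card T = card {-S..S} * (\<Prod>i\<in>UNIV - {i0}. card {0..<int H})"
   unfolding T_def card_PiE[OF finite] by (subst prod.remove[of _ i0]) auto
  also have "... = nat (2 * S + 1) * H ^ (m - 1)" by (simp add: m_def card_Diff_singleton)
  finally have "real (card T) = real (nat (2 * S + 1)) * real H ^ (m - 1)" by simp
  also have "real (nat (2 * S + 1)) = 2 * (m + 1) * X + 1" by (simp add: S_def X_def algebra_simps)
  also have "(2 * (m + 1) * X + 1) * real H ^ (m - 1) <= ((2 * m + 3) * X) * (2 * m / r) ^ (m - 1)"
   using X1 H by (intro mult_mono power_mono) (auto simp: algebra_simps)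
  also have "... <= 2 ^ (K * n)" using big by (simp add: m_def n_def X_def r_def)
  also have "... = (2 ^ K) ^ n" by (simp add: power_mult)
  also have "... < (2 ^ K + 1) ^ n" using m1 by (intro power_strict_mono) auto
  also have "... = real (card QS)"
   unfolding QS_def card_PiE[OF finite] by (simp add: n_def nat_add_distrib nat_power_eq add.commute)
  finally show ?thesis by simp
 qed
 finally have "\<not> inj_on \<Phi> QS" by (rule pigeonhole)
 then obtain q1 q2 where q: "q1 \<in> QS" "q2 \<in> QS" "q1 ~= q2" "\<Phi> q1 = \<Phi> q2" by (auto simp: inj_on_def)
 define q where "q = (%j. q1 j - q2 j)"
 have q0: "q ~= (%_. 0)" using q(3) by (auto simp: q_def fun_eq_iff)
 have qb: "\<bar>q j\<bar> <= 2 ^ K" for j using QSb[OF q(1), of j] QSb[OF q(2), of j] by (auto simp: q_def)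
 define w where "w i = y q1 i - y q2 i" for i
 have lw: "lin \<alpha> q i - of_int (\<lfloor>lin \<alpha> q1 i\<rfloor> - \<lfloor>lin \<alpha> q2 i\<rfloor>) = w i" for i
  by (simp add: q_def lin_diff w_def y_def frac_def)
 have w: "\<bar>w i\<bar> < 1 / H" if "i ~= i0" for i
 proof -
  have "\<lfloor>H * y q1 i\<rfloor> = \<lfloor>H * y q2 i\<rfloor>" using fun_cong[OF q(4), of i] that by (simp add: \<Phi>_def)
  then have "\<bar>H * y q1 i - H * y q2 i\<bar> < 1" by linarith
  then have "H * \<bar>w i\<bar> < 1" unfolding w_def right_diff_distrib[symmetric] by (simp add: abs_mult)
  then show ?thesis using H by (simp add: field_simps)
 qed
 have Hr: "1 / H <= r / m" using H m1 r by (simp add: field_simps)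
 \<comment> \<open>Subtracting the relations for \<open>q1\<close> and \<open>q2\<close> expresses
   \<open>xi i0 * w i0\<close> through the \<open>\<epsilon>\<close> terms, worth at most
   \<open>X * r\<close>, and the other coordinates, worth less than another
   \<open>X * r\<close>.\<close>
 have wi0: "\<bar>w i0\<bar> < 2 * r"
 proof -
  have "s q1 = s q2" using fun_cong[OF q(4), of i0] by (simp add: \<Phi>_def)
  then have "(\<Sum>i\<in>UNIV. of_int (xi i) * w i) = (\<Sum>j\<in>UNIV. of_int (q j) * \<epsilon> j)"
   using s_eq[of q1] s_eq[of q2] by (simp add: w_def q_def algebra_simps sum_subtractf)
  then have "of_int (xi i0) * w i0 = (\<Sum>j\<in>UNIV. of_int (q j) * \<epsilon> j) - (\<Sum>i\<in>UNIV - {i0}. of_int (xi i) * w i)"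
   by (subst (asm) sum.remove[of _ i0]) auto
  then have "\<bar>of_int (xi i0) * w i0\<bar> <= \<bar>\<Sum>j\<in>UNIV. of_int (q j) * \<epsilon> j\<bar> + \<bar>\<Sum>i\<in>UNIV - {i0}. of_int (xi i) * w i\<bar>"
   by simp
  also have "\<bar>\<Sum>j\<in>UNIV. of_int (q j) * \<epsilon> j\<bar> <= X * r" by (rule \<epsilon>sum[OF qb])
  also have "\<bar>\<Sum>i\<in>UNIV - {i0}. of_int (xi i) * w i\<bar> <= (\<Sum>i\<in>UNIV - {i0}. X * (r / m))"
  proof (rule order_trans[OF sum_abs], rule sum_mono)
   fix i assume "i \<in> UNIV - {i0}"
   then have "\<bar>w i\<bar> <= r / m" using w[of i] Hr by auto
   then show "\<bar>of_int (xi i) * w i\<bar> <= X * (r / m)" unfolding abs_mult using Xi X1 by (intro mult_mono) auto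
  qed
  also have "... = X * (r * (real (m - 1) / m))" by (simp add: m_def card_Diff_singleton)
  also have "... < X * (r * 1)" using X1 r m1 by (intro mult_strict_left_mono) auto
  finally have "X * \<bar>w i0\<bar> < X * (2 * r)" by (simp add: abs_mult X_def mult_ac)
  then show ?thesis using X1 by simp
 qed
 have "\<bar>w i\<bar> < 2 * r" for i
 proof (cases "i = i0")
  case False
  have "r / m <= r" using m1 r by (simp add: field_simps)
  then show ?thesis using w[OF False] Hr r by linarith
 qed (use wi0 in simp)
 moreover obtain i where "!!v::int. 2 * \<rho> K <= \<bar>lin \<alpha> q i - of_int v\<bar>" using sep'[OF K q0 qb] by blast
 ultimately show False using lw[of i] by (metis not_le r_def)
qed

text \<open>The counting condition of \<open>dual_raw\<close> is raised to the power
  \<open>m\<close>, so that \<open>(1 / \<rho>)^m\<close> can be replaced by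
  \<open>2^(K n) * K^A\<close> from \<open>\<rho>_low\<close>. This uses up \<open>m - 1\<close> of
  the \<open>m\<close> available powers of \<open>2^(K n)\<close>; the last one pays for
  \<open>|xi|^m\<close>. The condition \<open>c <= K\<close> turns constants into powers of
  \<open>K\<close>.\<close>

lemma dual_mid:
 defines "c \<equiv> (2 * CARD('m) + 3) * (2 * CARD('m)) ^ (CARD('m) - 1)"
 fixes xi :: "'m => int"
 assumes K: "k0 <= K" "c <= K" and i0: "xi i0 ~= 0" and X: "!!i. \<bar>xi i\<bar> <= \<bar>xi i0\<bar>"
  and big: "\<bar>real_of_int (xi i0)\<bar> ^ CARD('m) * real K ^ (CARD('m) + A * CARD('m)) <= 2 ^ (K * CARD('n))"
 shows "EX j. \<forall>v::int. \<bar>real_of_int (xi i0)\<bar> * \<rho> K / (real CARD('n) * 2 ^ K) <= \<bar>dual \<alpha> xi j - of_int v\<bar>"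
proof (rule dual_raw[where xi = xi, OF K(1) i0 X])
 define m where "m = CARD('m)"
 define n where "n = CARD('n)"
 define X where "X = \<bar>real_of_int (xi i0)\<bar>"
 define r where "r = \<rho> K"
 have r: "0 < r" "r < 1" using \<rho>_pos[OF K(1)] \<rho>_lt_1[OF K(1)] by (auto simp: r_def)
 have m1: "1 <= m" by (simp_all add: m_def Suc_leI)
 have K1: "1 <= K" using K k0_ge_2 by simp
 define E where "E = (2 * m + 3) * X * (2 * m / r) ^ (m - 1)"
 have "E = c * X * (1 / r) ^ (m - 1)"
  unfolding E_def c_def m_def by (simp add: power_divide)
 then have "E ^ m = real c ^ m * X ^ m * ((1 / r) ^ m) ^ (m - 1)"
  by (simp add: power_mult_distrib power_mult[symmetric] mult.commute)
 also have "... <= real K ^ m * X ^ m * (2 ^ (K * n) * real K ^ A) ^ (m - 1)"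
 proof (intro mult_mono power_mono)
  have "1 <= r ^ m * 2 ^ (K * n) * real K ^ A" using \<rho>_low[OF K(1)] by (simp add: r_def m_def n_def)
  then have "1 <= (2 ^ (K * n) * real K ^ A) * r ^ m" by (simp add: mult_ac)
  then show "(1 / r) ^ m <= 2 ^ (K * n) * real K ^ A"
   using r by (simp add: power_divide pos_divide_le_eq)
 qed (use K r in \<open>auto simp: X_def\<close>)
 also have "... = (X ^ m * real K ^ (m + A * (m - 1))) * (2 ^ (K * n)) ^ (m - 1)"
  by (simp add: power_mult_distrib power_add power_mult mult_ac)
 also have "... <= (X ^ m * real K ^ (m + A * m)) * (2 ^ (K * n)) ^ (m - 1)"
  using K1 by (intro mult_right_mono mult_left_mono power_increasing) (auto simp: X_def)
 also have "... <= 2 ^ (K * n) * (2 ^ (K * n)) ^ (m - 1)"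
  using big by (intro mult_right_mono) (auto simp: X_def m_def n_def)
 also have "... = (2 ^ (K * n)) ^ m" using m1 by (simp add: power_eq_if)
 finally have "E <= 2 ^ (K * n)" using m1 by (subst (asm) power_mono_iff) (auto simp: E_def X_def r less_imp_le)
 then show "(2 * CARD('m) + 3) * \<bar>real_of_int (xi i0)\<bar> * (2 * CARD('m) / \<rho> K) ^ (CARD('m) - 1) <= 2 ^ (K * CARD('n))"
  by (simp add: E_def m_def n_def X_def r_def)
qed

text \<open>The bound of \<open>dual_mid\<close> is proportional to
  \<open>|xi| * \<rho> K' / 2^K'\<close> and is therefore used at the smallest admissible scale
  \<open>K'\<close>, the one matched to the size of \<open>xi\<close>. By minimality
  \<open>|xi|^m\<close> is about \<open>2^(K' n)\<close> up to powers of \<open>K'\<close>, so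
  \<open>|xi| * \<rho> K'\<close> is at least a negative power of \<open>K'\<close>, and
  \<open>K' <= K\<close> gives the claim.\<close>

lemma dual_lower:
 "EX C K0. 1 <= K0 & (\<forall>K X (xi :: 'm => int). K0 <= K --> xi ~= (%_. 0) -->
   (ALL i. \<bar>real_of_int (xi i)\<bar> <= X) --> X ^ CARD('m) * real K ^ C <= 2 ^ (K * CARD('n)) -->
    (EX j. \<forall>v::int. 1 / (2 ^ K * real K ^ C) <= \<bar>dual \<alpha> xi j - of_int v\<bar>))"
proof -
 define m where "m = CARD('m)"
 define n where "n = CARD('n)"
 have m1: "1 <= m" "1 <= n" by (simp_all add: m_def n_def Suc_leI)
 define c where "c = (2 * m + 3) * (2 * m) ^ (m - 1)"
 define B where "B = m + A * m"
 define J where "J = max k0 c"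
 have J: "k0 <= J" "c <= J" "2 <= J" using k0_ge_2 by (auto simp: J_def)
 define b where "b = \<rho> J / (real n * 2 ^ J)"
 have b: "b > 0" using \<rho>_pos[OF J(1)] m1 by (simp add: b_def)
 \<comment> \<open>Takes care of the case in which the minimal scale is the initial one
   \<open>J\<close>, where minimality says nothing.\<close>
 obtain K1 where K1: "(1/2::real) ^ K1 < b" using real_arch_pow_inv[OF b, of "1/2"] by auto
 \<comment> \<open>The entry \<open>n * 2 ^ n\<close> lets one extra power of \<open>K\<close>
   absorb the constants; hence the \<open>+ 1\<close> in \<open>C\<close>.\<close>
 define K0 where "K0 = max (max J K1) (n * 2 ^ n)"
 define C where "C = B + A + 1"
 show ?thesis
 proof (rule exI[of _ C], rule exI[of _ K0], intro conjI allI impI)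
  show "1 <= K0" using J by (simp add: K0_def)
  fix K :: nat and X :: real and xi :: "'m => int"
  assume K: "K0 <= K" and xi: "xi ~= (%_. 0)" and X: "ALL i. \<bar>real_of_int (xi i)\<bar> <= X"
   and big: "X ^ CARD('m) * real K ^ C <= 2 ^ (K * CARD('n))"
  have KJ: "J <= K" "K1 <= K" "n * 2 ^ n <= K" using K by (auto simp: K0_def)
  have "EX i0. ALL i. \<bar>xi i\<bar> <= \<bar>xi i0\<bar>"
  proof -
   have "finite (range (%i. \<bar>xi i\<bar>))" by simp
   then have "Max (range (%i. \<bar>xi i\<bar>)) \<in> range (%i. \<bar>xi i\<bar>)" by (rule Max_in) auto
   then obtain i0 where "Max (range (%i. \<bar>xi i\<bar>)) = \<bar>xi i0\<bar>" by (rule imageE)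
   then have "\<bar>xi i\<bar> <= \<bar>xi i0\<bar>" for i using Max_ge[of "range (%i. \<bar>xi i\<bar>)" "\<bar>xi i\<bar>"] by auto
   then show ?thesis by blast
  qed
  then obtain i0 where i0: "!!i. \<bar>xi i\<bar> <= \<bar>xi i0\<bar>" by blast
  have i0n: "xi i0 ~= 0" using xi i0 by (auto simp: fun_eq_iff)
  define Y where "Y = \<bar>real_of_int (xi i0)\<bar>"
  have Y: "1 <= Y" "Y <= X" using i0n X by (simp_all add: Y_def)
  have P: "Y ^ m * real K ^ B <= 2 ^ (K * n)"
  proof -
   have "Y ^ m * real K ^ B <= X ^ m * real K ^ C"
    using Y KJ J by (intro mult_mono power_mono power_increasing) (auto simp: C_def)
   then show ?thesis using big by (simp add: m_def n_def)
  qed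
  define K' where "K' = (LEAST k. J <= k & Y ^ m * real k ^ B <= 2 ^ (k * n))"
  have K': "J <= K'" "Y ^ m * real K' ^ B <= 2 ^ (K' * n)"
   using LeastI[of "%k. J <= k & Y ^ m * real k ^ B <= 2 ^ (k * n)" K] P KJ by (auto simp: K'_def)
  have K'K: "K' <= K" unfolding K'_def by (rule Least_le) (use P KJ in auto)
  obtain j where j: "!!v::int. Y * \<rho> K' / (real n * 2 ^ K') <= \<bar>dual \<alpha> xi j - of_int v\<bar>"
   using dual_mid[of K' xi i0] K' J i0 i0n unfolding Y_def m_def n_def c_def B_def by auto
  have "1 / (2 ^ K * real K ^ C) <= Y * \<rho> K' / (real n * 2 ^ K')"
  proof (cases "K' = J")
   case True
   have "1 / (2 ^ K * real K ^ C) <= 1 / (2 ^ K * 1)"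
    using KJ J by (intro divide_left_mono mult_left_mono one_le_power) auto
   also have "... = (1/2) ^ K" by (simp add: power_divide)
   also have "... <= (1/2) ^ K1" using KJ by (intro power_decreasing) auto
   also have "... <= b" using K1 by simp
   also have "... <= Y * b" using Y b by simp
   finally show ?thesis by (simp add: b_def True)
  next
   case False
   then have J': "J <= K' - 1" "K' - 1 < K'" "0 < K'" using K' J by auto
   have "\<not> (J <= K' - 1 & Y ^ m * real (K' - 1) ^ B <= 2 ^ ((K' - 1) * n))"
    by (rule not_less_Least) (use J' in \<open>simp add: K'_def\<close>)
   then have "2 ^ ((K' - 1) * n) < Y ^ m * real (K' - 1) ^ B" using J' by auto
   also have "... <= Y ^ m * real K' ^ B" using Y J' by (intro mult_left_mono power_mono) auto
   finally have y1: "2 ^ ((K' - 1) * n) <= Y ^ m * real K' ^ B" by simp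
   have r: "0 < \<rho> K'" using \<rho>_pos J K' by auto
   have l: "1 <= \<rho> K' ^ m * 2 ^ (K' * n) * real K' ^ A"
    using \<rho>_low[of K'] J K' by (simp add: m_def n_def)
   have "1 * 2 ^ ((K' - 1) * n) <= (\<rho> K' ^ m * 2 ^ (K' * n) * real K' ^ A) * (Y ^ m * real K' ^ B)"
    using l y1 r by (intro mult_mono) auto
   also have "... = (Y * \<rho> K') ^ m * real K' ^ (A + B) * 2 ^ (K' * n)"
    by (simp add: power_mult_distrib power_add mult_ac)
   also have "(2::real) ^ (K' * n) = 2 ^ ((K' - 1) * n) * 2 ^ n"
    using J' by (simp add: power_add[symmetric] diff_mult_distrib)
   finally have "1 * 2 ^ ((K' - 1) * n) <= ((Y * \<rho> K') ^ m * real K' ^ (A + B) * 2 ^ n) * (2 ^ ((K' - 1) * n) :: real)"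
    by (simp add: mult_ac)
   then have "1 <= (Y * \<rho> K') ^ m * real K' ^ (A + B) * 2 ^ n"
    by (subst (asm) mult_le_cancel_right_pos) auto
   then have z: "1 / (real K' ^ (A + B) * 2 ^ n) <= (Y * \<rho> K') ^ m"
    using J' by (subst pos_divide_le_eq) (auto simp: mult_ac)
   have z': "1 / (real K' ^ (A + B) * 2 ^ n) <= Y * \<rho> K'"
   proof (cases "1 <= Y * \<rho> K'")
    case True
    have "1 * 1 <= real K' ^ (A + B) * 2 ^ n" using J' by (intro mult_mono one_le_power) auto
    then have "1 / (real K' ^ (A + B) * 2 ^ n) <= 1" by simp
    then show ?thesis using True by simp
   next
    case False
    then have "(Y * \<rho> K') ^ m <= (Y * \<rho> K') ^ 1" using Y r m1 by (intro power_decreasing) auto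
    then show ?thesis using z by simp
   qed
   have "1 / (2 ^ K * real K ^ C) <= 1 / (2 ^ K' * (real K' ^ (A + B) * (real n * 2 ^ n)))"
   proof (rule divide_left_mono)
    have "real K' ^ (A + B) * (real n * 2 ^ n) <= real K ^ (A + B) * real K"
    proof (rule mult_mono)
     have "real (n * 2 ^ n) <= real K" using KJ(3) by (rule of_nat_mono)
     then show "real n * 2 ^ n <= real K" by simp
    qed (use K'K in \<open>auto intro!: power_mono\<close>)
    then show "2 ^ K' * (real K' ^ (A + B) * (real n * 2 ^ n)) <= 2 ^ K * real K ^ C"
     using K'K by (intro mult_mono power_increasing) (auto simp: C_def add_ac mult_ac)
    show "0 < 2 ^ K * real K ^ C * (2 ^ K' * (real K' ^ (A + B) * (real n * 2 ^ n)))"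
     using J' K'K m1 by (intro mult_pos_pos zero_less_power) auto
   qed auto
   also have "... = 1 / (real K' ^ (A + B) * 2 ^ n) / (real n * 2 ^ K')" by (simp add: field_simps)
   also have "... <= Y * \<rho> K' / (real n * 2 ^ K')" using z' by (intro divide_right_mono) auto
   finally show ?thesis .
  qed
  then show "EX j. \<forall>v::int. 1 / (2 ^ K * real K ^ C) <= \<bar>dual \<alpha> xi j - of_int v\<bar>"
   by (intro exI[of _ j] allI order_trans[OF _ j])
 qed
qed

end

section \<open>Fourier coefficients at one scale and correlations at equal frequencies\<close>

text \<open>\<open>g\<close> and \<open>a\<close> define the count; \<open>h\<close> and
  \<open>b\<close> only dominate its frequency tails, as provided by
  \<open>kernel_pair\<close>.\<close>

locale twisted_kernels = twisted \<alpha> \<rho> t k0 A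
 for \<alpha> :: "real^'n^'m" and \<rho> :: "nat => real" and t :: "nat => nat" and k0 A :: nat +
 fixes g h :: "nat => real => real" and a b :: "nat => int => real"
 assumes kern_a: "k0 <= k ==> kern (\<rho> k) (g k) (a k)" and kern_b: "k0 <= k ==> kern (\<rho> k) (h k) (b k)"
  and a_0: "k0 <= k ==> a k 0 = 3 * \<rho> k / 4" and a_le: "k0 <= k ==> a k j <= a k 0"
  and a_le_b: "k0 <= k ==> a k j <= 4 * b k j"
  and a_decay: "k0 <= k ==> a k j * (\<rho> k * of_int j)\<^sup>2 <= 4 * b k j"
begin

definition u :: "nat => ('m => int) => real" where
 "u k xi = cprod (a k) xi * Wt (2 ^ k) \<alpha> xi"

lemma u_nonneg: "k0 <= k ==> 0 <= u k xi"
 unfolding u_def by (intro mult_nonneg_nonneg Wt_nonneg cprod_nonneg[OF kern_a])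

text \<open>By separation the only near return in the box is \<open>q = 0\<close>. The kernel is
  left general because the bound is used for \<open>a\<close> and for the dominating
  \<open>b\<close>.\<close>

lemma sum_kernel_le_1:
 assumes k: "k0 <= k" and "kern (\<rho> k) f c" "finite F"
 shows "(\<Sum>xi\<in>F. cprod c xi * Wt (2 ^ k) \<alpha> xi) <= 1"
proof -
 have "{q \<in> ibox (2 ^ k). ALL i. \<exists>v::int. \<bar>lin \<alpha> q i - of_int v\<bar> < \<rho> k} \<subseteq> {%_. 0}"
 proof
  fix q assume q: "q \<in> {q \<in> ibox (2 ^ k). ALL i. \<exists>v::int. \<bar>lin \<alpha> q i - of_int v\<bar> < \<rho> k}"
  show "q \<in> {%_. 0}"
  proof (rule ccontr)
   assume "q \<notin> {%_. 0}"
   then have "q ~= (%_. 0)" by simp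
   then obtain i where i: "!!v::int. 2 * \<rho> k <= \<bar>lin \<alpha> q i - of_int v\<bar>"
    using sep'[OF k, of q] q by (auto simp: ibox_iff)
   obtain v :: int where "\<bar>lin \<alpha> q i - of_int v\<bar> < \<rho> k" using q by blast
   then show False using i[of v] \<rho>_pos[OF k] by simp
  qed
 qed
 then have "card {q \<in> ibox (2 ^ k). ALL i. \<exists>v::int. \<bar>lin \<alpha> q i - of_int v\<bar> < \<rho> k} <= card {(%_. 0) :: 'n => int}"
  by (intro card_mono) auto
 then have "real (card {q \<in> ibox (2 ^ k). ALL i. \<exists>v::int. \<bar>lin \<alpha> q i - of_int v\<bar> < \<rho> k}) <= 1" by simp
 then show ?thesis
  using sum_le_Gf_0[OF assms(2) _ assms(3), of "2 ^ k" \<alpha>] Gf_0_le_card[OF assms(2), of "2 ^ k" \<alpha>]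
  by simp
qed

lemma sum_u_le_1: "k0 <= k ==> finite F ==> (\<Sum>xi\<in>F. u k xi) <= 1"
 unfolding u_def by (rule sum_kernel_le_1[OF _ kern_a])

lemma u_0: "k0 <= k ==> u k (%_. 0) = (3 * \<rho> k / 4) ^ CARD('m) * (2 ^ k) ^ CARD('n)"
 by (simp add: u_def cprod_def Wt_0 a_0)

lemma cprod_a_le: "k0 <= k ==> cprod (a k) (xi :: 'm => int) <= (3 * \<rho> k / 4) ^ CARD('m)"
proof -
 assume k: "k0 <= k"
 have "cprod (a k) xi <= (\<Prod>i\<in>(UNIV::'m set). a k 0)"
  unfolding cprod_def using k by (intro prod_mono) (auto simp: a_le kern_nonneg[OF kern_a])
 then show ?thesis by (simp add: a_0[OF k])
qed

lemma u_le_Wt: "k0 <= k ==> u k xi <= (3 * \<rho> k / 4) ^ CARD('m) * Wt (2 ^ k) \<alpha> xi"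
 unfolding u_def by (intro mult_right_mono cprod_a_le Wt_nonneg)

lemma u_le_u_0: "k0 <= k ==> u k xi <= u k (%_. 0)"
proof -
 assume k: "k0 <= k"
 have "u k xi <= (3 * \<rho> k / 4) ^ CARD('m) * Wt (2 ^ k) \<alpha> xi" by (rule u_le_Wt[OF k])
 also have "... <= (3 * \<rho> k / 4) ^ CARD('m) * real (2 ^ k) ^ CARD('n)"
  using \<rho>_pos[OF k] by (intro mult_left_mono Wt_le) auto
 finally show ?thesis by (simp add: u_0[OF k])
qed

lemma u_0_le_1: "k0 <= k ==> u k (%_. 0) <= 1"
 using sum_u_le_1[of k "{%_. 0}"] by simp

lemma u_far:
 assumes k: "k0 <= k" and "!!v::int. \<tau> <= \<bar>dual \<alpha> xi j - of_int v\<bar>" "\<tau> > 0"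
 shows "u k xi <= u k (%_. 0) / (2 ^ k * \<tau>)\<^sup>2"
proof -
 have "u k xi <= (3 * \<rho> k / 4) ^ CARD('m) * Wt (2 ^ k) \<alpha> xi" by (rule u_le_Wt[OF k])
 also have "... <= (3 * \<rho> k / 4) ^ CARD('m) * (real (2 ^ k) ^ CARD('n) / (real (2 ^ k) * \<tau>)\<^sup>2)"
  using \<rho>_pos[OF k] assms by (intro mult_left_mono Wt_far) auto
 finally show ?thesis by (simp add: u_0[OF k])
qed

text \<open>In the coordinate exceeding \<open>Y\<close> the decay of \<open>a\<close> against
  \<open>b\<close> gains \<open>(\<rho> k * Y)^(-2)\<close>; the remaining coordinates are dominated
  with a factor 4 each, and the dominating coefficients sum to at most 1.\<close>

lemma u_tail:
 assumes k: "k0 <= k" and Y: "Y > 0" and F: "finite F" "!!xi. xi \<in> F ==> EX i. Y < \<bar>real_of_int (xi i)\<bar>"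
 shows "(\<Sum>xi\<in>F. u k xi) <= 4 ^ CARD('m) / (\<rho> k * Y)\<^sup>2"
proof -
 define Z where "Z = (\<rho> k * Y)\<^sup>2"
 have Z: "Z > 0" using \<rho>_pos[OF k] Y by (simp add: Z_def)
 have an: "0 <= a k j" "0 <= b k j" for j using kern_nonneg kern_a[OF k] kern_b[OF k] by blast+
 have "u k xi <= 4 ^ CARD('m) / Z * (cprod (b k) xi * Wt (2 ^ k) \<alpha> xi)" if xi: "xi \<in> F" for xi
 proof -
  obtain i where i: "Y < \<bar>real_of_int (xi i)\<bar>" using F(2)[OF xi] by blast
  have "a k (xi i) * Z <= a k (xi i) * (\<rho> k * of_int (xi i))\<^sup>2"
   unfolding Z_def power_mult_distrib using i Y an
   by (intro mult_left_mono) (auto simp: abs_le_square_iff[symmetric])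
  also have "... <= 4 * b k (xi i)" by (rule a_decay[OF k])
  finally have ai: "a k (xi i) <= 4 * b k (xi i) / Z" using Z by (simp add: pos_le_divide_eq)
  have "cprod (a k) xi = a k (xi i) * (\<Prod>j\<in>UNIV - {i}. a k (xi j))"
   unfolding cprod_def by (rule prod.remove) auto
  also have "... <= (4 * b k (xi i) / Z) * (\<Prod>j\<in>UNIV - {i}. 4 * b k (xi j))"
   using an Z by (intro mult_mono ai prod_mono prod_nonneg) (auto simp: a_le_b[OF k])
  also have "... = (\<Prod>j\<in>UNIV. 4 * b k (xi j)) / Z"
   by (subst prod.remove[of UNIV i]) auto
  also have "... = 4 ^ CARD('m) / Z * cprod (b k) xi" by (simp add: prod.distrib cprod_def)
  finally have "u k xi <= 4 ^ CARD('m) / Z * cprod (b k) xi * Wt (2 ^ k) \<alpha> xi"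
   unfolding u_def by (intro mult_right_mono Wt_nonneg)
  then show ?thesis by simp
 qed
 then have "(\<Sum>xi\<in>F. u k xi) <= 4 ^ CARD('m) / Z * (\<Sum>xi\<in>F. cprod (b k) xi * Wt (2 ^ k) \<alpha> xi)"
  unfolding sum_distrib_left by (rule sum_mono)
 also have "... <= 4 ^ CARD('m) / Z * 1"
  using Z by (intro mult_left_mono sum_kernel_le_1[OF k kern_b[OF k] F(1)]) auto
 finally show ?thesis by (simp add: Z_def)
qed

text \<open>Two near returns of radius \<open>\<rho> k\<close> differ by a return of radius
  \<open>2 * \<rho> k\<close>, so each subcube with \<open>2^k * t k + 1\<close> integer points per
  side contains at most one. Counting subcubes gives the bound; a larger \<open>t\<close> means
  fewer near returns.\<close>

lemma card_near:
 assumes k: "k0 <= k"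
 shows "real (card {q \<in> ibox N. ALL i. \<exists>v::int. \<bar>lin \<alpha> q i - of_int v\<bar> < \<rho> k})
  <= (2 * N / (2 ^ k * t k) + 2) ^ CARD('n)"
proof -
 define Q where "Q = {q \<in> ibox N. ALL i. \<exists>v::int. \<bar>lin \<alpha> q i - of_int v\<bar> < \<rho> k}"
 define M where "M = 2 ^ k * int (t k) + 1"
 have t1: "1 <= int (t k)" using t_ge_1[OF k] by simp
 have M: "0 < M" using t1 by (simp add: M_def add_pos_pos)
 define c where "c q = (%j::'n. (q j + int N) div M)" for q :: "'n => int"
 define B where "B = nat (2 * int N div M) + 1"
 have "inj_on c Q"
 proof (rule inj_onI)
  fix q q' assume q: "q \<in> Q" "q' \<in> Q" "c q = c q'"
  show "q = q'"
  proof (rule ccontr)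
   assume ne: "q ~= q'"
   have "\<bar>q j - q' j\<bar> <= 2 ^ k * int (t k)" for j
   proof -
    have "(q j + int N) div M = (q' j + int N) div M" using fun_cong[OF q(3), of j] by (simp add: c_def)
    moreover have "q j + int N = M * ((q j + int N) div M) + (q j + int N) mod M"
     "q' j + int N = M * ((q' j + int N) div M) + (q' j + int N) mod M" by simp_all
    moreover have "0 <= (q j + int N) mod M" "(q j + int N) mod M < M" "0 <= (q' j + int N) mod M" "(q' j + int N) mod M < M"
     using M by simp_all
    ultimately have "\<bar>q j - q' j\<bar> < M" by (smt (verit))
    then show ?thesis by (simp add: M_def)
   qed
   moreover have "(%j. q j - q' j) ~= (%_. 0)" using ne by (auto simp: fun_eq_iff)
   ultimately obtain i where i: "!!v::int. 2 * \<rho> k <= \<bar>lin \<alpha> (%j. q j - q' j) i - of_int v\<bar>"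
    using sep[OF k, of "%j. q j - q' j"] by blast
   obtain v v' :: int where "\<bar>lin \<alpha> q i - of_int v\<bar> < \<rho> k" "\<bar>lin \<alpha> q' i - of_int v'\<bar> < \<rho> k"
    using q unfolding Q_def by blast
   then show False using i[of "v - v'"] by (simp add: lin_diff)
  qed
 qed
 then have "card Q = card (c ` Q)" by (simp add: card_image)
 also have "... <= card (PiE (UNIV::'n set) (%_. {0..<int B}))"
 proof (rule card_mono)
  show "c ` Q \<subseteq> PiE UNIV (%_. {0..<int B})"
  proof
   fix z assume "z \<in> c ` Q"
   then obtain q where q: "q \<in> Q" "z = c q" by auto
   have "0 <= (q j + int N) div M & (q j + int N) div M < int B" for j
   proof -
    have qj: "\<bar>q j\<bar> <= int N" using q by (auto simp: Q_def ibox_iff)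
    then have "(q j + int N) div M <= 2 * int N div M" using M by (intro zdiv_mono1) auto
    moreover have "0 <= 2 * int N div M" using M by (simp add: pos_imp_zdiv_nonneg_iff)
    ultimately show ?thesis using qj M by (auto simp: B_def pos_imp_zdiv_nonneg_iff)
   qed
   then show "z \<in> PiE UNIV (%_. {0..<int B})" by (auto simp: q c_def PiE_iff)
  qed
 qed (auto intro!: finite_PiE)
 also have "... = B ^ CARD('n)" by (simp add: card_PiE)
 finally have "real (card Q) <= real B ^ CARD('n)" by (metis of_nat_le_iff of_nat_power)
 also have "... <= (2 * N / (2 ^ k * t k) + 2) ^ CARD('n)"
 proof (rule power_mono)
  have "real B = real_of_int (2 * int N div M) + 1"
   using M by (simp add: B_def pos_imp_zdiv_nonneg_iff)
  also have "real_of_int (2 * int N div M) <= real_of_int (2 * int N) / real_of_int M"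
   by (rule real_of_int_div4)
  also have "... <= 2 * N / (2 ^ k * t k)"
   using t1 M by (simp add: M_def) (intro divide_left_mono mult_pos_pos add_pos_pos; simp)
  finally show "real B <= 2 * N / (2 ^ k * t k) + 2" by simp
 qed simp
 finally show ?thesis by (simp add: Q_def)
qed

text \<open>The arithmetic weight at scale \<open>k\<close> and the kernel at scale \<open>l\<close>
  are bounded trivially. What remains mixes the radius \<open>\<rho> k\<close> with the box of size
  \<open>2^l\<close>, and its sum is a number of near returns, counted by \<open>card_near\<close>.
  Here the dilation \<open>t k\<close> yields the saving \<open>1 / ln k\<close>; the second term
  stems from the incomplete subcubes.\<close>

lemma u_near_diag:
 assumes k: "k0 <= k" "k <= l" and X: "finite X"
 shows "(\<Sum>xi\<in>X. u k xi * u l xi) <= u l (%_. 0) * (4 ^ CARD('n) * (1 / ln k + (1/2) ^ (l - k)))"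
proof -
 define n where "n = CARD('n)"
 have l: "k0 <= l" using k by simp
 have n1: "n \<ge> 1" by (simp add: n_def Suc_leI)
 have t1: "1 <= real (t k)" using t_ge_1[OF k(1)] by simp
 have lnk: "0 < ln (real k)" using k k0_ge_2 by simp
 define R where "R = (3 * \<rho> l / 4) ^ CARD('m)"
 have R: "0 <= R" using \<rho>_pos[OF l] by (simp add: R_def)
 have "(\<Sum>xi\<in>X. u k xi * u l xi) <= (\<Sum>xi\<in>X. (R * (2 ^ k) ^ n) * (cprod (a k) xi * Wt (2 ^ l) \<alpha> xi))"
 proof (rule sum_mono)
  fix xi
  have "u k xi <= cprod (a k) xi * (2 ^ k) ^ n"
   unfolding u_def using Wt_le[of "2 ^ k" \<alpha> xi]
   by (intro mult_left_mono cprod_nonneg[OF kern_a[OF k(1)]]) (auto simp: n_def)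
  then have "u k xi * u l xi <= (cprod (a k) xi * (2 ^ k) ^ n) * (R * Wt (2 ^ l) \<alpha> xi)"
   using u_le_Wt[OF l, of xi] u_nonneg k l cprod_nonneg[OF kern_a[OF k(1)]]
   by (intro mult_mono mult_nonneg_nonneg) (auto simp: R_def)
  then show "u k xi * u l xi <= (R * (2 ^ k) ^ n) * (cprod (a k) xi * Wt (2 ^ l) \<alpha> xi)"
   by (simp add: mult_ac)
 qed
 also have "... = (R * (2 ^ k) ^ n) * (\<Sum>xi\<in>X. cprod (a k) xi * Wt (2 ^ l) \<alpha> xi)"
  by (simp add: sum_distrib_left)
 also have "... <= (R * (2 ^ k) ^ n) * (2 * (2 ^ l) / (2 ^ k * t k) + 2) ^ n"
 proof (rule mult_left_mono)
  have "(\<Sum>xi\<in>X. cprod (a k) xi * Wt (2 ^ l) \<alpha> xi) <= Gf (2 ^ l) (g k) \<alpha> 0"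
   by (rule sum_le_Gf_0[OF kern_a[OF k(1)] _ X]) simp
  also have "... <= card {q \<in> ibox (2 ^ l). ALL i. \<exists>v::int. \<bar>lin \<alpha> q i - of_int v\<bar> < \<rho> k}"
   by (rule Gf_0_le_card[OF kern_a[OF k(1)]])
  also have "... <= (2 * real (2 ^ l) / (2 ^ k * t k) + 2) ^ n"
   unfolding n_def by (rule card_near[OF k(1)])
  finally show "(\<Sum>xi\<in>X. cprod (a k) xi * Wt (2 ^ l) \<alpha> xi) <= (2 * (2 ^ l) / (2 ^ k * t k) + 2) ^ n" by simp
 qed (use R in auto)
 also have "... = R * (2 * 2 ^ l / t k + 2 * 2 ^ k) ^ n"
  by (simp add: mult.assoc power_mult_distrib[symmetric] distrib_left mult.commute[of 2])
 also have "... <= R * (4 ^ n * ((2 ^ l / t k) ^ n + (2 ^ k) ^ n))"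
 proof (rule mult_left_mono[OF _ R])
  define M where "M = max (2 ^ l / real (t k)) (2 ^ k)"
  have M: "0 <= M" by (simp add: M_def le_max_iff_disj)
  have "(2 * 2 ^ l / t k + 2 * 2 ^ k) ^ n <= (4 * M) ^ n"
  proof (rule power_mono)
   have "2 ^ l / real (t k) <= M" "2 ^ k <= M" by (auto simp: M_def)
   then show "2 * 2 ^ l / real (t k) + 2 * 2 ^ k <= 4 * M" by simp
  qed simp
  also have "... = 4 ^ n * M ^ n" by (simp add: power_mult_distrib)
  also have "M ^ n <= (2 ^ l / t k) ^ n + (2 ^ k) ^ n" unfolding M_def max_def by auto
  finally show "(2 * 2 ^ l / t k + 2 * 2 ^ k) ^ n <= 4 ^ n * ((2 ^ l / t k) ^ n + (2 ^ k) ^ n)" by simp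
 qed
 also have "... <= R * (4 ^ n * ((2 ^ l) ^ n / ln k + (2 ^ l) ^ n * (1/2) ^ (l - k)))"
 proof (intro mult_left_mono add_mono R)
  show "(2 ^ l / real (t k)) ^ n <= (2 ^ l) ^ n / ln (real k)"
   unfolding power_divide using t_ge_ln[OF k(1)] lnk t1 by (intro divide_left_mono mult_pos_pos) (auto simp: n_def)
  have "(2::real) ^ k = 2 ^ l * (1/2) ^ (l - k)"
   using k(2) by (simp add: power_divide power_diff)
  then have "((2::real) ^ k) ^ n = (2 ^ l) ^ n * ((1/2) ^ (l - k)) ^ n" by (simp only: power_mult_distrib)
  also have "... <= (2 ^ l) ^ n * ((1/2) ^ (l - k)) ^ 1"
   using n1 by (intro mult_left_mono power_decreasing) (auto simp: power_le_one)
  finally show "((2::real) ^ k) ^ n <= (2 ^ l) ^ n * (1/2) ^ (l - k)" by simp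
 qed auto
 also have "... = u l (%_. 0) * (4 ^ CARD('n) * (1 / ln k + (1/2) ^ (l - k)))"
  unfolding u_0[OF l] R_def n_def by (simp add: distrib_left mult_ac)
 finally show ?thesis .
qed

text \<open>Frequencies beyond \<open>Y\<close> form a tail at the smaller scale \<open>k\<close>.
  For the others the dual forms stay at distance about \<open>l * 2^(-l)\<close> from the integers,
  so the coefficient at the larger scale \<open>l\<close> drops by \<open>l^2\<close>. Both bounds
  are available once \<open>2^(l - k)\<close> exceeds a fixed power of \<open>l\<close>.\<close>

lemma u_far_diag:
 obtains D L0 :: nat where "1 <= L0" "!!k l X. k0 <= k ==> k <= l ==> L0 <= l ==> l ^ D <= 2 ^ (l - k) ==> finite X ==> (%_. 0) \<notin> X ==>
  (\<Sum>xi\<in>X. u k xi * u l xi) <= u l (%_. 0) * ((1 + 4 ^ CARD('m)) / (real l)\<^sup>2)"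
proof -
 define m where "m = CARD('m)"
 define n where "n = CARD('n)"
 have m1: "1 <= m" "1 <= n" by (simp_all add: m_def n_def Suc_leI)
 obtain C K0 :: nat where K0: "1 <= K0"
  and dl: "!!K X xi. K0 <= K ==> xi ~= (%_. 0) ==> (!!i. \<bar>real_of_int (xi i)\<bar> <= X) ==>
    X ^ m * real K ^ C <= 2 ^ (K * n) ==>
    EX j. \<forall>v::int. 1 / (2 ^ K * real K ^ C) <= \<bar>dual \<alpha> xi j - of_int v\<bar>"
  using dual_lower[folded m_def n_def] by blast
 \<comment> \<open>\<open>l^(m + A + C)\<close> pays for the range of frequencies in
   \<open>dual_lower\<close>, and \<open>l^(C + 2)\<close> for the shift \<open>2^p\<close> between
   the scale \<open>l\<close> and the scale \<open>K\<close> used below.\<close>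
 define D where "D = m + A + 2 * C + 2"
 show thesis
 proof (rule that[of "2 ^ K0 + 2" D])
  fix k l :: nat and X :: "('m => int) set"
  assume kl: "k0 <= k" "k <= l" "2 ^ K0 + 2 <= l" and big: "l ^ D <= 2 ^ (l - k)" and X: "finite X" "(%_. 0) \<notin> X"
  have l: "k0 <= l" using kl by simp
  have l2: "2 <= l" "2 ^ K0 <= l" using kl by auto
  have l1: "1 <= real l" using l2 by simp
  have "2 * 1 <= l * l ^ C" using l2 by (intro mult_mono one_le_power) auto
  then have lC: "2 <= l ^ (C + 1)" by simp
  \<comment> \<open>\<open>2^p\<close> is the first power of 2 above \<open>l^(C + 1)\<close>: at
    the scale \<open>K = l - p\<close> the bound \<open>1 / (2^K * K^C)\<close> exceeds
    \<open>l / 2^l\<close>.\<close>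
  obtain p' where p': "2 ^ p' < l ^ (C + 1)" "l ^ (C + 1) <= 2 ^ (p' + 1)"
   using ex_power_ivl2[OF order_refl lC] by auto
  define p where "p = p' + 1"
  have p: "l ^ (C + 1) <= 2 ^ p" "2 ^ p <= l ^ (C + 2)"
  proof -
   show "l ^ (C + 1) <= 2 ^ p" using p' by (simp add: p_def)
   have "2 ^ p <= 2 * l ^ (C + 1)" using p' by (simp add: p_def)
   also have "... <= l * l ^ (C + 1)" using l2 by (intro mult_right_mono) auto
   finally show "2 ^ p <= l ^ (C + 2)" by simp
  qed
  have "l ^ (C + 2) <= l ^ D" using l2 by (intro power_increasing) (auto simp: D_def)
  with p(2) have "(2::nat) ^ p <= l ^ D" by (rule order_trans)
  then have "(2::nat) ^ p <= 2 ^ (l - k)" using big by (rule order_trans)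
  then have plk: "p <= l - k" by simp
  define K where "K = l - p"
  have Kk: "k <= K" "K <= l" "l = K + p" "l - k = (K - k) + p" using plk kl by (auto simp: K_def)
  have pw: "l ^ (m + A + C) <= 2 ^ (K - k)"
  proof -
   have "l ^ (m + A + C) * l ^ (C + 2) = l ^ ((m + A + C) + (C + 2))" by (rule power_add[symmetric])
   also have "(m + A + C) + (C + 2) = D" by (simp add: D_def)
   also have "l ^ D <= 2 ^ (K - k) * 2 ^ p" using big unfolding Kk(4) power_add .
   also have "... <= 2 ^ (K - k) * l ^ (C + 2)" using p by (intro mult_left_mono) auto
   finally show ?thesis using l2 by simp
  qed
  have KK0: "K0 <= K"
  proof -
   have "2 ^ K0 <= l ^ 1" using l2 by simp
   also have "... <= l ^ (m + A + C)" using l2 m1 by (intro power_increasing) auto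
   also have "... <= 2 ^ (K - k)" by (rule pw)
   finally have "K0 <= K - k" by simp
   then show ?thesis by simp
  qed
  \<comment> \<open>Chosen so that \<open>\<rho> k * Y = l\<close>, which makes the tail at scale
    \<open>k\<close> at most \<open>4^m / l^2\<close>.\<close>
  define Y where "Y = real l / \<rho> k"
  have r: "0 < \<rho> k" "\<rho> k < 1" using \<rho>_pos \<rho>_lt_1 kl by auto
  have Y: "Y > 0" using r l1 by (simp add: Y_def)
  have YK: "Y ^ m * real K ^ C <= 2 ^ (K * n)"
  proof -
   have "1 <= \<rho> k ^ m * 2 ^ (k * n) * real k ^ A" using \<rho>_low[OF kl(1)] by (simp add: m_def n_def)
   then have "1 <= (2 ^ (k * n) * real k ^ A) * \<rho> k ^ m" by (simp add: mult_ac)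
   then have "1 / \<rho> k ^ m <= 2 ^ (k * n) * real k ^ A" using r by (simp add: pos_divide_le_eq)
   also have "... <= 2 ^ (k * n) * real l ^ A" using kl by (intro mult_left_mono power_mono) auto
   finally have 1: "1 / \<rho> k ^ m <= 2 ^ (k * n) * real l ^ A" .
   have "Y ^ m * real K ^ C = real l ^ m * (1 / \<rho> k ^ m) * real K ^ C" by (simp add: Y_def power_divide)
   also have "... <= real l ^ m * (2 ^ (k * n) * real l ^ A) * real l ^ C"
    using 1 Kk r by (intro mult_mono power_mono) auto
   also have "... = real (l ^ (m + A + C)) * 2 ^ (k * n)" by (simp add: power_add mult_ac)
   also have "... <= real (2 ^ (K - k)) * 2 ^ (k * n)" using pw by (intro mult_right_mono of_nat_mono) auto
   also have "... <= (2 ^ (K - k)) ^ n * 2 ^ (k * n)"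
    using m1 power_increasing[of 1 n "2 ^ (K - k) :: real"] by (intro mult_right_mono) auto
   also have "... = 2 ^ (K * n)" using Kk by (simp add: power_mult[symmetric] power_add[symmetric] add_mult_distrib[symmetric])
   finally show ?thesis .
  qed
  define X1 where "X1 = {xi\<in>X. ALL i. \<bar>real_of_int (xi i)\<bar> <= Y}"
  have "(\<Sum>xi\<in>X. u k xi * u l xi) = (\<Sum>xi\<in>X1. u k xi * u l xi) + (\<Sum>xi\<in>X - X1. u k xi * u l xi)"
   using X by (subst sum.subset_diff[of X1 X]) (auto simp: X1_def add.commute)
  also have "(\<Sum>xi\<in>X1. u k xi * u l xi) <= (\<Sum>xi\<in>X1. u k xi * (u l (%_. 0) / (real l)\<^sup>2))"
  proof (intro sum_mono mult_left_mono u_nonneg kl)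
   fix xi assume xi: "xi \<in> X1"
   then have "xi ~= (%_. 0)" using X by (auto simp: X1_def)
   then obtain j where j: "!!v::int. 1 / (2 ^ K * real K ^ C) <= \<bar>dual \<alpha> xi j - of_int v\<bar>"
    using dl[OF KK0 _ _ YK, of xi] xi by (auto simp: X1_def)
   have K1: "1 <= real K" using KK0 K0 by simp
   have "u l xi <= u l (%_. 0) / (2 ^ l * (1 / (2 ^ K * real K ^ C)))\<^sup>2"
    by (rule u_far[OF l j]) (use K1 in auto)
   also have "... <= u l (%_. 0) / (real l)\<^sup>2"
   proof (rule divide_left_mono)
    have "real l * real K ^ C <= real l * real l ^ C" using Kk by (intro mult_left_mono power_mono) auto
    also have "... = real (l ^ (C + 1))" by simp
    also have "... <= real (2 ^ p)" using p(1) by (rule of_nat_mono)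
    finally have "real l <= 2 ^ p / real K ^ C" using K1 by (simp add: pos_le_divide_eq)
    also have "... = 2 ^ l * (1 / (2 ^ K * real K ^ C))" by (simp add: Kk(3) power_add)
    finally show "(real l)\<^sup>2 <= (2 ^ l * (1 / (2 ^ K * real K ^ C)))\<^sup>2" by (intro power_mono) auto
    show "0 <= u l (%_. 0)" by (rule u_nonneg[OF l])
    show "0 < (2 ^ l * (1 / (2 ^ K * real K ^ C)))\<^sup>2 * (real l)\<^sup>2" using K1 l1 by auto
   qed
   finally show "u l xi <= u l (%_. 0) / (real l)\<^sup>2" .
  qed
  also have "... = (\<Sum>xi\<in>X1. u k xi) * (u l (%_. 0) / (real l)\<^sup>2)" by (rule sum_distrib_right[symmetric])
  also have "... <= 1 * (u l (%_. 0) / (real l)\<^sup>2)"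
   using X u_nonneg[OF l] by (intro mult_right_mono sum_u_le_1[OF kl(1)]) (auto simp: X1_def)
  also have "(\<Sum>xi\<in>X - X1. u k xi * u l xi) <= (\<Sum>xi\<in>X - X1. u k xi * u l (%_. 0))"
   by (intro sum_mono mult_left_mono u_nonneg kl u_le_u_0 l)
  also have "... = (\<Sum>xi\<in>X - X1. u k xi) * u l (%_. 0)" by (rule sum_distrib_right[symmetric])
  also have "... <= (4 ^ m / (\<rho> k * Y)\<^sup>2) * u l (%_. 0)"
   unfolding m_def using X u_nonneg[OF l]
   by (intro mult_right_mono u_tail[OF kl(1) Y]) (auto simp: X1_def not_le)
  also have "\<rho> k * Y = real l" using r by (simp add: Y_def)
  finally show "(\<Sum>xi\<in>X. u k xi * u l xi) <= u l (%_. 0) * ((1 + 4 ^ CARD('m)) / (real l)\<^sup>2)"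
   by (simp add: m_def add_divide_distrib distrib_left mult_ac)
 qed simp
qed

end

section \<open>Correlations at distinct frequencies\<close>

lemma eventually_power_le_powr:
 "\<forall>\<^sub>F K in sequentially. real K ^ C <= 2 powr (real K / 16 - 1)"
proof -
 have "evt x::real. x ^ C <= 2 powr (x / 16 - 1)" by real_asymp
 then show ?thesis
  using eventually_compose_filterlim[OF _ filterlim_real_sequentially] by fast
qed

lemma two_powr_div_le: "2 powr (real k / real E - 1) <= 2 ^ (k div E)" if "0 < E"
proof -
 have "real k < real E * (real (k div E) + 1)"
 proof -
  have "k < E * (k div E + 1)" using that dividend_less_times_div[of E k] by simp
  then have "real k < real (E * (k div E + 1))" by (simp only: of_nat_less_iff)
  then show ?thesis by (simp add: distrib_left)
 qed
 then have "real k / real E - 1 <= real (k div E)" using that by (simp add: field_simps)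
 then have "2 powr (real k / real E - 1) <= 2 powr real (k div E)" by simp
 then show ?thesis by (simp add: powr_realpow)
qed

lemma power_div_le_two_powr: "2 ^ (k div E) <= 2 powr (real k / real E)" if "0 < E"
proof -
 have "real (k div E) <= real k / real E" by (rule of_nat_div_le_of_nat)
 then have "2 powr real (k div E) <= 2 powr (real k / real E)" by simp
 then show ?thesis by (simp add: powr_realpow)
qed

lemma card_ibox: "real (card (ibox J :: ('m::finite => int) set)) = (2 * J + 1) ^ CARD('m)"
 unfolding ibox_def by (simp add: card_PiE nat_add_distrib nat_mult_distrib)

text \<open>With \<open>E = 16 * m\<close> the box of side \<open>2^(k / E)\<close> has only about
  \<open>2^(k / 16)\<close> points, negligible against the savings of order
  \<open>2^(-3 k / 2)\<close> below, while its side is still a power of \<open>2^k\<close>.\<close>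

lemma card_ibox_le:
 fixes k :: nat
 defines "E \<equiv> 16 * CARD('m::finite)"
 shows "real (card (ibox (2 ^ (k div E)) :: ('m => int) set)) <= 3 ^ CARD('m) * 2 powr (real k / 16)"
proof -
 define m where "m = CARD('m)"
 have m: "0 < m" "E = 16 * m" by (simp_all add: m_def E_def)
 have "real (card (ibox (2 ^ (k div E)) :: ('m => int) set)) = (2 * 2 ^ (k div E) + 1) ^ m"
  by (simp add: card_ibox m_def add.commute)
 also have "... <= (3 * 2 powr (real k / real E)) ^ m"
 proof (rule power_mono)
  have "1 <= (2::real) ^ (k div E)" by simp
  moreover have "2 ^ (k div E) <= 2 powr (real k / real E)" by (rule power_div_le_two_powr) (use m in simp)
  ultimately show "2 * 2 ^ (k div E) + 1 <= 3 * 2 powr (real k / real E)" by linarith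
 qed simp
 also have "... = 3 ^ m * 2 powr (real m * (real k / real E))"
  by (simp add: power_mult_distrib powr_power mult.commute)
 also have "real m * (real k / real E) = real k / 16" using m by simp
 finally show ?thesis by (simp add: m_def)
qed

context twisted
begin

text \<open>\<open>dual_lower\<close> at the scale \<open>K div 8\<close>: the range of
  \<open>xi\<close> and the logarithmic factor cost \<open>2^(K / 16)\<close> each, which just fits
  into \<open>2^(K / 8)\<close>, and the resulting bound is well above
  \<open>2^(- K / 4)\<close>.\<close>

lemma dual_crude:
 defines "E \<equiv> 16 * CARD('m)"
 shows "EX K1. ALL K xi. K1 <= K --> xi ~= (%_. 0) --> xi \<in> ibox (2 ^ (K div E)) -->
  (EX j. \<forall>v::int. 2 powr (- real K / 4) <= \<bar>dual \<alpha> xi j - of_int v\<bar>)"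
proof -
 define m where "m = CARD('m)"
 define n where "n = CARD('n)"
 have m1: "1 <= m" "1 <= n" by (simp_all add: m_def n_def Suc_leI)
 obtain C K0 where K0: "1 <= K0"
  and dl: "!!K X (xi :: 'm => int). K0 <= K ==> xi ~= (%_. 0) ==> (!!i. \<bar>real_of_int (xi i)\<bar> <= X) ==>
    X ^ m * real K ^ C <= 2 ^ (K * n) ==>
    EX j. \<forall>v::int. 1 / (2 ^ K * real K ^ C) <= \<bar>dual \<alpha> xi j - of_int v\<bar>"
  using dual_lower[folded m_def n_def] by blast
 obtain K2 where K2: "!!K. K2 <= K ==> real K ^ C <= 2 powr (real K / 16 - 1)"
  using eventually_power_le_powr[of C] by (auto simp: eventually_sequentially)
 show ?thesis
 proof (intro exI[of _ "max K2 (8 * K0)"] allI impI)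
  fix K :: nat and xi :: "'m => int"
  assume K: "max K2 (8 * K0) <= K" and xi: "xi ~= (%_. 0)" "xi \<in> ibox (2 ^ (K div E))"
  define K' where "K' = K div 8"
  have K': "K0 <= K'" "1 <= K'" "K' <= K" using K K0 by (auto simp: K'_def)
  have KC: "real K' ^ C <= 2 powr (real K / 16 - 1)"
   by (rule order_trans[OF power_mono K2]) (use K K' in auto)
  have "EX j. \<forall>v::int. 1 / (2 ^ K' * real K' ^ C) <= \<bar>dual \<alpha> xi j - of_int v\<bar>"
  proof (rule dl[OF K'(1) xi(1)])
   show "\<bar>real_of_int (xi i)\<bar> <= 2 powr (real K / real E)" for i
   proof -
    have "\<bar>xi i\<bar> <= 2 ^ (K div E)" using xi by (simp add: ibox_iff)
    then have "\<bar>real_of_int (xi i)\<bar> <= 2 ^ (K div E)" by (metis of_int_abs of_int_le_numeral_power_cancel_iff)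
    also have "... <= 2 powr (real K / real E)" by (rule power_div_le_two_powr) (simp add: E_def)
    finally show ?thesis .
   qed
   have "(2 powr (real K / real E)) ^ m = 2 powr (real K / 16)"
    using m1 by (simp add: powr_power E_def m_def)
   then have "(2 powr (real K / real E)) ^ m * real K' ^ C <= 2 powr (real K / 16) * 2 powr (real K / 16 - 1)"
    using KC by simp
   also have "... = 2 powr (real K / real 8 - 1)" by (simp add: powr_add[symmetric])
   also have "... <= 2 ^ K'" unfolding K'_def by (rule two_powr_div_le) simp
   also have "... <= 2 ^ (K' * n)" using m1 by (intro power_increasing) auto
   finally show "(2 powr (real K / real E)) ^ m * real K' ^ C <= 2 ^ (K' * n)" .
  qed
  then obtain j where j: "!!v::int. 1 / (2 ^ K' * real K' ^ C) <= \<bar>dual \<alpha> xi j - of_int v\<bar>" by blast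
  have "2 powr (- real K / 4) = 1 / 2 powr (real K / 4)" by (simp add: powr_minus_divide)
  also have "... <= 1 / (2 ^ K' * real K' ^ C)"
  proof (rule divide_left_mono)
   have "2 ^ K' * real K' ^ C <= 2 powr (real K / real 8) * 2 powr (real K / 16 - 1)"
    unfolding K'_def by (intro mult_mono power_div_le_two_powr KC[unfolded K'_def]) auto
   also have "... <= 2 powr (real K / 4)" by (simp add: powr_add[symmetric])
   finally show "2 ^ K' * real K' ^ C <= 2 powr (real K / 4)" .
   show "0 < 2 powr (real K / 4) * (2 ^ K' * real K' ^ C)" using K' by (intro mult_pos_pos) auto
  qed simp
  finally have "2 powr (- real K / 4) <= 1 / (2 ^ K' * real K' ^ C)" .
  then show "EX j. \<forall>v::int. 2 powr (- real K / 4) <= \<bar>dual \<alpha> xi j - of_int v\<bar>"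
   by (intro exI[of _ j] allI order_trans[OF _ j])
 qed
qed

end

context twisted_kernels
begin

lemma u_far':
 assumes k: "k0 <= k" and "!!v::int. \<tau> <= \<bar>dual \<alpha> xi j - of_int v\<bar>" "\<tau> > 0"
 shows "u k xi <= 1 / (2 ^ k * \<tau>)\<^sup>2"
 by (rule order_trans[OF u_far[OF assms]]) (intro divide_right_mono u_0_le_1 k, simp)

text \<open>For a fixed \<open>xi'\<close> the map \<open>xi - xi'\<close> is injective, so at most
  \<open>card (ibox J)\<close> frequencies \<open>xi\<close> contribute.\<close>

lemma sum_shift_le:
 fixes X :: "('m => int) set"
 assumes "finite X" "0 <= e" "!!xi'. xi' \<in> X ==> 0 <= f xi'" "(\<Sum>xi'\<in>X. f xi') <= (1::real)"
 shows "(\<Sum>xi\<in>X. \<Sum>xi'\<in>X. if (%i. xi i - xi' i) \<in> ibox J then e * f xi' else 0) <= e * card (ibox J :: ('m => int) set)"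
proof -
 have "(\<Sum>xi\<in>X. \<Sum>xi'\<in>X. if (%i. xi i - xi' i) \<in> ibox J then e * f xi' else 0) =
   (\<Sum>xi'\<in>X. \<Sum>xi\<in>{xi\<in>X. (%i. xi i - xi' i) \<in> ibox J}. e * f xi')"
  by (subst sum.swap) (intro sum.cong refl sum.inter_filter[symmetric] assms(1))
 also have "... <= (\<Sum>xi'\<in>X. (e * card (ibox J :: ('m => int) set)) * f xi')"
 proof (rule sum_mono)
  fix xi' :: "'m => int" assume x: "xi' \<in> X"
  have "card {xi\<in>X. (%i. xi i - xi' i) \<in> ibox J} <= card (ibox J :: ('m => int) set)"
  proof (rule card_inj_on_le)
   show "inj_on (%xi i. xi i - xi' i) {xi\<in>X. (%i. xi i - xi' i) \<in> ibox J}"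
    by (rule inj_onI) (auto simp: fun_eq_iff)
  qed auto
  then have "real (card {xi\<in>X. (%i. xi i - xi' i) \<in> ibox J}) * (e * f xi') <= real (card (ibox J :: ('m => int) set)) * (e * f xi')"
   using assms x by (intro mult_right_mono) auto
  then show "(\<Sum>xi\<in>{xi\<in>X. (%i. xi i - xi' i) \<in> ibox J}. e * f xi') <= (e * card (ibox J :: ('m => int) set)) * f xi'"
   by (simp add: mult_ac)
 qed
 also have "... = (e * card (ibox J :: ('m => int) set)) * (\<Sum>xi'\<in>X. f xi')" by (simp add: sum_distrib_left)
 also have "... <= (e * card (ibox J :: ('m => int) set)) * 1" using assms by (intro mult_left_mono) auto
 finally show ?thesis by simp
qed

lemma sum_uu_le_1:
 assumes "k0 <= k" "k0 <= l" "finite X"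
 shows "(\<Sum>xi\<in>X. \<Sum>xi'\<in>X. u k xi * u l xi') <= 1"
proof -
 have "(\<Sum>xi\<in>X. \<Sum>xi'\<in>X. u k xi * u l xi') = (\<Sum>xi\<in>X. u k xi) * (\<Sum>xi\<in>X. u l xi)"
  by (simp add: sum_product)
 also have "... <= 1 * 1" using assms by (intro mult_mono sum_u_le_1 sum_nonneg u_nonneg) auto
 finally show ?thesis by simp
qed

text \<open>\<open>M\<close> is to be the modulus of the Fourier transform of the measure. A large
  difference of frequencies is handled by the decay of \<open>M\<close>. For a small nonzero
  difference, the dual form of the difference is far from the integers, so that one of the two
  coefficients is tiny, and there are few such differences. Savings in terms of the smaller scale
  \<open>k\<close> suffice only if \<open>l <= B * k\<close>; otherwise they must come from
  \<open>l\<close> itself.\<close>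

lemma off_diagonal:
 fixes M :: "('m => int) => real"
 assumes M: "!!\<nu>. 0 <= M \<nu>" "!!\<nu>. M \<nu> <= V" and \<delta>: "\<delta> > 0"
  and dec: "!!\<nu> i Y. 0 < Y ==> Y < \<bar>real_of_int (\<nu> i)\<bar> ==> M \<nu> <= V * Y powr (- \<delta>)"
 shows "\<exists>k1 C \<eta>. k0 <= k1 & 0 <= C & 0 < \<eta> & (ALL k l X. k1 <= k --> k <= l --> finite X --> (%_. 0) \<notin> X -->
  (\<Sum>xi\<in>X. \<Sum>xi'\<in>X. if xi = xi' then 0 else u k xi * u l xi' * M (%i. xi i - xi' i)) <= C * 2 powr (- \<eta> * real l))"
proof -
 define m where "m = CARD('m)"
 define n where "n = CARD('n)"
 define E where "E = 16 * m"
 \<comment> \<open>If \<open>l > B * k\<close>, then \<open>2^(2 k n)\<close>, which bounds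
   \<open>1 / \<rho> k\<close>, is at most \<open>2^(l / (2 E))\<close>.\<close>
 define B where "B = 4 * n * E"
 have m1: "1 <= m" "1 <= n" "0 < E" "0 < B" by (simp_all add: m_def n_def E_def B_def Suc_leI)
 have V: "0 <= V" using M[of "%_. 0"] by simp
 obtain K1 where K1: "!!K (xi :: 'm => int). K1 <= K ==> xi ~= (%_. 0) ==> xi \<in> ibox (2 ^ (K div E)) ==>
  EX j. \<forall>v::int. 2 powr (- real K / 4) <= \<bar>dual \<alpha> xi j - of_int v\<bar>"
  using dual_crude unfolding E_def m_def by blast
 obtain K2 where K2: "!!K. K2 <= K ==> real K ^ A <= 2 powr (real K / 16 - 1)"
  using eventually_power_le_powr[of A] by (auto simp: eventually_sequentially)
 define k1 where "k1 = max k0 (max K1 K2)"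
 \<comment> \<open>The three available rates: few frequencies against tiny coefficients, the decay
   of \<open>M\<close> at size \<open>2^(k / E)\<close> or \<open>2^(l / E)\<close>, and the kernel
   tail.\<close>
 define \<eta>0 where "\<eta>0 = min 1 (min (\<delta> / E) (1 / E))"
 have \<eta>0: "0 < \<eta>0" "\<eta>0 <= 1" "\<eta>0 <= \<delta> / E" "\<eta>0 <= 1 / E" using m1 \<delta> by (auto simp: \<eta>0_def)
 define C where "C = V * (8 * 3 ^ m + 2 powr \<delta> + 3 ^ m + 16 * 4 ^ m + 2 powr (2 * \<delta>))"
 have C: "0 <= C" using V by (simp add: C_def)
 have main: "(\<Sum>xi\<in>X. \<Sum>xi'\<in>X. if xi = xi' then 0 else u k xi * u l xi' * M (%i. xi i - xi' i)) <= C * 2 powr (- (\<eta>0 / B) * real l)"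
  (is "?S <= _") if k: "k1 <= k" "k <= l" and X: "finite X" "(%_. 0) \<notin> X" for k l X
 proof -
  have kk: "k0 <= k" "k0 <= l" "K1 <= k" "K1 <= l" "K2 <= k" using k by (auto simp: k1_def)
  have un: "0 <= u k xi" "0 <= u l xi" for xi using u_nonneg kk by auto
  have su: "(\<Sum>xi\<in>X. u k xi) <= 1" "(\<Sum>xi\<in>X. u l xi) <= 1" using sum_u_le_1 kk X by auto
  show ?thesis
  proof (cases "l <= B * k")
   case True
   \<comment> \<open>Comparable scales: a saving \<open>2^(- \<eta>0 * k)\<close> is also one in
     terms of \<open>l\<close>, with \<open>\<eta>0\<close> divided by \<open>B\<close>.\<close>
   define J where "J = (2 ^ (k div E) :: nat)"
   define e where "e = 4 * 2 powr (- 3 * real k / 2)"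
   define d where "d = 2 powr \<delta> * 2 powr (- (\<delta> / E) * real k)"
   have e0: "0 <= e" by (simp add: e_def)
   have pt: "(if xi = xi' then 0 else u k xi * u l xi' * M (%i. xi i - xi' i)) <=
     V * ((if (%i. xi i - xi' i) \<in> ibox J then e * u l xi' else 0) +
        (if (%i. xi' i - xi i) \<in> ibox J then e * u k xi else 0) + d * (u k xi * u l xi'))" for xi xi'
   proof (cases "xi = xi'")
    case True
    then show ?thesis using V e0 un by (auto simp: d_def)
   next
    case ne: False
    define \<nu> where "\<nu> = (%i. xi i - xi' i)"
    show ?thesis
    proof (cases "\<nu> \<in> ibox J")
     case True
     then have T2: "(%i. xi' i - xi i) \<in> ibox J" by (auto simp: ibox_iff \<nu>_def abs_minus_commute)
     have "\<nu> ~= (%_. 0)" using ne by (auto simp: \<nu>_def fun_eq_iff)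
     then obtain j where j: "!!v::int. 2 powr (- real k / 4) <= \<bar>dual \<alpha> \<nu> j - of_int v\<bar>"
      using K1[OF kk(3), of \<nu>] True by (auto simp: J_def)
     \<comment> \<open>Half of the distance known for the difference: the dual forms at
       \<open>xi\<close> and \<open>xi'\<close> cannot both lie within \<open>\<tau>\<close> of an
       integer.\<close>
     define \<tau> where "\<tau> = 2 powr (- real k / 4) / 2"
     have \<tau>: "\<tau> > 0" by (simp add: \<tau>_def)
     have e_eq: "1 / (2 ^ k * \<tau>)\<^sup>2 = e"
     proof -
      have t: "2 ^ k * \<tau> = 2 powr (3 * real k / 4) / 2"
       by (simp add: \<tau>_def powr_realpow[symmetric] powr_add[symmetric])
      have "(2 ^ k * \<tau>)\<^sup>2 = 2 powr (3 * real k / 2) / 4"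
       unfolding t by (simp add: power_divide power2_eq_square powr_add[symmetric])
      then have "1 / (2 ^ k * \<tau>)\<^sup>2 = 1 / (2 powr (3 * real k / 2) / 4)" by (rule arg_cong)
      then show ?thesis by (simp add: e_def powr_minus_divide)
     qed
     have "u k xi * u l xi' <= e * u l xi' + e * u k xi"
     proof (cases "\<forall>v::int. \<tau> <= \<bar>dual \<alpha> xi j - of_int v\<bar>")
      case True
      then have "u k xi <= e" using u_far'[OF kk(1) _ \<tau>, of xi j] by (simp add: e_eq)
      then have "u k xi * u l xi' <= e * u l xi'" using un by (intro mult_right_mono) auto
      then show ?thesis using e0 un by (simp add: add_increasing2)
     next
      case False
      then obtain v :: int where v: "\<bar>dual \<alpha> xi j - of_int v\<bar> < \<tau>" by (auto simp: not_le)
      have "\<tau> <= \<bar>dual \<alpha> xi' j - of_int w\<bar>" for w :: int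
      proof -
       have "2 * \<tau> <= \<bar>dual \<alpha> xi j - dual \<alpha> xi' j - (of_int v - of_int w)\<bar>"
        using j[of "v - w"] by (simp add: \<nu>_def dual_diff \<tau>_def)
       then show ?thesis using v by linarith
      qed
      then have "u l xi' <= 1 / (2 ^ l * \<tau>)\<^sup>2" using u_far'[OF kk(2) _ \<tau>] by blast
      also have "... <= 1 / (2 ^ k * \<tau>)\<^sup>2"
       using \<tau> k by (intro divide_left_mono power_mono mult_right_mono power_increasing mult_pos_pos) auto
      finally have "u k xi * u l xi' <= u k xi * e" unfolding e_eq using un by (intro mult_left_mono) auto
      then show ?thesis using e0 un by (simp add: add_increasing mult.commute)
     qed
     then have "u k xi * u l xi' * M \<nu> <= (e * u l xi' + e * u k xi) * V"
      using M un e0 by (intro mult_mono) auto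
     then show ?thesis using ne True T2 V un by (simp add: \<nu>_def[symmetric] distrib_left mult_ac d_def add_increasing2)
    next
     case False
     then obtain i where "\<not> \<bar>\<nu> i\<bar> <= int J" by (auto simp: ibox_iff)
     then have i: "real J < \<bar>real_of_int (\<nu> i)\<bar>" by linarith
     have "M \<nu> <= V * real J powr (- \<delta>)" by (rule dec[of "real J" \<nu> i, OF _ i]) (simp add: J_def)
     also have "real J powr (- \<delta>) <= (2 powr (real k / E - 1)) powr (- \<delta>)"
      using two_powr_div_le[OF m1(3), of k] \<delta> by (intro powr_mono2') (auto simp: J_def)
     also have "... = d" by (simp add: d_def powr_powr powr_add[symmetric] algebra_simps)
     finally have "M \<nu> <= V * d" using V by (simp add: mult_left_mono)
     then have "u k xi * u l xi' * M \<nu> <= u k xi * u l xi' * (V * d)" using un by (intro mult_left_mono) auto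
     also have "... <= V * ((if (%i. xi i - xi' i) \<in> ibox J then e * u l xi' else 0) +
        (if (%i. xi' i - xi i) \<in> ibox J then e * u k xi else 0) + d * (u k xi * u l xi'))"
      using V un e0 by (simp add: distrib_left mult_ac)
     finally show ?thesis using ne by (simp add: \<nu>_def)
    qed
   qed
   have "?S <= (\<Sum>xi\<in>X. \<Sum>xi'\<in>X. V * ((if (%i. xi i - xi' i) \<in> ibox J then e * u l xi' else 0) +
        (if (%i. xi' i - xi i) \<in> ibox J then e * u k xi else 0) + d * (u k xi * u l xi')))"
    by (intro sum_mono pt)
   also have "... = V * ((\<Sum>xi\<in>X. \<Sum>xi'\<in>X. if (%i. xi i - xi' i) \<in> ibox J then e * u l xi' else 0) +
      (\<Sum>xi'\<in>X. \<Sum>xi\<in>X. if (%i. xi' i - xi i) \<in> ibox J then e * u k xi else 0) +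
      d * (\<Sum>xi\<in>X. \<Sum>xi'\<in>X. u k xi * u l xi'))"
    unfolding sum.distrib sum_distrib_left[symmetric]
    by (subst sum.swap[of "%xi' xi. if (%i. xi' i - xi i) \<in> ibox J then e * u k xi else 0"]) simp
   also have "... <= V * (e * card (ibox J :: ('m => int) set) + e * card (ibox J :: ('m => int) set) + d * 1)"
    using V un su X kk by (intro mult_left_mono add_mono sum_shift_le sum_uu_le_1) (auto simp: e0 d_def)
   also have "... <= V * (e * (3 ^ m * 2 powr (real k / 16)) + e * (3 ^ m * 2 powr (real k / 16)) + d)"
    using V card_ibox_le[where 'm = 'm, of k] e0 unfolding J_def E_def m_def
    by (intro mult_left_mono add_mono) auto
   finally have S0: "?S <= V * (e * (3 ^ m * 2 powr (real k / 16)) + e * (3 ^ m * 2 powr (real k / 16)) + d)" .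
   have e1: "e * (3 ^ m * 2 powr (real k / 16)) <= 4 * 3 ^ m * 2 powr (- \<eta>0 * real k)"
   proof -
    have "e * (3 ^ m * 2 powr (real k / 16)) = 4 * 3 ^ m * 2 powr (- 3 * real k / 2 + real k / 16)"
     unfolding e_def powr_add by (simp add: mult_ac)
    also have "2 powr (- 3 * real k / 2 + real k / 16) <= 2 powr (- \<eta>0 * real k)"
     using mult_right_mono[OF \<eta>0(2), of "real k"] by simp
    finally show ?thesis by simp
   qed
   have d1: "d <= 2 powr \<delta> * 2 powr (- \<eta>0 * real k)"
    unfolding d_def using mult_right_mono[OF \<eta>0(3), of "real k"] by simp
   have "?S <= V * (4 * 3 ^ m * 2 powr (- \<eta>0 * real k) + 4 * 3 ^ m * 2 powr (- \<eta>0 * real k) + 2 powr \<delta> * 2 powr (- \<eta>0 * real k))"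
    by (rule order_trans[OF S0]) (intro mult_left_mono add_mono e1 d1 V)
   also have "... = V * (8 * 3 ^ m + 2 powr \<delta>) * 2 powr (- \<eta>0 * real k)" by (simp add: algebra_simps)
   also have "... <= C * 2 powr (- (\<eta>0 / B) * real l)"
   proof (rule mult_mono)
    show "V * (8 * 3 ^ m + 2 powr \<delta>) <= C" unfolding C_def using V by (intro mult_left_mono) auto
    have "real l <= real B * real k" using True by (metis of_nat_le_iff of_nat_mult)
    then have "(\<eta>0 / B) * real l <= (\<eta>0 / B) * (real B * real k)" using \<eta>0 by (intro mult_left_mono) auto
    then show "2 powr (- \<eta>0 * real k) <= 2 powr (- (\<eta>0 / B) * real l)" using m1 by simp
   qed (use C in auto)
   finally show ?thesis .
  next
   case False
   \<comment> \<open>Now \<open>l\<close> is much larger than \<open>k\<close>. If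
     \<open>xi'\<close> is small, its own coefficient at scale \<open>l\<close> is tiny; if
     \<open>xi\<close> is large, it lies in the tail at scale \<open>k\<close>; otherwise the
     difference is at least \<open>J / 2\<close> in some coordinate.\<close>
   define J where "J = (2 ^ (l div E) :: nat)"
   define Y where "Y = real J / 2"
   have Y: "0 < Y" by (simp add: Y_def J_def)
   define e where "e = 2 powr (- 3 * real l / 2)"
   define d where "d = 2 powr (2 * \<delta>) * 2 powr (- (\<delta> / E) * real l)"
   have J_low: "2 powr (real l / E - 1) <= real J"
    using two_powr_div_le[OF m1(3), of l] by (simp add: J_def)
   have e0: "0 <= e" by (simp add: e_def)
   have pt: "(if xi = xi' then 0 else u k xi * u l xi' * M (%i. xi i - xi' i)) <=
     V * ((if xi' \<in> ibox J then e * u k xi else 0) +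
        (if EX i. Y < \<bar>real_of_int (xi i)\<bar> then u k xi * u l xi' else 0) + d * (u k xi * u l xi'))"
    if x: "xi' \<in> X" for xi xi'
   proof (cases "xi = xi'")
    case True
    then show ?thesis using V e0 un by (auto simp: d_def)
   next
    case ne: False
    define \<nu> where "\<nu> = (%i. xi i - xi' i)"
    consider "xi' \<in> ibox J" | "EX i. Y < \<bar>real_of_int (xi i)\<bar>" | "xi' \<notin> ibox J" "!!i. \<bar>real_of_int (xi i)\<bar> <= Y"
     by (meson not_le)
    then show ?thesis
    proof cases
     case 1
     have "xi' ~= (%_. 0)" using x X by auto
     then obtain j where j: "!!v::int. 2 powr (- real l / 4) <= \<bar>dual \<alpha> xi' j - of_int v\<bar>"
      using K1[OF kk(4), of xi'] 1 by (auto simp: J_def)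
     have "u l xi' <= 1 / (2 ^ l * 2 powr (- real l / 4))\<^sup>2"
      by (rule u_far'[OF kk(2) j]) simp
     also have "2 ^ l * 2 powr (- real l / 4) = 2 powr (3 * real l / 4)"
      by (simp add: powr_realpow[symmetric] powr_add[symmetric])
     also have "1 / (2 powr (3 * real l / 4))\<^sup>2 = e"
      by (simp add: e_def power2_eq_square powr_add[symmetric] powr_minus_divide)
     finally have "u k xi * u l xi' <= u k xi * e" using un by (intro mult_left_mono) auto
     then have "u k xi * u l xi' * M \<nu> <= (u k xi * e) * V" using M un e0 by (rule_tac mult_mono) auto
     also have "... <= V * ((if xi' \<in> ibox J then e * u k xi else 0) +
        (if EX i. Y < \<bar>real_of_int (xi i)\<bar> then u k xi * u l xi' else 0) + d * (u k xi * u l xi'))"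
      using 1 V un by (auto simp: distrib_left mult_ac d_def intro!: add_increasing2)
     finally show ?thesis using ne by (simp add: \<nu>_def)
    next
     case 2
     have "u k xi * u l xi' * M \<nu> <= (u k xi * u l xi') * V" using M un by (intro mult_mono) auto
     also have "... <= V * ((if xi' \<in> ibox J then e * u k xi else 0) +
        (if EX i. Y < \<bar>real_of_int (xi i)\<bar> then u k xi * u l xi' else 0) + d * (u k xi * u l xi'))"
      using 2 V un e0 by (auto simp: distrib_left mult_ac d_def intro!: add_increasing2 add_increasing)
     finally show ?thesis using ne by (simp add: \<nu>_def)
    next
     case 3
     then obtain i where "\<not> \<bar>xi' i\<bar> <= int J" by (auto simp: ibox_iff)
     then have i: "real J < \<bar>real_of_int (xi' i)\<bar>" by linarith
     have i': "Y < \<bar>real_of_int (\<nu> i)\<bar>"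
      using i 3(2)[of i] unfolding \<nu>_def Y_def of_int_diff by linarith
     have "M \<nu> <= V * Y powr (- \<delta>)" by (rule dec[of Y \<nu> i, OF Y i'])
     also have "Y powr (- \<delta>) <= (2 powr (real l / E - 2)) powr (- \<delta>)"
     proof (rule powr_mono2')
      have "2 powr (real l / E - 2) = 2 powr (real l / E - 1) / 2"
       by (simp add: powr_diff)
      then show "2 powr (real l / E - 2) <= Y" using J_low by (simp add: Y_def)
     qed (use \<delta> in auto)
     also have "... = d" by (simp add: d_def powr_powr powr_add[symmetric] algebra_simps)
     finally have "M \<nu> <= V * d" using V by (simp add: mult_left_mono)
     then have "u k xi * u l xi' * M \<nu> <= u k xi * u l xi' * (V * d)" using un by (intro mult_left_mono) auto
     also have "... <= V * ((if xi' \<in> ibox J then e * u k xi else 0) +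
        (if EX i. Y < \<bar>real_of_int (xi i)\<bar> then u k xi * u l xi' else 0) + d * (u k xi * u l xi'))"
      using V un e0 by (auto simp: distrib_left mult_ac)
     finally show ?thesis using ne by (simp add: \<nu>_def)
    qed
   qed
   define Xt where "Xt = {xi\<in>X. EX i. Y < \<bar>real_of_int (xi i)\<bar>}"
   have "?S <= (\<Sum>xi\<in>X. \<Sum>xi'\<in>X. V * ((if xi' \<in> ibox J then e * u k xi else 0) +
        (if EX i. Y < \<bar>real_of_int (xi i)\<bar> then u k xi * u l xi' else 0) + d * (u k xi * u l xi')))"
    by (intro sum_mono pt)
   also have "... = V * ((\<Sum>xi\<in>X. \<Sum>xi'\<in>X. if xi' \<in> ibox J then e * u k xi else 0) +
      (\<Sum>xi\<in>X. \<Sum>xi'\<in>X. if EX i. Y < \<bar>real_of_int (xi i)\<bar> then u k xi * u l xi' else 0) +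
      d * (\<Sum>xi\<in>X. \<Sum>xi'\<in>X. u k xi * u l xi'))"
    unfolding sum.distrib sum_distrib_left[symmetric] ..
   also have "... <= V * (e * card (ibox J :: ('m => int) set) + 4 ^ m / (\<rho> k * Y)\<^sup>2 + d * 1)"
   proof (intro mult_left_mono add_mono V)
    have "(\<Sum>xi\<in>X. \<Sum>xi'\<in>X. if xi' \<in> ibox J then e * u k xi else 0) =
      (\<Sum>xi\<in>X. u k xi * (e * card {xi'\<in>X. xi' \<in> ibox J}))"
     by (intro sum.cong refl) (simp add: sum.inter_filter[OF X(1), symmetric] mult_ac)
    also have "... = (\<Sum>xi\<in>X. u k xi) * (e * card {xi'\<in>X. xi' \<in> ibox J})"
     by (rule sum_distrib_right[symmetric])
    also have "... <= 1 * (e * card (ibox J :: ('m => int) set))"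
    proof (intro mult_mono su mult_left_mono e0)
     have "card {xi'\<in>X. xi' \<in> ibox J} <= card (ibox J :: ('m => int) set)" by (intro card_mono) auto
     then show "real (card {xi'\<in>X. xi' \<in> ibox J}) <= real (card (ibox J :: ('m => int) set))" by simp
    qed (use e0 in auto)
    finally show "(\<Sum>xi\<in>X. \<Sum>xi'\<in>X. if xi' \<in> ibox J then e * u k xi else 0) <= e * card (ibox J :: ('m => int) set)" by simp
    have "(\<Sum>xi\<in>X. \<Sum>xi'\<in>X. if EX i. Y < \<bar>real_of_int (xi i)\<bar> then u k xi * u l xi' else 0) =
     (\<Sum>xi\<in>X. if EX i. Y < \<bar>real_of_int (xi i)\<bar> then u k xi * (\<Sum>xi'\<in>X. u l xi') else 0)"
     by (intro sum.cong refl) (auto simp: sum_distrib_left)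
    also have "... = (\<Sum>xi\<in>Xt. u k xi * (\<Sum>xi'\<in>X. u l xi'))"
     unfolding Xt_def using X by (simp add: sum.inter_filter)
    also have "... <= (\<Sum>xi\<in>Xt. u k xi * 1)" using un su by (intro sum_mono mult_left_mono) auto
    also have "... <= 4 ^ m / (\<rho> k * Y)\<^sup>2"
    proof -
     have "finite Xt" "!!xi. xi \<in> Xt ==> EX i. Y < \<bar>real_of_int (xi i)\<bar>" using X by (simp_all add: Xt_def)
     then show ?thesis unfolding m_def mult_1_right by (rule u_tail[OF kk(1) Y])
    qed
    finally show "(\<Sum>xi\<in>X. \<Sum>xi'\<in>X. if EX i. Y < \<bar>real_of_int (xi i)\<bar> then u k xi * u l xi' else 0) <= 4 ^ m / (\<rho> k * Y)\<^sup>2" .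
   qed (use sum_uu_le_1 kk X in \<open>auto simp: d_def\<close>)
   finally have S0: "?S <= V * (e * card (ibox J :: ('m => int) set) + 4 ^ m / (\<rho> k * Y)\<^sup>2 + d * 1)" .
   have e1: "e * card (ibox J :: ('m => int) set) <= 3 ^ m * 2 powr (- \<eta>0 * real l)"
   proof -
    have "e * card (ibox J :: ('m => int) set) <= e * (3 ^ m * 2 powr (real l / 16))"
     using e0 card_ibox_le[where 'm = 'm, of l] unfolding J_def E_def m_def by (intro mult_left_mono) auto
    also have "... = 3 ^ m * 2 powr (- 3 * real l / 2 + real l / 16)"
     unfolding e_def powr_add by (simp add: mult_ac)
    also have "2 powr (- 3 * real l / 2 + real l / 16) <= 2 powr (- \<eta>0 * real l)"
     using mult_right_mono[OF \<eta>0(2), of "real l"] by simp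
    finally show ?thesis by simp
   qed
   have t1: "4 ^ m / (\<rho> k * Y)\<^sup>2 <= 16 * 4 ^ m * 2 powr (- \<eta>0 * real l)"
   proof -
    have r: "0 < \<rho> k" "\<rho> k < 1" using \<rho>_pos \<rho>_lt_1 kk by auto
    have "1 <= \<rho> k ^ m * 2 ^ (k * n) * real k ^ A" using \<rho>_low[OF kk(1)] by (simp add: m_def n_def)
    also have "... <= \<rho> k * 2 ^ (k * n) * 2 powr (real k / 16 - 1)"
     using r m1 power_decreasing[of 1 m "\<rho> k"] K2[OF kk(5)] by (intro mult_mono) auto
    also have "... <= \<rho> k * 2 powr (2 * real k * real n)"
    proof -
     have "(2::real) ^ (k * n) * 2 powr (real k / 16 - 1) = 2 powr (real k * real n + (real k / 16 - 1))"
      by (simp add: powr_add powr_realpow[symmetric])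
     also have "... <= 2 powr (2 * real k * real n)"
     proof -
      have "real k * 1 <= real k * real n" using m1 by (intro mult_left_mono) auto
      then show ?thesis by simp
     qed
     finally show ?thesis using r by (simp add: mult.assoc)
    qed
    \<comment> \<open>A lower bound for \<open>\<rho> k\<close> by a fixed power of
      \<open>2^k\<close>, crude but enough because \<open>2^k\<close> is a tiny power of
      \<open>2^l\<close> in this case.\<close>
    finally have rl: "2 powr (- (2 * real k * real n)) <= \<rho> k"
     by (simp add: powr_minus_divide pos_divide_le_eq)
    have "2 powr (real l / E - 2) <= Y" using J_low by (simp add: Y_def powr_diff)
    then have "2 powr (- (2 * real k * real n)) * 2 powr (real l / E - 2) <= \<rho> k * Y"
     using rl r by (intro mult_mono) auto
    moreover have "2 powr (real l / (2 * E) - 2) <= 2 powr (- (2 * real k * real n)) * 2 powr (real l / E - 2)"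
    proof -
     have "real B * real k <= real l" using False by (metis linorder_le_cases of_nat_le_iff of_nat_mult)
     then have "4 * real n * real k <= real l / E" using m1 by (simp add: B_def field_simps)
     then show ?thesis unfolding powr_add[symmetric] by (simp add: field_simps)
    qed
    ultimately have "2 powr (real l / (2 * E) - 2) <= \<rho> k * Y" by linarith
    then have sq: "(2 powr (real l / (2 * E) - 2))\<^sup>2 <= (\<rho> k * Y)\<^sup>2" by (intro power_mono) auto
    have eq: "(2 powr (real l / (2 * E) - 2))\<^sup>2 = 2 powr (real l / E) / 16"
     by (simp add: power2_eq_square powr_add[symmetric] powr_diff)
    have "4 ^ m / (\<rho> k * Y)\<^sup>2 <= 4 ^ m / (2 powr (real l / E) / 16)"
     by (rule divide_left_mono[OF sq[unfolded eq]]) (use r Y in auto)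
    also have "... = 16 * 4 ^ m * 2 powr (- (1 / E) * real l)" by (simp add: powr_minus_divide)
    also have "... <= 16 * 4 ^ m * 2 powr (- \<eta>0 * real l)"
     using mult_right_mono[OF \<eta>0(4), of "real l"] by simp
    finally show ?thesis .
   qed
   have d1: "d * 1 <= 2 powr (2 * \<delta>) * 2 powr (- \<eta>0 * real l)"
    unfolding d_def using mult_right_mono[OF \<eta>0(3), of "real l"] by simp
   have "?S <= V * (3 ^ m * 2 powr (- \<eta>0 * real l) + 16 * 4 ^ m * 2 powr (- \<eta>0 * real l) + 2 powr (2 * \<delta>) * 2 powr (- \<eta>0 * real l))"
    by (rule order_trans[OF S0]) (intro mult_left_mono add_mono e1 t1 d1 V)
   also have "... = V * (3 ^ m + 16 * 4 ^ m + 2 powr (2 * \<delta>)) * 2 powr (- \<eta>0 * real l)" by (simp add: algebra_simps)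
   also have "... <= C * 2 powr (- (\<eta>0 / B) * real l)"
   proof (rule mult_mono)
    show "V * (3 ^ m + 16 * 4 ^ m + 2 powr (2 * \<delta>)) <= C" unfolding C_def using V by (intro mult_left_mono) auto
    have "\<eta>0 / B <= \<eta>0" using \<eta>0 m1 by (simp add: field_simps)
    then show "2 powr (- \<eta>0 * real l) <= 2 powr (- (\<eta>0 / B) * real l)"
     using mult_right_mono[of "\<eta>0 / B" \<eta>0 "real l"] by simp
   qed (use C in auto)
   finally show ?thesis .
  qed
 qed
 show ?thesis
  by (rule exI[of _ k1], rule exI[of _ C], rule exI[of _ "\<eta>0 / B"])
    (use main C \<eta>0 m1 in \<open>auto simp: k1_def\<close>)
qed

end

section \<open>Summation over all scales\<close>

context twisted_kernels
begin

text \<open>Scales \<open>k\<close> with \<open>2^(l - k) >= l^D\<close> contribute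
  \<open>O(1 / l^2)\<close> each. There are \<open>O(ln l)\<close> remaining scales, and each of
  these costs \<open>O(1 / ln l)\<close> besides a geometric term: the two logarithms cancel. This
  cancellation is the purpose of the factor \<open>log log q\<close> in the hypothesis on
  \<open>\<alpha>\<close>.\<close>

lemma diagonal_sum:
 "EX k1 C. k0 <= k1 & 0 <= C & (ALL l X. k1 <= l --> finite X --> (%_. 0) \<notin> X -->
   (\<Sum>k=k1..l. \<Sum>xi\<in>X. u k xi * u l xi) <= C * u l (%_. 0))"
proof -
 define m where "m = CARD('m)"
 define n where "n = CARD('n)"
 obtain D L0 :: nat where L0: "1 <= L0" and fd: "!!k l X. k0 <= k ==> k <= l ==> L0 <= l ==> l ^ D <= 2 ^ (l - k) ==> finite X ==> (%_. 0) \<notin> X ==>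
  (\<Sum>xi\<in>X. u k xi * u l xi) <= u l (%_. 0) * ((1 + 4 ^ m) / (real l)\<^sup>2)"
  unfolding m_def by (rule u_far_diag) blast
 have "evt x::real. 2 * real D * ln x <= x / 2" by real_asymp
 then have "\<forall>\<^sub>F l in sequentially. 2 * real D * ln (real l) <= real l / 2"
  using eventually_compose_filterlim[OF _ filterlim_real_sequentially] by fast
 then obtain K3 where K3: "!!l. K3 <= l ==> 2 * real D * ln (real l) <= real l / 2"
  by (auto simp: eventually_sequentially)
 define k1 where "k1 = max k0 (max L0 (max 4 K3))"
 define C where "C = (1 + 4 ^ m) + 4 ^ n * (4 * real D + 2) + 4 ^ n * (2::real)"
 show ?thesis
 proof (rule exI[of _ k1], rule exI[of _ C], intro conjI allI impI)
  show "k0 <= k1" "0 <= C" by (auto simp: k1_def C_def)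
  fix l :: nat and X :: "('m => int) set"
  assume l: "k1 <= l" and X: "finite X" "(%_. 0) \<notin> X"
  have l4: "4 <= l" "k0 <= l" "L0 <= l" "K3 <= l" using l by (auto simp: k1_def)
  define N where "N = {k\<in>{k1..l}. 2 ^ (l - k) < l ^ D}"
  have ul: "0 <= u l (%_. 0)" by (rule u_nonneg[OF l4(2)])
  have ln1: "1 <= ln (real l)"
  proof -
   have "exp 1 <= real l" using exp_le l4 by simp
   then show ?thesis using l4 by (subst ln_ge_iff) auto
  qed
  have ln2: "1 / 2 <= ln (2::real)"
  proof -
   have "1 - 1 / 2 <= ln (2::real)" using ln_one_minus_pos_upper_bound[of "1/2"] by (simp add: ln_div)
   then show ?thesis by simp
  qed
  have Nk: "real (l - k) <= 2 * real D * ln (real l)" if "k \<in> N" for k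
  proof -
   have "(2::nat) ^ (l - k) < l ^ D" using that by (simp add: N_def)
   then have "real (2 ^ (l - k)) < real (l ^ D)" by (simp only: of_nat_less_iff)
   then have "ln (2 ^ (l - k)) <= ln (real l ^ D)" using l4 by (subst ln_le_cancel_iff) auto
   then have "real (l - k) * ln 2 <= real D * ln (real l)" using l4 by (simp add: ln_realpow)
   moreover have "real (l - k) * (1 / 2) <= real (l - k) * ln 2" using ln2 by (intro mult_left_mono) auto
   ultimately show ?thesis by simp
  qed
  \<comment> \<open>A near scale satisfies \<open>k >= l / 2 >= sqrt l\<close>, so
    \<open>ln k\<close> is at least half of \<open>ln l\<close>.\<close>
  have Nln: "1 / ln (real k) <= 2 / ln (real l)" if k: "k \<in> N" for k
  proof -
   have kl: "k <= l" "4 <= k" using k by (auto simp: N_def k1_def)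
   have "real l - real k <= real l / 2" using Nk[OF k] K3[OF l4(4)] kl by (simp add: of_nat_diff)
   then have "real l / 2 <= real k" by simp
   moreover have "sqrt (real l) <= real l / 2"
   proof (rule real_le_lsqrt)
    show "real l <= (real l / 2)\<^sup>2" using l4 by (simp add: power2_eq_square)
   qed (use l4 in auto)
   ultimately have "ln (sqrt (real l)) <= ln (real k)" using l4 by (subst ln_le_cancel_iff) auto
   then have "ln (real l) / 2 <= ln (real k)" using l4 by (simp add: ln_sqrt)
   then have "1 / ln (real k) <= 1 / (ln (real l) / 2)" using ln1 by (intro divide_left_mono mult_pos_pos) auto
   then show ?thesis by simp
  qed
  have cardN: "real (card N) <= 2 * real D * ln (real l) + 1"
  proof -
   define s where "s = nat \<lfloor>2 * real D * ln (real l)\<rfloor>"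
   have "N \<subseteq> {l - s..l}"
   proof
    fix k assume k: "k \<in> N"
    have "l - k <= s" unfolding s_def using Nk[OF k] by (simp add: le_nat_floor)
    then show "k \<in> {l - s..l}" using k by (auto simp: N_def)
   qed
   then have "card N <= card {l - s..l}" by (intro card_mono) auto
   also have "... <= s + 1" by simp
   finally have "real (card N) <= real s + 1" by simp
   also have "real s <= 2 * real D * ln (real l)" unfolding s_def using ln1 by (simp add: of_nat_floor)
   finally show ?thesis by simp
  qed
  have pt: "(\<Sum>xi\<in>X. u k xi * u l xi) <= u l (%_. 0) * ((1 + 4 ^ m) / (real l)\<^sup>2 + (if k \<in> N then 4 ^ n * (2 / ln (real l)) else 0) + 4 ^ n * (1/2) ^ (l - k))"
   if k: "k \<in> {k1..l}" for k
  proof (cases "k \<in> N")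
   case True
   have kk: "k0 <= k" "k <= l" using k by (auto simp: k1_def)
   have "(\<Sum>xi\<in>X. u k xi * u l xi) <= u l (%_. 0) * (4 ^ n * (1 / ln k + (1/2) ^ (l - k)))"
    unfolding n_def by (rule u_near_diag[OF kk X(1)])
   also have "... <= u l (%_. 0) * ((1 + 4 ^ m) / (real l)\<^sup>2 + 4 ^ n * (2 / ln (real l)) + 4 ^ n * (1/2) ^ (l - k))"
   proof (rule mult_left_mono[OF _ ul])
    have "4 ^ n * (1 / ln (real k)) <= 4 ^ n * (2 / ln (real l))" using Nln[OF True] by (intro mult_left_mono) auto
    moreover have "0 <= (1 + 4 ^ m) / (real l)\<^sup>2" by simp
    ultimately show "4 ^ n * (1 / ln (real k) + (1/2) ^ (l - k)) <= (1 + 4 ^ m) / (real l)\<^sup>2 + 4 ^ n * (2 / ln (real l)) + 4 ^ n * (1/2) ^ (l - k)"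
     unfolding distrib_left by linarith
   qed
   finally show ?thesis using True by simp
  next
   case False
   have kk: "k0 <= k" "k <= l" using k by (auto simp: k1_def)
   have "(\<Sum>xi\<in>X. u k xi * u l xi) <= u l (%_. 0) * ((1 + 4 ^ m) / (real l)\<^sup>2)"
    using False k by (intro fd kk l4 X) (auto simp: N_def not_less)
   also have "... <= u l (%_. 0) * ((1 + 4 ^ m) / (real l)\<^sup>2 + 0 + 4 ^ n * (1/2) ^ (l - k))"
    by (rule mult_left_mono[OF _ ul]) simp
   finally show ?thesis using False by simp
  qed
  have "(\<Sum>k=k1..l. \<Sum>xi\<in>X. u k xi * u l xi) <= (\<Sum>k=k1..l. u l (%_. 0) * ((1 + 4 ^ m) / (real l)\<^sup>2 + (if k \<in> N then 4 ^ n * (2 / ln (real l)) else 0) + 4 ^ n * (1/2) ^ (l - k)))"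
   by (rule sum_mono[OF pt])
  also have "... = u l (%_. 0) * ((\<Sum>k=k1..l. (1 + 4 ^ m) / (real l)\<^sup>2) + (\<Sum>k=k1..l. if k \<in> N then 4 ^ n * (2 / ln (real l)) else 0) + 4 ^ n * (\<Sum>k=k1..l. (1/2) ^ (l - k)))"
   unfolding sum.distrib sum_distrib_left[symmetric] ..
  also have "... <= u l (%_. 0) * ((1 + 4 ^ m) + 4 ^ n * (4 * real D + 2) + 4 ^ n * 2)"
  proof (intro mult_left_mono[OF _ ul] add_mono)
   have "(\<Sum>k=k1..l. (1 + 4 ^ m) / (real l)\<^sup>2) = real (l + 1 - k1) * ((1 + 4 ^ m) / (real l)\<^sup>2)" by simp
   also have "... <= real l * ((1 + 4 ^ m) / (real l)\<^sup>2)"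
    by (intro mult_right_mono) (auto simp: k1_def)
   also have "... = (1 + 4 ^ m) / real l" using l4 by (simp add: power2_eq_square)
   also have "... <= (1 + 4 ^ m) / 1" using l4 by (intro divide_left_mono) auto
   finally show "(\<Sum>k=k1..l. (1 + 4 ^ m) / (real l)\<^sup>2) <= 1 + 4 ^ m" by simp
   have "(\<Sum>k=k1..l. if k \<in> N then 4 ^ n * (2 / ln (real l)) else 0) = real (card N) * (4 ^ n * (2 / ln (real l)))"
   proof -
    have "{k1..l} \<inter> N = N" by (auto simp: N_def)
    then show ?thesis by (simp add: sum.inter_restrict[symmetric])
   qed
   also have "... <= (2 * real D * ln (real l) + 1 * ln (real l)) * (4 ^ n * (2 / ln (real l)))"
    using cardN ln1 by (intro mult_right_mono) auto
   also have "... = 4 ^ n * (4 * real D + 2)" using ln1 by (simp add: field_simps)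
   finally show "(\<Sum>k=k1..l. if k \<in> N then 4 ^ n * (2 / ln (real l)) else 0) <= 4 ^ n * (4 * real D + 2)" .
   have "(\<Sum>k=k1..l. (1/2) ^ (l - k)) <= (2::real)"
   proof -
    have "(\<Sum>k=k1..l. (1/2) ^ (l - k)) = (\<Sum>j\<in>(%k. l - k) ` {k1..l}. (1/2::real) ^ j)"
     by (subst sum.reindex) (auto simp: inj_on_def)
    also have "... <= 1 / (1 - 1/2)" by (intro less_imp_le geometric_sum_less) auto
    finally show ?thesis by simp
   qed
   then show "4 ^ n * (\<Sum>k=k1..l. (1/2) ^ (l - k)) <= 4 ^ n * (2::real)" by simp
  qed
  also have "... = C * u l (%_. 0)" by (simp add: C_def)
  finally show "(\<Sum>k=k1..l. \<Sum>xi\<in>X. u k xi * u l xi) <= C * u l (%_. 0)" .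
 qed
qed

text \<open>The diagonal is \<open>diagonal_sum\<close>. The off-diagonal part is exponentially
  small in \<open>l\<close>, whereas \<open>u l 0\<close> is at least a negative power of
  \<open>l\<close> by \<open>\<rho>_low\<close>, so even \<open>l\<close> copies of it are
  absorbed.\<close>

lemma covariance_bound:
 fixes M :: "('m => int) => real"
 assumes M: "!!\<nu>. 0 <= M \<nu>" "!!\<nu>. M \<nu> <= V" and \<delta>: "\<delta> > 0"
  and dec: "!!\<nu> i Y. 0 < Y ==> Y < \<bar>real_of_int (\<nu> i)\<bar> ==> M \<nu> <= V * Y powr (- \<delta>)"
 shows "EX k1 C. k0 <= k1 & 0 <= C & (ALL l X. k1 <= l --> finite X --> (%_. 0) \<notin> X -->
  (\<Sum>k=k1..l. \<Sum>xi\<in>X. \<Sum>xi'\<in>X. u k xi * u l xi' * M (%i. xi i - xi' i)) <= C * u l (%_. 0))"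
proof -
 define m where "m = CARD('m)"
 define n where "n = CARD('n)"
 have V: "0 <= V" using M[of "%_. 0"] by simp
 obtain ka Ca where ka: "k0 <= ka" "0 <= Ca" and diag: "!!l X. ka <= l ==> finite X ==> (%_. 0) \<notin> X ==>
   (\<Sum>k=ka..l. \<Sum>xi\<in>X. u k xi * u l xi) <= Ca * u l (%_. 0)"
  using diagonal_sum by blast
 have "\<exists>kb Cb \<eta>. k0 <= kb & 0 <= Cb & 0 < \<eta> & (ALL k l X. kb <= k --> k <= l --> finite X --> (%_. 0) \<notin> X -->
  (\<Sum>xi\<in>X. \<Sum>xi'\<in>X. if xi = xi' then 0 else u k xi * u l xi' * M (%i. xi i - xi' i)) <= Cb * 2 powr (- \<eta> * real l))"
  by (rule off_diagonal[where M = M and V = V, OF M \<delta>]) (rule dec, assumption, assumption)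
 then obtain kb Cb \<eta> where K: "k0 <= kb & 0 <= Cb & 0 < \<eta> & (ALL k l X. kb <= k --> k <= l --> finite X --> (%_. 0) \<notin> X -->
  (\<Sum>xi\<in>X. \<Sum>xi'\<in>X. if xi = xi' then 0 else u k xi * u l xi' * M (%i. xi i - xi' i)) <= Cb * 2 powr (- \<eta> * real l))"
  by (elim exE)
 then have kb: "k0 <= kb" "0 <= Cb" "0 < \<eta>" by simp_all
 note off = K[THEN conjunct2, THEN conjunct2, THEN conjunct2, rule_format]
 have "evt x::real. x ^ (A + 1) <= 2 powr (\<eta> * x)" using kb(3) by real_asymp
 then have "\<forall>\<^sub>F l in sequentially. real l ^ (A + 1) <= 2 powr (\<eta> * real l)"
  using eventually_compose_filterlim[OF _ filterlim_real_sequentially] by fast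
 then obtain K3 where K3: "!!l. K3 <= l ==> real l ^ (A + 1) <= 2 powr (\<eta> * real l)"
  by (auto simp: eventually_sequentially)
 define k1 where "k1 = max (max ka kb) K3"
 define C where "C = V * Ca + Cb * (4/3) ^ m"
 show ?thesis
 proof (rule exI[of _ k1], rule exI[of _ C], intro conjI allI impI)
  show "k0 <= k1" "0 <= C" using ka kb V by (auto simp: k1_def C_def)
  fix l :: nat and X :: "('m => int) set"
  assume l: "k1 <= l" and X: "finite X" "(%_. 0) \<notin> X"
  have ll: "ka <= l" "kb <= l" "K3 <= l" "k0 <= l" "1 <= l" using l ka k0_ge_2 by (auto simp: k1_def)
  have un: "0 <= u k xi" if "k1 <= k" for k xi using that ka by (intro u_nonneg) (auto simp: k1_def)
  have "(\<Sum>k=k1..l. \<Sum>xi\<in>X. \<Sum>xi'\<in>X. u k xi * u l xi' * M (%i. xi i - xi' i)) <=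
    (\<Sum>k=k1..l. V * (\<Sum>xi\<in>X. u k xi * u l xi) + Cb * 2 powr (- \<eta> * real l))"
  proof (rule sum_mono)
   fix k assume k: "k \<in> {k1..l}"
   have "(\<Sum>xi\<in>X. \<Sum>xi'\<in>X. u k xi * u l xi' * M (%i. xi i - xi' i)) =
     (\<Sum>xi\<in>X. \<Sum>xi'\<in>X. (if xi = xi' then u k xi * u l xi * M (%_. 0) else 0) +
      (if xi = xi' then 0 else u k xi * u l xi' * M (%i. xi i - xi' i)))"
    by (intro sum.cong refl) auto
   also have "... = (\<Sum>xi\<in>X. u k xi * u l xi * M (%_. 0)) + (\<Sum>xi\<in>X. \<Sum>xi'\<in>X. if xi = xi' then 0 else u k xi * u l xi' * M (%i. xi i - xi' i))"
    unfolding sum.distrib using X by simp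
   also have "(\<Sum>xi\<in>X. u k xi * u l xi * M (%_. 0)) <= (\<Sum>xi\<in>X. u k xi * u l xi * V)"
    using M un l k by (intro sum_mono mult_left_mono mult_nonneg_nonneg) auto
   also have "... = V * (\<Sum>xi\<in>X. u k xi * u l xi)" by (simp add: sum_distrib_left mult_ac)
   also have "(\<Sum>xi\<in>X. \<Sum>xi'\<in>X. if xi = xi' then 0 else u k xi * u l xi' * M (%i. xi i - xi' i)) <= Cb * 2 powr (- \<eta> * real l)"
    using k by (intro off X) (auto simp: k1_def)
   finally show "(\<Sum>xi\<in>X. \<Sum>xi'\<in>X. u k xi * u l xi' * M (%i. xi i - xi' i)) <=
     V * (\<Sum>xi\<in>X. u k xi * u l xi) + Cb * 2 powr (- \<eta> * real l)" by simp
  qed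
  also have "... = V * (\<Sum>k=k1..l. \<Sum>xi\<in>X. u k xi * u l xi) + real (l + 1 - k1) * (Cb * 2 powr (- \<eta> * real l))"
   by (simp add: sum.distrib sum_distrib_left[symmetric])
  also have "... <= V * (Ca * u l (%_. 0)) + Cb * ((4/3) ^ m * u l (%_. 0))"
  proof (intro add_mono mult_left_mono V)
   have "(\<Sum>k=k1..l. \<Sum>xi\<in>X. u k xi * u l xi) <= (\<Sum>k=ka..l. \<Sum>xi\<in>X. u k xi * u l xi)"
    using ka ll by (intro sum_mono2 sum_nonneg mult_nonneg_nonneg u_nonneg) (auto simp: k1_def)
   then show "(\<Sum>k=k1..l. \<Sum>xi\<in>X. u k xi * u l xi) <= Ca * u l (%_. 0)"
    using diag[OF ll(1) X] by linarith
   \<comment> \<open>Rearranged: \<open>l * 2^(- \<eta> l) <= l^(- A)\<close>, and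
     \<open>l^(- A)\<close> is at most \<open>(4/3)^m * u l 0\<close>.\<close>
   have "real l * real l ^ A * 2 powr (- \<eta> * real l) <= 1"
    using K3[OF ll(3)] by (simp add: powr_minus_divide)
   also have "1 <= \<rho> l ^ m * 2 ^ (l * n) * real l ^ A"
    using \<rho>_low[OF ll(4)] by (simp add: m_def n_def)
   also have "\<rho> l ^ m * 2 ^ (l * n) = (4/3) ^ m * u l (%_. 0)"
   proof -
    have "(4/3) ^ m * (3 * \<rho> l / 4) ^ m = (\<rho> l) ^ m" unfolding power_mult_distrib[symmetric] by simp
    then show ?thesis unfolding u_0[OF ll(4)] m_def n_def by (simp add: power_mult mult.assoc[symmetric])
   qed
   finally have "(real l * 2 powr (- \<eta> * real l)) * real l ^ A <= ((4/3) ^ m * u l (%_. 0)) * real l ^ A"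
    by (simp add: mult_ac)
   then have lu: "real l * 2 powr (- \<eta> * real l) <= (4/3) ^ m * u l (%_. 0)"
    by (rule mult_right_le_imp_le) (use ll in simp)
   have "real (l + 1 - k1) * (Cb * 2 powr (- \<eta> * real l)) <= real l * (Cb * 2 powr (- \<eta> * real l))"
    using kb ka k0_ge_2 by (intro mult_right_mono) (auto simp: k1_def)
   also have "... = Cb * (real l * 2 powr (- \<eta> * real l))" by simp
   also have "... <= Cb * ((4/3) ^ m * u l (%_. 0))" using kb lu by (intro mult_left_mono) auto
   finally show "real (l + 1 - k1) * (Cb * 2 powr (- \<eta> * real l)) <= Cb * ((4/3) ^ m * u l (%_. 0))" .
  qed
  also have "... = C * u l (%_. 0)" by (simp add: C_def distrib_right)
  finally show "(\<Sum>k=k1..l. \<Sum>xi\<in>X. \<Sum>xi'\<in>X. u k xi * u l xi' * M (%i. xi i - xi' i)) <= C * u l (%_. 0)" .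
 qed
qed

end

context twisted
begin

text \<open>A nonzero value of the counting function exhibits a \<open>q\<close> in the box all of
  whose kernel factors are nonzero, that is, a hit. So \<open>second_moment\<close> with the
  covariance bound gives the result, the zero coefficients being \<open>(3/4)^m\<close> times the
  terms of the divergent series.\<close>

theorem infinitely_many_hits:
 fixes \<nu> :: "'w measure" and F :: "'w => real^'m"
 assumes fin: "finite_measure \<nu>" and F [measurable]: "F \<in> borel_measurable \<nu>"
  and \<delta>: "\<delta> > 0"
  and dec: "!!xi i Y. 0 < Y ==> Y < \<bar>real_of_int (xi i)\<bar> ==> norm (\<integral>om. ee (idot xi (F om)) \<partial>\<nu>) <= V * Y powr (- \<delta>)"
  and div: "\<not> summable (%k. \<rho> k ^ CARD('m) * 2 ^ (k * CARD('n)))"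
 shows "AE om in \<nu>. ALL K. \<exists>k\<ge>K. \<exists>q::'n => int. (ALL j. \<bar>q j\<bar> <= 2 ^ k) &
   (ALL i. \<exists>p::int. \<bar>lin \<alpha> q i + F om $ i - of_int p\<bar> < \<rho> k)"
proof -
 interpret \<nu>: finite_measure \<nu> by (rule fin)
 have "EX g a h b. kern (\<rho> k) g a & kern (\<rho> k) h b & a 0 = 3 * \<rho> k / 4 & (ALL j. a j <= a 0) &
   (ALL j. a j <= 4 * b j) & (ALL j. a j * (\<rho> k * of_int j)\<^sup>2 <= 4 * b j)" if "k0 <= k" for k
  by (rule kernel_pair[OF \<rho>_pos[OF that] \<rho>_lt_1[OF that]]) blast
 then have "ALL k. EX z. k0 <= k --> (case z of (g, a, h, b) => kern (\<rho> k) g a & kern (\<rho> k) h b & a 0 = 3 * \<rho> k / 4 & (ALL j. a j <= a 0) &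
   (ALL j. a j <= 4 * b j) & (ALL j. a j * (\<rho> k * of_int j)\<^sup>2 <= 4 * b j))"
  by fastforce
 from choice[OF this] obtain z where z: "!!k. k0 <= k ==> (case z k of (g, a, h, b) => kern (\<rho> k) g a & kern (\<rho> k) h b & a 0 = 3 * \<rho> k / 4 & (ALL j. a j <= a 0) &
   (ALL j. a j <= 4 * b j) & (ALL j. a j * (\<rho> k * of_int j)\<^sup>2 <= 4 * b j))" by auto
 interpret K: twisted_kernels \<alpha> \<rho> t k0 A "%k. fst (z k)" "%k. fst (snd (snd (z k)))" "%k. fst (snd (z k))" "%k. snd (snd (snd (z k)))"
  by unfold_locales (use z in \<open>auto simp: case_prod_unfold\<close>)
 define M where "M xi = norm (\<integral>om. ee (idot xi (F om)) \<partial>\<nu>)" for xi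
 \<comment> \<open>The covariance bound needs a constant valid at every frequency, including 0,
   where only the total mass is available.\<close>
 define V' where "V' = max V (measure \<nu> (space \<nu>))"
 have M1: "0 <= M xi" for xi by (simp add: M_def)
 have M2: "M xi <= V'" for xi
 proof -
  have "M xi <= (\<integral>om. norm (ee (idot xi (F om))) \<partial>\<nu>)" unfolding M_def by (rule integral_norm_bound)
  also have "... = measure \<nu> (space \<nu>)" by simp
  finally show ?thesis by (simp add: V'_def)
 qed
 have M3: "M xi <= V' * Y powr (- \<delta>)" if "0 < Y" "Y < \<bar>real_of_int (xi i)\<bar>" for xi i Y
 proof -
  have "M xi <= V * Y powr (- \<delta>)" unfolding M_def by (rule dec[of Y xi i, OF that])
  also have "... <= V' * Y powr (- \<delta>)" by (intro mult_right_mono) (auto simp: V'_def)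
  finally show ?thesis .
 qed
 have "EX k1 C. k0 <= k1 & 0 <= C & (ALL l X. k1 <= l --> finite X --> (%_. 0) \<notin> X -->
  (\<Sum>k=k1..l. \<Sum>xi\<in>X. \<Sum>xi'\<in>X. K.u k xi * K.u l xi' * M (%i. xi i - xi' i)) <= C * K.u l (%_. 0))"
  by (rule K.covariance_bound[where M = M and V = V', OF M1 M2 \<delta>]) (rule M3, assumption, assumption)
 then obtain k1 C where
  kC: "k0 <= k1 & 0 <= C & (ALL l X. k1 <= l --> finite X --> (%_. 0) \<notin> X -->
  (\<Sum>k=k1..l. \<Sum>xi\<in>X. \<Sum>xi'\<in>X. K.u k xi * K.u l xi' * M (%i. xi i - xi' i)) <= C * K.u l (%_. 0))"
  by (elim exE)
 then have k1: "k0 <= k1" "0 <= C" by simp_all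
 note cov = kC[THEN conjunct2, THEN conjunct2, rule_format]
 \<comment> \<open>\<open>max k1 k\<close> keeps every index in the admissible range without
   affecting arbitrarily late nonzero values.\<close>
 have "AE om in \<nu>. ALL K. \<exists>k\<ge>K. Gf (2 ^ (max k1 k)) (fst (z (max k1 k))) \<alpha> (F om) ~= 0"
 proof (rule second_moment[OF fin F, where u = K.u and kb = k1 and C = C])
  show "0 <= K.u k xi" if "k1 <= k" for k xi using that k1 by (intro K.u_nonneg) auto
  show "0 <= C" by (rule k1)
  show "(\<Sum>k=k1..l. \<Sum>xi\<in>X. \<Sum>xi'\<in>X. K.u k xi * K.u l xi' * norm (\<integral>om. ee (idot (%i. xi i - xi' i) (F om)) \<partial>\<nu>)) <= C * K.u l (%_. 0)"
   if "k1 <= l" "finite X" "(%_. 0) \<notin> X" for l X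
   using cov[OF that] by (simp add: M_def)
  show "uniform_limit UNIV (%J \<beta>. \<Sum>xi\<in>ibox J. of_real (K.u k xi) * ee (idot xi \<beta>))
     (%\<beta>. of_real (Gf (2 ^ (max k1 k)) (fst (z (max k1 k))) \<alpha> \<beta>)) sequentially" if "k1 <= k" for k
   using Gf_uniform_limit[OF K.kern_a[of k], of "2 ^ k" \<alpha>] that k1 by (simp add: K.u_def max_def)
  show "\<not> summable (%k. K.u k (%_. 0))"
  proof
   assume s: "summable (%k. K.u k (%_. 0))"
   have s': "summable (%k. (4/3) ^ CARD('m) * K.u k (%_. 0))" by (rule summable_mult[OF s])
   have "\<forall>\<^sub>F k in sequentially. (4/3) ^ CARD('m) * K.u k (%_. 0) = \<rho> k ^ CARD('m) * 2 ^ (k * CARD('n))"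
    using eventually_ge_at_top[of k0]
   proof eventually_elim
    case (elim k)
    have "(4/3) ^ CARD('m) * (3 * \<rho> k / 4) ^ CARD('m) = (\<rho> k) ^ CARD('m)" unfolding power_mult_distrib[symmetric] by simp
    then show ?case unfolding K.u_0[OF elim] by (simp add: power_mult mult.assoc[symmetric])
   qed
   from summable_cong[OF this] s' div show False by simp
  qed
 qed
 then show ?thesis
 proof eventually_elim
  case (elim om)
  show ?case
  proof
   fix K'
   obtain k where k: "K' <= k" "Gf (2 ^ (max k1 k)) (fst (z (max k1 k))) \<alpha> (F om) ~= 0" using elim by blast
   define k' where "k' = max k1 k"
   have k': "k0 <= k'" "K' <= k'" using k k1 by (auto simp: k'_def)
   obtain q where q: "q \<in> ibox (2 ^ k')" "(\<Prod>i\<in>UNIV. fst (z k') (lin \<alpha> q i + F om $ i)) ~= 0"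
    using k(2) unfolding Gf_def k'_def[symmetric] by (metis (no_types, lifting) mult_zero_right sum.neutral)
   have "\<exists>p::int. \<bar>lin \<alpha> q i + F om $ i - of_int p\<bar> < \<rho> k'" for i
    using q(2) K.kern_a[OF k'(1)] by (auto simp: kern_def)
   moreover have "\<bar>q j\<bar> <= 2 ^ k'" for j using q(1) by (simp add: ibox_iff)
   ultimately show "\<exists>k\<ge>K'. \<exists>q::'n => int. (ALL j. \<bar>q j\<bar> <= 2 ^ k) & (ALL i. \<exists>p::int. \<bar>lin \<alpha> q i + F om $ i - of_int p\<bar> < \<rho> k)"
    using k' by blast
  qed
 qed
qed

end

section \<open>Van der Corput's lemma for oscillatory integrals\<close>

lemma ee_has_vector_derivative:
 assumes "(th has_real_derivative d) (at t within S)"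
 shows "((%t. ee (th t)) has_vector_derivative (2 * pi * d) *\<^sub>R (\<i> * ee (th t))) (at t within S)"
proof -
 have "((%t. cos (2 * pi * th t)) has_real_derivative - (sin (2 * pi * th t)) * (2 * pi * d)) (at t within S)"
  "((%t. sin (2 * pi * th t)) has_real_derivative cos (2 * pi * th t) * (2 * pi * d)) (at t within S)"
  by (auto intro!: derivative_eq_intros assms)
 then have "((%t. Complex (cos (2 * pi * th t)) (sin (2 * pi * th t))) has_vector_derivative
   Complex (- (sin (2 * pi * th t)) * (2 * pi * d)) (cos (2 * pi * th t) * (2 * pi * d))) (at t within S)"
  unfolding has_real_derivative_iff_has_vector_derivative has_vector_derivative_complex_iff by simp
 moreover have "(%t. Complex (cos (2 * pi * th t)) (sin (2 * pi * th t))) = (%t. ee (th t))"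
  by (auto simp: ee_def complex_eq_iff)
 moreover have "Complex (- (sin (2 * pi * th t)) * (2 * pi * d)) (cos (2 * pi * th t) * (2 * pi * d)) = (2 * pi * d) *\<^sub>R (\<i> * ee (th t))"
  by (simp add: ee_def complex_eq_iff)
 ultimately show ?thesis by simp
qed

text \<open>The phase is carried along with all its derivatives as one sequence, one-sided at the
  end points, so that restricting to a subinterval or changing sign preserves the data.\<close>

definition smooth_phase :: "(nat => real => real) => real => real => bool" where
 "smooth_phase th a c \<longleftrightarrow> (ALL i. \<forall>t\<in>{a..c}. (th i has_real_derivative th (Suc i) t) (at t within {a..c}))"

lemma smooth_phaseD: "smooth_phase th a c ==> t \<in> {a..c} ==> (th i has_real_derivative th (Suc i) t) (at t within {a..c})"
 by (simp add: smooth_phase_def)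

lemma smooth_phase_subset:
 assumes "smooth_phase th a c" "a <= a'" "c' <= c" shows "smooth_phase th a' c'"
 unfolding smooth_phase_def
proof (intro allI ballI)
 fix i t assume t: "t \<in> {a'..c'}"
 show "(th i has_real_derivative th (Suc i) t) (at t within {a'..c'})"
  by (rule DERIV_subset[OF smooth_phaseD[OF assms(1)]]) (use t assms in auto)
qed

lemma smooth_phase_continuous:
 assumes "smooth_phase th a c" shows "continuous_on {a..c} (th i)"
 using smooth_phaseD[OF assms] DERIV_continuous by (fastforce simp: continuous_on_eq_continuous_within)

lemma norm_integral_ee_le:
 assumes "a <= c" "continuous_on {a..c} th"
 shows "norm (integral {a..c} (%t. ee (th t))) <= c - a"
proof -
 have "norm (integral {a..c} (%t. ee (th t))) <= integral {a..c} (%t. 1)"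
  by (rule integral_norm_bound_integral)
    (auto intro!: integrable_continuous_real continuous_intros assms)
 then show ?thesis using assms by simp
qed

text \<open>Integration by parts. The error term is controlled by a bound on the second derivative
  of the same order \<open>La\<close> as the phase, in place of the monotonicity of the first
  derivative in the classical test.\<close>

lemma van_der_Corput_base:
 assumes "a <= c" "c - a <= 1" "smooth_phase th a c" "1 <= La" "0 < \<kappa>" "\<kappa> <= 1" "1 <= B"
  "!!t. t \<in> {a..c} ==> \<bar>th 2 t\<bar> <= B * La" "!!t. t \<in> {a..c} ==> \<kappa> * La <= \<bar>th 1 t\<bar>"
 shows "norm (integral {a..c} (%t. ee (th 0 t))) <= 2 * B / (\<kappa>\<^sup>2 * La)"
proof -
 have kl: "0 < \<kappa> * La" using assms by simp
 have nz: "th 1 t ~= 0" if "t \<in> {a..c}" for t using assms(9)[OF that] kl by auto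
 note cont = smooth_phase_continuous[OF assms(3)]
 define P where "P t = (1 / (2 * pi * th 1 t)) *\<^sub>R (- \<i> * ee (th 0 t))" for t
 define E where "E t = (th 2 t / (2 * pi * (th 1 t)\<^sup>2)) *\<^sub>R (\<i> * ee (th 0 t))" for t
 have P: "(P has_vector_derivative (ee (th 0 t) + E t)) (at t within {a..c})" if t: "t \<in> {a..c}" for t
 proof -
  have d1: "((%t. 1 / (2 * pi * th 1 t)) has_real_derivative - (th 2 t / (2 * pi * (th 1 t)\<^sup>2))) (at t within {a..c})"
   using smooth_phaseD[OF assms(3) t, of 1] nz[OF t]
   by (auto intro!: derivative_eq_intros simp: numeral_2_eq_2 power2_eq_square)
  have d2: "((%t. - \<i> * ee (th 0 t)) has_vector_derivative - \<i> * ((2 * pi * th 1 t) *\<^sub>R (\<i> * ee (th 0 t)))) (at t within {a..c})"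
   using ee_has_vector_derivative[OF smooth_phaseD[OF assms(3) t, of 0]]
   by (intro has_vector_derivative_mult_right) simp
  have "(P has_vector_derivative ((1 / (2 * pi * th 1 t)) *\<^sub>R (- \<i> * ((2 * pi * th 1 t) *\<^sub>R (\<i> * ee (th 0 t)))) +
    (- (th 2 t / (2 * pi * (th 1 t)\<^sup>2))) *\<^sub>R (- \<i> * ee (th 0 t)))) (at t within {a..c})"
   unfolding P_def by (rule has_vector_derivative_scaleR[OF d1 d2])
  also have "(1 / (2 * pi * th 1 t)) *\<^sub>R (- \<i> * ((2 * pi * th 1 t) *\<^sub>R (\<i> * ee (th 0 t)))) +
    (- (th 2 t / (2 * pi * (th 1 t)\<^sup>2))) *\<^sub>R (- \<i> * ee (th 0 t)) = ee (th 0 t) + E t"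
   using nz[OF t] by (simp add: E_def mult.assoc[symmetric])
  finally show ?thesis .
 qed
 have "((%t. ee (th 0 t) + E t) has_integral (P c - P a)) {a..c}"
  by (rule fundamental_theorem_of_calculus[OF assms(1) P])
 moreover have cE: "continuous_on {a..c} E"
  unfolding E_def using nz by (intro continuous_intros cont) auto
 have iE: "E integrable_on {a..c}" by (rule integrable_continuous_real[OF cE])
 ultimately have "((%t. ee (th 0 t) + E t - E t) has_integral (P c - P a - integral {a..c} E)) {a..c}"
  by (intro has_integral_diff) auto
 then have "integral {a..c} (%t. ee (th 0 t)) = P c - P a - integral {a..c} E" by (simp add: integral_unique)
 also have "norm ... <= norm (P c) + norm (P a) + norm (integral {a..c} E)"
  by (meson norm_triangle_ineq4 order_trans add_mono order_refl)
 also have "... <= 1 / (2 * (\<kappa> * La)) + 1 / (2 * (\<kappa> * La)) + B / (\<kappa>\<^sup>2 * La)"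
 proof (intro add_mono)
  have pb: "norm (P t) <= 1 / (2 * (\<kappa> * La))" if "t \<in> {a..c}" for t
  proof -
   have "norm (P t) = 1 / (2 * pi * \<bar>th 1 t\<bar>)" by (simp add: P_def norm_mult abs_mult)
   also have "... <= 1 / (2 * (\<kappa> * La))"
   proof (rule divide_left_mono)
    have "1 * (\<kappa> * La) <= pi * \<bar>th 1 t\<bar>" using assms(9)[OF that] kl pi_ge_two by (intro mult_mono) auto
    then show "2 * (\<kappa> * La) <= 2 * pi * \<bar>th 1 t\<bar>" by simp
   qed (use nz[OF that] kl in auto)
   finally show ?thesis .
  qed
  show "norm (P c) <= 1 / (2 * (\<kappa> * La))" "norm (P a) <= 1 / (2 * (\<kappa> * La))" using assms by (auto intro!: pb)
  have "norm (integral {a..c} E) <= integral {a..c} (%t. B / (\<kappa>\<^sup>2 * La))"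
  proof (rule integral_norm_bound_integral[OF iE])
   fix t assume t: "t \<in> {a..c}"
   have "norm (E t) = \<bar>th 2 t\<bar> / (2 * pi * \<bar>th 1 t\<bar>\<^sup>2)" by (simp add: E_def norm_mult abs_mult)
   also have "... <= (B * La) / (1 * (\<kappa> * La)\<^sup>2)"
    using assms(8,9)[OF t] kl pi_ge_two assms by (intro frac_le mult_mono power_mono) auto
   also have "... = B / (\<kappa>\<^sup>2 * La)" using assms by (simp add: power2_eq_square)
   finally show "norm (E t) <= B / (\<kappa>\<^sup>2 * La)" .
  qed auto
  also have "... = (c - a) * (B / (\<kappa>\<^sup>2 * La))" using assms by simp
  also have "... <= 1 * (B / (\<kappa>\<^sup>2 * La))" using assms by (intro mult_right_mono) auto
  finally show "norm (integral {a..c} E) <= B / (\<kappa>\<^sup>2 * La)" by simp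
 qed
 also have "1 / (2 * (\<kappa> * La)) + 1 / (2 * (\<kappa> * La)) = 1 / (\<kappa> * La)" using kl by simp
 also have "1 / (\<kappa> * La) <= B / (\<kappa>\<^sup>2 * La)"
 proof -
  have "\<kappa>\<^sup>2 <= \<kappa>" using assms by (simp add: power2_eq_square)
  then have "\<kappa>\<^sup>2 * La <= \<kappa> * La" using assms by (intro mult_right_mono) auto
  then show ?thesis using assms by (intro frac_le) auto
 qed
 finally show ?thesis by (simp add: mult.commute)
qed

text \<open>A function with slope at least \<open>K\<close> crosses the band between
  \<open>-\<mu>\<close> and \<open>\<mu>\<close> within length \<open>2 * \<mu> / K\<close>. The
  degenerate cases, in which a side is empty, explain the strict premises in the conclusion.\<close>

lemma increasing_split:
 fixes w :: "real => real"
 assumes ac: "a <= c" and d: "!!t. t \<in> {a..c} ==> (w has_real_derivative w' t) (at t within {a..c})"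
  and w': "!!t. t \<in> {a..c} ==> K <= w' t" and K: "0 < K" and \<mu>: "0 < \<mu>"
 obtains p r where "a <= p" "p <= r" "r <= c" "r - p <= 2 * \<mu> / K"
  "!!t. t \<in> {a..p} ==> a < p ==> w t <= - \<mu>" "!!t. t \<in> {r..c} ==> r < c ==> \<mu> <= w t"
proof -
 have slope: "K * (y - x) <= w y - w x" if xy: "x \<in> {a..c}" "y \<in> {a..c}" "x <= y" for x y
 proof (cases "x = y")
  case False
  then have lt: "x < y" using xy by simp
  have "\<exists>z\<in>{x<..<y}. w y - w x = (%h. h * w' z) (y - x)"
  proof (rule mvt_simple[OF lt])
   fix t assume "x <= t" "t <= y"
   then have t: "t \<in> {x..y}" by simp
   then have "(w has_real_derivative w' t) (at t within {x..y})"
    using xy by (intro DERIV_subset[OF d]) auto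
   then have "(w has_derivative (%h. w' t * h)) (at t within {x..y})" by (simp only: has_field_derivative_def)
   then show "(w has_derivative (%h. h * w' t)) (at t within {x..y})" by (simp only: mult.commute)
  qed
  then obtain z where z: "z \<in> {x<..<y}" "w y - w x = (y - x) * w' z" by auto
  have "(y - x) * K <= (y - x) * w' z" using z xy lt by (intro mult_left_mono w') auto
  then show ?thesis using z by (simp add: mult.commute)
 qed simp
 have mono: "w x <= w y" if "x \<in> {a..c}" "y \<in> {a..c}" "x <= y" for x y
 proof -
  have "0 <= K * (y - x)" using that K by simp
  then show ?thesis using slope[OF that] by linarith
 qed
 have cont: "continuous_on {a..c} w"
  using d DERIV_continuous by (fastforce simp: continuous_on_eq_continuous_within)
 have lev: "\<exists>p\<in>{a..c}. (p < c --> s <= w p) & (a < p --> w p <= s)" for s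
 proof -
  consider "s <= w a" | "w c <= s" | "w a <= s" "s <= w c" by linarith
  then show ?thesis
  proof cases
   case 1 then show ?thesis using ac by (intro bexI[of _ a]) auto
  next
   case 2 then show ?thesis using ac by (intro bexI[of _ c]) auto
  next
   case 3
   obtain p where "a <= p" "p <= c" "w p = s" using IVT'[OF 3 ac cont] by blast
   then show ?thesis by (intro bexI[of _ p]) auto
  qed
 qed
 obtain p where p: "p \<in> {a..c}" "p < c ==> - \<mu> <= w p" "a < p ==> w p <= - \<mu>" using lev[of "- \<mu>"] by blast
 obtain r where r: "r \<in> {a..c}" "r < c ==> \<mu> <= w r" "a < r ==> w r <= \<mu>" using lev[of \<mu>] by blast
 have pr: "p <= r"
 proof (rule ccontr)
  assume "\<not> p <= r"
  then have "w r <= w p" "\<mu> <= w r" "w p <= - \<mu>" using p r mono[of r p] by auto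
  then show False using \<mu> by linarith
 qed
 have "r - p <= 2 * \<mu> / K"
 proof (cases "p = r")
  case False
  then have "p < r" using pr by simp
  then have "w r <= \<mu>" "- \<mu> <= w p" using p r by auto
  then have "K * (r - p) <= 2 * \<mu>" using slope[OF p(1) r(1) pr] by linarith
  then show ?thesis using K by (simp add: pos_le_divide_eq mult.commute)
 qed (use \<mu> K in simp)
 then show thesis
 proof (rule that[rotated 3])
  show "w t <= - \<mu>" if "t \<in> {a..p}" "a < p" for t using mono[of t p] p that by auto
  show "\<mu> <= w t" if "t \<in> {r..c}" "r < c" for t using mono[of r t] r that by auto
 qed (use p r pr in auto)
qed

lemma smooth_phase_uminus: "smooth_phase th a c ==> smooth_phase (%i t. - th i t) a c"
 unfolding smooth_phase_def by (auto intro!: derivative_eq_intros)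

text \<open>A lower bound on the derivative of order \<open>Suc j\<close> makes the one of order
  \<open>j\<close> small only on a short interval. That interval is estimated by its length, and the
  induction hypothesis covers the two remaining sides.\<close>

lemma van_der_Corput_step:
 assumes ac: "a <= c" "c - a <= 1" and sm: "smooth_phase th a c" and La: "1 <= La" and \<kappa>: "0 < \<kappa>" "\<kappa> <= 1"
  and th2: "!!t. t \<in> {a..c} ==> \<bar>th 2 t\<bar> <= B * La"
  and low: "!!t. t \<in> {a..c} ==> \<kappa> * La <= th (Suc j) t"
  and C: "0 <= C" "0 < \<gamma>" "0 <= s"
  and IH: "!!a c \<mu>. a <= c ==> c - a <= 1 ==> smooth_phase th a c ==> 0 < \<mu> ==> \<mu> <= 1 ==>
    (!!t. t \<in> {a..c} ==> \<bar>th 2 t\<bar> <= B * La) ==> (!!t. t \<in> {a..c} ==> \<mu> * La <= \<bar>th j t\<bar>) ==>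
    norm (integral {a..c} (%t. ee (th 0 t))) <= C * \<mu> powr (- s) * La powr (- \<gamma>)"
 shows "norm (integral {a..c} (%t. ee (th 0 t))) <= (2 * C + 2) * \<kappa> powr (- 1) * La powr (- (\<gamma> / (s + 1)))"
proof -
 \<comment> \<open>Balances the two contributions: this value makes
   \<open>\<mu> powr (- s) * La powr (- \<gamma>)\<close> equal to \<open>\<mu>\<close>.\<close>
 define \<mu> where "\<mu> = La powr (- (\<gamma> / (s + 1)))"
 have \<mu>: "0 < \<mu>" "\<mu> <= 1"
 proof -
  show "0 < \<mu>" using La by (simp add: \<mu>_def)
  have "1 <= La powr (\<gamma> / (s + 1))" using La C by (intro ge_one_powr_ge_zero) auto
  then show "\<mu> <= 1" unfolding \<mu>_def powr_minus_divide using La by (subst pos_divide_le_eq) auto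
 qed
 obtain p r where pr: "a <= p" "p <= r" "r <= c" "r - p <= 2 * (\<mu> * La) / (\<kappa> * La)"
  "!!t. t \<in> {a..p} ==> a < p ==> th j t <= - (\<mu> * La)" "!!t. t \<in> {r..c} ==> r < c ==> \<mu> * La <= th j t"
  by (rule increasing_split[OF ac(1) smooth_phaseD[OF sm], of "\<kappa> * La" j "\<mu> * La"])
    (use low \<kappa> La \<mu> in auto)
 note cont = smooth_phase_continuous[OF sm, of 0]
 have i: "(%t. ee (th 0 t)) integrable_on {x..y}" if "a <= x" "y <= c" for x y
  using that by (intro integrable_continuous_real continuous_intros continuous_on_subset[OF cont]) auto
 have b1: "norm (integral {a..p} (%t. ee (th 0 t))) <= C * \<mu> powr (- s) * La powr (- \<gamma>)"
 proof (cases "a < p")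
  case True
  show ?thesis
  proof (rule IH)
   show "smooth_phase th a p" using pr by (intro smooth_phase_subset[OF sm]) auto
   fix t assume "t \<in> {a..p}"
   then show "\<mu> * La <= \<bar>th j t\<bar>" using pr(5)[OF _ True, of t] by linarith
  qed (use pr ac \<mu> th2 in auto)
 next
  case False
  then have "p = a" using pr by simp
  then show ?thesis using C by simp
 qed
 have b2: "norm (integral {r..c} (%t. ee (th 0 t))) <= C * \<mu> powr (- s) * La powr (- \<gamma>)"
 proof (cases "r < c")
  case True
  show ?thesis
  proof (rule IH)
   show "smooth_phase th r c" using pr by (intro smooth_phase_subset[OF sm]) auto
   fix t assume "t \<in> {r..c}"
   then show "\<mu> * La <= \<bar>th j t\<bar>" using pr(6)[OF _ True, of t] by linarith
  qed (use pr ac \<mu> th2 in auto)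
 next
  case False
  then have "r = c" using pr by simp
  then show ?thesis using C by simp
 qed
 have b3: "norm (integral {p..r} (%t. ee (th 0 t))) <= 2 * \<mu> / \<kappa>"
 proof -
  have "norm (integral {p..r} (%t. ee (th 0 t))) <= r - p"
   using pr by (intro norm_integral_ee_le continuous_on_subset[OF cont]) auto
  also have "... <= 2 * \<mu> / \<kappa>" using pr(4) La by simp
  finally show ?thesis .
 qed
 have "integral {a..c} (%t. ee (th 0 t)) = integral {a..p} (%t. ee (th 0 t)) + (integral {p..r} (%t. ee (th 0 t)) + integral {r..c} (%t. ee (th 0 t)))"
  using pr Henstock_Kurzweil_Integration.integral_combine[OF _ _ i, of a p c]
   Henstock_Kurzweil_Integration.integral_combine[OF _ _ i, of p r c] by simp
 also have "norm ... <= C * \<mu> powr (- s) * La powr (- \<gamma>) + (2 * \<mu> / \<kappa> + C * \<mu> powr (- s) * La powr (- \<gamma>))"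
  by (intro order_trans[OF norm_triangle_ineq] add_mono b1 b2 b3)
 also have "C * \<mu> powr (- s) * La powr (- \<gamma>) = C * \<mu>"
 proof -
  have "\<mu> powr (- s) * La powr (- \<gamma>) = La powr (- (\<gamma> / (s + 1)) * (- s) + - \<gamma>)"
   by (simp only: \<mu>_def powr_powr powr_add)
  also have "- (\<gamma> / (s + 1)) * (- s) + - \<gamma> = - (\<gamma> / (s + 1))" using C by (simp add: field_simps)
  finally show ?thesis by (simp add: \<mu>_def)
 qed
 also have "C * \<mu> + (2 * \<mu> / \<kappa> + C * \<mu>) <= (2 * C + 2) * (1 / \<kappa>) * \<mu>"
 proof -
  have "1 <= 1 / \<kappa>" using \<kappa> by simp
  then have "2 * C * \<mu> * 1 <= 2 * C * \<mu> * (1 / \<kappa>)" using C \<mu> by (intro mult_left_mono) auto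
  then show ?thesis by (simp add: algebra_simps add_divide_distrib)
 qed
 finally show ?thesis using \<kappa> by (simp add: \<mu>_def powr_minus_divide)
qed

text \<open>The bound must be uniform in the interval, the phase and \<open>La\<close>, and its
  dependence on \<open>\<kappa>\<close> must be explicit, since the induction shrinks
  \<open>\<kappa>\<close> to a negative power of \<open>La\<close>. Only some positive exponent
  \<open>\<gamma>\<close> matters; it deteriorates with the order.\<close>

lemma van_der_Corput:
 assumes B: "1 <= B"
 shows "\<exists>C \<gamma> s. 0 <= C & 0 < \<gamma> & 0 <= s & (\<forall>a c th La \<kappa>. a <= c --> c - a <= 1 --> smooth_phase th a c --> 1 <= La -->
   0 < \<kappa> --> \<kappa> <= 1 --> (\<forall>t\<in>{a..c}. \<bar>th 2 t\<bar> <= B * La) --> (\<forall>t\<in>{a..c}. \<kappa> * La <= \<bar>th (Suc j) t\<bar>) -->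
   norm (integral {a..c} (%t. ee (th 0 t))) <= C * \<kappa> powr (- s) * La powr (- \<gamma>))"
proof (induction j)
 case 0
 show ?case
 proof (rule exI[of _ "2 * B"], rule exI[of _ 1], rule exI[of _ 2], intro conjI allI impI)
  fix a c :: real and th :: "nat => real => real" and La \<kappa> :: real
  assume h: "a <= c" "c - a <= 1" "smooth_phase th a c" "1 <= La" "0 < \<kappa>" "\<kappa> <= 1"
   "\<forall>t\<in>{a..c}. \<bar>th 2 t\<bar> <= B * La" "\<forall>t\<in>{a..c}. \<kappa> * La <= \<bar>th (Suc 0) t\<bar>"
  have "norm (integral {a..c} (%t. ee (th 0 t))) <= 2 * B / (\<kappa>\<^sup>2 * La)"
   by (rule van_der_Corput_base) (use h B in auto)
  also have "... = 2 * B * \<kappa> powr (- 2) * La powr (- 1)"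
   using h by (simp add: powr_minus_divide powr_numeral)
  finally show "norm (integral {a..c} (%t. ee (th 0 t))) <= 2 * B * \<kappa> powr (- 2) * La powr (- 1)" .
 qed (use B in auto)
next
 case (Suc j)
 then obtain C \<gamma> s where C: "0 <= C & 0 < \<gamma> & 0 <= s & (\<forall>a c th La \<kappa>. a <= c --> c - a <= 1 --> smooth_phase th a c --> 1 <= La -->
   0 < \<kappa> --> \<kappa> <= 1 --> (\<forall>t\<in>{a..c}. \<bar>th 2 t\<bar> <= B * La) --> (\<forall>t\<in>{a..c}. \<kappa> * La <= \<bar>th (Suc j) t\<bar>) -->
   norm (integral {a..c} (%t. ee (th 0 t))) <= C * \<kappa> powr (- s) * La powr (- \<gamma>))" by (elim exE)
 then have C0: "0 <= C" "0 < \<gamma>" "0 <= s" by simp_all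
 note IH = C[THEN conjunct2, THEN conjunct2, THEN conjunct2, rule_format]
 show ?case
 proof (rule exI[of _ "2 * C + 2"], rule exI[of _ "\<gamma> / (s + 1)"], rule exI[of _ 1], intro conjI allI impI)
  fix a c :: real and th :: "nat => real => real" and La \<kappa> :: real
  assume h: "a <= c" "c - a <= 1" "smooth_phase th a c" "1 <= La" "0 < \<kappa>" "\<kappa> <= 1"
   "\<forall>t\<in>{a..c}. \<bar>th 2 t\<bar> <= B * La" "\<forall>t\<in>{a..c}. \<kappa> * La <= \<bar>th (Suc (Suc j)) t\<bar>"
  have kl: "0 < \<kappa> * La" using h by simp
  \<comment> \<open>The derivative is continuous and bounded away from 0, so it keeps its sign; a
    negative sign is reduced to a positive one by conjugating the integral.\<close>
  have sgn: "(\<forall>t\<in>{a..c}. 0 < th (Suc (Suc j)) t) \<or> (\<forall>t\<in>{a..c}. th (Suc (Suc j)) t < 0)"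
  proof (rule ccontr)
   assume "\<not> ?thesis"
   then obtain x y where xy: "x \<in> {a..c}" "y \<in> {a..c}" "th (Suc (Suc j)) x <= 0" "0 <= th (Suc (Suc j)) y"
    by (auto simp: not_less)
   have "connected (th (Suc (Suc j)) ` {a..c})"
    by (intro connected_continuous_image smooth_phase_continuous[OF h(3)]) simp
   then have "0 \<in> th (Suc (Suc j)) ` {a..c}"
    using xy connectedD_interval[of "th (Suc (Suc j)) ` {a..c}" "th (Suc (Suc j)) x" "th (Suc (Suc j)) y" 0] by auto
   then show False using h(8) kl by force
  qed
  show "norm (integral {a..c} (%t. ee (th 0 t))) <= (2 * C + 2) * \<kappa> powr (- 1) * La powr (- (\<gamma> / (s + 1)))"
   using sgn
  proof
   assume pos: "\<forall>t\<in>{a..c}. 0 < th (Suc (Suc j)) t"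
   show ?thesis
   proof (rule van_der_Corput_step[where B = B and j = "Suc j", OF h(1-6) _ _ C0])
    fix a' c' \<mu> :: real
    assume h': "a' <= c'" "c' - a' <= 1" "smooth_phase th a' c'" "0 < \<mu>" "\<mu> <= 1"
     "!!t. t \<in> {a'..c'} ==> \<bar>th 2 t\<bar> <= B * La" "!!t. t \<in> {a'..c'} ==> \<mu> * La <= \<bar>th (Suc j) t\<bar>"
    show "norm (integral {a'..c'} (%t. ee (th 0 t))) <= C * \<mu> powr (- s) * La powr (- \<gamma>)"
     by (rule IH) (use h' h in auto)
   qed (use h pos in force)+
  next
   assume neg: "\<forall>t\<in>{a..c}. th (Suc (Suc j)) t < 0"
   define th' where "th' = (%i t. - th i t)"
   have "norm (integral {a..c} (%t. ee (th' 0 t))) <= (2 * C + 2) * \<kappa> powr (- 1) * La powr (- (\<gamma> / (s + 1)))"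
   proof (rule van_der_Corput_step[where B = B and j = "Suc j", OF h(1,2) _ h(4-6) _ _ C0])
    show "smooth_phase th' a c" unfolding th'_def by (rule smooth_phase_uminus[OF h(3)])
    fix a' c' \<mu> :: real
    assume h': "a' <= c'" "c' - a' <= 1" "smooth_phase th' a' c'" "0 < \<mu>" "\<mu> <= 1"
     "!!t. t \<in> {a'..c'} ==> \<bar>th' 2 t\<bar> <= B * La" "!!t. t \<in> {a'..c'} ==> \<mu> * La <= \<bar>th' (Suc j) t\<bar>"
    show "norm (integral {a'..c'} (%t. ee (th' 0 t))) <= C * \<mu> powr (- s) * La powr (- \<gamma>)"
     by (rule IH) (use h' h in auto)
   qed (use h neg in \<open>force simp: th'_def\<close>)+
   moreover have "integral {a..c} (%t. ee (th' 0 t)) = cnj (integral {a..c} (%t. ee (th 0 t)))"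
    unfolding th'_def ee_minus by (rule Henstock_Kurzweil_Integration.integral_cnj[symmetric])
   ultimately show ?thesis by simp
  qed
 qed (use C0 in auto)
qed

section \<open>Power series and their complexification along lines\<close>

locale multi_series =
 fixes f :: "real^'d => real^'m" and x0 :: "real^'d" and c :: "('d => nat) => real^'m" and e :: real
 assumes e_pos: "0 < e"
  and expansion: "!!y. y \<in> ball x0 e ==>
    ((%k. (\<Prod>j\<in>UNIV. (y $ j - x0 $ j) ^ k j) *\<^sub>R c k) has_sum f y) UNIV"
begin

text \<open>The point all of whose coordinates are \<open>R\<close> away from \<open>x0\<close> is
  still within \<open>e / 2\<close> of it; absolute convergence there dominates the series on the
  whole closed polydisc of radius \<open>R\<close>.\<close>

definition R :: real where "R = e / (2 * CARD('d))"

lemma R_pos: "0 < R"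
 using e_pos by (simp add: R_def)

lemma in_ball_of_componentwise:
 assumes "!!j. \<bar>z $ j\<bar> <= R" shows "x0 + z \<in> ball x0 e"
proof -
 have "norm z <= (\<Sum>j\<in>(UNIV::'d set). \<bar>z $ j\<bar>)" by (rule norm_le_l1_cart)
 also have "... <= (\<Sum>j\<in>(UNIV::'d set). R)" by (intro sum_mono assms)
 also have "... < e" using e_pos by (simp add: R_def)
 finally show ?thesis by (simp add: dist_norm)
qed

lemma coeff_summable: "(%k. \<bar>c k $ i\<bar> * (\<Prod>j\<in>UNIV. R ^ k j)) summable_on UNIV"
proof -
 have "x0 + (\<chi> j. R) \<in> ball x0 e" by (rule in_ball_of_componentwise) (use R_pos in simp)
 from expansion[OF this]
 have "((%k. (\<Prod>j\<in>UNIV. R ^ k j) *\<^sub>R c k) has_sum f (x0 + (\<chi> j. R))) UNIV" by simp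
 then have "((%k. ((\<Prod>j\<in>UNIV. R ^ k j) *\<^sub>R c k) $ i) has_sum f (x0 + (\<chi> j. R)) $ i) UNIV"
  by (rule has_sum_bounded_linear[OF bounded_linear_vec_nth])
 then have "(%k. ((\<Prod>j\<in>UNIV. R ^ k j) *\<^sub>R c k) $ i) summable_on UNIV"
  by (rule has_sum_imp_summable)
 then have "(%k. (\<Prod>j\<in>UNIV. R ^ k j) * c k $ i) summable_on UNIV" by simp
 then have "(%k. \<bar>(\<Prod>j\<in>UNIV. R ^ k j) * c k $ i\<bar>) summable_on UNIV"
  by (subst (asm) summable_on_iff_abs_summable_on_real) simp
 moreover have "\<bar>(\<Prod>j\<in>UNIV. R ^ k j) * c k $ i\<bar> = \<bar>c k $ i\<bar> * (\<Prod>j\<in>UNIV. R ^ k j)" for k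
  using R_pos by (simp add: abs_mult abs_prod mult.commute prod_nonneg)
 ultimately show ?thesis by simp
qed

definition mon :: "('d => nat) => complex^'d => complex" where
 "mon k w = (\<Prod>j\<in>UNIV. (w $ j) ^ k j)"

text \<open>Complexification of the \<open>i\<close>-th coordinate of \<open>f\<close>, recentred at
  0. Complex variables provide Cauchy's inequalities, hence derivative bounds uniform in point and
  direction, and the identity theorem.\<close>

definition Phi :: "'m => complex^'d => complex" where
 "Phi i w = (\<Sum>\<^sub>\<infinity>k. of_real (c k $ i) * mon k w)"

definition polydisc :: "(complex^'d) set" where
 "polydisc = {w. ALL j. norm (w $ j) <= R}"

lemma term_bound:
 assumes "w \<in> polydisc"
 shows "norm (of_real (c k $ i) * mon k w) <= \<bar>c k $ i\<bar> * (\<Prod>j\<in>UNIV. R ^ k j)"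
 using assms unfolding norm_mult mon_def prod_norm[symmetric] norm_power polydisc_def
 by (intro mult_mono prod_mono) (auto intro!: power_mono prod_nonneg)

lemma continuous_on_mon [continuous_intros]:
 assumes "continuous_on S w" shows "continuous_on S (%t. mon k (w t))"
 unfolding mon_def by (intro continuous_intros assms)

lemma Phi_uniform:
 "uniform_limit polydisc (%X w. \<Sum>k\<in>X. of_real (c k $ i) * mon k w) (Phi i) (finite_subsets_at_top UNIV)"
 unfolding Phi_def[abs_def] by (rule Weierstrass_m_test_general[OF term_bound coeff_summable])

lemma continuous_on_Phi: "continuous_on polydisc (Phi i)"
 by (rule uniform_limit_theorem[OF _ Phi_uniform]) (auto intro!: always_eventually continuous_intros)

lemma compact_polydisc: "compact polydisc"
proof -
 have "closed polydisc"
  unfolding polydisc_def by (intro closed_Collect_all closed_Collect_le continuous_intros)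
 moreover have "bounded polydisc"
  unfolding bounded_iff
 proof (intro exI ballI)
  fix w assume "w \<in> polydisc"
  then show "norm w <= norm (\<chi> j::'d. complex_of_real R)"
   using R_pos by (intro norm_le_componentwise_cart) (auto simp: polydisc_def)
 qed
 ultimately show ?thesis by (simp add: compact_eq_bounded_closed)
qed

lemma Phi_real:
 assumes "!!j. \<bar>z $ j\<bar> <= R"
 shows "Phi i (\<chi> j. of_real (z $ j)) = of_real (f (x0 + z) $ i)"
proof -
 have "((%k. (\<Prod>j\<in>UNIV. (z $ j) ^ k j) *\<^sub>R c k) has_sum f (x0 + z)) UNIV"
  using expansion[OF in_ball_of_componentwise[OF assms]] by simp
 then have h: "((%k. complex_of_real (((\<Prod>j\<in>UNIV. (z $ j) ^ k j) *\<^sub>R c k) $ i)) has_sum of_real (f (x0 + z) $ i)) UNIV"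
  by (rule has_sum_bounded_linear[OF bounded_linear_compose[OF bounded_linear_of_real bounded_linear_vec_nth]])
 have "complex_of_real (((\<Prod>j\<in>UNIV. (z $ j) ^ k j) *\<^sub>R c k) $ i) = of_real (c k $ i) * mon k (\<chi> j. of_real (z $ j))" for k
  by (simp add: mon_def mult.commute)
 with h show ?thesis unfolding Phi_def by (simp only: infsumI)
qed

definition path :: "real^'d => real^'d => complex => complex^'d" where
 "path z v t = (\<chi> j. of_real (z $ j) + t * of_real (v $ j))"

text \<open>The function \<open>u . f\<close> on the complex line through \<open>x0 + z\<close> in
  the direction \<open>v\<close>, so that one-variable holomorphic function theory applies.\<close>

definition ph :: "real^'m => real^'d => real^'d => complex => complex" where
 "ph u z v t = (\<Sum>i\<in>UNIV. of_real (u $ i) * Phi i (path z v t))"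

lemma path_in_polydisc:
 assumes "norm z <= R / 2" "norm v <= 1" "norm t <= R / 2"
 shows "path z v t \<in> polydisc"
proof -
 have "norm (of_real (z $ j) + t * of_real (v $ j)) <= R" for j
 proof -
  have "norm (of_real (z $ j) + t * of_real (v $ j)) <= \<bar>z $ j\<bar> + norm t * \<bar>v $ j\<bar>"
   by (rule order_trans[OF norm_triangle_ineq]) (simp add: norm_mult)
  also have "... <= R / 2 + R / 2 * 1"
   using assms component_le_norm_cart[of z j] component_le_norm_cart[of v j] R_pos
   by (intro add_mono mult_mono) auto
  finally show ?thesis by simp
 qed
 then show ?thesis by (simp add: polydisc_def path_def)
qed

lemma continuous_on_path [continuous_intros]: "continuous_on S (path z v)"
 unfolding path_def by (intro continuous_intros)

lemma Phi_path_holomorphic: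
 assumes "norm z <= R / 2" "norm v <= 1"
 shows "(%t. Phi i (path z v t)) holomorphic_on ball 0 (R / 2)"
  and "continuous_on (cball 0 (R / 2)) (%t. Phi i (path z v t))"
proof -
 have in_p: "path z v t \<in> polydisc" if "t \<in> cball 0 (R / 2)" for t
  using path_in_polydisc[OF assms, of t] that by simp
 have ul: "uniform_limit (cball 0 (R / 2)) (%X t. \<Sum>k\<in>X. of_real (c k $ i) * mon k (path z v t))
   (%t. Phi i (path z v t)) (finite_subsets_at_top UNIV)"
  using Phi_uniform[of i] in_p unfolding uniform_limit_iff by (auto elim!: eventually_mono)
 have ev: "\<forall>\<^sub>F X in finite_subsets_at_top UNIV. continuous_on (cball 0 (R / 2)) (%t. \<Sum>k\<in>X. of_real (c k $ i) * mon k (path z v t)) &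
   (%t. \<Sum>k\<in>X. of_real (c k $ i) * mon k (path z v t)) holomorphic_on ball 0 (R / 2)"
 proof (intro always_eventually allI conjI)
  fix X :: "('d => nat) set"
  show "continuous_on (cball 0 (R / 2)) (%t. \<Sum>k\<in>X. of_real (c k $ i) * mon k (path z v t))"
   by (intro continuous_intros)
  show "(%t. \<Sum>k\<in>X. of_real (c k $ i) * mon k (path z v t)) holomorphic_on ball 0 (R / 2)"
   unfolding mon_def path_def vec_lambda_beta by (intro holomorphic_intros)
 qed
 show "(%t. Phi i (path z v t)) holomorphic_on ball 0 (R / 2)"
  by (rule holomorphic_uniform_limit[OF ev ul]) auto
 show "continuous_on (cball 0 (R / 2)) (%t. Phi i (path z v t))"
  by (rule holomorphic_uniform_limit[OF ev ul]) auto
qed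

lemma ph_holomorphic:
 assumes "norm z <= R / 2" "norm v <= 1"
 shows "ph u z v holomorphic_on ball 0 (R / 2)" "continuous_on (cball 0 (R / 2)) (ph u z v)"
 unfolding ph_def using Phi_path_holomorphic[OF assms]
 by (auto intro!: holomorphic_intros continuous_intros)

lemma ph_real:
 assumes "norm z <= R / 2" "norm v <= 1" "\<bar>t\<bar> <= R / 2"
 shows "ph u z v (of_real t) = of_real (u \<bullet> f (x0 + z + t *\<^sub>R v))"
proof -
 have "\<bar>(z + t *\<^sub>R v) $ j\<bar> <= R" for j
 proof -
  have "norm (path z v (of_real t) $ j) <= R" using path_in_polydisc[OF assms(1,2), of "of_real t"] assms(3) by (simp add: polydisc_def)
  moreover have "path z v (of_real t) $ j = of_real ((z + t *\<^sub>R v) $ j)" by (simp add: path_def)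
  ultimately show ?thesis by (simp only: norm_of_real)
 qed
 from Phi_real[of "z + t *\<^sub>R v", OF this]
 have "Phi i (path z v (of_real t)) = of_real (f (x0 + (z + t *\<^sub>R v)) $ i)" for i
  by (simp add: path_def)
 then show ?thesis by (simp add: ph_def inner_vec_def add.assoc)
qed

lemma ph_bounded:
 obtains B where "1 <= B" "!!u z v t. norm u <= 1 ==> norm z <= R / 2 ==> norm v <= 1 ==> norm t <= R / 2 ==> norm (ph u z v t) <= B"
proof -
 have "EX b. \<forall>w\<in>polydisc. norm (Phi i w) <= b" for i
  using compact_imp_bounded[OF compact_continuous_image[OF continuous_on_Phi compact_polydisc, of i]]
  by (auto simp: bounded_iff)
 then obtain b where b: "!!i w. w \<in> polydisc ==> norm (Phi i w) <= b i" by metis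
 show thesis
 proof (rule that[of "max 1 (\<Sum>i\<in>UNIV. \<bar>b i\<bar>)"])
  fix u :: "real^'m" and z v :: "real^'d" and t :: complex assume h: "norm u <= 1" "norm z <= R / 2" "norm v <= 1" "norm t <= R / 2"
  have "norm (ph u z v t) <= (\<Sum>i\<in>UNIV. \<bar>b i\<bar>)"
   unfolding ph_def
  proof (rule sum_norm_le)
   fix i
   have "norm (of_real (u $ i) * Phi i (path z v t)) = \<bar>u $ i\<bar> * norm (Phi i (path z v t))" by (simp add: norm_mult)
   also have "... <= 1 * \<bar>b i\<bar>"
    using h component_le_norm_cart[of u i] b[OF path_in_polydisc[OF h(2-4)], of i] by (intro mult_mono) auto
   finally show "norm (of_real (u $ i) * Phi i (path z v t)) <= \<bar>b i\<bar>" by simp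
  qed
  then show "norm (ph u z v t) <= max 1 (\<Sum>i\<in>UNIV. \<bar>b i\<bar>)" by simp
 qed simp
qed

text \<open>The variation in \<open>z\<close> comes from uniform continuity of \<open>Phi\<close> on
  the compact polydisc. The variation in \<open>u\<close> comes from linearity and the bound
  \<open>B\<close>, which is applied to the normalised difference.\<close>

lemma ph_continuous:
 assumes "0 < \<epsilon>"
 obtains r where "0 < r" "r <= R / 4" "!!u u' z v t. norm u <= 1 ==> norm (u - u') <= r ==> norm z <= r ==> norm v <= 1 ==> norm t <= R / 4 ==>
   norm (ph u z v t - ph u' 0 v t) <= \<epsilon>"
proof -
 define m where "m = real CARD('m)"
 have m: "0 < m" by (simp add: m_def)
 obtain B where B: "1 <= B" "!!u z v t. norm u <= 1 ==> norm z <= R / 2 ==> norm v <= 1 ==> norm t <= R / 2 ==> norm (ph u z v t) <= B"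
  by (rule ph_bounded) blast
 have "ALL i. \<exists>d>0. \<forall>w\<in>polydisc. \<forall>w'\<in>polydisc. dist w' w < d --> dist (Phi i w') (Phi i w) < \<epsilon> / (2 * m)"
  using compact_uniformly_continuous[OF continuous_on_Phi compact_polydisc] assms m
  unfolding uniformly_continuous_on_def by auto
 from choice[OF this] obtain d where d: "!!i. 0 < d i" "!!i w w'. w \<in> polydisc ==> w' \<in> polydisc ==> dist w' w < d i ==> dist (Phi i w') (Phi i w) < \<epsilon> / (2 * m)"
  by blast
 define d0 where "d0 = Min (range d)"
 have d0: "0 < d0" "!!i. d0 <= d i" using d(1) by (auto simp: d0_def)
 define r where "r = min (min (R / 4) (d0 / 2)) (\<epsilon> / (2 * B))"
 have r: "0 < r" "r <= R / 4" "r < d0" "r * B <= \<epsilon> / 2"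
 proof -
  show "0 < r" "r <= R / 4" using R_pos d0 assms B(1) by (auto simp: r_def)
  have "r <= d0 / 2" by (simp add: r_def)
  then show "r < d0" using d0 by linarith
  have "r <= \<epsilon> / (2 * B)" by (simp add: r_def)
  then show "r * B <= \<epsilon> / 2" using B(1) by (simp add: field_simps)
 qed
 show thesis
 proof (rule that[OF r(1,2)])
  fix u u' :: "real^'m" and z v :: "real^'d" and t :: complex
  assume h: "norm u <= 1" "norm (u - u') <= r" "norm z <= r" "norm v <= 1" "norm t <= R / 4"
  have rr: "norm z <= R / 2" "norm t <= R / 2" using h r R_pos by auto
  have p: "path z v t \<in> polydisc" "path 0 v t \<in> polydisc"
   using path_in_polydisc[of z v t] path_in_polydisc[of 0 v t] rr h R_pos by auto
  have "dist (path z v t) (path 0 v t) <= norm z"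
  proof -
   have "path z v t - path 0 v t = (\<chi> j. of_real (z $ j))" by (simp add: path_def vec_eq_iff)
   moreover have "norm (\<chi> j. complex_of_real (z $ j)) = norm z" by (simp add: norm_vec_def)
   ultimately show ?thesis by (simp add: dist_norm)
  qed
  then have dd: "dist (path z v t) (path 0 v t) < d i" for i using h r d0(2)[of i] by linarith
  have "norm (ph u z v t - ph u 0 v t) <= (\<Sum>i\<in>(UNIV::'m set). \<epsilon> / (2 * m))"
   unfolding ph_def sum_subtractf[symmetric]
  proof (rule sum_norm_le)
   fix i
   have "norm (of_real (u $ i) * Phi i (path z v t) - of_real (u $ i) * Phi i (path 0 v t)) =
    \<bar>u $ i\<bar> * dist (Phi i (path z v t)) (Phi i (path 0 v t))"
    by (simp add: norm_mult[symmetric] right_diff_distrib dist_norm norm_mult del: norm_mult) (simp add: norm_mult right_diff_distrib[symmetric])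
   also have "... <= 1 * (\<epsilon> / (2 * m))"
    using h component_le_norm_cart[of u i] d(2)[OF p(2,1) dd, of i] by (intro mult_mono) auto
   finally show "norm (of_real (u $ i) * Phi i (path z v t) - of_real (u $ i) * Phi i (path 0 v t)) <= \<epsilon> / (2 * m)" by simp
  qed
  also have "... = \<epsilon> / 2" using m by (simp add: m_def)
  finally have 1: "norm (ph u z v t - ph u 0 v t) <= \<epsilon> / 2" .
  have 2: "norm (ph u 0 v t - ph u' 0 v t) <= \<epsilon> / 2"
  proof (cases "u = u'")
   case False
   define w where "w = (1 / norm (u - u')) *\<^sub>R (u - u')"
   have nw: "norm w <= 1" "0 < norm (u - u')" using False by (auto simp: w_def)
   have "ph u 0 v t - ph u' 0 v t = of_real (norm (u - u')) * ph w 0 v t"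
    using nw(2) unfolding ph_def w_def sum_subtractf[symmetric] sum_distrib_left
    by (intro sum.cong refl) (simp add: left_diff_distrib)
   then have "norm (ph u 0 v t - ph u' 0 v t) = norm (u - u') * norm (ph w 0 v t)" by (simp add: norm_mult)
   also have "... <= r * B" using h r rr R_pos B(2)[OF nw(1), of 0 v t] by (intro mult_mono) auto
   finally show ?thesis using r(4) by linarith
  qed (use assms in simp)
  show "norm (ph u z v t - ph u' 0 v t) <= \<epsilon>"
   using norm_triangle_ineq[of "ph u z v t - ph u 0 v t" "ph u 0 v t - ph u' 0 v t"] 1 2 by simp
 qed
qed

text \<open>The \<open>n\<close>-th directional derivative of \<open>u . f\<close> at
  \<open>x0 + z\<close> along \<open>v\<close>; through Cauchy's inequality it inherits boundedness
  and joint continuity from \<open>ph\<close>.\<close>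

definition Dp :: "nat => real^'m => real^'d => real^'d => complex" where
 "Dp n u z v = (deriv ^^ n) (ph u z v) 0"

lemma Dp_bounded:
 obtains B where "1 <= B" "!!u z v. norm u <= 1 ==> norm z <= R / 2 ==> norm v <= 1 ==> norm (Dp n u z v) <= B"
proof -
 obtain B where B: "1 <= B" "!!u z v t. norm u <= 1 ==> norm z <= R / 2 ==> norm v <= 1 ==> norm t <= R / 2 ==> norm (ph u z v t) <= B"
  by (rule ph_bounded) blast
 show thesis
 proof (rule that[of "max 1 (fact n * B / (R / 2) ^ n)"])
  fix u :: "real^'m" and z v :: "real^'d" assume h: "norm u <= 1" "norm z <= R / 2" "norm v <= 1"
  have "norm (Dp n u z v) <= fact n * B / (R / 2) ^ n"
   unfolding Dp_def
   by (rule Cauchy_inequality) (use ph_holomorphic[OF h(2,3)] R_pos B(2)[OF h] in auto)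
  then show "norm (Dp n u z v) <= max 1 (fact n * B / (R / 2) ^ n)" by simp
 qed simp
qed

lemma Dp_continuous:
 assumes "0 < \<epsilon>"
 obtains r where "0 < r" "r <= R / 4" "!!u u' z v. norm u <= 1 ==> norm (u - u') <= r ==> norm z <= r ==> norm v <= 1 ==>
   norm (Dp n u z v - Dp n u' 0 v) <= \<epsilon>"
proof -
 define \<epsilon>' where "\<epsilon>' = \<epsilon> * (R / 4) ^ n / fact n"
 have e': "0 < \<epsilon>'" using assms R_pos by (simp add: \<epsilon>'_def)
 obtain r where r: "0 < r" "r <= R / 4" and pc: "!!u u' z v t. norm u <= 1 ==> norm (u - u') <= r ==> norm z <= r ==> norm v <= 1 ==> norm t <= R / 4 ==>
   norm (ph u z v t - ph u' 0 v t) <= \<epsilon>'"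
  by (rule ph_continuous[OF e']) blast
 show thesis
 proof (rule that[OF r])
  fix u u' :: "real^'m" and z v :: "real^'d"
  assume h: "norm u <= 1" "norm (u - u') <= r" "norm z <= r" "norm v <= 1"
  have z2: "norm z <= R / 2" "norm (0::real^'d) <= R / 2" using h r R_pos by auto
  have sub: "ball 0 (R / 4) \<subseteq> ball (0::complex) (R / 2)" "cball 0 (R / 4) \<subseteq> cball (0::complex) (R / 2)" using R_pos by auto
  note hol = ph_holomorphic[OF z2(1) h(4), of u] ph_holomorphic[OF z2(2) h(4), of u']
  have "Dp n u z v - Dp n u' 0 v = (deriv ^^ n) (%t. ph u z v t - ph u' 0 v t) 0"
   unfolding Dp_def
   by (rule higher_deriv_diff[symmetric, of _ "ball 0 (R / 2)"]) (use hol R_pos in auto)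
  also have "norm ... <= fact n * \<epsilon>' / (R / 4) ^ n"
  proof (rule Cauchy_inequality)
   show "(%t. ph u z v t - ph u' 0 v t) holomorphic_on ball 0 (R / 4)"
    using hol sub by (intro holomorphic_intros) (auto intro: holomorphic_on_subset)
   show "continuous_on (cball 0 (R / 4)) (%t. ph u z v t - ph u' 0 v t)"
    using hol sub by (intro continuous_intros) (auto intro: continuous_on_subset)
  qed (use pc[OF h] R_pos in auto)
  also have "... = \<epsilon>" using R_pos by (simp add: \<epsilon>'_def)
  finally show "norm (Dp n u z v - Dp n u' 0 v) <= \<epsilon>" .
 qed
qed

lemma deriv_ph_shift:
 assumes "norm z <= R / 8" "norm v <= 1" "\<bar>t\<bar> <= R / 8"
 shows "(deriv ^^ n) (ph u z v) (of_real t) = Dp n u (z + t *\<^sub>R v) v"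
proof -
 have "(deriv ^^ n) (%w. ph u z v (1 * w + of_real t)) 0 = 1 ^ n * (deriv ^^ n) (ph u z v) (1 * 0 + of_real t)"
 proof (rule higher_deriv_compose_linear')
  show "ph u z v holomorphic_on ball 0 (R / 2)" using assms R_pos by (intro ph_holomorphic) auto
  show "1 * w + complex_of_real t \<in> ball 0 (R / 2)" if "w \<in> ball 0 (R / 4)" for w
   using that norm_triangle_ineq[of w "of_real t"] assms R_pos by simp
 qed (use R_pos in auto)
 moreover have "(%w. ph u z v (1 * w + of_real t)) = ph u (z + t *\<^sub>R v) v"
  by (simp add: fun_eq_iff ph_def path_def algebra_simps)
 ultimately show ?thesis by (simp add: Dp_def)
qed

lemma ph_smooth_phase:
 assumes "norm z <= R / 2" "norm v <= 1" "T < R / 2" "0 <= T"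
 shows "smooth_phase (%n t. La * Re ((deriv ^^ n) (ph u z v) (of_real t))) 0 T"
 unfolding smooth_phase_def
proof (intro allI ballI)
 fix n t assume t: "t \<in> {0..T}"
 have "((deriv ^^ n) (ph u z v) has_field_derivative (deriv ^^ Suc n) (ph u z v) (of_real t)) (at (of_real t))"
  by (rule has_field_derivative_higher_deriv[OF ph_holomorphic(1)[OF assms(1,2)]]) (use t assms in auto)
 then have "((%t. (deriv ^^ n) (ph u z v) (of_real t)) has_vector_derivative (deriv ^^ Suc n) (ph u z v) (of_real t)) (at t within {0..T})"
  by (rule has_vector_derivative_real_field)
 then have "((%t. Re ((deriv ^^ n) (ph u z v) (of_real t))) has_vector_derivative Re ((deriv ^^ Suc n) (ph u z v) (of_real t))) (at t within {0..T})"
  by (rule bounded_linear.has_vector_derivative[OF bounded_linear_Re])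
 then have "((%t. Re ((deriv ^^ n) (ph u z v) (of_real t))) has_real_derivative Re ((deriv ^^ Suc n) (ph u z v) (of_real t))) (at t within {0..T})"
  by (simp only: has_real_derivative_iff_has_vector_derivative)
 then show "((%t. La * Re ((deriv ^^ n) (ph u z v) (of_real t))) has_real_derivative La * Re ((deriv ^^ Suc n) (ph u z v) (of_real t))) (at t within {0..T})"
  by (rule DERIV_cmult)
qed

text \<open>\<open>ph\<close> is real on the real axis, so its derivatives along that axis are real
  as well; thus a nonzero complex derivative has nonzero real part.\<close>

lemma Im_deriv_ph:
 assumes "norm v <= 1" "\<bar>t\<bar> < R / 2"
 shows "Im ((deriv ^^ n) (ph u 0 v) (of_real t)) = 0"
 using assms(2)
proof (induction n arbitrary: t)
 case 0
 then show ?case using ph_real[of 0 v t u] assms(1) R_pos by simp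
next
 case (Suc n)
 have "((deriv ^^ n) (ph u 0 v) has_field_derivative (deriv ^^ Suc n) (ph u 0 v) (of_real t)) (at (of_real t))"
  by (rule has_field_derivative_higher_deriv[OF ph_holomorphic(1)]) (use Suc.prems assms R_pos in auto)
 then have "((%t. (deriv ^^ n) (ph u 0 v) (of_real t)) has_vector_derivative (deriv ^^ Suc n) (ph u 0 v) (of_real t)) (at t)"
  by (rule has_vector_derivative_real_field)
 then have d1: "((%t. Im ((deriv ^^ n) (ph u 0 v) (of_real t))) has_vector_derivative Im ((deriv ^^ Suc n) (ph u 0 v) (of_real t))) (at t)"
  by (rule bounded_linear.has_vector_derivative[OF bounded_linear_Im])
 have "((%t. 0::real) has_vector_derivative 0) (at t)" by (rule has_vector_derivative_const)
 then have "((%t. Im ((deriv ^^ n) (ph u 0 v) (of_real t))) has_vector_derivative 0) (at t)"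
 proof (rule has_vector_derivative_transform_within_open[of _ _ _ "{- (R / 2)<..<R / 2}"])
  fix s assume "s \<in> {- (R / 2)<..<R / 2}"
  then have "\<bar>s\<bar> < R / 2" by auto
  then show "0 = Im ((deriv ^^ n) (ph u 0 v) (of_real s))" using Suc.IH by simp
 qed (use Suc.prems in auto)
 with d1 show ?case by (rule vector_derivative_unique_at)
qed

text \<open>Take \<open>v\<close> along the segment from \<open>x0\<close> to a nearby point where
  \<open>u . f\<close> differs from its value at \<open>x0\<close>. If all derivatives of positive
  order along \<open>v\<close> vanished, the identity theorem would make \<open>u . f\<close>
  constant on that segment.\<close>

lemma ex_Dp_nonzero:
 assumes nc: "!!r. 0 < r ==> \<exists>y\<in>ball x0 r. u \<bullet> f y ~= u \<bullet> f x0"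
 shows "EX v n. norm v <= 1 & Re (Dp (Suc n) u 0 v) ~= 0"
proof -
 have R4: "0 < R / 4" using R_pos by simp
 obtain y where y: "y \<in> ball x0 (R / 4)" "u \<bullet> f y ~= u \<bullet> f x0" using nc[OF R4] by blast
 define v where "v = (4 / R) *\<^sub>R (y - x0)"
 have "norm (y - x0) < R / 4" using y(1) by (simp add: dist_norm norm_minus_commute)
 then have "4 / R * norm (y - x0) <= 4 / R * (R / 4)" using R_pos by (intro mult_left_mono) auto
 moreover have "norm v = 4 / R * norm (y - x0)" unfolding v_def norm_scaleR using R_pos by simp
 ultimately have v: "norm v <= 1" using R_pos by simp
 have yv: "x0 + 0 + (R / 4) *\<^sub>R v = y" using R_pos by (simp add: v_def)
 note hol = ph_holomorphic(1)[of 0 v u]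
 have "\<exists>n>0. (deriv ^^ n) (ph u 0 v) 0 ~= 0"
 proof (rule ccontr)
  assume "\<not> ?thesis"
  then have z: "(deriv ^^ n) (ph u 0 v) 0 = 0" if "0 < n" for n using that by blast
  have "ph u 0 v (of_real (R / 4)) = ph u 0 v 0"
  proof (rule holomorphic_fun_eq_const_on_connected[of "ph u 0 v" "ball 0 (R / 2)" 0])
   show "ph u 0 v holomorphic_on ball 0 (R / 2)" using hol v R_pos by simp
   show "(deriv ^^ n) (ph u 0 v) 0 = 0" if "0 < n" for n by (rule z[OF that])
  qed (use R_pos in simp_all)
  then have "ph u 0 v (of_real (R / 4)) = ph u 0 v (of_real 0)" by simp
  then have "u \<bullet> f y = u \<bullet> f x0"
   using ph_real[of 0 v "R / 4" u] ph_real[of 0 v 0 u] v R_pos yv by simp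
  then show False using y by simp
 qed
 then obtain n where n: "n > 0" "Dp n u 0 v ~= 0" unfolding Dp_def by blast
 obtain n' where n': "n = Suc n'" using n(1) by (cases n) auto
 have "Im (Dp n u 0 v) = 0" using Im_deriv_ph[OF v, of 0 n u] R_pos by (simp add: Dp_def)
 with n(2) have "Re (Dp n u 0 v) ~= 0" using complex_eqI[of "Dp n u 0 v" 0] by auto
 then have "Re (Dp (Suc n') u 0 v) ~= 0" unfolding n' .
 then show ?thesis using v by blast
qed

end

section \<open>Fourier decay of the image measure of an analytic patch\<close>

context multi_series
begin

text \<open>Compactness of the unit sphere: by continuity of \<open>Dp\<close>, a direction and an
  order that work for \<open>u\<close> also work near \<open>u\<close> and near \<open>x0\<close>.
  Finitely many choices suffice, so the order is at most some \<open>N\<close> and the lower bound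
  \<open>a\<close> is uniform.\<close>

lemma uniform_directions:
 assumes nc: "!!u r. u ~= 0 ==> 0 < r ==> \<exists>y\<in>ball x0 r. u \<bullet> f y ~= u \<bullet> f x0"
 shows "EX N a r. 0 < a & a <= 1 & 0 < r & r <= R / 8 & (ALL u. norm u = 1 -->
  (EX v n. norm v <= 1 & n <= N & (ALL z. norm z <= r --> a <= \<bar>Re (Dp (Suc n) u z v)\<bar>)))"
proof -
 have "EX v n b r. norm v <= 1 & 0 < b & 0 < r &
  (ALL u' z. norm u' = 1 --> norm (u' - u) <= r --> norm z <= r --> b <= \<bar>Re (Dp (Suc n) u' z v)\<bar>)"
  if u: "norm u = 1" for u
 proof -
  have "u ~= 0" using u by auto
  obtain v n where v: "norm v <= 1" "Re (Dp (Suc n) u 0 v) ~= 0" using ex_Dp_nonzero[OF nc[OF \<open>u ~= 0\<close>]] by blast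
  define b where "b = \<bar>Re (Dp (Suc n) u 0 v)\<bar> / 2"
  have b: "0 < b" using v by (simp add: b_def)
  obtain r where r: "0 < r" and c: "!!u1 u2 z v. norm u1 <= 1 ==> norm (u1 - u2) <= r ==> norm z <= r ==> norm v <= 1 ==>
    norm (Dp (Suc n) u1 z v - Dp (Suc n) u2 0 v) <= b"
   by (rule Dp_continuous[OF b]) blast
  have "b <= \<bar>Re (Dp (Suc n) u' z v)\<bar>" if "norm u' = 1" "norm (u' - u) <= r" "norm z <= r" for u' z
  proof -
   have "norm (Dp (Suc n) u' z v - Dp (Suc n) u 0 v) <= b" using c[of u' u z v] that v by simp
   then have "\<bar>Re (Dp (Suc n) u' z v) - Re (Dp (Suc n) u 0 v)\<bar> <= b"
    using abs_Re_le_cmod[of "Dp (Suc n) u' z v - Dp (Suc n) u 0 v"] by simp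
   then show ?thesis unfolding b_def by linarith
  qed
  then show ?thesis using v b r by blast
 qed
 then have "ALL u. EX w. norm u = 1 --> (case w of (v, n, b, r) => norm v <= 1 & 0 < b & 0 < r &
  (ALL u' z. norm u' = 1 --> norm (u' - u) <= r --> norm z <= r --> b <= \<bar>Re (Dp (Suc n) u' z v)\<bar>))"
  by fastforce
 from choice[OF this] obtain w where w: "ALL u. norm u = 1 --> (case w u of (v, n, b, r) => norm v <= 1 & 0 < b & 0 < r &
  (ALL u' z. norm u' = 1 --> norm (u' - u) <= r --> norm z <= r --> b <= \<bar>Re (Dp (Suc n) u' z v)\<bar>))"
  by (elim exE)
 define V where "V u = fst (w u)" for u
 define n where "n u = fst (snd (w u))" for u
 define b where "b u = fst (snd (snd (w u)))" for u
 define r where "r u = snd (snd (snd (w u)))" for u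
 have W: "norm (V u) <= 1" "0 < b u" "0 < r u"
  "!!u' z. norm u' = 1 ==> norm (u' - u) <= r u ==> norm z <= r u ==> b u <= \<bar>Re (Dp (Suc (n u)) u' z (V u))\<bar>"
  if "norm u = 1" for u
  using w[rule_format, OF that] by (simp_all add: V_def n_def b_def r_def case_prod_unfold)
 obtain C' where C': "C' \<subseteq> sphere 0 1" "finite C'" "sphere 0 1 \<subseteq> (\<Union>c\<in>C'. ball c (r c))"
 proof (rule compactE_image[of "sphere (0::real^'m) 1" "sphere 0 1" "%c. ball c (r c)"])
  show "sphere 0 1 \<subseteq> (\<Union>c\<in>sphere 0 1. ball c (r c))" using W(3) by fastforce
 qed auto
 have ne: "C' ~= {}"
 proof -
  have "axis undefined 1 \<in> sphere (0::real^'m) 1" by simp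
  then show ?thesis using C'(3) by blast
 qed
 define N where "N = Max (n ` C')"
 define a where "a = min 1 (Min (b ` C'))"
 define r0 where "r0 = min (R / 8) (Min (r ` C'))"
 show ?thesis
 proof (rule exI[of _ N], rule exI[of _ a], rule exI[of _ r0], intro conjI allI impI)
  show "0 < a" "a <= 1" using C' ne W(2) by (auto simp: a_def)
  show "0 < r0" "r0 <= R / 8" using C' ne W(3) R_pos by (auto simp: r0_def)
  fix u :: "real^'m" assume u: "norm u = 1"
  then obtain c where c: "c \<in> C'" "u \<in> ball c (r c)" using C'(3) by auto
  then have c1: "norm c = 1" using C'(1) by auto
  have uc: "norm (u - c) <= r c" using c(2) by (simp add: dist_norm norm_minus_commute)
  have "a <= b c" "r0 <= r c" "n c <= N" using c C'(2) by (auto simp: a_def r0_def N_def min_le_iff_disj)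
  then have "ALL z. norm z <= r0 --> a <= \<bar>Re (Dp (Suc (n c)) u z (V c))\<bar>"
   using W(4)[OF c1 u uc] by (meson order_trans)
  then show "EX v n. norm v <= 1 & n <= N & (ALL z. norm z <= r0 --> a <= \<bar>Re (Dp (Suc n) u z v)\<bar>)"
   using W(1)[OF c1] \<open>n c <= N\<close> by blast
 qed
qed

lemma continuous_on_f: "continuous_on (ball x0 R) f"
proof -
 have eq: "f x = (\<chi> i. Re (Phi i (\<chi> j. of_real ((x - x0) $ j))))" if "x \<in> ball x0 R" for x
 proof -
  have "norm (x - x0) < R" using that by (simp add: dist_norm norm_minus_commute)
  then have "\<bar>(x - x0) $ j\<bar> <= R" for j using component_le_norm_cart[of "x - x0" j] by linarith
  from Phi_real[OF this] show ?thesis by (simp add: vec_eq_iff)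
 qed
 have "continuous_on (ball x0 R) (%x. \<chi> i. Re (Phi i (\<chi> j. of_real ((x - x0) $ j))))"
 proof (intro continuous_intros continuous_on_compose2[OF continuous_on_Phi])
  show "(%x. \<chi> j. complex_of_real ((x - x0) $ j)) ` ball x0 R \<subseteq> polydisc"
  proof
   fix y assume "y \<in> (%x. \<chi> j. complex_of_real ((x - x0) $ j)) ` ball x0 R"
   then obtain x where xb: "x \<in> ball x0 R" and y: "y = (\<chi> j. complex_of_real ((x - x0) $ j))" by blast
   then have x: "norm (x - x0) < R" by (simp add: dist_norm norm_minus_commute)
   have "\<bar>(x - x0) $ j\<bar> <= R" for j using component_le_norm_cart[of "x - x0" j] x by linarith
   then show "y \<in> polydisc" unfolding y polydisc_def mem_Collect_eq vec_lambda_beta norm_of_real by blast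
  qed
 qed
 then show ?thesis by (rule continuous_on_eq) (simp add: eq)
qed

text \<open>Cutting \<open>f\<close> off outside a ball on which it is continuous gives a Borel
  function on the whole space.\<close>

definition G :: "real^'d => real^'m" where
 "G x = (if x \<in> ball x0 R then f x else 0)"

lemma G_measurable [measurable]: "G \<in> borel_measurable borel"
 unfolding G_def[abs_def] by (rule borel_measurable_continuous_on_if) (auto intro: continuous_on_f)

text \<open>A Lipschitz cone, positive exactly on the open ball, so that null sets of the weighted
  measure are Lebesgue null there. Smoothness is dispensable because only its variation along short
  segments enters.\<close>

definition chi :: "real => real^'d => real" where
 "chi r x = max 0 (1 - norm (x - x0) / r)"

lemma chi_measurable [measurable]: "chi r \<in> borel_measurable borel"
 unfolding chi_def[abs_def] by measurable

lemma chi_bounds: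
 assumes "0 < r"
 shows "0 <= chi r x" "chi r x <= 1" "x \<notin> ball x0 r ==> chi r x = 0" "x \<in> ball x0 r ==> 0 < chi r x"
 using assms by (auto simp: chi_def dist_norm norm_minus_commute field_simps)

lemma chi_lipschitz: "0 < r ==> \<bar>chi r x - chi r y\<bar> <= norm (x - y) / r"
proof -
 assume r: "0 < r"
 have "\<bar>norm (x - x0) - norm (y - x0)\<bar> <= norm (x - y)"
  using norm_triangle_ineq3[of "x - x0" "y - x0"] by simp
 then have "\<bar>norm (x - x0) / r - norm (y - x0) / r\<bar> <= norm (x - y) / r"
  using r by (simp add: diff_divide_distrib[symmetric] divide_right_mono)
 then show ?thesis unfolding chi_def by linarith
qed

text \<open>The cutoff is frozen at its value at \<open>x\<close>; along a segment of length at most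
  \<open>T\<close> this costs at most \<open>T / r0\<close> pointwise. What is left is the pure
  oscillatory integral.\<close>

lemma inner_integral_bound:
 assumes v: "norm v <= 1" and r0: "0 < r0" "2 * r0 <= R / 8" "r0 <= 1" and T: "0 <= T" "T <= r0"
  and w: "w = La *\<^sub>R u" and K: "0 <= K"
  and vdc: "norm (integral {0..T} (%t. ee (La * Re (ph u (x - x0) v (of_real t))))) <= K"
  and x: "x \<in> ball x0 (2 * r0)"
 shows "norm (\<integral>t. indicator {0..T} t *\<^sub>R (of_real (chi r0 (x + t *\<^sub>R v)) * ee (w \<bullet> G (x + t *\<^sub>R v))) \<partial>lborel) <= T * (T / r0) + K"
proof -
 define z where "z = x - x0"
 have z: "norm z < 2 * r0" using x by (simp add: z_def dist_norm norm_minus_commute)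
 have z2: "norm z <= R / 2" using z r0 R_pos by linarith
 have eqt: "w \<bullet> G (x + t *\<^sub>R v) = La * Re (ph u z v (of_real t))" if t: "t \<in> {0..T}" for t
 proof -
  have tR: "\<bar>t\<bar> <= R / 2" using t T r0 by auto
  have tv: "norm (t *\<^sub>R v) <= r0 * 1" unfolding norm_scaleR using t T v by (intro mult_mono) auto
  have "norm (z + t *\<^sub>R v) < R" using norm_triangle_ineq[of z "t *\<^sub>R v"] z tv r0 R_pos by linarith
  then have "x + t *\<^sub>R v \<in> ball x0 R"
   unfolding mem_ball dist_norm using norm_minus_commute[of x0 "x + t *\<^sub>R v"] by (simp add: z_def algebra_simps)
  then have "G (x + t *\<^sub>R v) = f (x0 + z + t *\<^sub>R v)" by (simp add: G_def z_def)
  then show ?thesis using ph_real[OF z2 v tR, of u] by (simp add: w)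
 qed
 have cph: "continuous_on {0..T} (%t. ph u z v (of_real t))"
  by (rule continuous_on_compose2[OF ph_holomorphic(2)[OF z2 v]])
    (use T r0 R_pos in \<open>auto intro!: continuous_intros\<close>)
 define q where "q t = of_real (chi r0 (x + t *\<^sub>R v)) * ee (La * Re (ph u z v (of_real t)))" for t
 have cq: "continuous_on {0..T} q"
  unfolding q_def chi_def using r0 by (intro continuous_intros cph) auto
 have "(\<integral>t. indicator {0..T} t *\<^sub>R (of_real (chi r0 (x + t *\<^sub>R v)) * ee (w \<bullet> G (x + t *\<^sub>R v))) \<partial>lborel) =
   (\<integral>t. indicator {0..T} t *\<^sub>R q t \<partial>lborel)"
  by (rule Bochner_Integration.integral_cong) (auto simp: q_def eqt indicator_def)
 also have "... = integral {0..T} q"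
  using set_borel_integral_eq_integral(2)[OF borel_integrable_atLeastAtMost'[OF cq]]
  by (simp add: set_lebesgue_integral_def)
 also have "... = integral {0..T} (%t. (q t - of_real (chi r0 x) * ee (La * Re (ph u z v (of_real t)))) + of_real (chi r0 x) * ee (La * Re (ph u z v (of_real t))))"
  by simp
 also have "... = integral {0..T} (%t. q t - of_real (chi r0 x) * ee (La * Re (ph u z v (of_real t)))) + integral {0..T} (%t. of_real (chi r0 x) * ee (La * Re (ph u z v (of_real t))))"
  by (rule Henstock_Kurzweil_Integration.integral_add)
    (intro integrable_continuous_real continuous_intros cph cq)+
 also have "norm ... <= T * (T / r0) + K"
 proof (rule norm_triangle_le, rule add_mono)
  have "norm (integral {0..T} (%t. q t - of_real (chi r0 x) * ee (La * Re (ph u z v (of_real t))))) <= integral {0..T} (%t. T / r0)"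
  proof (rule integral_norm_bound_integral)
   show "(%t. q t - of_real (chi r0 x) * ee (La * Re (ph u z v (of_real t)))) integrable_on {0..T}"
    by (intro integrable_continuous_real continuous_intros cph cq)
   fix t assume t: "t \<in> {0..T}"
   have "norm (q t - of_real (chi r0 x) * ee (La * Re (ph u z v (of_real t)))) = \<bar>chi r0 (x + t *\<^sub>R v) - chi r0 x\<bar>"
    unfolding q_def left_diff_distrib[symmetric] norm_mult norm_ee mult_1_right
    by (simp only: of_real_diff[symmetric] norm_of_real)
   also have "... <= norm (t *\<^sub>R v) / r0" using chi_lipschitz[OF r0(1), of "x + t *\<^sub>R v" x] by simp
   also have "... <= T * 1 / r0" unfolding norm_scaleR using t v r0 by (intro divide_right_mono mult_mono) auto
   finally show "norm (q t - of_real (chi r0 x) * ee (La * Re (ph u z v (of_real t)))) <= T / r0" by simp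
  qed auto
  then show "norm (integral {0..T} (%t. q t - of_real (chi r0 x) * ee (La * Re (ph u z v (of_real t))))) <= T * (T / r0)"
   using T by simp
  have "norm (integral {0..T} (%t. of_real (chi r0 x) * ee (La * Re (ph u z v (of_real t))))) = \<bar>chi r0 x\<bar> * norm (integral {0..T} (%t. ee (La * Re (ph u z v (of_real t)))))"
   by (simp add: norm_mult)
  also have "... <= 1 * K" using chi_bounds[OF r0(1), of x] vdc K by (intro mult_mono) (auto simp: z_def)
  finally show "norm (integral {0..T} (%t. of_real (chi r0 x) * ee (La * Re (ph u z v (of_real t))))) <= K" by simp
 qed
 finally show ?thesis .
qed

text \<open>By translation invariance the integral is unchanged under shifts by \<open>t v\<close>.
  Averaging over \<open>t\<close> in \<open>[0, T]\<close> and exchanging the integrals leaves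
  one-dimensional oscillatory integrals in a direction \<open>v\<close> of free choice. Shifts by at
  most \<open>r0\<close> enlarge the support to the ball of radius \<open>2 * r0\<close>.\<close>

lemma averaging_bound:
 assumes v: "norm v <= 1" and r0: "0 < r0" "2 * r0 <= R / 8" "r0 <= 1" and T: "0 < T" "T <= r0"
  and w: "w = La *\<^sub>R u" and K: "0 <= K"
  and vdc: "!!z. norm z <= 2 * r0 ==> norm (integral {0..T} (%t. ee (La * Re (ph u z v (of_real t))))) <= K"
 shows "norm (\<integral>x. of_real (chi r0 x) * ee (w \<bullet> G x) \<partial>lborel) <= measure lborel (ball x0 (2 * r0)) * (T / r0 + K / T)"
proof -
 define h where "h x = of_real (chi r0 x) * ee (w \<bullet> G x)" for x
 have hm [measurable]: "h \<in> borel_measurable borel" unfolding h_def[abs_def] by measurable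
 define I where "I = (\<integral>x. h x \<partial>lborel)"
 define Kf where "Kf t x = indicator {0..T} t *\<^sub>R h (x + t *\<^sub>R v)" for t :: real and x
 have tr: "(\<integral>x. h (x + y) \<partial>lborel) = I" for y
 proof -
  have "I = (\<integral>x. h x \<partial>(distr lborel borel ((+) y)))" unfolding I_def lborel_distr_plus ..
  also have "... = (\<integral>x. h (y + x) \<partial>lborel)" by (rule integral_distr) auto
  finally show ?thesis by (simp add: add.commute)
 qed
 have supp: "x \<in> ball x0 (2 * r0)" if "t \<in> {0..T}" "h (x + t *\<^sub>R v) ~= 0" for t x
 proof -
  have "chi r0 (x + t *\<^sub>R v) ~= 0" using that(2) by (auto simp: h_def)
  then have "x + t *\<^sub>R v \<in> ball x0 r0" using chi_bounds(3)[OF r0(1)] by blast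
  then have 1: "norm (x - x0 + t *\<^sub>R v) < r0" by (simp add: dist_norm norm_minus_commute algebra_simps)
  have 2: "norm (t *\<^sub>R v) <= r0 * 1" unfolding norm_scaleR using that(1) T v by (intro mult_mono) auto
  have "norm (x - x0) <= norm (x - x0 + t *\<^sub>R v) + norm (t *\<^sub>R v)"
   using norm_triangle_ineq4[of "x - x0 + t *\<^sub>R v" "t *\<^sub>R v"] by simp
  then show ?thesis using 1 2 by (simp add: dist_norm norm_minus_commute)
 qed
 have hb: "norm (h x) <= 1" for x
  unfolding h_def norm_mult using chi_bounds[OF r0(1), of x] by simp
 have int: "integrable (lborel \<Otimes>\<^sub>M lborel) (case_prod Kf)"
 proof (rule integrableI_bounded_set[where A = "{0..T} \<times> ball x0 (2 * r0)" and B = 1])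
  show "{0..T} \<times> ball x0 (2 * r0) \<in> sets (lborel \<Otimes>\<^sub>M lborel)" by (intro pair_measureI) auto
  show "case_prod Kf \<in> borel_measurable (lborel \<Otimes>\<^sub>M lborel)" unfolding Kf_def by measurable
  have "emeasure (lborel \<Otimes>\<^sub>M lborel) ({0..T} \<times> ball x0 (2 * r0)) = emeasure lborel {0..T} * emeasure lborel (ball x0 (2 * r0))"
   by (rule lborel.emeasure_pair_measure_Times) auto
  also have "... < \<infinity>"
   using emeasure_lborel_ball_finite[of x0 "2 * r0"] T by (simp add: ennreal_mult_less_top)
  finally show "emeasure (lborel \<Otimes>\<^sub>M lborel) ({0..T} \<times> ball x0 (2 * r0)) < \<infinity>" .
  show "AE x in lborel \<Otimes>\<^sub>M lborel. x \<in> {0..T} \<times> ball x0 (2 * r0) --> norm (case x of (t, x) => Kf t x) <= 1"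
   using hb by (auto simp: Kf_def indicator_def)
  show "AE x in lborel \<Otimes>\<^sub>M lborel. x \<notin> {0..T} \<times> ball x0 (2 * r0) --> (case x of (t, x) => Kf t x) = 0"
  proof (intro AE_I2 impI)
   fix p assume "p \<notin> {0..T} \<times> ball x0 (2 * r0)"
   then show "(case p of (t, x) => Kf t x) = 0"
    using supp[of "fst p" "snd p"] by (cases p) (auto simp: Kf_def indicator_def)
  qed
 qed
 have "T *\<^sub>R I = (\<integral>t. indicator {0..T} t *\<^sub>R I \<partial>lborel)" using T by simp
 also have "... = (\<integral>t. (\<integral>x. Kf t x \<partial>lborel) \<partial>lborel)" by (simp add: Kf_def tr)
 also have "... = (\<integral>x. (\<integral>t. Kf t x \<partial>lborel) \<partial>lborel)" by (rule lborel_pair.Fubini_integral[OF int, symmetric])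
 finally have eq: "T *\<^sub>R I = (\<integral>x. (\<integral>t. Kf t x \<partial>lborel) \<partial>lborel)" .
 have b: "norm (\<integral>t. Kf t x \<partial>lborel) <= indicator (ball x0 (2 * r0)) x *\<^sub>R (T * (T / r0) + K)" for x
 proof (cases "x \<in> ball x0 (2 * r0)")
  case True
  then have "norm (x - x0) <= 2 * r0" by (simp add: dist_norm norm_minus_commute)
  then show ?thesis
   using inner_integral_bound[OF v r0 _ T(2) w K vdc True] T True by (simp add: Kf_def h_def)
 next
  case False
  then have "Kf t x = 0" for t using supp[of t x] by (auto simp: Kf_def indicator_def)
  then show ?thesis using False by simp
 qed
 have "T * norm I = norm (T *\<^sub>R I)" using T by simp
 also have "... <= (\<integral>x. norm (\<integral>t. Kf t x \<partial>lborel) \<partial>lborel)" unfolding eq by (rule integral_norm_bound)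
 also have "... <= (\<integral>x. indicator (ball x0 (2 * r0)) x *\<^sub>R (T * (T / r0) + K) \<partial>lborel)"
 proof (rule integral_mono)
  show "integrable lborel (%x. norm (\<integral>t. Kf t x \<partial>lborel))"
   using lborel_pair.integrable_snd[OF int] by (rule integrable_norm)
  show "integrable lborel (%x. indicator (ball x0 (2 * r0)) x *\<^sub>R (T * (T / r0) + K))"
   using emeasure_lborel_ball_finite[of x0 "2 * r0"] by (intro integrable_scaleR_left) simp
 qed (rule b)
 also have "... = measure lborel (ball x0 (2 * r0)) * (T * (T / r0) + K)" by simp
 also have "... = T * (measure lborel (ball x0 (2 * r0)) * (T / r0 + K / T))" using T by (simp add: field_simps)
 finally have "norm I <= measure lborel (ball x0 (2 * r0)) * (T / r0 + K / T)" using T by simp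
 then show ?thesis by (simp add: I_def h_def)
qed

text \<open>The direction \<open>v\<close> and the order of the derivative depend on the direction
  of \<open>w\<close>, but by \<open>uniform_directions\<close> only finitely many orders occur and
  the lower bound is uniform; hence so are the constants of van der Corput's lemma.\<close>

theorem fourier_decay:
 assumes nc: "!!u r. u ~= 0 ==> 0 < r ==> \<exists>y\<in>ball x0 r. u \<bullet> f y ~= u \<bullet> f x0"
 shows "\<exists>r0 V \<delta>. 0 < r0 & r0 < R & 0 <= V & 0 < \<delta> & (ALL w. 1 <= norm w -->
   norm (\<integral>x. of_real (chi r0 x) * ee (w \<bullet> G x) \<partial>lborel) <= V * norm w powr (- \<delta>))"
proof -
 obtain N a r where a: "0 < a" "a <= 1" and r: "0 < r" "r <= R / 8" and dir: "!!u. norm u = 1 ==>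
  (EX v n. norm v <= 1 & n <= N & (ALL z. norm z <= r --> a <= \<bar>Re (Dp (Suc n) u z v)\<bar>))"
  using uniform_directions[OF nc] by blast
 obtain B where B: "1 <= B" "!!u z v. norm u <= 1 ==> norm z <= R / 2 ==> norm v <= 1 ==> norm (Dp 2 u z v) <= B"
  by (rule Dp_bounded[of 2]) blast
 have "ALL j. EX q. case q of (C, \<gamma>, s) => 0 <= C & 0 < \<gamma> & 0 <= s & (\<forall>a c th La \<kappa>. a <= c --> c - a <= 1 --> smooth_phase th a c --> 1 <= La -->
   0 < \<kappa> --> \<kappa> <= 1 --> (\<forall>t\<in>{a..c}. \<bar>th 2 t\<bar> <= B * La) --> (\<forall>t\<in>{a..c}. \<kappa> * La <= \<bar>th (Suc j) t\<bar>) -->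
   norm (integral {a..c} (%t. ee (th 0 t))) <= C * \<kappa> powr (- s) * La powr (- \<gamma>))"
  unfolding split_paired_Ex case_prod_conv by (intro allI van_der_Corput[OF B(1)])
 from choice[OF this] obtain q where q: "ALL j. case q j of (C, \<gamma>, s) => 0 <= C & 0 < \<gamma> & 0 <= s & (\<forall>a c th La \<kappa>. a <= c --> c - a <= 1 --> smooth_phase th a c --> 1 <= La -->
   0 < \<kappa> --> \<kappa> <= 1 --> (\<forall>t\<in>{a..c}. \<bar>th 2 t\<bar> <= B * La) --> (\<forall>t\<in>{a..c}. \<kappa> * La <= \<bar>th (Suc j) t\<bar>) -->
   norm (integral {a..c} (%t. ee (th 0 t))) <= C * \<kappa> powr (- s) * La powr (- \<gamma>))" by (elim exE)
 define C where "C j = fst (q j)" for j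
 define g where "g j = fst (snd (q j))" for j
 define s where "s j = snd (snd (q j))" for j
 have Q0: "0 <= C j" "0 < g j" for j using q[rule_format, of j] by (simp_all add: C_def g_def case_prod_unfold)
 have Q: "norm (integral {b..c} (%t. ee (th 0 t))) <= C j * \<kappa> powr (- s j) * La powr (- g j)"
  if "b <= c" "c - b <= 1" "smooth_phase th b c" "1 <= La" "0 < \<kappa>" "\<kappa> <= 1"
   "\<forall>t\<in>{b..c}. \<bar>th 2 t\<bar> <= B * La" "\<forall>t\<in>{b..c}. \<kappa> * La <= \<bar>th (Suc j) t\<bar>" for j b c th La \<kappa>
  using q[rule_format, of j] that by (simp add: C_def g_def s_def case_prod_unfold)
 \<comment> \<open>The worst exponent among the orders up to \<open>N\<close>; \<open>K\<close>
   likewise bounds all the constants.\<close>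
 define \<gamma> where "\<gamma> = Min (g ` {..N})"
 have \<gamma>: "0 < \<gamma>" "!!j. j <= N ==> \<gamma> <= g j" using Q0(2) by (auto simp: \<gamma>_def)
 define K where "K = (\<Sum>j\<le>N. C j * a powr (- s j))"
 have K: "0 <= K" "!!j. j <= N ==> C j * a powr (- s j) <= K"
  unfolding K_def using Q0(1) by (auto intro!: sum_nonneg mult_nonneg_nonneg member_le_sum)
 define r0 where "r0 = min (r / 3) 1"
 have r0: "0 < r0" "2 * r0 <= R / 8" "r0 <= 1" "3 * r0 <= r" "r0 < R" using r R_pos by (auto simp: r0_def)
 define V where "V = measure lborel (ball x0 (2 * r0)) * (1 + K / r0)"
 have V: "0 <= V" using K r0 by (simp add: V_def)
 show ?thesis
 proof (rule exI[of _ r0], rule exI[of _ V], rule exI[of _ "\<gamma> / 2"], intro conjI allI impI)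
  fix w :: "real^'m" assume w1: "1 <= norm w"
  define La where "La = norm w"
  define u where "u = (1 / La) *\<^sub>R w"
  have La: "1 <= La" using w1 by (simp add: La_def)
  have u: "norm u = 1" "w = La *\<^sub>R u" using La by (auto simp: u_def La_def)
  obtain v n where v: "norm v <= 1" "n <= N" and low: "!!z. norm z <= r ==> a <= \<bar>Re (Dp (Suc n) u z v)\<bar>"
   using dir[OF u(1)] by blast
  \<comment> \<open>Balances the cost \<open>T / r0\<close> of freezing the cutoff with the
    oscillatory bound of order \<open>La powr (- \<gamma>)\<close> divided by
    \<open>T\<close>.\<close>
  define T where "T = r0 * La powr (- (\<gamma> / 2))"
  have T1: "La powr (- (\<gamma> / 2)) <= 1" using La \<gamma> powr_mono[of "- (\<gamma> / 2)" 0 La] by simp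
  have T: "0 < T" "T <= r0" using r0 La T1 by (auto simp: T_def)
  have "norm (\<integral>x. of_real (chi r0 x) * ee (w \<bullet> G x) \<partial>lborel) <= measure lborel (ball x0 (2 * r0)) * (T / r0 + (K * La powr (- \<gamma>)) / T)"
  proof (rule averaging_bound[OF v(1) r0(1-3) T u(2)])
   show "0 <= K * La powr (- \<gamma>)" using K by simp
   fix z :: "real^'d" assume z: "norm z <= 2 * r0"
   define th where "th = (%n t. La * Re ((deriv ^^ n) (ph u z v) (of_real t)))"
   have zt: "norm (z + t *\<^sub>R v) <= 3 * r0" if "t \<in> {0..T}" for t
   proof -
    have "norm (t *\<^sub>R v) <= r0 * 1" unfolding norm_scaleR using that T v by (intro mult_mono) auto
    then show ?thesis using norm_triangle_ineq[of z "t *\<^sub>R v"] z by linarith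
   qed
   have sh: "th k t = La * Re (Dp k u (z + t *\<^sub>R v) v)" if "t \<in> {0..T}" for k t
    unfolding th_def using z r0 that T v by (subst deriv_ph_shift) auto
   have "norm (integral {0..T} (%t. ee (th 0 t))) <= C n * a powr (- s n) * La powr (- g n)"
   proof (rule Q)
    show "smooth_phase th 0 T" unfolding th_def using z r0 T v R_pos by (intro ph_smooth_phase) auto
    show "\<forall>t\<in>{0..T}. \<bar>th 2 t\<bar> <= B * La"
    proof
     fix t assume t: "t \<in> {0..T}"
     have "\<bar>Re (Dp 2 u (z + t *\<^sub>R v) v)\<bar> <= B"
      using B(2)[of u "z + t *\<^sub>R v" v] u v zt[OF t] r0 r R_pos abs_Re_le_cmod[of "Dp 2 u (z + t *\<^sub>R v) v"] by simp
     then show "\<bar>th 2 t\<bar> <= B * La" unfolding sh[OF t] abs_mult using La by (simp add: mult.commute mult_right_mono)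
    qed
    show "\<forall>t\<in>{0..T}. a * La <= \<bar>th (Suc n) t\<bar>"
    proof
     fix t assume t: "t \<in> {0..T}"
     have "a <= \<bar>Re (Dp (Suc n) u (z + t *\<^sub>R v) v)\<bar>" using low zt[OF t] r0 by simp
     then show "a * La <= \<bar>th (Suc n) t\<bar>" unfolding sh[OF t] abs_mult using La by (simp add: mult.commute mult_left_mono)
    qed
   qed (use T r0 La a in auto)
   also have "... <= K * La powr (- \<gamma>)"
    using K v \<gamma> La by (intro mult_mono powr_mono) auto
   finally show "norm (integral {0..T} (%t. ee (La * Re (ph u z v (of_real t))))) <= K * La powr (- \<gamma>)"
    by (simp add: th_def)
  qed
  also have "T / r0 + (K * La powr (- \<gamma>)) / T = (1 + K / r0) * La powr (- (\<gamma> / 2))"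
  proof -
   have "La powr (- \<gamma>) = La powr (- (\<gamma> / 2)) * La powr (- (\<gamma> / 2))" by (simp add: powr_add[symmetric])
   then show ?thesis using r0 La by (simp add: T_def field_simps)
  qed
  finally show "norm (\<integral>x. of_real (chi r0 x) * ee (w \<bullet> G x) \<partial>lborel) <= V * norm w powr (- (\<gamma> / 2))"
   by (simp add: V_def La_def mult.assoc)
 qed (use r0 V \<gamma> in auto)
qed

end

section \<open>Hardy fields of germs at infinity\<close>

inductive_set polyR :: "(real => real) set => (real => real) set" for G where
 const: "(%_. c) \<in> polyR G"
| gen: "g \<in> G ==> g \<in> polyR G"
| add: "f \<in> polyR G ==> h \<in> polyR G ==> (%x. f x + h x) \<in> polyR G"
| mult: "f \<in> polyR G ==> h \<in> polyR G ==> (%x. f x * h x) \<in> polyR G"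

text \<open>Only germs matter: agreement with the quotient is required eventually, and the
  denominator must be eventually nonzero.\<close>

definition ratR :: "(real => real) set => (real => real) set" where
 "ratR G = {f. \<exists>P\<in>polyR G. \<exists>Q\<in>polyR G. evt x. Q x ~= 0 & f x = P x / Q x}"

text \<open>The rational expressions in \<open>G\<close> form a Hardy field: every polynomial is
  eventually zero or eventually without zeros, so that germs can be divided, and derivatives of the
  generators stay inside. These two conditions can be checked on generators.\<close>

definition hardy :: "(real => real) set => bool" where
 "hardy G \<longleftrightarrow> (\<forall>P\<in>polyR G. (evt x. P x = 0) \<or> (evt x. P x ~= 0)) &
   (\<forall>g\<in>G. \<exists>d\<in>ratR G. evt x. (g has_real_derivative d x) (at x))"

lemma polyR_mono: "G \<subseteq> H ==> polyR G \<subseteq> polyR H"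
proof
 fix f assume "G \<subseteq> H" "f \<in> polyR G"
 from this(2,1) show "f \<in> polyR H" by induction (auto intro: polyR.intros)
qed

lemma ratR_mono: "G \<subseteq> H ==> ratR G \<subseteq> ratR H"
 using polyR_mono unfolding ratR_def by blast

lemma ratR_poly: "f \<in> polyR G ==> f \<in> ratR G"
 unfolding ratR_def mem_Collect_eq
 by (rule bexI[of _ f], rule bexI[of _ "%_. 1"]) (simp_all add: polyR.const)

lemma ratR_const: "(%_. c) \<in> ratR G"
 by (intro ratR_poly polyR.const)

lemma ratR_I:
 assumes "evt x. Q x ~= 0 & f x = P x / Q x" "P \<in> polyR G" "Q \<in> polyR G"
 shows "f \<in> ratR G"
 unfolding ratR_def mem_Collect_eq by (rule bexI[of _ P], rule bexI[of _ Q]) (rule assms)+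

lemma ratR_ev_eq:
 assumes "f \<in> ratR G" "evt x. h x = f x" shows "h \<in> ratR G"
proof -
 obtain P Q where PQ: "P \<in> polyR G" "Q \<in> polyR G" "evt x. Q x ~= 0 & f x = P x / Q x"
  using assms(1) by (auto simp: ratR_def)
 have "evt x. Q x ~= 0 & h x = P x / Q x"
  using PQ(3) assms(2) by eventually_elim simp
 then show ?thesis using PQ(1,2) unfolding ratR_def by blast
qed

lemma ratR_add:
 assumes "f \<in> ratR G" "h \<in> ratR G" shows "(%x. f x + h x) \<in> ratR G"
proof -
 obtain P Q where PQ: "P \<in> polyR G" "Q \<in> polyR G" "evt x. Q x ~= 0 & f x = P x / Q x"
  using assms(1) by (auto simp: ratR_def)
 obtain P' Q' where PQ': "P' \<in> polyR G" "Q' \<in> polyR G" "evt x. Q' x ~= 0 & h x = P' x / Q' x"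
  using assms(2) by (auto simp: ratR_def)
 have "evt x. Q x * Q' x ~= 0 & f x + h x = (P x * Q' x + P' x * Q x) / (Q x * Q' x)"
  using PQ(3) PQ'(3) by eventually_elim (simp add: field_simps)
 moreover have "(%x. P x * Q' x + P' x * Q x) \<in> polyR G" "(%x. Q x * Q' x) \<in> polyR G"
  by (intro polyR.add polyR.mult PQ PQ')+
 ultimately show ?thesis by (rule ratR_I)
qed

lemma ratR_mult:
 assumes "f \<in> ratR G" "h \<in> ratR G" shows "(%x. f x * h x) \<in> ratR G"
proof -
 obtain P Q where PQ: "P \<in> polyR G" "Q \<in> polyR G" "evt x. Q x ~= 0 & f x = P x / Q x"
  using assms(1) by (auto simp: ratR_def)
 obtain P' Q' where PQ': "P' \<in> polyR G" "Q' \<in> polyR G" "evt x. Q' x ~= 0 & h x = P' x / Q' x"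
  using assms(2) by (auto simp: ratR_def)
 have "evt x. Q x * Q' x ~= 0 & f x * h x = (P x * P' x) / (Q x * Q' x)"
  using PQ(3) PQ'(3) by eventually_elim simp
 moreover have "(%x. P x * P' x) \<in> polyR G" "(%x. Q x * Q' x) \<in> polyR G"
  by (intro polyR.add polyR.mult PQ PQ')+
 ultimately show ?thesis by (rule ratR_I)
qed

lemma ratR_inverse:
 assumes "f \<in> ratR G" "evt x. f x ~= 0" shows "(%x. 1 / f x) \<in> ratR G"
proof -
 obtain P Q where PQ: "P \<in> polyR G" "Q \<in> polyR G" "evt x. Q x ~= 0 & f x = P x / Q x"
  using assms(1) by (auto simp: ratR_def)
 have "evt x. P x ~= 0 & 1 / f x = Q x / P x"
  using PQ(3) assms(2) by eventually_elim auto
 then show ?thesis using PQ(1,2) unfolding ratR_def by blast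
qed

lemma ratR_divide:
 assumes "f \<in> ratR G" "h \<in> ratR G" "evt x. h x ~= 0" shows "(%x. f x / h x) \<in> ratR G"
 using ratR_mult[OF assms(1) ratR_inverse[OF assms(2,3)]] by simp

lemma ratR_diff:
 assumes "f \<in> ratR G" "h \<in> ratR G" shows "(%x. f x - h x) \<in> ratR G"
 using ratR_add[OF assms(1) ratR_mult[OF ratR_const[of "-1"] assms(2)]] by simp

lemma ratR_power: "f \<in> ratR G ==> (%x. f x ^ n) \<in> ratR G"
 by (induction n) (auto intro: ratR_const ratR_mult)

lemma hardy_zero_or_nonzero:
 assumes "hardy G" "f \<in> ratR G"
 shows "(evt x. f x = 0) \<or> (evt x. f x ~= 0)"
proof -
 obtain P Q where PQ: "P \<in> polyR G" "Q \<in> polyR G" "evt x. Q x ~= 0 & f x = P x / Q x"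
  using assms(2) by (auto simp: ratR_def)
 have "(evt x. P x = 0) \<or> (evt x. P x ~= 0)" using assms(1) PQ(1) by (simp add: hardy_def)
 then show ?thesis
 proof
  assume "evt x. P x = 0"
  then have "evt x. f x = 0" using PQ(3) by eventually_elim simp
  then show ?thesis ..
 next
  assume "evt x. P x ~= 0"
  then have "evt x. f x ~= 0" using PQ(3) by eventually_elim simp
  then show ?thesis ..
 qed
qed

lemma polyR_derivative:
 assumes G: "!!g. g \<in> G ==> \<exists>d\<in>ratR G. evt x. (g has_real_derivative d x) (at x)"
  and f: "f \<in> polyR G"
 shows "\<exists>d\<in>ratR G. evt x. (f has_real_derivative d x) (at x)"
 using f
proof induction
 case (const c)
 show ?case by (intro bexI[of _ "%_. 0"] ratR_const always_eventually allI) simp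
next
 case (gen g)
 then show ?case by (rule G)
next
 case (add f h)
 then obtain d d' where d: "d \<in> ratR G" "d' \<in> ratR G" "evt x. (f has_real_derivative d x) (at x)"
  "evt x. (h has_real_derivative d' x) (at x)" by blast
 have "evt x. ((%x. f x + h x) has_real_derivative d x + d' x) (at x)"
  using d(3,4) by eventually_elim (rule DERIV_add)
 then show ?case using ratR_add[OF d(1,2)] by (intro bexI[of _ "%x. d x + d' x"])
next
 case (mult f h)
 then obtain d d' where d: "d \<in> ratR G" "d' \<in> ratR G" "evt x. (f has_real_derivative d x) (at x)"
  "evt x. (h has_real_derivative d' x) (at x)" by blast
 have "evt x. ((%x. f x * h x) has_real_derivative d x * h x + d' x * f x) (at x)"
  using d(3,4) by eventually_elim (rule DERIV_mult)
 moreover have "(%x. d x * h x + d' x * f x) \<in> ratR G"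
  by (intro ratR_add ratR_mult ratR_poly[OF mult.hyps(1)] ratR_poly[OF mult.hyps(2)] d(1,2))
 ultimately show ?case by (intro bexI[of _ "%x. d x * h x + d' x * f x"])
qed

lemma hardy_derivative:
 assumes h: "hardy G" and f: "f \<in> ratR G"
 shows "\<exists>d\<in>ratR G. evt x. (f has_real_derivative d x) (at x)"
proof -
 obtain P Q where PQ: "P \<in> polyR G" "Q \<in> polyR G" "evt x. Q x ~= 0 & f x = P x / Q x"
  using f by (auto simp: ratR_def)
 have G: "!!g. g \<in> G ==> \<exists>d\<in>ratR G. evt x. (g has_real_derivative d x) (at x)"
  using h by (simp add: hardy_def)
 obtain p where p: "p \<in> ratR G" "evt x. (P has_real_derivative p x) (at x)"
  using polyR_derivative[OF G PQ(1)] by blast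
 obtain q where q: "q \<in> ratR G" "evt x. (Q has_real_derivative q x) (at x)"
  using polyR_derivative[OF G PQ(2)] by blast
 define d where "d x = (p x * Q x - P x * q x) / (Q x * Q x)" for x
 have "evt x. Q x * Q x ~= 0" using PQ(3) by eventually_elim simp
 then have dr: "d \<in> ratR G" unfolding d_def
  by (intro ratR_divide ratR_diff ratR_mult p q ratR_poly PQ)
 obtain a where a: "!!x. x \<ge> a ==> Q x ~= 0 & f x = P x / Q x"
  using PQ(3) by (auto simp: eventually_at_top_linorder)
 have "evt x. (f has_real_derivative d x) (at x)"
  using p(2) q(2) eventually_gt_at_top[of a]
 proof eventually_elim
  case (elim x)
  have "((%x. P x / Q x) has_real_derivative d x) (at x)"
   unfolding d_def using elim a[of x] by (intro DERIV_divide) auto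
  then show ?case
   by (rule has_field_derivative_transform_within_open[of _ _ _ "{a<..}"]) (use elim a in auto)
 qed
 then show ?thesis using dr by blast
qed

text \<open>If \<open>h'\<close> is eventually without zeros, Rolle's theorem makes \<open>h\<close>
  injective there, so it has at most one zero; if \<open>h'\<close> vanishes eventually,
  \<open>h\<close> is eventually constant.\<close>

lemma eventually_nonzero_of_derivative:
 assumes d: "evt x. (h has_real_derivative h' x) (at x)"
  and z: "(evt x. h' x = 0) \<or> (evt x. h' x ~= (0::real))"
 shows "(evt x. h x = 0) \<or> (evt x. h x ~= 0)"
proof -
 obtain a where a: "!!x. x \<ge> a ==> (h has_real_derivative h' x) (at x)"
  using d by (auto simp: eventually_at_top_linorder)
 from z show ?thesis
 proof
  assume "evt x. h' x = 0"
  then obtain b where b: "!!x. x \<ge> b ==> h' x = 0" by (auto simp: eventually_at_top_linorder)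
  define c where "c = max a b"
  have hc: "h x = h c" if "x \<ge> c" for x
  proof (cases "c = x")
   case False
   then have "c < x" using that by simp
   then show ?thesis
   proof (rule DERIV_isconst_end)
    show "continuous_on {c..x} h"
    proof (intro continuous_at_imp_continuous_on ballI)
     fix z assume "z \<in> {c..x}"
     then have "a <= z" by (simp add: c_def)
     then show "isCont h z" by (rule DERIV_isCont[OF a])
    qed
    show "DERIV h z :> 0" if "c < z" "z < x" for z
     using a[of z] b[of z] that by (auto simp: c_def)
   qed
  qed simp
  have "evt x. h x = h c"
   using eventually_ge_at_top[of c] by eventually_elim (rule hc)
  then show ?thesis by (cases "h c = 0") (simp_all add: eventually_mono)
 next
  assume "evt x. h' x ~= 0"
  then obtain b where b: "!!x. x \<ge> b ==> h' x ~= 0" by (auto simp: eventually_at_top_linorder)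
  define c where "c = max a b"
  have inj: "h x ~= h y" if "c <= x" "x < y" for x y
  proof
   assume eq: "h x = h y"
   have "\<exists>z>x. z < y & DERIV h z :> 0"
   proof (rule Rolle[OF that(2) eq])
    show "continuous_on {x..y} h"
    proof (intro continuous_at_imp_continuous_on ballI)
     fix z assume "z \<in> {x..y}"
     then have "a <= z" using \<open>c <= x\<close> by (simp add: c_def)
     then show "isCont h z" by (rule DERIV_isCont[OF a])
    qed
    show "h differentiable at z" if "x < z" "z < y" for z
     using a[of z] that \<open>c <= x\<close> by (auto simp: c_def real_differentiable_def)
   qed
   then obtain z where "x < z" "z < y" "DERIV h z :> 0" by blast
   then show False using a[of z] b[of z] that DERIV_unique[of h 0 z "h' z"] by (auto simp: c_def)
  qed
  show ?thesis
  proof (cases "\<exists>x\<ge>c. h x = 0")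
   case True
   then obtain x where "c <= x" "h x = 0" by blast
   then have "\<forall>y>x. h y ~= 0" using inj[of x] by metis
   then show ?thesis by (auto simp: eventually_at_top_dense)
  qed (auto simp: eventually_at_top_linorder)
 qed
qed

lemma polyR_insert:
 assumes "f \<in> polyR (insert g G)"
 shows "EX n c. (ALL i. c i \<in> polyR G) & f = (%x. \<Sum>i<n. c i x * g x ^ i)"
 using assms
proof induction
 case (const c)
 show ?case
  by (rule exI[of _ 1], rule exI[of _ "%_ _. c"]) (auto intro: polyR.const)
next
 case (gen h)
 show ?case
 proof (cases "h \<in> G")
  case True
  then show ?thesis by (intro exI[of _ 1] exI[of _ "%_. h"]) (auto intro: polyR.gen)
 next
  case False
  then have "h = g" using gen by simp
  then show ?thesis
   by (intro exI[of _ 2] exI[of _ "%i _. if i = 1 then 1 else 0"]) (auto intro: polyR.const simp: numeral_2_eq_2)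
 qed
next
 case (add f h)
 then obtain n c n' c' where c: "ALL i. c i \<in> polyR G" "f = (%x. \<Sum>i<n. c i x * g x ^ i)"
  "ALL i. c' i \<in> polyR G" "h = (%x. \<Sum>i<n'. c' i x * g x ^ i)" by blast
 define N where "N = max n n'"
 define e where "e i x = (if i < n then c i x else 0) + (if i < n' then c' i x else 0)" for i x
 have "e i \<in> polyR G" for i
 proof -
  have "(%x. if i < n then c i x else 0) \<in> polyR G"
   using c(1) polyR.const[of 0 G] by (cases "i < n") simp_all
  moreover have "(%x. if i < n' then c' i x else 0) \<in> polyR G"
   using c(3) polyR.const[of 0 G] by (cases "i < n'") simp_all
  ultimately show ?thesis unfolding e_def by (rule polyR.add)
 qed
 moreover have "f x + h x = (\<Sum>i<N. e i x * g x ^ i)" for x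
 proof -
  have "(\<Sum>i<N. (if i < n then c i x else 0) * g x ^ i) = (\<Sum>i<n. c i x * g x ^ i)"
   by (rule sum.mono_neutral_cong_right) (auto simp: N_def)
  moreover have "(\<Sum>i<N. (if i < n' then c' i x else 0) * g x ^ i) = (\<Sum>i<n'. c' i x * g x ^ i)"
   by (rule sum.mono_neutral_cong_right) (auto simp: N_def)
  ultimately show ?thesis unfolding c e_def distrib_right sum.distrib by simp
 qed
 ultimately show ?case by blast
next
 case (mult f h)
 then obtain n c n' c' where c: "ALL i. c i \<in> polyR G" "f = (%x. \<Sum>i<n. c i x * g x ^ i)"
  "ALL i. c' i \<in> polyR G" "h = (%x. \<Sum>i<n'. c' i x * g x ^ i)" by blast
 define e where "e k x = (\<Sum>p\<in>{p\<in>{..<n} \<times> {..<n'}. fst p + snd p = k}. c (fst p) x * c' (snd p) x)" for k x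
 have psum: "(%x. \<Sum>p\<in>I. s p x) \<in> polyR G" if "!!p. p \<in> I ==> s p \<in> polyR G" for I :: "(nat \<times> nat) set" and s
  using that
 proof (induction I rule: infinite_finite_induct)
  case (insert p I)
  then show ?case by (simp add: polyR.add)
 qed (simp_all add: polyR.const)
 have "e k \<in> polyR G" for k
  unfolding e_def using c by (intro psum polyR.mult) auto
 moreover have "f x * h x = (\<Sum>k<n + n'. e k x * g x ^ k)" for x
 proof -
  have "f x * h x = (\<Sum>p\<in>{..<n} \<times> {..<n'}. (c (fst p) x * c' (snd p) x) * g x ^ (fst p + snd p))"
   unfolding c sum_product sum.cartesian_product by (simp add: case_prod_unfold power_add mult_ac)
  also have "... = (\<Sum>k<n + n'. \<Sum>p\<in>{p\<in>{..<n} \<times> {..<n'}. fst p + snd p = k}. (c (fst p) x * c' (snd p) x) * g x ^ (fst p + snd p))"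
   by (rule sum.group[symmetric]) auto
  also have "... = (\<Sum>k<n + n'. e k x * g x ^ k)"
   unfolding e_def sum_distrib_right by (intro sum.cong refl) auto
  finally show ?thesis .
 qed
 ultimately show ?case by blast
qed

lemma ratR_coeff_derivatives:
 assumes G: "hardy G" and c: "!!i::nat. c i \<in> ratR G"
 shows "EX c'. ALL i. c' i \<in> ratR G & (evt x. (c i has_real_derivative c' i x) (at x))"
proof (rule choice, rule allI)
 fix i
 from hardy_derivative[OF G c[of i]]
 show "EX y. y \<in> ratR G & (evt x. (c i has_real_derivative y x) (at x))"
  by (elim bexE) (rule exI, rule conjI)
qed

text \<open>Dividing by the constant coefficient and differentiating kills that term. As
  \<open>g' = a * g\<close>, the rest is \<open>g\<close> times a polynomial in \<open>g\<close>
  with fewer terms, to which the induction applies. The coefficients must range over the whole field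
  because of the division.\<close>

lemma zero_or_nonzero_exp:
 assumes G: "hardy G" and a: "a \<in> ratR G" and g: "evt x. (g has_real_derivative a x * g x) (at x)"
  and g0: "evt x. g x ~= 0" and c: "!!i. c i \<in> ratR G"
 shows "(evt x. (\<Sum>i<n. c i x * g x ^ i) = 0) \<or> (evt x. (\<Sum>i<n. c i x * g x ^ i) ~= 0)"
 using c
proof (induction n arbitrary: c)
 case 0
 then show ?case by simp
next
 case (Suc n)
 have shift: "(\<Sum>i<Suc n. c i x * g x ^ i) = c 0 x + g x * (\<Sum>i<n. c (Suc i) x * g x ^ i)" for c :: "nat => real => real" and x
  unfolding sum.lessThan_Suc_shift by (simp add: sum_distrib_left mult_ac)
 from hardy_zero_or_nonzero[OF G Suc.prems[of 0]] show ?case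
 proof
  assume z: "evt x. c 0 x = 0"
  from Suc.IH[of "%i. c (Suc i)"] Suc.prems
  have "(evt x. (\<Sum>i<n. c (Suc i) x * g x ^ i) = 0) \<or> (evt x. (\<Sum>i<n. c (Suc i) x * g x ^ i) ~= 0)" by blast
  then show ?thesis
  proof
   assume "evt x. (\<Sum>i<n. c (Suc i) x * g x ^ i) = 0"
   then have "evt x. (\<Sum>i<Suc n. c i x * g x ^ i) = 0"
    using z by eventually_elim (simp only: shift)
   then show ?thesis ..
  next
   assume "evt x. (\<Sum>i<n. c (Suc i) x * g x ^ i) ~= 0"
   then have "evt x. (\<Sum>i<Suc n. c i x * g x ^ i) ~= 0"
    using z g0 by eventually_elim (simp only: shift, simp)
   then show ?thesis ..
  qed
 next
  assume nz: "evt x. c 0 x ~= 0"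
  define d where "d i x = c i x / c 0 x" for i x
  have d: "d i \<in> ratR G" for i unfolding d_def by (intro ratR_divide Suc.prems nz)
  from ratR_coeff_derivatives[of G d, OF G d] obtain d' where
   dd: "ALL i. d' i \<in> ratR G & (evt x. (d i has_real_derivative d' i x) (at x))"
   by (elim exE)
  have d': "d' i \<in> ratR G" "evt x. (d i has_real_derivative d' i x) (at x)" for i
   using dd[rule_format, of i] by simp_all
  define e where "e i x = d' (Suc i) x + of_nat (Suc i) * (a x * d (Suc i) x)" for i x
  have e: "e i \<in> ratR G" for i unfolding e_def by (intro ratR_add ratR_mult ratR_const a d d')
  define h where "h x = 1 + (\<Sum>i<n. d (Suc i) x * g x ^ Suc i)" for x
  define h' where "h' x = g x * (\<Sum>i<n. e i x * g x ^ i)" for x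
  have "evt x. \<forall>i\<in>{..<n}. (d (Suc i) has_real_derivative d' (Suc i) x) (at x)"
   by (rule eventually_ball_finite) (auto intro: d')
  then have dh: "evt x. (h has_real_derivative h' x) (at x)"
   using g
  proof eventually_elim
   case (elim x)
   have "((%x. d (Suc i) x * g x ^ Suc i) has_real_derivative e i x * g x ^ Suc i) (at x)" if "i < n" for i
   proof -
    have "((%x. d (Suc i) x * g x ^ Suc i) has_real_derivative
      d' (Suc i) x * g x ^ Suc i + (of_nat (Suc i) * (a x * g x * g x ^ (Suc i - Suc 0))) * d (Suc i) x) (at x)"
     by (intro DERIV_mult DERIV_power) (use elim that in auto)
    also have "d' (Suc i) x * g x ^ Suc i + (of_nat (Suc i) * (a x * g x * g x ^ (Suc i - Suc 0))) * d (Suc i) x = e i x * g x ^ Suc i"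
     by (simp add: e_def algebra_simps)
    finally show ?thesis .
   qed
   then have "((%x. \<Sum>i<n. d (Suc i) x * g x ^ Suc i) has_real_derivative (\<Sum>i<n. e i x * g x ^ Suc i)) (at x)"
    by (intro DERIV_sum) auto
   then have "(h has_real_derivative 0 + (\<Sum>i<n. e i x * g x ^ Suc i)) (at x)"
    unfolding h_def by (intro DERIV_add DERIV_const)
   then show ?case by (simp add: h'_def sum_distrib_left mult_ac)
  qed
  have "(evt x. (\<Sum>i<n. e i x * g x ^ i) = 0) \<or> (evt x. (\<Sum>i<n. e i x * g x ^ i) ~= 0)"
   by (rule Suc.IH[OF e])
  then have "(evt x. h' x = 0) \<or> (evt x. h' x ~= 0)"
  proof
   assume "evt x. (\<Sum>i<n. e i x * g x ^ i) = 0"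
   then have "evt x. h' x = 0" by eventually_elim (simp add: h'_def)
   then show ?thesis ..
  next
   assume "evt x. (\<Sum>i<n. e i x * g x ^ i) ~= 0"
   then have "evt x. h' x ~= 0" using g0 by eventually_elim (simp add: h'_def)
   then show ?thesis ..
  qed
  from eventually_nonzero_of_derivative[OF dh this]
  have hh: "(evt x. h x = 0) \<or> (evt x. h x ~= 0)" .
  have eq: "evt x. (\<Sum>i<Suc n. c i x * g x ^ i) = c 0 x * h x"
   using nz
  proof eventually_elim
   case (elim x)
   have "c 0 x * h x = c 0 x + g x * (\<Sum>i<n. (c 0 x * d (Suc i) x) * g x ^ i)"
    by (simp add: h_def distrib_left sum_distrib_left mult_ac)
   then show ?case using elim by (simp only: shift) (simp add: d_def)
  qed
  from hh show ?thesis
  proof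
   assume "evt x. h x = 0"
   then have "evt x. (\<Sum>i<Suc n. c i x * g x ^ i) = 0" using eq by eventually_elim simp
   then show ?thesis ..
  next
   assume "evt x. h x ~= 0"
   then have "evt x. (\<Sum>i<Suc n. c i x * g x ^ i) ~= 0" using eq nz by eventually_elim simp
   then show ?thesis ..
  qed
 qed
qed

text \<open>Here \<open>g'\<close> lies in the field, so the induction runs from the other end:
  after division by the leading coefficient, differentiation lowers the degree in
  \<open>g\<close>.\<close>

lemma zero_or_nonzero_log:
 assumes G: "hardy G" and b: "b \<in> ratR G" and g: "evt x. (g has_real_derivative b x) (at x)"
  and c: "!!i. c i \<in> ratR G"
 shows "(evt x. (\<Sum>i<n. c i x * g x ^ i) = 0) \<or> (evt x. (\<Sum>i<n. c i x * g x ^ i) ~= 0)"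
 using c
proof (induction n arbitrary: c)
 case 0
 then show ?case by simp
next
 case (Suc n)
 from hardy_zero_or_nonzero[OF G Suc.prems[of n]] show ?case
 proof
  assume z: "evt x. c n x = 0"
  from Suc.IH[of c] Suc.prems
  have "(evt x. (\<Sum>i<n. c i x * g x ^ i) = 0) \<or> (evt x. (\<Sum>i<n. c i x * g x ^ i) ~= 0)" by blast
  then show ?thesis
  proof
   assume "evt x. (\<Sum>i<n. c i x * g x ^ i) = 0"
   then have "evt x. (\<Sum>i<Suc n. c i x * g x ^ i) = 0" using z by eventually_elim simp
   then show ?thesis ..
  next
   assume "evt x. (\<Sum>i<n. c i x * g x ^ i) ~= 0"
   then have "evt x. (\<Sum>i<Suc n. c i x * g x ^ i) ~= 0" using z by eventually_elim simp
   then show ?thesis ..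
  qed
 next
  assume nz: "evt x. c n x ~= 0"
  define d where "d i x = (if i = n then 1 else c i x / c n x)" for i x
  have d: "d i \<in> ratR G" for i
  proof (cases "i = n")
   case True
   then show ?thesis using ratR_const[of 1 G] by (simp add: d_def[abs_def])
  next
   case False
   then show ?thesis using ratR_divide[OF Suc.prems[of i] Suc.prems[of n] nz] by (simp add: d_def[abs_def])
  qed
  from ratR_coeff_derivatives[of G d, OF G d] obtain d' where
   dd: "ALL i. d' i \<in> ratR G & (evt x. (d i has_real_derivative d' i x) (at x))"
   by (elim exE)
  have d': "d' i \<in> ratR G" "evt x. (d i has_real_derivative d' i x) (at x)" for i
   using dd[rule_format, of i] by simp_all
  define e where "e i x = d' i x + of_nat (Suc i) * (d (Suc i) x * b x)" for i x
  have e: "e i \<in> ratR G" for i unfolding e_def by (intro ratR_add ratR_mult ratR_const b d d')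
  define h where "h x = g x ^ n + (\<Sum>i<n. d i x * g x ^ i)" for x
  define h' where "h' x = (\<Sum>i<n. e i x * g x ^ i)" for x
  have "evt x. \<forall>i\<in>{..<n}. (d i has_real_derivative d' i x) (at x)"
   by (rule eventually_ball_finite) (auto intro: d')
  then have dh: "evt x. (h has_real_derivative h' x) (at x)"
   using g
  proof eventually_elim
   case (elim x)
   have pw: "((%x. g x ^ i) has_real_derivative of_nat i * (b x * g x ^ (i - Suc 0))) (at x)" for i
    by (rule DERIV_power) (use elim in auto)
   have "((%x. d i x * g x ^ i) has_real_derivative d' i x * g x ^ i + (of_nat i * (b x * g x ^ (i - Suc 0))) * d i x) (at x)" if "i < n" for i
    by (intro DERIV_mult pw) (use elim that in auto)
   then have "((%x. \<Sum>i<n. d i x * g x ^ i) has_real_derivative (\<Sum>i<n. d' i x * g x ^ i + (of_nat i * (b x * g x ^ (i - Suc 0))) * d i x)) (at x)"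
    by (intro DERIV_sum) auto
   then have hd: "(h has_real_derivative of_nat n * (b x * g x ^ (n - Suc 0)) + (\<Sum>i<n. d' i x * g x ^ i + (of_nat i * (b x * g x ^ (i - Suc 0))) * d i x)) (at x)"
    unfolding h_def by (intro DERIV_add pw)
   have tel: "of_nat n * (b x * g x ^ (n - Suc 0)) + (\<Sum>i<n. (of_nat i * (b x * g x ^ (i - Suc 0))) * d i x) = (\<Sum>i<n. of_nat (Suc i) * (d (Suc i) x * b x) * g x ^ i)"
   proof (cases n)
    case (Suc k)
    have dn: "d n x = 1" by (simp add: d_def)
    have "(\<Sum>i<Suc n. (of_nat i * (b x * g x ^ (i - Suc 0))) * d i x) = (\<Sum>i<n. (of_nat (Suc i) * (b x * g x ^ i)) * d (Suc i) x)"
     by (subst sum.lessThan_Suc_shift) simp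
    then show ?thesis by (simp add: dn mult_ac add.commute)
   qed simp
   have "h' x = of_nat n * (b x * g x ^ (n - Suc 0)) + (\<Sum>i<n. d' i x * g x ^ i + (of_nat i * (b x * g x ^ (i - Suc 0))) * d i x)"
    using tel unfolding h'_def e_def sum.distrib distrib_right by linarith
   then show ?case using hd by simp
  qed
  have "(evt x. h' x = 0) \<or> (evt x. h' x ~= 0)"
   unfolding h'_def by (rule Suc.IH[OF e])
  from eventually_nonzero_of_derivative[OF dh this]
  have hh: "(evt x. h x = 0) \<or> (evt x. h x ~= 0)" .
  have eq: "evt x. (\<Sum>i<Suc n. c i x * g x ^ i) = c n x * h x"
   using nz
  proof eventually_elim
   case (elim x)
   have "(\<Sum>i<n. c n x * (d i x * g x ^ i)) = (\<Sum>i<n. c i x * g x ^ i)"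
    by (rule sum.cong) (use elim in \<open>auto simp: d_def\<close>)
   then show ?case by (simp add: h_def distrib_left sum_distrib_left)
  qed
  from hh show ?thesis
  proof
   assume "evt x. h x = 0"
   then have "evt x. (\<Sum>i<Suc n. c i x * g x ^ i) = 0" using eq by eventually_elim simp
   then show ?thesis ..
  next
   assume "evt x. h x ~= 0"
   then have "evt x. (\<Sum>i<Suc n. c i x * g x ^ i) ~= 0" using eq nz by eventually_elim simp
   then show ?thesis ..
  qed
 qed
qed

lemma hardy_insert:
 assumes G: "hardy G" and d: "d \<in> ratR (insert g G)" "evt x. (g has_real_derivative d x) (at x)"
  and z: "!!n c. (!!i. c i \<in> ratR G) ==>
   (evt x. (\<Sum>i<n. c i x * g x ^ i) = 0) \<or> (evt x. (\<Sum>i<n. c i x * g x ^ i) ~= 0)"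
 shows "hardy (insert g G)"
 unfolding hardy_def
proof (intro conjI ballI)
 fix P assume "P \<in> polyR (insert g G)"
 from polyR_insert[OF this] obtain n c where c: "ALL i. c i \<in> polyR G" "P = (%x. \<Sum>i<n. c i x * g x ^ i)" by blast
 show "(evt x. P x = 0) \<or> (evt x. P x ~= 0)"
  unfolding c(2) by (rule z) (use c(1) ratR_poly in blast)
next
 fix k assume k: "k \<in> insert g G"
 show "\<exists>d\<in>ratR (insert g G). evt x. (k has_real_derivative d x) (at x)"
 proof (cases "k = g")
  case True
  then show ?thesis using d by blast
 next
  case False
  then have "k \<in> G" using k by simp
  then show ?thesis using G ratR_mono[of G "insert g G"] unfolding hardy_def by blast
 qed
qed

lemma hardy_empty: "hardy {}"
proof -
 have c: "EX c. f = (%_. c)" if "f \<in> polyR {}" for f :: "real => real" using that by induction auto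
 show ?thesis unfolding hardy_def
 proof (intro conjI ballI)
  fix P :: "real => real" assume "P \<in> polyR {}"
  from c[OF this] obtain c where "P = (%_. c)" by (elim exE)
  then show "(evt x. P x = 0) \<or> (evt x. P x ~= 0)" by (cases "c = 0") simp_all
 qed simp
qed

lemma hardy_insert_exp:
 assumes G: "hardy G" and u: "u \<in> ratR G"
 shows "hardy (insert (%x. exp (u x)) G)"
proof -
 obtain d where d: "d \<in> ratR G" "evt x. (u has_real_derivative d x) (at x)"
  using hardy_derivative[OF G u] by blast
 have g: "evt x. ((%x. exp (u x)) has_real_derivative d x * exp (u x)) (at x)"
  using d(2) by eventually_elim (auto intro!: derivative_eq_intros)
 show ?thesis
 proof (rule hardy_insert[OF G _ g])
  show "(%x. d x * exp (u x)) \<in> ratR (insert (%x. exp (u x)) G)"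
  proof (rule ratR_mult)
   show "d \<in> ratR (insert (%x. exp (u x)) G)"
    by (rule subsetD[OF ratR_mono d(1)]) blast
  qed (simp add: ratR_poly polyR.gen)
 qed (rule zero_or_nonzero_exp[OF G d(1) g], auto)
qed

lemma hardy_insert_primitive:
 assumes G: "hardy G" and b: "b \<in> ratR G" "evt x. (g has_real_derivative b x) (at x)"
 shows "hardy (insert g G)"
proof (rule hardy_insert[OF G _ b(2)])
 show "b \<in> ratR (insert g G)" using b(1) ratR_mono[of G "insert g G"] by auto
qed (rule zero_or_nonzero_log[OF G b], auto)

lemma hardy_insert_ln:
 assumes G: "hardy G" and u: "u \<in> ratR G" "evt x. 0 < u x"
 shows "hardy (insert (%x. ln (u x)) G)"
proof -
 obtain d where d: "d \<in> ratR G" "evt x. (u has_real_derivative d x) (at x)"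
  using hardy_derivative[OF G u(1)] by blast
 have nz: "evt x. u x ~= 0" using u(2) by eventually_elim simp
 show ?thesis
 proof (rule hardy_insert_primitive[OF G ratR_divide[OF d(1) u(1) nz]])
  show "evt x. ((%x. ln (u x)) has_real_derivative d x / u x) (at x)"
   using d(2) u(2) by eventually_elim (auto intro!: derivative_eq_intros)
 qed
qed

lemma hardy_id: "hardy {%x. x}"
 by (rule hardy_insert_primitive[OF hardy_empty ratR_const[of 1]]) (auto intro!: always_eventually)

text \<open>Each exponential or logarithm adjoins one generator. The extension is threaded through
  the subexpressions so that both operands lie in one field, and finiteness of the generating set is
  kept because it later bounds the transcendence degree.\<close>

lemma hardy_L_expr:
 assumes "evt t. L_defined e t" "hardy G" "finite G" "(%x. x) \<in> G"
 shows "EX H. hardy H & finite H & G \<subseteq> H & L_val e \<in> ratR H"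
 using assms
proof (induction e arbitrary: G)
 case L_Var
 have "L_val L_Var = (%x. x)" by (rule ext) simp
 then show ?case using L_Var ratR_poly[OF polyR.gen[OF L_Var(4)]] by (intro exI[of _ G]) simp
next
 case (L_Const c)
 have "L_val (L_Const c) = (%_. c)" by (rule ext) simp
 then show ?case using L_Const ratR_const[of c G] by (intro exI[of _ G]) simp
next
 case (L_Add a b)
 have d: "evt t. L_defined a t" "evt t. L_defined b t"
  using L_Add.prems(1) by (auto simp: eventually_conj_iff)
 obtain H where H: "hardy H" "finite H" "G \<subseteq> H" "L_val a \<in> ratR H"
  using L_Add.IH(1)[OF d(1) L_Add.prems(2-)] by (elim exE conjE)
 have "(%x. x) \<in> H" using H(3) L_Add.prems(4) by (rule subsetD)
 from L_Add.IH(2)[OF d(2) H(1,2) this] obtain K where K: "hardy K" "finite K" "H \<subseteq> K" "L_val b \<in> ratR K"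
  by (elim exE conjE)
 have "(%t. L_val a t + L_val b t) \<in> ratR K"
  using H(4) K(3,4) ratR_mono[OF K(3)] by (intro ratR_add) auto
 moreover have "L_val (L_Add a b) = (%t. L_val a t + L_val b t)" by (rule ext) simp
 ultimately show ?case using K H(3) by (intro exI[of _ K]) (simp add: subset_trans)
next
 case (L_Sub a b)
 have d: "evt t. L_defined a t" "evt t. L_defined b t"
  using L_Sub.prems(1) by (auto simp: eventually_conj_iff)
 obtain H where H: "hardy H" "finite H" "G \<subseteq> H" "L_val a \<in> ratR H"
  using L_Sub.IH(1)[OF d(1) L_Sub.prems(2-)] by (elim exE conjE)
 have "(%x. x) \<in> H" using H(3) L_Sub.prems(4) by (rule subsetD)
 from L_Sub.IH(2)[OF d(2) H(1,2) this] obtain K where K: "hardy K" "finite K" "H \<subseteq> K" "L_val b \<in> ratR K"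
  by (elim exE conjE)
 have "(%t. L_val a t - L_val b t) \<in> ratR K"
  using H(4) K(3,4) ratR_mono[OF K(3)] by (intro ratR_diff) auto
 moreover have "L_val (L_Sub a b) = (%t. L_val a t - L_val b t)" by (rule ext) simp
 ultimately show ?case using K H(3) by (intro exI[of _ K]) (simp add: subset_trans)
next
 case (L_Mul a b)
 have d: "evt t. L_defined a t" "evt t. L_defined b t"
  using L_Mul.prems(1) by (auto simp: eventually_conj_iff)
 obtain H where H: "hardy H" "finite H" "G \<subseteq> H" "L_val a \<in> ratR H"
  using L_Mul.IH(1)[OF d(1) L_Mul.prems(2-)] by (elim exE conjE)
 have "(%x. x) \<in> H" using H(3) L_Mul.prems(4) by (rule subsetD)
 from L_Mul.IH(2)[OF d(2) H(1,2) this] obtain K where K: "hardy K" "finite K" "H \<subseteq> K" "L_val b \<in> ratR K"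
  by (elim exE conjE)
 have "(%t. L_val a t * L_val b t) \<in> ratR K"
  using H(4) K(3,4) ratR_mono[OF K(3)] by (intro ratR_mult) auto
 moreover have "L_val (L_Mul a b) = (%t. L_val a t * L_val b t)" by (rule ext) simp
 ultimately show ?case using K H(3) by (intro exI[of _ K]) (simp add: subset_trans)
next
 case (L_Div a b)
 have d: "evt t. L_defined a t" "evt t. L_defined b t" "evt t. L_val b t ~= 0"
  using L_Div.prems(1) by (auto simp: eventually_conj_iff)
 obtain H where H: "hardy H" "finite H" "G \<subseteq> H" "L_val a \<in> ratR H"
  using L_Div.IH(1)[OF d(1) L_Div.prems(2-)] by (elim exE conjE)
 have "(%x. x) \<in> H" using H(3) L_Div.prems(4) by (rule subsetD)
 from L_Div.IH(2)[OF d(2) H(1,2) this] obtain K where K: "hardy K" "finite K" "H \<subseteq> K" "L_val b \<in> ratR K"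
  by (elim exE conjE)
 have "(%t. L_val a t / L_val b t) \<in> ratR K"
  using H(4) K(3,4) d(3) ratR_mono[OF K(3)] by (intro ratR_divide) auto
 moreover have "L_val (L_Div a b) = (%t. L_val a t / L_val b t)" by (rule ext) simp
 ultimately show ?case using K H(3) by (intro exI[of _ K]) (simp add: subset_trans)
next
 case (L_Exp a)
 have d: "evt t. L_defined a t" using L_Exp.prems(1) by simp
 obtain H where H: "hardy H" "finite H" "G \<subseteq> H" "L_val a \<in> ratR H"
  using L_Exp.IH[OF d L_Exp.prems(2-)] by (elim exE conjE)
 define K where "K = insert (%t. exp (L_val a t)) H"
 have "L_val (L_Exp a) = (%t. exp (L_val a t))" by (rule ext) simp
 moreover have "(%t. exp (L_val a t)) \<in> ratR K" by (intro ratR_poly polyR.gen) (simp add: K_def)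
 moreover have "hardy K" unfolding K_def by (rule hardy_insert_exp[OF H(1,4)])
 moreover have "finite K" "G \<subseteq> K" using H(2,3) by (auto simp: K_def)
 ultimately show ?case by (intro exI[of _ K]) simp
next
 case (L_Log a)
 have d: "evt t. L_defined a t" "evt t. 0 < L_val a t"
  using L_Log.prems(1) by (auto simp: eventually_conj_iff)
 obtain H where H: "hardy H" "finite H" "G \<subseteq> H" "L_val a \<in> ratR H"
  using L_Log.IH[OF d(1) L_Log.prems(2-)] by (elim exE conjE)
 define K where "K = insert (%t. ln (L_val a t)) H"
 have "L_val (L_Log a) = (%t. ln (L_val a t))" by (rule ext) simp
 moreover have "(%t. ln (L_val a t)) \<in> ratR K" by (intro ratR_poly polyR.gen) (simp add: K_def)
 moreover have "hardy K" unfolding K_def by (rule hardy_insert_ln[OF H(1,4) d(2)])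
 moreover have "finite K" "G \<subseteq> K" using H(2,3) by (auto simp: K_def)
 ultimately show ?case by (intro exI[of _ K]) simp
qed

section \<open>Algebraic dependence and comparability chains\<close>

text \<open>Gaussian elimination: a column \<open>z\<close> that is nonzero in row \<open>b\<close>
  clears that row from all other columns, and its own coefficient is determined at the end.\<close>

lemma underdetermined_system:
 fixes u :: "'a => 'b => real"
 assumes "finite B" "finite A" "card B < card A"
 shows "EX c. (\<exists>a\<in>A. c a ~= 0) & (\<forall>b\<in>B. (\<Sum>a\<in>A. c a * u a b) = 0)"
 using assms
proof (induction B arbitrary: A u rule: finite_induct)
 case empty
 then obtain a where "a \<in> A" by fastforce
 then show ?case by (intro exI[of _ "%_. 1"]) auto
next
 case (insert b B)
 show ?case
 proof (cases "\<forall>a\<in>A. u a b = 0")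
  case True
  have "card B < card A" using insert by simp
  from insert.IH[OF insert.prems(1) this, of u] obtain c where
   c: "\<exists>a\<in>A. c a ~= 0" "\<forall>b\<in>B. (\<Sum>a\<in>A. c a * u a b) = 0" by (elim exE conjE)
  moreover have "(\<Sum>a\<in>A. c a * u a b) = 0" using True by simp
  ultimately show ?thesis by (intro exI[of _ c]) simp
 next
  case False
  then obtain z where z: "z \<in> A" "u z b ~= 0" by blast
  define v where "v a b' = u a b' - u a b / u z b * u z b'" for a b'
  have "card B < card (A - {z})" using insert z by simp
  from insert.IH[OF _ this, of v] insert.prems(1) obtain c where
   c: "\<exists>a\<in>A - {z}. c a ~= 0" "\<forall>b\<in>B. (\<Sum>a\<in>A - {z}. c a * v a b) = 0" by auto
  define d where "d a = (if a = z then - (\<Sum>a\<in>A - {z}. c a * u a b) / u z b else c a)" for a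
  have split: "(\<Sum>a\<in>A. d a * u a b') = d z * u z b' + (\<Sum>a\<in>A - {z}. c a * u a b')" for b'
  proof -
   have "(\<Sum>a\<in>A - {z}. d a * u a b') = (\<Sum>a\<in>A - {z}. c a * u a b')"
    by (rule sum.cong) (auto simp: d_def)
   then show ?thesis using sum.remove[OF insert.prems(1) z(1), of "%a. d a * u a b'"] by simp
  qed
  have "(\<Sum>a\<in>A. d a * u a b) = 0" using z(2) unfolding split by (simp add: d_def)
  moreover have "(\<Sum>a\<in>A. d a * u a b') = 0" if "b' \<in> B" for b'
  proof -
   have "(\<Sum>a\<in>A - {z}. c a * v a b') = (\<Sum>a\<in>A - {z}. c a * u a b') - (\<Sum>a\<in>A - {z}. c a * u a b) * (u z b' / u z b)"
    unfolding v_def sum_distrib_right sum_subtractf[symmetric] by (rule sum.cong) (auto simp: algebra_simps)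
   then show ?thesis using c(2) that unfolding split by (simp add: d_def)
  qed
  moreover have "\<exists>a\<in>A. d a ~= 0" using c(1) by (auto simp: d_def)
  ultimately show ?thesis by (intro exI[of _ d]) simp
 qed
qed

text \<open>The degree is bounded in each generator separately, so that there are exactly
  \<open>(D + 1)^r\<close> exponent vectors for \<open>r\<close> generators; degrees add under
  multiplication.\<close>

inductive_set pol_deg :: "(real => real) set => nat => (real => real) set" for G D where
 zero: "(%_. 0) \<in> pol_deg G D"
| monom: "b \<in> G \<rightarrow>\<^sub>E {..D} ==> (%x. \<Prod>g\<in>G. g x ^ b g) \<in> pol_deg G D"
| add: "f \<in> pol_deg G D ==> h \<in> pol_deg G D ==> (%x. f x + h x) \<in> pol_deg G D"
| scale: "f \<in> pol_deg G D ==> (%x. c * f x) \<in> pol_deg G D"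

lemma pol_deg_mono: "D <= E ==> f \<in> pol_deg G D ==> f \<in> pol_deg G E"
proof -
 assume DE: "D <= E"
 assume "f \<in> pol_deg G D"
 then show "f \<in> pol_deg G E"
 proof induction
  case (monom b)
  have "b \<in> G \<rightarrow>\<^sub>E {..E}" using monom DE by (auto simp: PiE_iff intro: order_trans)
  then show ?case by (rule pol_deg.monom)
 qed (auto intro: pol_deg.intros)
qed

lemma pol_deg_mult:
 assumes "f \<in> pol_deg G D" "h \<in> pol_deg G E"
 shows "(%x. f x * h x) \<in> pol_deg G (D + E)"
 using assms(1)
proof induction
 case (monom b)
 from assms(2) show ?case
 proof induction
  case (monom b')
  have "(\<lambda>g\<in>G. b g + b' g) \<in> G \<rightarrow>\<^sub>E {..D + E}"
   using monom \<open>b \<in> G \<rightarrow>\<^sub>E {..D}\<close> by (auto simp: PiE_iff intro!: add_mono)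
  from pol_deg.monom[OF this] show ?case
   by (simp add: power_add prod.distrib)
 next
  case (add f h)
  then show ?case unfolding distrib_left by (intro pol_deg.add)
 next
  case (scale f c)
  then show ?case using pol_deg.scale[OF scale(2), of c] by (simp add: mult.left_commute)
 qed (simp add: pol_deg.zero)
next
 case (add f' h')
 then show ?case unfolding distrib_right by (intro pol_deg.add)
next
 case (scale f c)
 then show ?case using pol_deg.scale[OF scale(2), of c] by (simp add: mult.assoc)
qed (simp add: pol_deg.zero)

lemma pol_deg_one: "(%_. 1) \<in> pol_deg G D"
proof -
 have "(\<lambda>g\<in>G. 0) \<in> G \<rightarrow>\<^sub>E {..D}" by simp
 from pol_deg.monom[OF this] show ?thesis by simp
qed

lemma pol_deg_power: "f \<in> pol_deg G D ==> (%x. f x ^ k) \<in> pol_deg G (k * D)"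
proof (induction k)
 case (Suc k)
 then show ?case using pol_deg_mult[OF Suc.prems Suc.IH[OF Suc.prems]] by simp
qed (simp add: pol_deg_one)

lemma pol_deg_prod:
 assumes "!!i. i < (k::nat) ==> f i \<in> pol_deg G D" shows "(%x. \<Prod>i<k. f i x) \<in> pol_deg G (k * D)"
 using assms
proof (induction k)
 case (Suc k)
 have "(%x. f k x * (\<Prod>i<k. f i x)) \<in> pol_deg G (D + k * D)"
  by (rule pol_deg_mult[OF Suc.prems Suc.IH[OF Suc.prems]]) auto
 then show ?case by (simp add: mult.commute)
qed (simp add: pol_deg_one)

lemma polyR_pol_deg:
 assumes "finite G" "f \<in> polyR G" shows "EX D. f \<in> pol_deg G D"
 using assms(2)
proof induction
 case (const c)
 show ?case using pol_deg.scale[OF pol_deg_one[of G 0], of c] by (intro exI[of _ 0]) simp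
next
 case (gen g)
 have "(\<lambda>h\<in>G. if h = g then 1 else 0) \<in> G \<rightarrow>\<^sub>E {..1::nat}" by auto
 from pol_deg.monom[OF this]
 have "(%x. \<Prod>h\<in>G. h x ^ (\<lambda>h\<in>G. if h = g then 1 else 0) h) \<in> pol_deg G 1" .
 moreover have "(\<Prod>h\<in>G. h x ^ (\<lambda>h\<in>G. if h = g then 1 else 0) h) = g x" for x
 proof -
  have "(\<Prod>h\<in>G. h x ^ (\<lambda>h\<in>G. if h = g then 1 else 0) h) = (\<Prod>h\<in>G. if h = g then g x else 1)"
   by (rule prod.cong) auto
  also have "... = g x" using gen assms(1) by (simp add: prod.delta)
  finally show ?thesis .
 qed
 ultimately show ?case by (intro exI[of _ 1]) simp
next
 case (add f h)
 then obtain D E where "f \<in> pol_deg G D" "h \<in> pol_deg G E" by (elim exE)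
 then have "f \<in> pol_deg G (max D E)" "h \<in> pol_deg G (max D E)"
  using pol_deg_mono[of D "max D E"] pol_deg_mono[of E "max D E"] by simp_all
 then show ?case by (intro exI[of _ "max D E"] pol_deg.add)
next
 case (mult f h)
 then obtain D E where "f \<in> pol_deg G D" "h \<in> pol_deg G E" by (elim exE)
 then show ?case by (intro exI[of _ "D + E"] pol_deg_mult)
qed

lemma pol_deg_coefficients:
 assumes "finite G" "f \<in> pol_deg G D"
 shows "EX c. ALL x. f x = (\<Sum>b\<in>G \<rightarrow>\<^sub>E {..D}. c b * (\<Prod>g\<in>G. g x ^ b g))"
 using assms(2)
proof induction
 case zero
 show ?case by (intro exI[of _ "%_. 0"]) simp
next
 case (monom b)
 have "finite (G \<rightarrow>\<^sub>E {..D})" using assms(1) by (simp add: finite_PiE)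
 then show ?case using monom
  by (intro exI[of _ "%b'. if b' = b then 1 else 0"])
   (simp add: if_distrib[of "%u. u * _"] sum.delta cong: if_cong)
next
 case (add f h)
 then obtain c c' where "ALL x. f x = (\<Sum>b\<in>G \<rightarrow>\<^sub>E {..D}. c b * (\<Prod>g\<in>G. g x ^ b g))"
  "ALL x. h x = (\<Sum>b\<in>G \<rightarrow>\<^sub>E {..D}. c' b * (\<Prod>g\<in>G. g x ^ b g))" by (elim exE)
 then show ?case by (intro exI[of _ "%b. c b + c' b"]) (simp add: distrib_right sum.distrib)
next
 case (scale f k)
 then obtain c where "ALL x. f x = (\<Sum>b\<in>G \<rightarrow>\<^sub>E {..D}. c b * (\<Prod>g\<in>G. g x ^ b g))" by (elim exE)
 then show ?case by (intro exI[of _ "%b. k * c b"]) (simp add: sum_distrib_left mult.assoc)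
qed

text \<open>The transcendence degree of a field generated by \<open>r\<close> germs is at most \<open>r\<close>: there are more
 monomials of partial degrees at most \<open>N\<close> in \<open>r + 1\<close> elements than monomials in the generators
 available to express them.\<close>

lemma ratR_algebraic_dependence:
 assumes G: "finite G" and T: "!!i. i <= card G ==> T i \<in> ratR G"
 shows "EX N c. (\<exists>a\<in>{..card G} \<rightarrow>\<^sub>E {..N}. c a ~= 0) &
  (evt x. (\<Sum>a\<in>{..card G} \<rightarrow>\<^sub>E {..N}. c a * (\<Prod>i\<le>card G. T i x ^ a i)) = 0)"
proof -
 define r where "r = card G"
 have "ALL i. EX P Q. i <= r --> P \<in> polyR G & Q \<in> polyR G & (evt x. Q x ~= 0 & T i x = P x / Q x)"
  using T unfolding ratR_def r_def by blast
 from choice[OF this] obtain P where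
  "ALL i. EX Q. i <= r --> P i \<in> polyR G & Q \<in> polyR G & (evt x. Q x ~= 0 & T i x = P i x / Q x)"
  by (elim exE)
 from choice[OF this] obtain Q where
  PQ0: "ALL i. i <= r --> P i \<in> polyR G & Q i \<in> polyR G & (evt x. Q i x ~= 0 & T i x = P i x / Q i x)"
  by (elim exE)
 then have PQ: "P i \<in> polyR G" "Q i \<in> polyR G" "evt x. Q i x ~= 0 & T i x = P i x / Q i x"
  if "i <= r" for i using that by simp_all
 \<comment> \<open>A common denominator: all the \<open>T i\<close> become \<open>S i / q\<close>
   with polynomials \<open>S i\<close>.\<close>
 define q where "q x = (\<Prod>i\<le>r. Q i x)" for x
 define S where "S i x = P i x * (\<Prod>l\<in>{..r} - {i}. Q l x)" for i x
 have prod_poly: "(%x. \<Prod>i\<in>I. Q i x) \<in> polyR G" if "finite I" "I \<subseteq> {..r}" for I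
  using that
 proof (induction I rule: finite_induct)
  case (insert i I)
  then show ?case using PQ(2)[of i] by (simp add: polyR.mult)
 qed (simp add: polyR.const)
 have qp: "q \<in> polyR G" unfolding q_def by (rule prod_poly) auto
 have Sp: "S i \<in> polyR G" if "i <= r" for i
  unfolding S_def by (intro polyR.mult PQ(1) that prod_poly) auto
 have "evt x. \<forall>i\<in>{..r}. Q i x ~= 0 & T i x = P i x / Q i x"
  by (rule eventually_ball_finite) (auto intro: PQ(3))
 then have ev: "evt x. q x ~= 0 & (\<forall>i\<le>r. S i x = q x * T i x)"
 proof eventually_elim
  case (elim x)
  have "S i x = q x * T i x" if "i <= r" for i
  proof -
   have "q x = Q i x * (\<Prod>l\<in>{..r} - {i}. Q l x)" unfolding q_def by (rule prod.remove) (use that in auto)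
   then show ?thesis using elim that by (simp add: S_def)
  qed
  then show ?case using elim by (simp add: q_def)
 qed
 have "ALL i. EX D. i <= r --> S i \<in> pol_deg G D" using polyR_pol_deg[OF G Sp] by blast
 from choice[OF this] obtain DS where DS: "ALL i. i <= r --> S i \<in> pol_deg G (DS i)" by (elim exE)
 obtain Dq where Dq: "q \<in> pol_deg G Dq" using polyR_pol_deg[OF G qp] by (elim exE)
 define D where "D = Dq + (\<Sum>i\<le>r. DS i)"
 have qD: "q \<in> pol_deg G D" by (rule pol_deg_mono[OF _ Dq]) (simp add: D_def)
 have SD: "S i \<in> pol_deg G D" if "i <= r" for i
 proof (rule pol_deg_mono)
  show "S i \<in> pol_deg G (DS i)" using DS that by blast
  show "DS i <= D" unfolding D_def using member_le_sum[of i "{..r}" DS] that by simp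
 qed
 \<comment> \<open>With \<open>N = K^r\<close> the count closes: \<open>(E + 1)^r <= (K * (N + 1))^r
   = N * (N + 1)^r < (N + 1)^(r + 1)\<close>.\<close>
 define K where "K = D * Suc r + 1"
 define N where "N = K ^ r"
 define E where "E = Suc r * (N * D)"
 define A where "A = {..r} \<rightarrow>\<^sub>E {..N}"
 define B where "B = G \<rightarrow>\<^sub>E {..E}"
 have finA: "finite A" unfolding A_def by (simp add: finite_PiE)
 have finB: "finite B" unfolding B_def using G by (simp add: finite_PiE)
 have "card B = Suc E ^ r" unfolding B_def using G by (simp add: card_PiE r_def)
 also have "... <= (K * Suc N) ^ r"
  by (rule power_mono) (simp_all add: E_def K_def algebra_simps)
 also have "... = N * Suc N ^ r" unfolding power_mult_distrib by (simp only: N_def[symmetric])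
 also have "... < Suc N ^ Suc r" by simp
 also have "... = card A" unfolding A_def by (simp add: card_PiE)
 finally have card: "card B < card A" .
 \<comment> \<open>The monomial in the \<open>T i\<close> multiplied by
   \<open>q^(N * (r + 1))\<close>, the same power for every exponent vector, so that a linear
   relation between the \<open>W a\<close> is one between the monomials.\<close>
 define W where "W a x = (\<Prod>i<Suc r. q x ^ (N - a i) * S i x ^ a i)" for a x
 have W: "W a \<in> pol_deg G E" if a: "a \<in> A" for a
  unfolding W_def E_def
 proof (rule pol_deg_prod)
  fix i assume i: "i < Suc r"
  then have "a i <= N" using a by (auto simp: A_def PiE_iff)
  have "(%x. q x ^ (N - a i) * S i x ^ a i) \<in> pol_deg G ((N - a i) * D + a i * D)"
   by (intro pol_deg_mult pol_deg_power qD SD) (use i in simp)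
  also have "(N - a i) * D + a i * D = N * D"
   using \<open>a i <= N\<close> by (metis add_mult_distrib le_add_diff_inverse2)
  finally show "(%x. q x ^ (N - a i) * S i x ^ a i) \<in> pol_deg G (N * D)" .
 qed
 have "ALL a. EX u. a \<in> A --> (ALL x. W a x = (\<Sum>b\<in>B. u b * (\<Prod>g\<in>G. g x ^ b g)))"
  using pol_deg_coefficients[OF G W] unfolding B_def by blast
 from choice[OF this] obtain u where u: "ALL a. a \<in> A --> (ALL x. W a x = (\<Sum>b\<in>B. u a b * (\<Prod>g\<in>G. g x ^ b g)))"
  by (elim exE)
 from underdetermined_system[OF finB finA card, of u] obtain c where
  c: "\<exists>a\<in>A. c a ~= 0" "\<forall>b\<in>B. (\<Sum>a\<in>A. c a * u a b) = 0" by (elim exE conjE)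
 have zero: "(\<Sum>a\<in>A. c a * W a x) = 0" for x
 proof -
  have "(\<Sum>a\<in>A. c a * W a x) = (\<Sum>a\<in>A. \<Sum>b\<in>B. (c a * u a b) * (\<Prod>g\<in>G. g x ^ b g))"
   using u by (intro sum.cong refl) (simp add: sum_distrib_left mult.assoc)
  also have "... = (\<Sum>b\<in>B. (\<Sum>a\<in>A. c a * u a b) * (\<Prod>g\<in>G. g x ^ b g))"
   by (subst sum.swap) (simp add: sum_distrib_right)
  finally show ?thesis using c(2) by simp
 qed
 have "evt x. (\<Sum>a\<in>A. c a * (\<Prod>i\<le>r. T i x ^ a i)) = 0"
  using ev
 proof eventually_elim
  case (elim x)
  have "W a x = q x ^ (N * Suc r) * (\<Prod>i\<le>r. T i x ^ a i)" if a: "a \<in> A" for a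
  proof -
   have "q x ^ (N - a i) * S i x ^ a i = q x ^ N * T i x ^ a i" if "i <= r" for i
   proof -
    have "a i <= N" using a that by (auto simp: A_def PiE_iff)
    then show ?thesis using elim that by (simp add: power_mult_distrib mult.assoc[symmetric] power_add[symmetric])
   qed
   then have "W a x = (\<Prod>i<Suc r. q x ^ N * T i x ^ a i)" unfolding W_def by (intro prod.cong) auto
   then show ?thesis by (simp only: prod.distrib lessThan_Suc_atMost) (simp add: power_mult power_add)
  qed
  then have "(\<Sum>a\<in>A. c a * W a x) = q x ^ (N * Suc r) * (\<Sum>a\<in>A. c a * (\<Prod>i\<le>r. T i x ^ a i))"
   unfolding sum_distrib_left by (intro sum.cong) (auto simp: mult_ac)
  then show ?case using zero[of x] elim by simp
 qed
 then show ?thesis using c(1) unfolding A_def r_def by (intro exI[of _ N] exI[of _ c]) simp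
qed

lemma finite_total_maximum:
 assumes "finite C" "C ~= {}" "!!a b. a \<in> C ==> b \<in> C ==> a ~= b ==> R a b \<or> R b a"
  and "!!a b c. a \<in> C ==> b \<in> C ==> c \<in> C ==> R a b ==> R b c ==> R a c"
 shows "\<exists>a\<in>C. \<forall>b\<in>C - {a}. R b a"
 using assms
proof (induction C rule: finite_ne_induct)
 case (insert x F)
 have "\<exists>a\<in>F. \<forall>b\<in>F - {a}. R b a"
  by (rule insert.IH) (use insert.prems in \<open>blast+\<close>)
 then obtain a where a: "a \<in> F" "\<forall>b\<in>F - {a}. R b a" by blast
 have ne: "x ~= a" using a(1) insert.hyps by blast
 have "R x a \<or> R a x" using insert.prems(1)[of x a] a(1) ne by blast
 then show ?case
 proof
  assume "R x a"
  then show ?thesis using a by blast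
 next
  assume ax: "R a x"
  have "R b x" if "b \<in> F" for b
  proof (cases "b = a")
   case False
   then have "R b a" using a that by blast
   then show ?thesis using insert.prems(2)[of b a x] ax that a(1) by blast
  qed (use ax in simp)
  then show ?thesis by blast
 qed
next
 case (singleton x)
 show ?case by simp
qed

text \<open>Among the terms with nonzero coefficient one dominates all others; dividing the relation
  by it and passing to the limit shows that its coefficient is zero after all.\<close>

lemma independent_of_comparable:
 fixes f :: "'a => real => real"
 assumes C: "finite C"
  and nz: "!!a. a \<in> C ==> evt x. f a x ~= 0"
  and comp: "!!a b. a \<in> C ==> b \<in> C ==> a ~= b ==>
   ((%x. f a x / f b x) \<longlongrightarrow> 0) at_top \<or> ((%x. f b x / f a x) \<longlongrightarrow> 0) at_top"
  and zero: "evt x. (\<Sum>a\<in>C. c a * f a x) = 0"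
  and a: "a \<in> C"
 shows "c a = 0"
proof (rule ccontr)
 assume ca: "c a ~= 0"
 define E where "E = {a \<in> C. c a ~= 0}"
 have E: "finite E" "E ~= {}" using C a ca by (auto simp: E_def)
 have "\<exists>a\<in>E. \<forall>b\<in>E - {a}. ((%x. f b x / f a x) \<longlongrightarrow> 0) at_top"
 proof (rule finite_total_maximum[OF E])
  fix a b assume "a \<in> E" "b \<in> E" "a ~= b"
  then show "((%x. f a x / f b x) \<longlongrightarrow> 0) at_top \<or> ((%x. f b x / f a x) \<longlongrightarrow> 0) at_top"
   by (intro comp) (auto simp: E_def)
 next
  fix a b d assume *: "a \<in> E" "b \<in> E" "d \<in> E" "((%x. f a x / f b x) \<longlongrightarrow> 0) at_top" "((%x. f b x / f d x) \<longlongrightarrow> 0) at_top"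
  have "evt x. f a x / f b x * (f b x / f d x) = f a x / f d x"
   using nz[of b] *(2) by (auto simp: E_def elim: eventually_mono)
  moreover have "((%x. f a x / f b x * (f b x / f d x)) \<longlongrightarrow> 0) at_top"
   using tendsto_mult[OF *(4,5)] by (simp only: mult_zero_left)
  ultimately show "((%x. f a x / f d x) \<longlongrightarrow> 0) at_top"
   by (rule Lim_transform_eventually[rotated])
 qed
 then obtain m where m: "m \<in> E" "!!b. b \<in> E - {m} ==> ((%x. f b x / f m x) \<longlongrightarrow> 0) at_top" by blast
 have "((%x. c m + (\<Sum>b\<in>E - {m}. c b * (f b x / f m x))) \<longlongrightarrow> c m + (\<Sum>b\<in>E - {m}. c b * 0)) at_top"
  by (intro tendsto_intros m(2))
 then have lim: "((%x. c m + (\<Sum>b\<in>E - {m}. c b * (f b x / f m x))) \<longlongrightarrow> c m) at_top"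
  by simp
 have "evt x. c m + (\<Sum>b\<in>E - {m}. c b * (f b x / f m x)) = 0"
 proof -
  have "evt x. f m x ~= 0" using m(1) nz by (simp add: E_def)
  with zero show ?thesis
  proof eventually_elim
   case (elim x)
   have "(\<Sum>a\<in>C. c a * f a x) = (\<Sum>a\<in>E. c a * f a x)"
    by (rule sum.mono_neutral_right) (use C in \<open>auto simp: E_def\<close>)
   also have "... = c m * f m x + (\<Sum>b\<in>E - {m}. c b * f b x)" by (rule sum.remove) (use E m in auto)
   also have "... = f m x * (c m + (\<Sum>b\<in>E - {m}. c b * (f b x / f m x)))"
    using elim(2) by (simp add: distrib_left sum_distrib_left mult.commute)
   finally show ?case using elim by simp
  qed
 qed
 then have "((%x::real. 0::real) \<longlongrightarrow> c m) at_top"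
  by (rule Lim_transform_eventually[OF lim])
 then have "c m = 0" by (simp add: tendsto_const_iff)
 then show False using m(1) by (simp add: E_def)
qed

text \<open>Germs of rapidly decreasing orders of growth are algebraically independent, so there cannot be
 infinitely many of them in a finitely generated field.\<close>

lemma no_infinite_comparability_chain:
 assumes G: "finite G" and T: "!!i::nat. T i \<in> ratR G"
  and top: "!!i. filterlim (T i) at_top at_top"
  and dom: "!!i A. evt x. T (Suc i) x ^ A <= T i x"
 shows False
proof -
 define r where "r = card G"
 from ratR_algebraic_dependence[of G T, OF G T] obtain N c where
  c: "\<exists>a\<in>{..r} \<rightarrow>\<^sub>E {..N}. c a ~= 0"
  and ev: "evt x. (\<Sum>a\<in>{..r} \<rightarrow>\<^sub>E {..N}. c a * (\<Prod>i\<le>r. T i x ^ a i)) = 0"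
  unfolding r_def by (elim exE conjE)
 have pos: "evt x. \<forall>i\<in>{..Suc r}. 1 <= T i x"
  by (rule eventually_ball_finite) (use top in \<open>auto simp: filterlim_at_top\<close>)
 have "evt x. \<forall>i\<in>{..r}. T (Suc i) x ^ 1 <= T i x"
  by (rule eventually_ball_finite) (simp, intro ballI dom)
 then have dec: "evt x. ALL i l. i < l --> l <= Suc r --> T l x <= T (Suc i) x"
 proof eventually_elim
  case (elim x)
  have "T l x <= T (Suc i) x" if "Suc i <= l" "l <= Suc r" for i l
   using that
  proof (induction l rule: dec_induct)
   case (step l)
   then have "T (Suc l) x <= T l x" using elim by simp
   then show ?case using step by simp
  qed simp
  then show ?case by simp
 qed
 \<comment> \<open>Exponent vectors are compared lexicographically: the first index where they
   differ decides, since \<open>T k\<close> outgrows every power of the later germs.\<close>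
 have small: "((%x. (\<Prod>i\<le>r. T i x ^ b i) / (\<Prod>i\<le>r. T i x ^ a i)) \<longlongrightarrow> 0) at_top"
  if ab: "a \<in> {..r} \<rightarrow>\<^sub>E {..N}" "b \<in> {..r} \<rightarrow>\<^sub>E {..N}" and k: "k <= r" "b k < a k" "!!i. i < k ==> a i = b i" for a b k
 proof (rule tendsto_sandwich)
  have "evt x. T (Suc k) x ^ (N * r + 1) <= T k x" by (rule dom)
  then show "evt x. (\<Prod>i\<le>r. T i x ^ b i) / (\<Prod>i\<le>r. T i x ^ a i) <= inverse (T (Suc k) x)"
   using pos dec
  proof eventually_elim
   case (elim x)
   have T1: "1 <= T i x" if "i <= Suc r" for i using elim(2) that by simp
   have T0: "0 < T i x" if "i <= Suc r" for i using T1[OF that] by simp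
   have split: "(\<Prod>i\<le>r. T i x ^ u i) = (\<Prod>i<k. T i x ^ u i) * (T k x ^ u k * (\<Prod>i\<in>{k<..r}. T i x ^ u i))" for u
   proof -
    have *: "{..r} = {..<k} \<union> insert k {k<..r}" using k(1) by auto
    show ?thesis unfolding * by (subst prod.union_disjoint) auto
   qed
   have "(\<Prod>i\<in>{k<..r}. T i x ^ b i) <= (\<Prod>i\<in>{k<..r}. T (Suc k) x ^ N)"
   proof (rule prod_mono, rule conjI)
    fix i assume i: "i \<in> {k<..r}"
    show "0 <= T i x ^ b i" using T0[of i] i by simp
    have "T i x ^ b i <= T (Suc k) x ^ b i" using elim(3) i T0[of i] by (intro power_mono) auto
    also have "... <= T (Suc k) x ^ N" using T1[of "Suc k"] k ab(2) i by (intro power_increasing) (auto simp: PiE_iff)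
    finally show "T i x ^ b i <= T (Suc k) x ^ N" .
   qed
   also have "... <= T (Suc k) x ^ (N * r)"
    using T1[of "Suc k"] k by (simp add: power_mult[symmetric] power_increasing)
   finally have "(\<Prod>i\<in>{k<..r}. T i x ^ b i) * T (Suc k) x <= T (Suc k) x ^ (N * r + 1)"
    using T0[of "Suc k"] k by (simp add: mult.commute)
   also have "... <= T k x" by (rule elim(1))
   finally have 1: "(\<Prod>i\<in>{k<..r}. T i x ^ b i) * T (Suc k) x <= T k x" .
   have 2: "1 <= (\<Prod>i\<in>{k<..r}. T i x ^ a i)" using T1 by (intro prod_ge_1) auto
   have p: "0 < (\<Prod>i<k. T i x ^ a i)" using T0 k by (intro prod_pos) auto
   have "(\<Prod>i\<le>r. T i x ^ b i) * T (Suc k) x = (\<Prod>i<k. T i x ^ a i) * (T k x ^ b k * ((\<Prod>i\<in>{k<..r}. T i x ^ b i) * T (Suc k) x))"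
    unfolding split[of b] using k(3) by (simp add: mult_ac)
   also have "... <= (\<Prod>i<k. T i x ^ a i) * (T k x ^ b k * T k x)"
    using 1 p T0[of k] k by (intro mult_left_mono) auto
   also have "... = (\<Prod>i<k. T i x ^ a i) * T k x ^ Suc (b k)" by simp
   also have "... <= (\<Prod>i<k. T i x ^ a i) * T k x ^ a k"
    using p T1[of k] k by (intro mult_left_mono power_increasing) auto
   also have "... <= (\<Prod>i<k. T i x ^ a i) * (T k x ^ a k * (\<Prod>i\<in>{k<..r}. T i x ^ a i))"
   proof (rule mult_left_mono)
    show "T k x ^ a k <= T k x ^ a k * (\<Prod>i\<in>{k<..r}. T i x ^ a i)"
     using mult_left_mono[OF 2, of "T k x ^ a k"] T0[of k] k by simp
   qed (use p in simp)
   also have "... = (\<Prod>i\<le>r. T i x ^ a i)" by (rule split[symmetric])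
   finally have "(\<Prod>i\<le>r. T i x ^ b i) * T (Suc k) x <= (\<Prod>i\<le>r. T i x ^ a i)" .
   moreover have "0 < (\<Prod>i\<le>r. T i x ^ a i)" using T0 by (intro prod_pos) auto
   ultimately show ?case using T0[of "Suc k"] k by (simp add: field_simps)
  qed
  show "evt x. 0 <= (\<Prod>i\<le>r. T i x ^ b i) / (\<Prod>i\<le>r. T i x ^ a i)"
   using pos
  proof eventually_elim
   case (elim x)
   have "0 <= T i x" if "i <= r" for i using elim that by (auto dest: bspec[of _ _ i])
   then show ?case by (intro divide_nonneg_nonneg prod_nonneg) auto
  qed
  show "((%x. inverse (T (Suc k) x)) \<longlongrightarrow> 0) at_top"
   using top by (rule tendsto_inverse_0_at_top)
 qed simp
 have "c a = 0" if "a \<in> {..r} \<rightarrow>\<^sub>E {..N}" for a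
 proof (rule independent_of_comparable[where f = "%a x. \<Prod>i\<le>r. T i x ^ a i", OF _ _ _ ev that])
  show "finite ({..r} \<rightarrow>\<^sub>E {..N})" by (simp add: finite_PiE)
  show "evt x. (\<Prod>i\<le>r. T i x ^ a i) ~= 0" for a
   using pos
  proof eventually_elim
   case (elim x)
   have "T i x ~= 0" if "i <= r" for i using elim that by (auto dest: bspec[of _ _ i])
   then show ?case by simp
  qed
  fix a b assume ab: "a \<in> {..r} \<rightarrow>\<^sub>E {..N}" "b \<in> {..r} \<rightarrow>\<^sub>E {..N}" "a ~= b"
  have "\<exists>i\<in>{..r}. a i ~= b i" using PiE_ext[OF ab(1,2)] ab(3) by blast
  then obtain i where i: "i <= r" "a i ~= b i" by auto
  define k where "k = (LEAST i. a i ~= b i)"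
  have k: "a k ~= b k" unfolding k_def using i(2) by (rule LeastI)
  have kr: "k <= r" using Least_le[of "%i. a i ~= b i" i] i by (simp add: k_def)
  have lt: "a i = b i" if "i < k" for i using not_less_Least[of i "%i. a i ~= b i"] that by (auto simp: k_def)
  show "((%x. (\<Prod>i\<le>r. T i x ^ a i) / (\<Prod>i\<le>r. T i x ^ b i)) \<longlongrightarrow> 0) at_top \<or>
   ((%x. (\<Prod>i\<le>r. T i x ^ b i) / (\<Prod>i\<le>r. T i x ^ a i)) \<longlongrightarrow> 0) at_top"
  proof (cases "b k < a k")
   case True
   then show ?thesis using small[OF ab(1,2) kr True] lt by simp
  next
   case False
   then have "a k < b k" using k by simp
   then show ?thesis using small[OF ab(2,1) kr \<open>a k < b k\<close>] lt by simp
  qed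
 qed
 then show False using c by blast
qed

section \<open>Growth of primitives of germs in a Hardy field\<close>

lemma hardy_sign:
 assumes G: "hardy G" and f: "f \<in> ratR G"
 shows "(evt x. f x = 0) \<or> (evt x. 0 < f x) \<or> (evt x. f x < 0)"
proof -
 obtain d where d: "evt x. (f has_real_derivative d x) (at x)"
  using hardy_derivative[OF G f] by blast
 have "(evt x. 0 < f x) \<or> (evt x. f x < 0)" if nz: "evt x. f x ~= 0"
 proof -
  obtain a where a: "!!x. x \<ge> a ==> f x ~= 0 & (f has_real_derivative d x) (at x)"
   using eventually_conj[OF nz d] by (auto simp: eventually_at_top_linorder)
  have cont: "isCont f x" if "x \<ge> a" for x using a[OF that] by (blast intro: DERIV_isCont)
  show ?thesis
  proof (cases "0 < f a")
   case True
   have "0 < f x" if "x \<ge> a" for x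
   proof (rule ccontr)
    assume "\<not> 0 < f x"
    then have "\<exists>y\<ge>a. y <= x & f y = 0" using True that cont by (intro IVT2) auto
    then show False using a by blast
   qed
   then show ?thesis by (intro disjI1 eventually_at_top_linorderI[of a])
  next
   case False
   then have neg: "f a < 0" using a[of a] by simp
   have "f x < 0" if "x \<ge> a" for x
   proof (rule ccontr)
    assume "\<not> f x < 0"
    then have "\<exists>y\<ge>a. y <= x & f y = 0" using neg that cont by (intro IVT) auto
    then show False using a by blast
   qed
   then show ?thesis by (intro disjI2 eventually_at_top_linorderI[of a])
  qed
 qed
 then show ?thesis using hardy_zero_or_nonzero[OF G f] by blast
qed

lemma eventually_bounded_of_derivative_nonpos:
 fixes f :: "real => real"
 assumes "evt x. (f has_real_derivative d x) (at x) & d x <= 0"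
 shows "EX c. evt x. f x <= c"
proof -
 obtain a where a: "!!x. x \<ge> a ==> (f has_real_derivative d x) (at x) & d x <= 0"
  using assms by (auto simp: eventually_at_top_linorder)
 have "f x <= f a" if "x \<ge> a" for x
  by (rule DERIV_nonpos_imp_nonincreasing[OF that]) (use a in blast)
 then show ?thesis by (intro exI[of _ "f a"] eventually_at_top_linorderI[of a])
qed

text \<open>\<open>f - C\<close> has an eventual sign, so exceeding \<open>C\<close> at arbitrarily
  large arguments already means exceeding it from some point on.\<close>

lemma hardy_frequently_large_at_top:
 assumes G: "hardy G" and f: "f \<in> ratR G" and large: "!!C. \<exists>\<^sub>F x in at_top. C < f x"
 shows "filterlim f at_top at_top"
proof -
 have "evt x. C <= f x" for C
 proof -
  have "(%x. f x - C) \<in> ratR G" by (intro ratR_diff f ratR_const)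
  from hardy_sign[OF G this] show ?thesis
  proof (elim disjE)
   assume "evt x. f x - C = 0"
   then show ?thesis by eventually_elim simp
  next
   assume "evt x. 0 < f x - C"
   then show ?thesis by eventually_elim simp
  next
   assume "evt x. f x - C < 0"
   then have "evt x. \<not> C < f x" by eventually_elim simp
   then show ?thesis using large[of C] by (simp add: frequently_def)
  qed
 qed
 then show ?thesis by (simp add: filterlim_at_top)
qed

lemma exp_iter_mono: "x <= y ==> (exp ^^ j) x <= (exp ^^ j) (y::real)"
 by (induction j) auto

lemma filterlim_exp_iter: "filterlim F at_top A ==> filterlim (%x. (exp ^^ j) (F x :: real)) at_top A"
 by (induction j) (auto intro: filterlim_compose[OF exp_at_top])

lemma filterlim_ln_iter: "filterlim (%x::real. (ln ^^ j) x) at_top at_top"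
 by (induction j) (auto intro: filterlim_ident filterlim_compose[OF ln_at_top])

lemma exp_iter_ln_iter: "evt x::real. (exp ^^ j) ((ln ^^ j) x) = x"
proof (induction j)
 case (Suc j)
 have "evt x::real. 0 < (ln ^^ j) x" using filterlim_ln_iter[of j] by (simp add: filterlim_at_top_dense)
 with Suc show ?case
 proof eventually_elim
  case (elim x)
  have "(exp ^^ Suc j) ((ln ^^ Suc j) x) = (exp ^^ j) (exp (ln ((ln ^^ j) x)))"
   by (simp only: funpow_Suc_right[of _ exp] o_def funpow.simps(2)[of _ ln])
  then show ?case using elim by simp
 qed
qed simp

text \<open>The factor \<open>e\<close> is a product of iterated exponentials of \<open>F\<close>;
  only its lower bound by the outermost one matters.\<close>

lemma exp_iter_derivative:
 assumes "evt x. (F has_real_derivative f x) (at x)" "filterlim F at_top at_top"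
 shows "EX e. evt x. ((%x. (exp ^^ Suc j) (F x)) has_real_derivative f x * e x) (at x) & (exp ^^ Suc j) (F x) <= e x"
proof (induction j)
 case 0
 have "evt x. ((%x. (exp ^^ Suc 0) (F x)) has_real_derivative f x * exp (F x)) (at x) & (exp ^^ Suc 0) (F x) <= exp (F x)"
  using assms(1) by eventually_elim (auto intro!: derivative_eq_intros)
 then show ?case by (intro exI[of _ "%x. exp (F x)"])
next
 case (Suc j)
 then obtain e where e: "evt x. ((%x. (exp ^^ Suc j) (F x)) has_real_derivative f x * e x) (at x) & (exp ^^ Suc j) (F x) <= e x"
  by (elim exE)
 have "evt x. 1 <= (exp ^^ Suc j) (F x)"
  using filterlim_exp_iter[OF assms(2), of "Suc j"] unfolding filterlim_at_top by blast
 with e have "evt x. ((%x. (exp ^^ Suc (Suc j)) (F x)) has_real_derivative f x * (e x * (exp ^^ Suc (Suc j)) (F x))) (at x)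
   & (exp ^^ Suc (Suc j)) (F x) <= e x * (exp ^^ Suc (Suc j)) (F x)"
 proof eventually_elim
  case (elim x)
  have "((%x. exp ((exp ^^ Suc j) (F x))) has_real_derivative exp ((exp ^^ Suc j) (F x)) * (f x * e x)) (at x)"
   using elim by (intro DERIV_chain2[OF DERIV_exp]) blast
  moreover have "1 <= e x" using elim(2) elim(1)[THEN conjunct2] by (rule order_trans)
  ultimately show ?case by (simp add: mult_ac)
 qed
 then show ?case by (intro exI[of _ "%x. e x * (exp ^^ Suc (Suc j)) (F x)"])
qed

text \<open>The quotient is the derivative of \<open>ln T\<close> with respect to \<open>F\<close>.
  One more exponential of \<open>F\<close> has an even larger derivative, so \<open>ln T\<close> is
  at most that exponential plus a constant. The second of the three extra iterations absorbs the
  constant, the third undoes the logarithm.\<close>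

lemma eventually_le_exp_iter_of_log_derivative:
 assumes F: "evt x. (F has_real_derivative f x) (at x)" "filterlim F at_top at_top"
  and f: "evt x. 0 < f x"
  and T: "evt x. (T has_real_derivative d x) (at x)" "evt x. 0 < T x"
  and le: "evt x. d x / (T x * f x) <= (exp ^^ j) (F x)"
 shows "evt x. T x <= (exp ^^ (j + 3)) (F x)"
proof -
 obtain e where e: "evt x. ((%x. (exp ^^ Suc j) (F x)) has_real_derivative f x * e x) (at x) & (exp ^^ Suc j) (F x) <= e x"
  using exp_iter_derivative[OF F, of j] by (elim exE)
 have "evt x. ((%x. ln (T x) - (exp ^^ Suc j) (F x)) has_real_derivative d x / T x - f x * e x) (at x) & d x / T x - f x * e x <= 0"
  using e T f le
 proof eventually_elim
  case (elim x)
  have "((%x. ln (T x)) has_real_derivative d x / T x) (at x)"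
   using elim(2,3) by (auto intro!: derivative_eq_intros)
  then have 1: "((%x. ln (T x) - (exp ^^ Suc j) (F x)) has_real_derivative d x / T x - f x * e x) (at x)"
   using elim(1) by (intro DERIV_diff) auto
  have "(exp ^^ j) (F x) <= (exp ^^ Suc j) (F x)" using exp_ge_add_one_self[of "(exp ^^ j) (F x)"] by (simp del: exp_ge_add_one_self)
  then have "d x / (T x * f x) <= e x" using elim(1,5) by linarith
  then have "f x * (d x / (T x * f x)) <= f x * e x" using elim(4) by (intro mult_left_mono) auto
  moreover have "f x * (d x / (T x * f x)) = d x / T x" using elim(4) by simp
  ultimately show ?case using 1 by simp
 qed
 from eventually_bounded_of_derivative_nonpos[OF this] obtain c where
  c: "evt x. ln (T x) - (exp ^^ Suc j) (F x) <= c" by (elim exE)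
 have "filterlim (%y::real. exp y - y) at_top at_top" by real_asymp
 then have "filterlim (%x. exp ((exp ^^ Suc j) (F x)) - (exp ^^ Suc j) (F x)) at_top at_top"
  using filterlim_exp_iter[OF F(2), of "Suc j"] by (rule filterlim_compose)
 then have "evt x. c <= exp ((exp ^^ Suc j) (F x)) - (exp ^^ Suc j) (F x)" unfolding filterlim_at_top by blast
 with c T(2) show ?thesis
 proof eventually_elim
  case (elim x)
  have "T x = exp (ln (T x))" using elim by simp
  also have "... <= exp (exp ((exp ^^ Suc j) (F x)))" using elim by (subst exp_le_cancel_iff) linarith
  finally show ?case by (simp add: eval_nat_numeral)
 qed
qed

text \<open>The iterates \<open>T(k+1) = T(k)' / (T(k) f)\<close> starting from \<open>T(0) = x\<close> would form an infinite
 comparability chain if the primitive of \<open>f\<close> grew more slowly than every iterated logarithm.\<close>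

theorem hardy_primitive_ge_ln_iter:
 assumes G: "hardy G" "finite G" "(%x. x) \<in> G" and f: "f \<in> ratR G" "evt x. 0 < f x"
  and F: "evt x. (F has_real_derivative f x) (at x)" "filterlim F at_top at_top"
 shows "EX j. evt x. (ln ^^ j) x <= F x"
proof (rule ccontr)
 assume "\<not> ?thesis"
 then have slow: "\<exists>\<^sub>F x in at_top. F x < (ln ^^ j) x" for j
  by (simp add: not_le[symmetric] frequently_def)
 have "ALL T. EX d. T \<in> ratR G --> d \<in> ratR G & (evt x. (T has_real_derivative d x) (at x))"
  using hardy_derivative[OF G(1)] by blast
 from choice[OF this] obtain D where
  D0: "ALL T. T \<in> ratR G --> D T \<in> ratR G & (evt x. (T has_real_derivative D T x) (at x))" by (elim exE)
 then have D: "D T \<in> ratR G" "evt x. (T has_real_derivative D T x) (at x)" if "T \<in> ratR G" for T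
  using that by simp_all
 define T where "T k = ((%h x. D h x / (h x * f x)) ^^ k) (%x. x)" for k
 have T_Suc: "T (Suc k) = (%x. D (T k) x / (T k x * f x))" for k by (simp add: T_def)
 \<comment> \<open>Only \<open>frequently\<close> is available: \<open>F\<close> and its iterated
   exponentials need not lie in the field, so no sign argument compares them with
   \<open>T k\<close>. The induction step is the contrapositive of
   \<open>eventually_le_exp_iter_of_log_derivative\<close>.\<close>
 have inv: "T k \<in> ratR G & (ALL j. \<exists>\<^sub>F x in at_top. (exp ^^ j) (F x) < T k x)" for k
 proof (induction k)
  case 0
  have "\<exists>\<^sub>F x in at_top. (exp ^^ j) (F x) < x" for j
  proof -
   have "\<exists>\<^sub>F x in at_top. F x < (ln ^^ Suc j) x & (exp ^^ Suc j) ((ln ^^ Suc j) x) = x"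
    by (rule frequently_eventually_frequently[OF slow exp_iter_ln_iter])
   then show ?thesis
   proof (rule frequently_mono[rotated], safe)
    fix x assume *: "F x < (ln ^^ Suc j) x" "(exp ^^ Suc j) ((ln ^^ Suc j) x) = x"
    have "(exp ^^ j) (F x) < (exp ^^ Suc j) (F x)"
     using exp_ge_add_one_self[of "(exp ^^ j) (F x)"] unfolding funpow.simps o_def by linarith
    also have "... <= (exp ^^ Suc j) ((ln ^^ Suc j) x)" by (rule exp_iter_mono) (use * in linarith)
    finally show "(exp ^^ j) (F x) < x" unfolding *(2) .
   qed
  qed
  moreover have "(%x. x) \<in> ratR G" by (intro ratR_poly polyR.gen G(3))
  ultimately show ?case by (simp add: T_def)
 next
  case (Suc k)
  have Tk: "T k \<in> ratR G" using Suc by blast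
  have top: "filterlim (T k) at_top at_top"
  proof (rule hardy_frequently_large_at_top[OF G(1) Tk])
   fix C
   have "evt x. C <= (exp ^^ 0) (F x)" using F(2) by (simp add: filterlim_at_top)
   moreover have "\<exists>\<^sub>F x in at_top. (exp ^^ 0) (F x) < T k x" using Suc by blast
   ultimately have "\<exists>\<^sub>F x in at_top. (exp ^^ 0) (F x) < T k x & C <= (exp ^^ 0) (F x)"
    by (intro frequently_eventually_frequently)
   then show "\<exists>\<^sub>F x in at_top. C < T k x" by (rule frequently_mono[rotated]) auto
  qed
  then have pos: "evt x. 0 < T k x" by (simp add: filterlim_at_top_dense)
  have nz: "evt x. T k x * f x ~= 0" using pos f(2) by eventually_elim simp
  have "T (Suc k) \<in> ratR G" unfolding T_Suc by (intro ratR_divide ratR_mult D(1) Tk f(1) nz)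
  moreover have "\<exists>\<^sub>F x in at_top. (exp ^^ j) (F x) < T (Suc k) x" for j
  proof (rule ccontr)
   assume "\<not> ?thesis"
   then have "evt x. D (T k) x / (T k x * f x) <= (exp ^^ j) (F x)"
    by (simp add: T_Suc frequently_def not_less)
   from eventually_le_exp_iter_of_log_derivative[OF F f(2) D(2)[OF Tk] pos this]
   have "\<not> (\<exists>\<^sub>F x in at_top. (exp ^^ (j + 3)) (F x) < T k x)" by (simp only: frequently_def not_less not_not)
   then show False using Suc by blast
  qed
  ultimately show ?case by blast
 qed
 have TR: "T k \<in> ratR G" for k using inv by blast
 have top: "filterlim (T k) at_top at_top" for k
 proof (rule hardy_frequently_large_at_top[OF G(1) TR])
  fix C
  have "evt x. C <= (exp ^^ 0) (F x)" using F(2) by (simp add: filterlim_at_top)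
  moreover have "\<exists>\<^sub>F x in at_top. (exp ^^ 0) (F x) < T k x" using inv by blast
  ultimately have "\<exists>\<^sub>F x in at_top. (exp ^^ 0) (F x) < T k x & C <= (exp ^^ 0) (F x)"
   by (intro frequently_eventually_frequently)
  then show "\<exists>\<^sub>F x in at_top. C < T k x" by (rule frequently_mono[rotated]) auto
 qed
 have "evt x. T (Suc k) x ^ A <= T k x" for k A
 proof (cases "A = 0")
  case True
  then show ?thesis using top[of k] by (simp add: filterlim_at_top)
 next
  case False
  have "(%x. T (Suc k) x ^ A - T k x) \<in> ratR G" by (intro ratR_diff ratR_power TR)
  from hardy_sign[OF G(1) this] consider "evt x. T (Suc k) x ^ A - T k x <= 0" | "evt x. 0 < T (Suc k) x ^ A - T k x"
   by (elim disjE) (simp_all add: eventually_mono[OF _ less_imp_le] eventually_mono[OF _ eq_refl])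
  then show ?thesis
  proof cases
   case 1
   then show ?thesis by eventually_elim simp
  next
   case 2
   \<comment> \<open>If \<open>T (Suc k) ^ A\<close> exceeds \<open>T k\<close>, then
     \<open>T k powr B\<close> is at most \<open>T k' / (T k * f)\<close>. Hence the derivative of
     \<open>T k powr (-B)\<close> is at most \<open>-B * f\<close>, so
     \<open>B * F + T k powr (-B)\<close> is nonincreasing, against \<open>F\<close> tending to
     infinity.\<close>
   define B where "B = 1 / real A"
   have B: "0 < B" using False by (simp add: B_def)
   have p: "evt x. 0 < T k x" "evt x. 0 < T (Suc k) x" using top by (simp_all add: filterlim_at_top_dense)
   have "evt x. ((%x. B * F x + T k x powr (-B)) has_real_derivative B * f x + (-B) * T k x powr (-B - 1) * D (T k) x) (at x)
     & B * f x + (-B) * T k x powr (-B - 1) * D (T k) x <= 0"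
    using 2 p F(1) f(2) D(2)[OF TR[of k]]
   proof eventually_elim
    case (elim x)
    have "((%x. T k x powr (-B)) has_real_derivative (-B) * T k x powr (-B - 1) * D (T k) x) (at x)"
     using elim(2,6) by (auto intro!: derivative_eq_intros simp: powr_diff)
    then have 1: "((%x. B * F x + T k x powr (-B)) has_real_derivative B * f x + (-B) * T k x powr (-B - 1) * D (T k) x) (at x)"
     using elim(4) by (intro DERIV_add DERIV_cmult) auto
    have "T k x powr B <= (T (Suc k) x ^ A) powr B"
     using elim(1,2) B by (intro powr_mono2) auto
    also have "... = T (Suc k) x"
     using elim(3) False by (simp add: B_def powr_realpow[symmetric] powr_powr)
    also have "... = D (T k) x / (T k x * f x)" by (simp add: T_Suc)
    finally have "T k x powr B * (T k x * f x) <= D (T k) x"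
     using elim(2,5) by (simp add: pos_le_divide_eq)
    then have "T k x powr (-B - 1) * (T k x powr B * (T k x * f x)) <= T k x powr (-B - 1) * D (T k) x"
     by (intro mult_left_mono) auto
    moreover have "T k x powr (-B - 1) * (T k x powr B * (T k x * f x)) = f x"
     using elim(2) by (simp add: powr_diff powr_minus field_simps)
    ultimately have "B * f x <= B * (T k x powr (-B - 1) * D (T k) x)" using B by (intro mult_left_mono) auto
    then show ?case using 1 by (simp add: mult.assoc)
   qed
   from eventually_bounded_of_derivative_nonpos[OF this] obtain c where
    c: "evt x. B * F x + T k x powr (-B) <= c" by (elim exE)
   have "evt x. (c + 1) / B <= F x" using F(2) unfolding filterlim_at_top by blast
   with c have "evt x::real. False"
   proof eventually_elim
    case (elim x)
    have "c + 1 <= B * F x" using elim(2) B by (simp add: pos_divide_le_eq mult.commute)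
    then show ?case using elim(1) powr_ge_zero[of "T k x" "-B"] by linarith
   qed
   then show ?thesis by simp
  qed
 qed
 from no_infinite_comparability_chain[of G T, OF G(2) TR top this] show False .
qed

lemma hardy_insert_ln_iter:
 assumes "hardy G" "finite G" "(%x. x) \<in> G"
 shows "EX H. hardy H & finite H & G \<subseteq> H & (\<forall>l\<le>j. (%x. (ln ^^ l) x) \<in> H)"
proof (induction j)
 case 0
 then show ?case using assms by (intro exI[of _ G]) simp
next
 case (Suc j)
 then obtain H where H: "hardy H" "finite H" "G \<subseteq> H" "\<forall>l\<le>j. (%x. (ln ^^ l) x) \<in> H" by (elim exE conjE)
 have u: "(%x. (ln ^^ j) x) \<in> ratR H" using H(4) by (intro ratR_poly polyR.gen) simp
 have pos: "evt x::real. 0 < (ln ^^ j) x" using filterlim_ln_iter[of j] by (simp add: filterlim_at_top_dense)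
 have "(%x. (ln ^^ l) x) \<in> insert (%x. ln ((ln ^^ j) x)) H" if "l <= Suc j" for l
  using H(4) that by (cases "l = Suc j") (simp_all add: o_def)
 then show ?case using H hardy_insert_ln[OF H(1) u pos]
  by (intro exI[of _ "insert (%x. ln ((ln ^^ j) x)) H"]) auto
qed

lemma ln_iter_derivative:
 "evt x::real. ((%x. (ln ^^ Suc j) x) has_real_derivative 1 / (x * (\<Prod>l=1..j. (ln ^^ l) x))) (at x)"
proof (induction j)
 case 0
 show ?case using eventually_gt_at_top[of 0] by eventually_elim (auto intro!: derivative_eq_intros)
next
 case (Suc j)
 have "evt x::real. 0 < (ln ^^ Suc j) x"
  using filterlim_ln_iter[of "Suc j"] unfolding filterlim_at_top_dense by blast
 with Suc show ?case
 proof eventually_elim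
  case (elim x)
  have 1: "((%x. ln ((ln ^^ Suc j) x)) has_real_derivative 1 / (ln ^^ Suc j) x * (1 / (x * (\<Prod>l=1..j. (ln ^^ l) x)))) (at x)"
   by (rule DERIV_chain2[OF DERIV_ln_divide[OF elim(2)] elim(1)])
  have 2: "1 / (ln ^^ Suc j) x * (1 / (x * (\<Prod>l=1..j. (ln ^^ l) x))) = 1 / (x * (\<Prod>l=1..Suc j. (ln ^^ l) x))"
   by (simp add: prod.nat_ivl_Suc' mult_ac)
  have 3: "(%x::real. (ln ^^ Suc (Suc j)) x) = (%x. ln ((ln ^^ Suc j) x))" by (rule ext) simp
  show ?case unfolding 3 using 1[unfolded 2] .
 qed
qed

lemma ln_iter_antimono:
 assumes "j <= k" shows "evt x::real. (ln ^^ k) x <= (ln ^^ j) x"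
 using assms
proof (induction k rule: dec_induct)
 case (step k)
 have "evt x::real. 0 < (ln ^^ k) x" using filterlim_ln_iter[of k] by (simp add: filterlim_at_top_dense)
 with step.IH show ?case
 proof eventually_elim
  case (elim x)
  then show ?case using ln_le_minus_one[of "(ln ^^ k) x"] by simp
 qed
qed simp

lemma hardy_primitive:
 assumes "hardy G" "f \<in> ratR G"
 shows "EX F. evt x. (F has_real_derivative f x) (at x)"
proof -
 obtain d where "evt x. (f has_real_derivative d x) (at x)"
  using hardy_derivative[OF assms] by blast
 then obtain a where a: "!!x. a <= x ==> (f has_real_derivative d x) (at x)" by (auto simp: eventually_at_top_linorder)
 have cont: "continuous_on {a..b} f" for b
  by (rule DERIV_continuous_on[where D = d], rule has_field_derivative_at_within, rule a) simp
 have "((%x. integral {a..x} f) has_real_derivative f x) (at x)" if "a < x" for x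
 proof -
  have "((%x. integral {a..x} f) has_real_derivative f x) (at x within {a..x + 1})"
   by (rule integral_has_real_derivative[OF cont]) (use that in auto)
  then show ?thesis using that by (subst (asm) at_within_interior) auto
 qed
 then have "evt x. ((%x. integral {a..x} f) has_real_derivative f x) (at x)"
  using eventually_gt_at_top[of a] by (rule eventually_mono[rotated])
 then show ?thesis by (intro exI[of _ "%x. integral {a..x} f"])
qed

text \<open>Integral test: the derivative of \<open>f\<close> has an eventual sign, so
  \<open>f\<close> is eventually monotone. By the mean value theorem the increments of
  \<open>F\<close> between consecutive integers are values of \<open>f\<close> in between; a bounded
  \<open>F\<close> would therefore bound the series by a telescoping one, on the left or on the
  right end points according to the direction of monotonicity.\<close>

lemma hardy_divergent_primitive:
 assumes G: "hardy G" and f: "f \<in> ratR G" "evt x. 0 < f x"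
  and F: "evt x. (F has_real_derivative f x) (at x)"
  and div: "\<not> summable (%q::nat. f (real q))"
 shows "filterlim F at_top at_top"
proof (rule ccontr)
 assume "\<not> ?thesis"
 then obtain C where C: "\<not> (evt x. C <= F x)" by (auto simp: filterlim_at_top)
 obtain d where d: "d \<in> ratR G" "evt x. (f has_real_derivative d x) (at x)"
  using hardy_derivative[OF G f(1)] by blast
 have "(evt x. 0 <= d x) \<or> (evt x. d x <= 0)"
  using hardy_sign[OF G d(1)] by (elim disjE) (simp_all add: eventually_mono[OF _ less_imp_le] eventually_mono[OF _ eq_refl])
 moreover have "\<exists>N::nat. \<forall>x\<ge>real N. 0 < f x & (F has_real_derivative f x) (at x) & (f has_real_derivative d x) (at x) & Q x"
  if "evt x. Q x" for Q
 proof -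
  have "evt x. 0 < f x & (F has_real_derivative f x) (at x) & (f has_real_derivative d x) (at x) & Q x"
   using f(2) F d(2) that by eventually_elim simp
  then obtain a where a: "\<forall>x\<ge>a. 0 < f x & (F has_real_derivative f x) (at x) & (f has_real_derivative d x) (at x) & Q x"
   unfolding eventually_at_top_linorder by blast
  obtain N where "a <= real N" using real_arch_simple by blast
  then show ?thesis using a by (intro exI[of _ N]) auto
 qed
 ultimately obtain N where N: "!!x. real N <= x ==> 0 < f x & (F has_real_derivative f x) (at x) & (f has_real_derivative d x) (at x)"
  and sgn: "(\<forall>x\<ge>real N. 0 <= d x) \<or> (\<forall>x\<ge>real N. d x <= 0)" by metis
 have mono: "F x <= F y" if "real N <= x" "x <= y" for x y
 proof (rule DERIV_nonneg_imp_nondecreasing[OF that(2)])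
  fix z assume "x <= z"
  then have "real N <= z" using that by simp
  from N[OF this] show "EX y. (F has_real_derivative y) (at z) & 0 <= y" by (intro exI[of _ "f z"]) simp
 qed
 have bdd: "F x <= C" if "real N <= x" for x
 proof (rule ccontr)
  assume "\<not> F x <= C"
  then have "C <= F y" if "x <= y" for y using mono[OF \<open>real N <= x\<close> that] by simp
  then show False using C eventually_at_top_linorderI[of x "%x. C <= F x"] by blast
 qed
 have inc: "incseq (%q. F (real (N + q)))" by (intro incseq_SucI mono) auto
 have "EX L. (%q. F (real (N + q))) \<longlonglongrightarrow> L"
  by (rule incseq_convergent[OF inc, of C]) (use bdd in auto)
 then obtain L where "(%q. F (real (N + q))) \<longlonglongrightarrow> L" by (elim exE)
 from telescope_summable[OF this]
 have sm: "summable (%q. F (real (N + Suc q)) - F (real (N + q)))" .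
 have mvt: "EX z. real (N + q) < z & z < real (N + Suc q) & F (real (N + Suc q)) - F (real (N + q)) = f z" for q
 proof -
  have "EX z. real (N + q) < z & z < real (N + Suc q) & F (real (N + Suc q)) - F (real (N + q)) = (real (N + Suc q) - real (N + q)) * f z"
   by (rule MVT2) (use N in auto)
  then show ?thesis by auto
 qed
 from sgn have "summable (%q. f (real q))"
 proof
  assume s: "\<forall>x\<ge>real N. 0 <= d x"
  have "summable (%q. f (real (q + N)))"
  proof (rule summable_comparison_test'[OF sm])
   fix q
   obtain z where z: "real (N + q) < z" "F (real (N + Suc q)) - F (real (N + q)) = f z" using mvt[of q] by blast
   have "f (real (N + q)) <= f z"
   proof (rule DERIV_nonneg_imp_nondecreasing[OF less_imp_le[OF z(1)]])
    fix y assume "real (N + q) <= y"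
    then have "real N <= y" by simp
    then show "EX l. (f has_real_derivative l) (at y) & 0 <= l" using N[of y] s by (intro exI[of _ "d y"]) simp
   qed
   then show "norm (f (real (q + N))) <= F (real (N + Suc q)) - F (real (N + q))"
    using N[of "real (q + N)"] z(2) by (simp add: add.commute)
  qed
  then show ?thesis by (simp only: summable_iff_shift[of "%q. f (real q)"])
 next
  assume s: "\<forall>x\<ge>real N. d x <= 0"
  have "summable (%q. f (real (q + Suc N)))"
  proof (rule summable_comparison_test'[OF sm])
   fix q
   obtain z where z: "real (N + q) < z" "z < real (N + Suc q)" "F (real (N + Suc q)) - F (real (N + q)) = f z" using mvt[of q] by blast
   have "f (real (N + Suc q)) <= f z"
   proof (rule DERIV_nonpos_imp_nonincreasing[OF less_imp_le[OF z(2)]])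
    fix y assume "z <= y"
    then have "real N <= y" using z(1) by simp
    then show "EX l. (f has_real_derivative l) (at y) & l <= 0" using N[of y] s by (intro exI[of _ "d y"]) simp
   qed
   then show "norm (f (real (q + Suc N))) <= F (real (N + Suc q)) - F (real (N + q))"
    using N[of "real (q + Suc N)"] z(3) by (simp add: ac_simps)
  qed
  then show ?thesis by (simp only: summable_iff_shift[of "%q. f (real q)"])
 qed
 then show False using div by blast
qed

text \<open>The \<open>m\<close>-th power of \<open>h_fun m n j\<close> times
  \<open>t^(n - 1)\<close> is the derivative of the iterated logarithm of order
  \<open>Suc j\<close>. A primitive that exceeds the iterated logarithm of order \<open>j\<close>
  cannot have a smaller derivative throughout, and inside a Hardy field derivatives are
  comparable.\<close>

theorem Hardy_L_ge_h_fun: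
 assumes \<psi>: "Hardy_L \<psi>" "evt t. 0 <= \<psi> t" and mn: "0 < m" "0 < n"
  and div: "\<not> summable (%q::nat. real q ^ (n - 1) * \<psi> (real q) ^ m)"
 shows "\<exists>j\<ge>i. evt t. h_fun m n j t <= \<psi> t"
proof -
 obtain e t0 where e: "!!t. t0 < t ==> L_defined e t & \<psi> t = L_val e t" using \<psi>(1) unfolding Hardy_L_def by blast
 have ev: "evt t. L_defined e t" "evt t. \<psi> t = L_val e t"
  using e by (auto intro!: eventually_mono[OF eventually_gt_at_top[of t0]])
 obtain G where G: "hardy G" "finite G" "{%x. x} \<subseteq> G" "L_val e \<in> ratR G"
  using hardy_L_expr[OF ev(1) hardy_id] by auto
 have id: "(%x. x) \<in> G" using G(3) by simp
 have \<psi>G: "\<psi> \<in> ratR G" by (rule ratR_ev_eq[OF G(4) ev(2)])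
 define f where "f t = t ^ (n - 1) * \<psi> t ^ m" for t
 have fG: "f \<in> ratR G" unfolding f_def by (intro ratR_mult ratR_power \<psi>G ratR_poly[OF polyR.gen[OF id]])
 have div': "\<not> summable (%q::nat. f (real q))" using div by (simp add: f_def)
 have fpos: "evt t. 0 < f t"
  using hardy_sign[OF G(1) fG]
 proof (elim disjE)
  assume "evt t. f t = 0"
  then have "\<forall>\<^sub>F q in sequentially. f (real q) = 0"
   by (rule eventually_compose_filterlim[OF _ filterlim_real_sequentially])
  then have "summable (%q::nat. f (real q)) = summable (%q::nat. 0::real)" by (rule summable_cong)
  then show ?thesis using div' by simp
 next
  assume neg: "evt t. f t < 0"
  have "evt t::real. False"
   using neg \<psi>(2) eventually_gt_at_top[of 0]
  proof eventually_elim
   case (elim t)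
   have "0 <= f t" unfolding f_def using elim by simp
   then show ?case using elim by simp
  qed
  then show ?thesis by simp
 qed
 obtain F where F: "evt t. (F has_real_derivative f t) (at t)"
  using hardy_primitive[OF G(1) fG] by (elim exE)
 have Ftop: "filterlim F at_top at_top" by (rule hardy_divergent_primitive[OF G(1) fG fpos F div'])
 obtain j0 where j0: "evt t. (ln ^^ j0) t <= F t"
  using hardy_primitive_ge_ln_iter[OF G(1,2) id fG fpos F Ftop] by (elim exE)
 \<comment> \<open>Raising the order keeps the lower bound for \<open>F\<close>, as iterated
   logarithms decrease with their order, and provides \<open>j >= i\<close>, needed to transfer the
   hypothesis on \<open>\<alpha>\<close>.\<close>
 define j where "j = max i j0"
 have Fj: "evt t. (ln ^^ j) t <= F t"
 proof -
  have "evt t::real. (ln ^^ j) t <= (ln ^^ j0) t" by (rule ln_iter_antimono) (simp add: j_def)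
  with j0 show ?thesis by eventually_elim (rule order_trans)
 qed
 obtain H where H: "hardy H" "finite H" "G \<subseteq> H" "\<forall>l\<le>j. (%x. (ln ^^ l) x) \<in> H"
  using hardy_insert_ln_iter[OF G(1,2) id, of j] by (elim exE conjE)
 \<comment> \<open>The derivative of the iterated logarithm of order \<open>Suc j\<close>. If
   \<open>f < w\<close> eventually, \<open>F\<close> would be at most that logarithm plus a
   constant, although it exceeds the one of order \<open>j\<close>.\<close>
 define w where "w t = 1 / (t * (\<Prod>l=1..j. (ln ^^ l) t))" for t :: real
 have "evt t::real. \<forall>l\<in>{..j}. 0 < (ln ^^ l) t"
  using filterlim_ln_iter by (intro eventually_ball_finite) (auto simp: filterlim_at_top_dense)
 then have lpos: "evt t::real. 0 < t & 0 < (\<Prod>l=1..j. (ln ^^ l) t)"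
  using eventually_gt_at_top[of 0] by eventually_elim (auto intro!: prod_pos)
 have prodH: "(%t. \<Prod>l=1..k. (ln ^^ l) t) \<in> polyR H" if "k <= j" for k
  using that
 proof (induction k)
  case (Suc k)
  then have "(%t. (ln ^^ Suc k) t) \<in> polyR H" using H(4) by (intro polyR.gen) blast
  from polyR.mult[OF this Suc.IH] Suc.prems show ?case by (simp add: prod.nat_ivl_Suc' mult.commute)
 qed (simp add: polyR.const)
 have wH: "w \<in> ratR H"
 proof (rule ratR_I)
  show "evt t. t * (\<Prod>l=1..j. (ln ^^ l) t) ~= 0 & w t = 1 / (t * (\<Prod>l=1..j. (ln ^^ l) t))"
   using lpos
  proof eventually_elim
   case (elim t)
   then have "0 < t * (\<Prod>l=1..j. (ln ^^ l) t)" by (intro mult_pos_pos) auto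
   then show ?case unfolding w_def by (intro conjI refl) linarith
  qed
  show "(%t. t * (\<Prod>l=1..j. (ln ^^ l) t)) \<in> polyR H"
   using id H(3) by (intro polyR.mult polyR.gen prodH) auto
 qed (rule polyR.const)
 have "f \<in> ratR H" using fG ratR_mono[OF H(3)] by blast
 then have "(%t. f t - w t) \<in> ratR H" by (intro ratR_diff wH)
 from hardy_sign[OF H(1) this] have wf: "evt t. w t <= f t"
 proof (elim disjE)
  assume neg: "evt t. f t - w t < 0"
  have "evt t. ((%t. F t - (ln ^^ Suc j) t) has_real_derivative f t - w t) (at t) & f t - w t <= 0"
   using F neg ln_iter_derivative[of j]
  proof eventually_elim
   case (elim t)
   then show ?case unfolding w_def by (intro conjI DERIV_diff) auto
  qed
  from eventually_bounded_of_derivative_nonpos[OF this] obtain c where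
   c: "evt t. F t - (ln ^^ Suc j) t <= c" by (elim exE)
  have "filterlim (%y::real. y - ln y) at_top at_top" by real_asymp
  then have "filterlim (%t::real. (ln ^^ j) t - ln ((ln ^^ j) t)) at_top at_top"
   by (rule filterlim_compose[OF _ filterlim_ln_iter])
  then have "evt t::real. c + 1 <= (ln ^^ j) t - ln ((ln ^^ j) t)" unfolding filterlim_at_top by blast
  with c Fj have "evt t::real. False" by eventually_elim simp
  then show ?thesis by simp
 next
  assume "evt t. f t - w t = 0"
  then show ?thesis by eventually_elim simp
 next
  assume "evt t. 0 < f t - w t"
  then show ?thesis by eventually_elim simp
 qed
 have "evt t. h_fun m n j t <= \<psi> t"
  using wf lpos \<psi>(2)
 proof eventually_elim
  case (elim t)
  define P where "P = (\<Prod>l=1..j. (ln ^^ l) t)"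
  have P: "0 < t" "0 < P" using elim(2) by (simp_all add: P_def)
  have tn: "t ^ n = t * t ^ (n - 1)" using mn(2) by (cases n) simp_all
  have "1 / (t * P) <= t ^ (n - 1) * \<psi> t ^ m" using elim(1) by (simp add: w_def f_def P_def)
  then have "1 / (t ^ n * P) <= \<psi> t ^ m" unfolding tn using P by (simp add: field_simps)
  then have "(1 / (t ^ n * P)) powr (1 / real m) <= (\<psi> t ^ m) powr (1 / real m)"
   using P by (intro powr_mono2) auto
  also have "(\<psi> t ^ m) powr (1 / real m) = \<psi> t"
  proof (cases "\<psi> t = 0")
   case False
   then have "0 < \<psi> t" using elim(3) by simp
   then show ?thesis using mn(1) by (simp add: powr_realpow[symmetric] powr_powr)
  qed (use mn(1) in simp)
  finally show ?case using P by (simp add: h_fun_def P_def powr_divide)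
 qed
 then show ?thesis by (intro exI[of _ j]) (simp add: j_def)
qed

section \<open>Asymptotics of \<open>h_fun\<close> and \<open>phi_fun\<close>\<close>

definition ln_prod :: "nat => real => real" where
 "ln_prod j x = (\<Prod>l=1..j. (ln ^^ l) x)"

lemma h_fun_eq: "h_fun m n j x = 1 / (x ^ n * ln_prod j x) powr (1 / real m)"
 by (simp add: h_fun_def ln_prod_def)

lemma inverse_powr_antimono: "0 < u ==> u <= v ==> 0 <= a ==> 1 / v powr a <= 1 / (u::real) powr a"
 by (intro frac_le powr_mono2) auto

lemma inverse_root_power: "0 < u ==> 0 < m ==> (1 / u powr (1 / real m)) ^ m = 1 / u"
 by (simp add: power_divide powr_power)

lemma ln_iter_ge_1: "\<exists>X\<ge>1. \<forall>x\<ge>X. \<forall>l\<le>j. 1 <= (ln ^^ l) (x::real)"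
proof -
 have "evt x::real. \<forall>l\<in>{..j}. 1 <= (ln ^^ l) x"
  using filterlim_ln_iter by (intro eventually_ball_finite) (auto simp: filterlim_at_top)
 then obtain X where "\<forall>x\<ge>X. \<forall>l\<in>{..j}. 1 <= (ln ^^ l) (x::real)" unfolding eventually_at_top_linorder by blast
 then show ?thesis by (intro exI[of _ "max 1 X"]) auto
qed

text \<open>Beyond \<open>X\<close> all iterated logarithms in play are at least 1, so positivity
  and monotonicity hold pointwise instead of eventually.\<close>

locale ln_range =
 fixes j :: nat and X :: real
 assumes X_ge_1: "1 <= X" and ge_1: "X <= x ==> l <= Suc j ==> 1 <= (ln ^^ l) x"
begin

lemma ln_iter_mono: "X <= x ==> x <= y ==> l <= Suc j ==> (ln ^^ l) x <= (ln ^^ l) y"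
proof (induction l)
 case (Suc l)
 then have "(ln ^^ l) x <= (ln ^^ l) y" "1 <= (ln ^^ l) x" using ge_1[of x l] by simp_all
 then show ?case by simp
qed simp

lemma ln_prod_ge_1: "X <= x ==> 1 <= ln_prod j x"
 unfolding ln_prod_def by (intro prod_ge_1) (auto intro: ge_1)

lemma ln_prod_mono: "X <= x ==> x <= y ==> ln_prod j x <= ln_prod j y"
 unfolding ln_prod_def by (intro prod_mono conjI ln_iter_mono order_trans[OF zero_le_one ge_1]) auto

lemma ln_prod_le: "X <= x ==> ln_prod j x <= ln x ^ j"
proof -
 assume x: "X <= x"
 have "(ln ^^ l) x <= ln x" if "1 <= l" "l <= j" for l
  using that
 proof (induction l rule: dec_induct)
  case (step l)
  then show ?case using ln_le_minus_one[of "(ln ^^ l) x"] ge_1[OF x, of l] by simp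
 qed simp
 then have "ln_prod j x <= (\<Prod>l=1..j. ln x)"
  unfolding ln_prod_def by (intro prod_mono conjI order_trans[OF zero_le_one ge_1[OF x]]) auto
 then show ?thesis by simp
qed

text \<open>Slow variation: squaring the argument at most doubles each iterated logarithm. It allows
  the argument \<open>y * t\<close> with \<open>t <= y\<close> to be replaced by \<open>y\<close> at
  the cost of a constant.\<close>

lemma ln_prod_square: "X <= x ==> ln_prod j (x ^ 2) <= 2 ^ j * ln_prod j x"
proof -
 assume x: "X <= x"
 have xx: "X <= x ^ 2" using x X_ge_1 power_increasing[of 1 2 x] by simp
 have "(ln ^^ l) (x ^ 2) <= 2 * (ln ^^ l) x" if "1 <= l" "l <= j" for l
  using that
 proof (induction l rule: dec_induct)
  case base
  then show ?case using x X_ge_1 by (simp add: ln_realpow)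
 next
  case (step l)
  have l: "1 <= (ln ^^ l) x" "1 <= (ln ^^ l) (x ^ 2)" "1 <= (ln ^^ Suc l) x"
   using ge_1[OF x, of l] ge_1[OF xx, of l] ge_1[OF x, of "Suc l"] step by simp_all
  have "(ln ^^ Suc l) (x ^ 2) <= ln (2 * (ln ^^ l) x)" using step l by simp
  also have "... = ln 2 + (ln ^^ Suc l) x" using l by (simp add: ln_mult)
  also have "... <= 2 * (ln ^^ Suc l) x" using l(3) ln_le_minus_one[of "2::real"] by linarith
  finally show ?case .
 qed
 then have "ln_prod j (x ^ 2) <= (\<Prod>l=1..j. 2 * (ln ^^ l) x)"
  unfolding ln_prod_def by (intro prod_mono conjI order_trans[OF zero_le_one ge_1[OF xx]]) auto
 then show ?thesis by (simp add: prod.distrib ln_prod_def)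
qed

lemma h_fun_pos: "X <= x ==> 0 < h_fun m n j x"
 unfolding h_fun_eq using ln_prod_ge_1[of x] X_ge_1 by simp

lemma h_fun_mono:
 assumes "X <= x" "x <= y" shows "h_fun m n j y <= h_fun m n j x"
proof -
 have *: "0 < x ^ n * ln_prod j x" using ln_prod_ge_1[of x] X_ge_1 assms by simp
 have "x ^ n * ln_prod j x <= y ^ n * ln_prod j y"
  using assms X_ge_1 ln_prod_mono[OF assms] ln_prod_ge_1[of x] by (intro mult_mono power_mono) auto
 then show ?thesis unfolding h_fun_eq by (intro inverse_powr_antimono *) simp_all
qed

lemma h_fun_power:
 assumes "X <= x" "0 < m" shows "h_fun m n j x ^ m = 1 / (x ^ n * ln_prod j x)"
proof -
 have "0 < x ^ n * ln_prod j x" using ln_prod_ge_1[of x] X_ge_1 assms by simp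
 then show ?thesis unfolding h_fun_eq using assms(2) by (rule inverse_root_power)
qed

lemma h_fun_le: "X <= x ==> 0 < m ==> 0 < n ==> h_fun m n j x <= x powr (- 1 / real m)"
proof -
 assume x: "X <= x" and mn: "0 < m" "0 < n"
 have "x ^ 1 * 1 <= x ^ n * ln_prod j x"
  using x X_ge_1 ln_prod_ge_1[OF x] mn by (intro mult_mono power_increasing) auto
 then have "x powr (1 / real m) <= (x ^ n * ln_prod j x) powr (1 / real m)"
  using x X_ge_1 by (intro powr_mono2) auto
 then show ?thesis unfolding h_fun_eq using x X_ge_1
  by (simp add: powr_minus divide_simps) 
qed

end

text \<open>The only increasing factor is \<open>ln (ln x)\<close>. It is paired with
  \<open>x powr (- 1 / m)\<close>, split off from the power of \<open>x\<close> in
  \<open>h_fun\<close>; the product \<open>g\<close> is eventually decreasing, and the remaining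
  factor is \<open>h_fun\<close> with exponent \<open>n - 1\<close>.\<close>

lemma phi_fun_decreasing:
 assumes "0 < m" "0 < n"
 shows "EX T. ALL x y. T <= x --> x <= y --> 0 < phi_fun m n j y & phi_fun m n j y <= phi_fun m n j x"
proof -
 have m: "0 < real m" using assms by simp
 have "evt x::real. 1 / ln x <= ln (ln x) / real m"
  using m by real_asymp
 moreover have "evt x::real. 1 < ln x" by real_asymp
 moreover have "evt x::real. 0 < ln (ln x)" by real_asymp
 ultimately have "evt x::real. 1 / ln x <= ln (ln x) / real m & 1 < ln x & 0 < ln (ln x)"
  by eventually_elim simp
 then obtain T0 where T0: "!!x::real. T0 <= x ==> 1 / ln x <= ln (ln x) / real m & 1 < ln x & 0 < ln (ln x)"
  unfolding eventually_at_top_linorder by blast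
 obtain X where X: "1 <= X" "\<forall>x\<ge>X. \<forall>l\<le>Suc j. 1 <= (ln ^^ l) (x::real)" using ln_iter_ge_1[of "Suc j"] by blast
 interpret ln_range j X by unfold_locales (use X in auto)
 define g where "g x = ln (ln x) * x powr (- 1 / real m)" for x
 have g: "g y <= g x" if "max T0 X <= x" "x <= y" for x y
 proof (rule DERIV_nonpos_imp_nonincreasing[OF that(2)])
  fix z assume z: "x <= z"
  then have z0: "0 < z" "1 < ln z" "1 / ln z <= ln (ln z) / real m" using that T0[of z] X_ge_1 by auto
  have "(g has_real_derivative z powr (- 1 / real m) / z * (1 / ln z - ln (ln z) / real m)) (at z)"
  proof -
   define a where "a = - 1 / real m"
   have "1 < z" using z0(1,2) ln_gt_zero_iff[of z] by linarith
   then have 1: "((%z. ln (ln z)) has_real_derivative 1 / ln z * (1 / z)) (at z)"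
    using z0(2) by (auto intro!: derivative_eq_intros)
   have "z powr (a - 1) = z powr a / z" using z0(1) by (simp add: powr_diff)
   moreover have "W / z * (1 / l - L / M) = 1 / l * (1 / z) * W + (- 1 / M) * (W / z) * L" for W l L M :: real
    by (simp add: right_diff_distrib mult_ac)
   ultimately have "z powr a / z * (1 / ln z - ln (ln z) / real m) = 1 / ln z * (1 / z) * z powr a + a * z powr (a - 1) * ln (ln z)"
    unfolding a_def by simp
   then show ?thesis
    using DERIV_mult[OF 1 has_real_derivative_powr[OF z0(1), of a]] unfolding g_def a_def by simp
  qed
  moreover have "z powr (- 1 / real m) / z * (1 / ln z - ln (ln z) / real m) <= 0"
   using z0 by (intro mult_nonneg_nonpos) auto
  ultimately show "EX d. (g has_real_derivative d) (at z) & d <= 0" by blast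
 qed
 have eq: "phi_fun m n j x = g x * h_fun m (n - 1) j x" if "max T0 X <= x" for x
 proof -
  have x: "0 < x" "1 <= ln_prod j x" using that X_ge_1 ln_prod_ge_1[of x] by auto
  have "x ^ n * ln_prod j x = x * (x ^ (n - 1) * ln_prod j x)" using assms by (cases n) simp_all
  then show ?thesis using x by (simp add: phi_fun_def h_fun_eq g_def powr_mult powr_minus divide_simps)
 qed
 have "0 < phi_fun m n j y & phi_fun m n j y <= phi_fun m n j x" if xy: "max T0 X <= x" "x <= y" for x y
 proof -
  have p: "0 < g y" using T0[of y] xy X_ge_1 by (simp add: g_def)
  have q: "0 < h_fun m (n - 1) j y" "h_fun m (n - 1) j y <= h_fun m (n - 1) j x"
   using xy by (auto intro: h_fun_pos h_fun_mono)
  have "g y * h_fun m (n - 1) j y <= g x * h_fun m (n - 1) j x"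
   using g[OF xy] p q by (intro mult_mono) auto
  then show ?thesis using eq[of x] eq[of y] xy p q by simp
 qed
 then show ?thesis by blast
qed

lemma phi_fun_tendsto_0:
 assumes "0 < m" "0 < n" shows "((phi_fun m n j) \<longlongrightarrow> 0) at_top"
proof -
 obtain X where X: "1 <= X" "\<forall>x\<ge>X. \<forall>l\<le>Suc j. 1 <= (ln ^^ l) (x::real)" using ln_iter_ge_1[of "Suc j"] by blast
 interpret ln_range j X by unfold_locales (use X in auto)
 have lnln: "evt x::real. 0 <= ln (ln x)" by real_asymp
 show ?thesis
 proof (rule tendsto_sandwich)
  show "evt x. 0 <= phi_fun m n j x"
   using lnln eventually_ge_at_top[of X]
  proof eventually_elim
   case (elim x)
   then show ?case using h_fun_pos[of x m n] by (simp add: phi_fun_def)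
  qed
  show "evt x. phi_fun m n j x <= x powr (- 1 / real m) * ln (ln x)"
   using lnln eventually_ge_at_top[of X]
  proof eventually_elim
   case (elim x)
   then show ?case unfolding phi_fun_def using h_fun_le[of x m n] assms by (intro mult_right_mono) auto
  qed
  have "0 < 1 / real m" using assms by simp
  then have "((%x::real. x powr (- (1 / real m)) * ln (ln x)) \<longlongrightarrow> 0) at_top" by real_asymp
  then show "((%x::real. x powr (- 1 / real m) * ln (ln x)) \<longlongrightarrow> 0) at_top" by simp
 qed simp
qed

lemma phi_fun_antimono:
 assumes "i <= j" shows "evt x. phi_fun m n j x <= phi_fun m n i x"
proof -
 obtain X where X: "1 <= X" "\<forall>x\<ge>X. \<forall>l\<le>Suc j. 1 <= (ln ^^ l) (x::real)" using ln_iter_ge_1[of "Suc j"] by blast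
 have "evt x::real. 0 <= ln (ln x)" by real_asymp
 then show ?thesis
  using eventually_ge_at_top[of X]
 proof eventually_elim
  case (elim x)
  have l: "1 <= (ln ^^ l) x" if "l <= j" for l using X(2) elim(2) that by simp
  have "{1..j} = {1..i} \<union> {Suc i..j}" using assms by auto
  then have split: "ln_prod j x = ln_prod i x * (\<Prod>l=Suc i..j. (ln ^^ l) x)"
   unfolding ln_prod_def by (simp add: prod.union_disjoint)
  have p: "1 <= ln_prod i x" unfolding ln_prod_def by (intro prod_ge_1) (use l assms in auto)
  have "1 <= (\<Prod>l=Suc i..j. (ln ^^ l) x)" by (intro prod_ge_1) (use l in auto)
  then have "ln_prod i x <= ln_prod j x" unfolding split using p mult_left_mono[of 1 _ "ln_prod i x"] by simp
  then have "x ^ n * ln_prod i x <= x ^ n * ln_prod j x" using elim X(1) by (intro mult_left_mono) auto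
  moreover have x: "0 < x ^ n * ln_prod i x" using p elim X(1) by simp
  ultimately have "h_fun m n j x <= h_fun m n i x" unfolding h_fun_eq by (intro inverse_powr_antimono) simp_all
  then show ?case unfolding phi_fun_def using elim by (intro mult_right_mono)
 qed
qed

section \<open>Separation from the Diophantine hypothesis\<close>

lemma int_vecs_scaleR: "x \<in> int_vecs ==> of_nat k *\<^sub>R x \<in> int_vecs"
 by (simp add: int_vecs_def)

lemma norm_int_vec_ge_1: "x \<in> int_vecs ==> x ~= 0 ==> 1 <= norm x"
proof -
 assume x: "x \<in> int_vecs" "x ~= 0"
 then obtain i where i: "x $ i ~= 0" by (auto simp: vec_eq_iff)
 have "x $ i \<in> \<int>" using x by (simp add: int_vecs_def)
 then have "1 <= \<bar>x $ i\<bar>" using i Ints_nonzero_abs_ge1 by blast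
 then show ?thesis using component_le_norm_cart[of x i] by linarith
qed

text \<open>Small vectors are brought into the asymptotic range by passing to a multiple.\<close>

lemma not_approximable_uniform:
 fixes \<alpha> :: "real^'n^'m"
 assumes na: "\<not> approximable (phi_fun CARD('m) CARD('n) i) \<alpha>" and ij: "i <= j"
 shows "EX Q0. \<forall>Q\<ge>Q0. \<forall>p\<in>int_vecs. \<forall>q\<in>int_vecs - {0}. norm q <= Q -->
  phi_fun CARD('m) CARD('n) j Q < norm (\<alpha> *v q + p)"
proof -
 let ?\<phi> = "phi_fun CARD('m) CARD('n)"
 define S where "S = {(p, q). p \<in> int_vecs & q \<in> int_vecs - {0} & norm (\<alpha> *v q + p) <= ?\<phi> i (norm q)}"
 have fin: "finite S" using na by (simp add: approximable_def S_def)
 obtain T1 where T1: "!!x y. T1 <= x ==> x <= y ==> 0 < ?\<phi> j y & ?\<phi> j y <= ?\<phi> j x"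
  using phi_fun_decreasing[of "CARD('m)" "CARD('n)" j] by auto
 obtain T2 where T2: "!!x. T2 <= x ==> ?\<phi> j x <= ?\<phi> i x"
  using phi_fun_antimono[OF ij, of "CARD('m)" "CARD('n)"] unfolding eventually_at_top_linorder by blast
 define T where "T = Max {T1, T2, 1}"
 have T: "T1 <= T" "T2 <= T" "1 <= T" by (simp_all add: T_def)
 have scaled: "\<alpha> *v (real k *\<^sub>R q) + real k *\<^sub>R p = real k *\<^sub>R (\<alpha> *v q + p)" for k p q
  by (simp add: matrix_vector_mult_scaleR scaleR_add_right)
 \<comment> \<open>An exact zero would persist under all integer multiples and give infinitely many
   approximations.\<close>
 have pos: "0 < norm (\<alpha> *v q + p)" if pq: "p \<in> int_vecs" "q \<in> int_vecs - {0}" for p q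
 proof (rule ccontr)
  assume "\<not> ?thesis"
  then have z: "\<alpha> *v q + p = 0" by simp
  obtain K :: nat where K: "T <= real K" using real_arch_simple by blast
  have "(real k *\<^sub>R p, real k *\<^sub>R q) \<in> S" if k: "k \<ge> K" for k
  proof -
   have "T <= real k" using K k by linarith
   also have "... <= real k * norm q" using norm_int_vec_ge_1[of q] pq mult_left_mono[of 1 "norm q" "real k"] by simp
   finally have nq: "T <= norm (real k *\<^sub>R q)" by simp
   have "0 <= ?\<phi> i (norm (real k *\<^sub>R q))"
    using T1[of "norm (real k *\<^sub>R q)" "norm (real k *\<^sub>R q)"] T2[of "norm (real k *\<^sub>R q)"] nq T by linarith
   moreover have "real k *\<^sub>R q ~= 0"
   proof
    assume "real k *\<^sub>R q = 0"
    then show False using nq T by (simp only: norm_zero)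
   qed
   ultimately show ?thesis using int_vecs_scaleR[of p k] int_vecs_scaleR[of q k] pq scaled[of k q p] z
    by (simp add: S_def)
  qed
  then have "(%k. (real k *\<^sub>R p, real k *\<^sub>R q)) ` {K..} \<subseteq> S" by auto
  then have "finite ((%k. (real k *\<^sub>R p, real k *\<^sub>R q)) ` {K..})" using fin finite_subset by blast
  moreover have "inj_on (%k. (real k *\<^sub>R p, real k *\<^sub>R q)) {K..}" using pq by (auto intro!: inj_onI)
  ultimately have "finite {K..}" by (simp add: finite_image_iff)
  then show False by (simp add: infinite_Ici)
 qed
 define \<mu> where "\<mu> = Min (insert 1 ((%(p, q). norm (\<alpha> *v q + p)) ` S))"
 have \<mu>: "0 < \<mu>" unfolding \<mu>_def using fin pos by (subst Min_gr_iff) (auto simp: S_def)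
 have \<mu>S: "\<mu> <= norm (\<alpha> *v q + p)" if "(p, q) \<in> S" for p q
  unfolding \<mu>_def using fin that by (intro Min_le) force+
 have large: "min \<mu> (?\<phi> j Q) <= norm (\<alpha> *v q + p)"
  if pq: "p \<in> int_vecs" "q \<in> int_vecs - {0}" "T <= norm q" "norm q <= Q" for p q Q
 proof (cases "(p, q) \<in> S")
  case True
  then show ?thesis using \<mu>S[of p q] by simp
 next
  case False
  then have "?\<phi> i (norm q) < norm (\<alpha> *v q + p)" using pq by (auto simp: S_def)
  then show ?thesis using T1[of "norm q" Q] T2[of "norm q"] pq T by linarith
 qed
 \<comment> \<open>For a short \<open>q\<close> the multiple \<open>K * q\<close> has norm between
   \<open>T\<close> and \<open>K * T\<close>, so the bound for long vectors applies to it; division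
   by \<open>K\<close> yields a constant \<open>c\<close> valid for all short \<open>q\<close> at
   once.\<close>
 obtain K :: nat where K: "T <= real K" using real_arch_simple by blast
 have K1: "1 <= real K" using K T by linarith
 define c where "c = min \<mu> (?\<phi> j (real K * T)) / real K"
 have "T <= real K * T" using K1 T mult_right_mono[of 1 "real K" T] by simp
 then have "0 < ?\<phi> j (real K * T)" using T1[of "real K * T" "real K * T"] T by linarith
 then have c: "0 < c" unfolding c_def using \<mu> K1 by (intro divide_pos_pos) auto
 have small: "c <= norm (\<alpha> *v q + p)" if pq: "p \<in> int_vecs" "q \<in> int_vecs - {0}" "norm q <= T" for p q
 proof -
  have "K ~= 0" using K1 by auto
  have "T <= real K * norm q" using K norm_int_vec_ge_1[of q] pq(2) mult_mono[of T "real K" 1 "norm q"] T by simp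
  then have "min \<mu> (?\<phi> j (real K * T)) <= norm (\<alpha> *v (real K *\<^sub>R q) + real K *\<^sub>R p)"
   using pq K1 \<open>K ~= 0\<close> int_vecs_scaleR[of p K] int_vecs_scaleR[of q K] by (intro large) (auto intro: mult_left_mono)
  then show ?thesis unfolding scaled c_def using K1 by (simp add: pos_divide_le_eq mult.commute)
 qed
 have "evt Q. ?\<phi> j Q < min c \<mu>"
  using order_tendstoD(2)[OF phi_fun_tendsto_0[of "CARD('m)" "CARD('n)" j], of "min c \<mu>"] c \<mu> by simp
 then have "evt Q. ?\<phi> j Q < min c \<mu> & T <= Q" using eventually_ge_at_top[of T] by eventually_elim simp
 then obtain Q0 where Q0: "!!Q. Q0 <= Q ==> ?\<phi> j Q < min c \<mu> & T <= Q" unfolding eventually_at_top_linorder by blast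
 have "?\<phi> j Q < norm (\<alpha> *v q + p)" if Q: "Q0 <= Q" and pq: "p \<in> int_vecs" "q \<in> int_vecs - {0}" "norm q <= Q" for Q p q
 proof (cases "norm q <= T")
  case True
  then show ?thesis using small[OF pq(1,2)] Q0[OF Q] by simp
 next
  case False
  show ?thesis
  proof (cases "(p, q) \<in> S")
   case True
   then show ?thesis using \<mu>S[of p q] Q0[OF Q] by simp
  next
   case nS: False
   then have "?\<phi> i (norm q) < norm (\<alpha> *v q + p)" using pq by (auto simp: S_def)
   then show ?thesis using T1[of "norm q" Q] T2[of "norm q"] pq False T by linarith
  qed
 qed
 then show ?thesis by blast
qed

text \<open>The boxes are enlarged by a factor \<open>t\<close> of size about \<open>(ln k)^(1/n)\<close>; this costs the factor
 \<open>log log q\<close> in the hypothesis on \<open>\<alpha>\<close>.\<close>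

lemma twisted_parameters:
 fixes \<alpha> :: "real^'n^'m"
 assumes m: "2 <= CARD('m)"
  and na: "\<not> approximable (phi_fun CARD('m) CARD('n) i) \<alpha>" and ij: "i <= j"
 defines "\<rho> \<equiv> %k. h_fun CARD('m) CARD('n) j (real CARD('n) * 2 ^ k) / real CARD('m)"
 shows "EX t k0 A. twisted \<alpha> \<rho> t k0 A"
  and "\<not> summable (%k. \<rho> k ^ CARD('m) * 2 ^ (k * CARD('n)))"
proof -
 define m where "m = CARD('m)"
 define n where "n = CARD('n)"
 have mn: "2 <= m" "1 <= n" using assms(1) by (simp_all add: m_def n_def Suc_leI)
 obtain X where X: "1 <= X" "\<forall>x\<ge>X. \<forall>l\<le>Suc j. 1 <= (ln ^^ l) (x::real)" using ln_iter_ge_1[of "Suc j"] by blast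
 interpret ln_range j X by unfold_locales (use X in auto)
 \<comment> \<open>Bounds the Euclidean norm of a vector with entries at most \<open>2^k\<close>.
   Likewise the division by \<open>m\<close> in \<open>\<rho>\<close> turns the coordinatewise
   condition into one on the norm.\<close>
 define y where "y k = real n * 2 ^ k" for k :: nat
 have \<rho>: "\<rho> k = h_fun m n j (y k) / real m" for k by (simp add: \<rho>_def m_def n_def y_def)
 obtain Q0 where Q0: "!!Q p q. Q0 <= Q ==> p \<in> int_vecs ==> q \<in> int_vecs - {0} ==> norm q <= Q ==>
   phi_fun m n j Q < norm (\<alpha> *v q + p)"
  using not_approximable_uniform[OF na ij] unfolding m_def n_def by blast
 \<comment> \<open>The floor plus 1 keeps \<open>t\<close> a natural number that is at least the
   real root, so that \<open>t^n >= ln k\<close>.\<close>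
 define t where "t k = nat \<lfloor>ln (real k) powr (1 / real n)\<rfloor> + 1" for k :: nat
 have ytop: "filterlim y at_top sequentially"
 proof -
  have "0 < real n" using mn by simp
  then show ?thesis unfolding y_def by real_asymp
 qed
 have "\<forall>\<^sub>F k in sequentially. Q0 <= y k" "\<forall>\<^sub>F k in sequentially. X <= y k"
  using ytop by (simp_all add: filterlim_at_top)
 moreover have "\<forall>\<^sub>F k in sequentially. 1 <= ln (real k)" by real_asymp
 moreover have "\<forall>\<^sub>F k in sequentially. 4 * 2 ^ (m + n + j) <= ln (real k)" by real_asymp
 moreover have "\<forall>\<^sub>F k in sequentially. 2 <= ln (real k)" by real_asymp
 moreover have "\<forall>\<^sub>F k in sequentially. 2 * (ln (real k) + 1) <= 2 ^ k" by real_asymp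
 moreover have "\<forall>\<^sub>F k in sequentially. ln (real k) / 2 <= ln (real k * ln 2)" by real_asymp
 moreover have "\<forall>\<^sub>F k in sequentially. real m ^ m * real n ^ n <= real k" by real_asymp
 moreover have "\<forall>\<^sub>F k in sequentially. ln (real n) + real k * ln 2 <= real k ^ 2" by real_asymp
 ultimately have "\<forall>\<^sub>F k in sequentially. Q0 <= y k & X <= y k & 2 <= ln (real k) & 4 * 2 ^ (m + n + j) <= ln (real k)
  & 2 * (ln (real k) + 1) <= 2 ^ k & ln (real k) / 2 <= ln (real k * ln 2) & real m ^ m * real n ^ n <= real k
  & ln (real n) + real k * ln 2 <= real k ^ 2"
  by eventually_elim (intro conjI)
 then obtain k1 where k1: "!!k. k1 <= k ==> Q0 <= y k & X <= y k & 2 <= ln (real k) & 4 * 2 ^ (m + n + j) <= ln (real k)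
  & 2 * (ln (real k) + 1) <= 2 ^ k & ln (real k) / 2 <= ln (real k * ln 2) & real m ^ m * real n ^ n <= real k
  & ln (real n) + real k * ln 2 <= real k ^ 2"
  unfolding eventually_sequentially by blast
 define k0 where "k0 = max 2 k1"
 have k0: "2 <= k0" "k1 <= k0" by (simp_all add: k0_def)
 have \<rho>m: "\<rho> k ^ m = 1 / (real m ^ m * (y k ^ n * ln_prod j (y k)))" if "X <= y k" for k
  unfolding \<rho> power_divide using h_fun_power[OF that, of m n] mn by simp
 have \<rho>pow: "\<rho> k ^ m * 2 ^ (k * n) = 1 / (real m ^ m * real n ^ n * ln_prod j (y k))" if "X <= y k" for k
  unfolding \<rho>m[OF that] using mn ln_prod_ge_1[OF that] by (simp add: y_def power_mult_distrib power_mult)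
 have h_double: "2 * h_fun m n j (y k) <= phi_fun m n j (y k * real (t k))" if k: "k0 <= k" for k
 proof -
  define L where "L = ln (real k)"
  define z where "z = y k * real (t k)"
  from k1[of k] k k0 have K: "X <= y k" "2 <= L" "4 * 2 ^ (m + n + j) <= L" "2 * (L + 1) <= 2 ^ k" "L / 2 <= ln (real k * ln 2)"
   unfolding L_def by auto
  have r: "1 <= L powr (1 / real n)" "L powr (1 / real n) <= L"
   using K(2) mn ge_one_powr_ge_zero[of L "1 / real n"] powr_mono[of "1 / real n" 1 L] by auto
  have t: "1 <= real (t k)" "real (t k) <= L powr (1 / real n) + 1" unfolding t_def L_def[symmetric] using r(1) by auto
  have "real (t k) <= 2 * L powr (1 / real n)" using t r by linarith
  then have "real (t k) ^ n <= (2 * L powr (1 / real n)) ^ n" using t by (intro power_mono) auto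
  also have "... = 2 ^ n * L" using mn K(2) by (simp add: power_mult_distrib powr_power)
  finally have tn: "real (t k) ^ n <= 2 ^ n * L" .
  have y1: "2 ^ k <= y k" using mn by (simp add: y_def)
  have "real (t k) <= L + 1" using t r by linarith
  also have "... <= 2 * (L + 1)" using K(2) by simp
  also have "... <= 2 ^ k" by (rule K(4))
  finally have "real (t k) <= 2 ^ k" .
  then have ty: "real (t k) <= y k" using y1 by linarith
  have yz: "y k <= z" unfolding z_def using t mult_left_mono[of 1 "real (t k)" "y k"] by (simp add: y_def)
  have Xz: "X <= z" using K(1) yz by simp
  have zy: "z <= y k ^ 2" unfolding z_def power2_eq_square using ty K(1) X_ge_1 by (intro mult_left_mono) auto
  have Lz: "ln_prod j z <= 2 ^ j * ln_prod j (y k)"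
   using ln_prod_mono[OF Xz zy] ln_prod_square[OF K(1)] by linarith
  have "1 <= k" using k k0 by simp
  have "real k * ln 2 = ln (2 ^ k)" by (simp add: ln_realpow)
  also have "... <= ln z" by (rule ln_mono[OF order_trans[OF y1 yz]]) simp
  finally have "real k * ln 2 <= ln z" .
  then have ll: "L / 2 <= ln (ln z)" using K(5) \<open>1 <= k\<close> ln_mono[of "real k * ln 2" "ln z"] by simp
  then have ll1: "1 <= ln (ln z)" using K(2) by simp
  \<comment> \<open>Enlarging the box costs \<open>L\<close> times a constant, and
    \<open>ln (ln z) ^ m\<close> is at least \<open>(L / 2)^2\<close>: the exponent
    \<open>m >= 2\<close> outweighs the constant for large \<open>k\<close>.\<close>
  have "2 ^ (m + n + j) * L <= L * L / 4" using K(2,3) mult_right_mono[OF K(3), of L] by simp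
  also have "... = (L / 2) ^ 2" by (simp add: power2_eq_square)
  also have "... <= ln (ln z) ^ 2" using ll K(2) by (intro power_mono) auto
  also have "... <= ln (ln z) ^ m" using ll1 mn by (intro power_increasing)
  finally have main: "2 ^ (m + n + j) * L <= ln (ln z) ^ m" .
  have P: "1 <= ln_prod j z" "1 <= ln_prod j (y k)" "0 < y k" "0 < z"
   using ln_prod_ge_1 K(1) Xz X_ge_1 by auto
  have "2 ^ m * (z ^ n * ln_prod j z) <= 2 ^ m * (y k ^ n * (2 ^ n * L) * (2 ^ j * ln_prod j (y k)))"
   unfolding z_def power_mult_distrib using tn Lz P K(2) unfolding z_def
   by (intro mult_left_mono mult_mono) auto
  also have "... = (2 ^ (m + n + j) * L) * (y k ^ n * ln_prod j (y k))" by (simp add: power_add mult_ac)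
  also have "... <= ln (ln z) ^ m * (y k ^ n * ln_prod j (y k))" using main P by (intro mult_right_mono) auto
  finally have fin: "2 ^ m * (z ^ n * ln_prod j z) <= ln (ln z) ^ m * (y k ^ n * ln_prod j (y k))" .
  have "(2 * h_fun m n j (y k)) ^ m <= phi_fun m n j z ^ m"
  proof -
   have fr: "u * (1 / a) <= 1 / b * v" if "0 < a" "0 < b" "u * b <= v * a" for u v a b :: real
    using that by (simp add: field_simps)
   have "0 < m" using mn by simp
   show ?thesis
    unfolding phi_fun_def power_mult_distrib h_fun_power[OF K(1) \<open>0 < m\<close>] h_fun_power[OF Xz \<open>0 < m\<close>]
    by (rule fr) (use P fin in simp_all)
  qed
  then have "2 * h_fun m n j (y k) <= phi_fun m n j z"
   using mn h_fun_pos[OF Xz, of m n] ll1 by (subst (asm) power_mono_iff) (auto simp: phi_fun_def h_fun_eq)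
  then show ?thesis by (simp add: z_def)
 qed
 have "twisted \<alpha> \<rho> t k0 (2 * j + 1)"
 proof
  fix k assume k: "k0 <= k"
  with k1[of k] k0 have K: "Q0 <= y k" "X <= y k" "2 <= ln (real k)" "real m ^ m * real n ^ n <= real k"
   "ln (real n) + real k * ln 2 <= real k ^ 2" by auto
  show "0 < \<rho> k" unfolding \<rho> using h_fun_pos[OF K(2)] mn by simp
  have "h_fun m n j (y k) <= 1"
  proof -
   have "1 <= y k" using K(2) X_ge_1 by simp
   then have "1 * 1 <= y k ^ n * ln_prod j (y k)" using ln_prod_ge_1[OF K(2)] by (intro mult_mono) auto
   then have "1 <= (y k ^ n * ln_prod j (y k)) powr (1 / real m)" using ge_one_powr_ge_zero[of "y k ^ n * ln_prod j (y k)" "1 / real m"] by simp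
   then show ?thesis unfolding h_fun_eq by (simp only: divide_le_eq) simp
  qed
  then show "\<rho> k < 1" unfolding \<rho> using mn by (simp add: divide_less_eq)
  show "1 <= t k" by (simp add: t_def)
  have "ln (real k) = (ln (real k) powr (1 / real n)) ^ n" using mn K(3) by (simp add: powr_power)
  also have "... <= real (t k) ^ n"
  proof (rule power_mono)
   show "ln (real k) powr (1 / real n) <= real (t k)" unfolding t_def by (simp add: le_nat_floor) linarith
  qed simp
  finally show "ln (real k) <= real (t k) ^ CARD('n)" by (simp add: n_def)
  have "ln_prod j (y k) <= ln (y k) ^ j" by (rule ln_prod_le[OF K(2)])
  also have "... <= (real k ^ 2) ^ j"
  proof (rule power_mono)
   show "ln (y k) <= real k ^ 2" using K(5) mn by (simp add: y_def ln_mult ln_realpow)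
   show "0 <= ln (y k)" using K(2) X_ge_1 by simp
  qed
  finally have "real m ^ m * real n ^ n * ln_prod j (y k) <= real k * (real k ^ 2) ^ j"
   using K(4) ln_prod_ge_1[OF K(2)] by (intro mult_mono) auto
  also have "... = real k ^ (2 * j + 1)" by (simp add: power_mult[symmetric])
  finally have le: "real m ^ m * real n ^ n * ln_prod j (y k) <= real k ^ (2 * j + 1)" .
  have "0 < real m ^ m * real n ^ n * ln_prod j (y k)" using mn ln_prod_ge_1[OF K(2)] by simp
  with le have "1 <= 1 / (real m ^ m * real n ^ n * ln_prod j (y k)) * real k ^ (2 * j + 1)"
   by (simp only: times_divide_eq_left mult_1 pos_le_divide_eq)
  then show "1 <= \<rho> k ^ CARD('m) * 2 ^ (k * CARD('n)) * real k ^ (2 * j + 1)"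
   unfolding m_def[symmetric] n_def[symmetric] \<rho>pow[OF K(2)] .
  fix q :: "'n => int" assume q: "q ~= (%_. 0)" "!!l. \<bar>q l\<bar> <= 2 ^ k * int (t k)"
  show "EX i. \<forall>v::int. 2 * \<rho> k <= \<bar>lin \<alpha> q i - of_int v\<bar>"
  proof (rule ccontr)
   assume "\<not> ?thesis"
   then have "ALL i. \<exists>v::int. \<bar>lin \<alpha> q i - of_int v\<bar> < 2 * \<rho> k" by (simp add: not_le)
   from choice[OF this] obtain v where v: "ALL i. \<bar>lin \<alpha> q i - of_int (v i)\<bar> < 2 * \<rho> k" by (elim exE)
   define Q p where "Q = (\<chi> l. real_of_int (q l))" and "p = (\<chi> i. - real_of_int (v i))"
   have "Q \<in> int_vecs - {0}" using q(1) by (auto simp: Q_def int_vecs_def vec_eq_iff fun_eq_iff)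
   moreover have "p \<in> int_vecs" by (simp add: p_def int_vecs_def)
   moreover have "norm Q <= y k * real (t k)"
   proof -
    have "norm Q <= (\<Sum>l\<in>UNIV. \<bar>Q $ l\<bar>)" by (rule norm_le_l1_cart)
    also have "... <= (\<Sum>l\<in>(UNIV :: 'n set). 2 ^ k * real (t k))"
    proof (rule sum_mono)
     fix l
     have "real_of_int \<bar>q l\<bar> <= real_of_int (2 ^ k * int (t k))" using q(2)[of l] by (simp only: of_int_le_iff)
     then show "\<bar>Q $ l\<bar> <= 2 ^ k * real (t k)" by (simp add: Q_def)
    qed
    finally show ?thesis by (simp add: y_def n_def mult.assoc)
   qed
   moreover have "Q0 <= y k * real (t k)"
   proof -
    have "0 <= y k" "1 <= real (t k)" by (simp_all add: y_def t_def)
    then show ?thesis using K(1) mult_left_mono[of 1 "real (t k)" "y k"] by simp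
   qed
   ultimately have "phi_fun m n j (y k * real (t k)) < norm (\<alpha> *v Q + p)" by (intro Q0)
   also have "... <= (\<Sum>i\<in>UNIV. \<bar>(\<alpha> *v Q + p) $ i\<bar>)" by (rule norm_le_l1_cart)
   also have "... <= (\<Sum>i\<in>(UNIV :: 'm set). 2 * \<rho> k)"
   proof (rule sum_mono)
    fix i
    have "(\<alpha> *v Q + p) $ i = lin \<alpha> q i - of_int (v i)"
     by (simp add: matrix_vector_mult_def lin_def Q_def p_def)
    then show "\<bar>(\<alpha> *v Q + p) $ i\<bar> <= 2 * \<rho> k" using v[rule_format, of i] by simp
   qed
   also have "... = 2 * h_fun m n j (y k)" using mn by (simp add: \<rho> m_def)
   finally show False using h_double[OF k] by simp
  qed
 qed (rule k0)
 then show "EX t k0 A. twisted \<alpha> \<rho> t k0 A" by blast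
 show "\<not> summable (%k. \<rho> k ^ CARD('m) * 2 ^ (k * CARD('n)))"
 proof
  assume "summable (%k. \<rho> k ^ CARD('m) * 2 ^ (k * CARD('n)))"
  then have sm: "summable (%k. real m ^ m * real n ^ n * (\<rho> k ^ m * 2 ^ (k * n)))"
   unfolding m_def n_def by (rule summable_mult)
  \<comment> \<open>The terms are \<open>1 / ln_prod j (y k)\<close> up to a constant. By the mean
    value theorem they dominate the increments of the iterated logarithm of order
    \<open>Suc j\<close> along \<open>y k\<close>, which telescope to infinity.\<close>
  obtain x1 where x1: "!!x. x1 <= x ==> ((%x. (ln ^^ Suc j) x) has_real_derivative 1 / (x * ln_prod j x)) (at x)"
   using ln_iter_derivative[of j] unfolding eventually_at_top_linorder ln_prod_def by blast
  have "\<forall>\<^sub>F k in sequentially. max X x1 <= y k" using ytop unfolding filterlim_at_top by blast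
  then have "\<forall>\<^sub>F k in sequentially. norm ((ln ^^ Suc j) (y (Suc k)) - (ln ^^ Suc j) (y k)) <= real m ^ m * real n ^ n * (\<rho> k ^ m * 2 ^ (k * n))"
  proof eventually_elim
   case (elim k)
   have y: "0 < y k" "y (Suc k) = 2 * y k" using mn by (simp_all add: y_def)
   have "EX z. y k < z & z < y (Suc k) & (ln ^^ Suc j) (y (Suc k)) - (ln ^^ Suc j) (y k) = (y (Suc k) - y k) * (1 / (z * ln_prod j z))"
    by (rule MVT2) (use y elim x1 in auto)
   then obtain z where z: "y k < z" "(ln ^^ Suc j) (y (Suc k)) - (ln ^^ Suc j) (y k) = y k * (1 / (z * ln_prod j z))"
    using y by auto
   have P: "1 <= ln_prod j (y k)" "ln_prod j (y k) <= ln_prod j z" using elim z(1) by (auto intro: ln_prod_ge_1 ln_prod_mono)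
   have "y k * ln_prod j (y k) <= z * ln_prod j z" using z(1) P y by (intro mult_mono) auto
   then have "1 / (z * ln_prod j z) <= 1 / (y k * ln_prod j (y k))" using y P by (intro frac_le) auto
   then have "y k * (1 / (z * ln_prod j z)) <= y k * (1 / (y k * ln_prod j (y k)))" using y by (intro mult_left_mono) auto
   also have "... = 1 / ln_prod j (y k)" using y by simp
   also have "... = real m ^ m * real n ^ n * (\<rho> k ^ m * 2 ^ (k * n))"
    using \<rho>pow[of k] elim mn by simp
   finally show ?case using z y P by simp
  qed
  then have "summable (%k. (ln ^^ Suc j) (y (Suc k)) - (ln ^^ Suc j) (y k))"
   using sm by (rule summable_comparison_test_ev)
  then have "convergent (%k. \<Sum>l<k. (ln ^^ Suc j) (y (Suc l)) - (ln ^^ Suc j) (y l))"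
   by (simp only: summable_iff_convergent)
  then have "convergent (%k. (ln ^^ Suc j) (y k) - (ln ^^ Suc j) (y 0))"
   unfolding sum_lessThan_telescope[of "%k. (ln ^^ Suc j) (y k)"] .
  from convergent_imp_Bseq[OF this] obtain B where "ALL k. norm ((ln ^^ Suc j) (y k) - (ln ^^ Suc j) (y 0)) <= B"
   by (rule BseqE)
  then have B: "\<bar>(ln ^^ Suc j) (y k) - (ln ^^ Suc j) (y 0)\<bar> <= B" for k by simp
  have "filterlim (%k. (ln ^^ Suc j) (y k)) at_top sequentially"
   by (rule filterlim_compose[OF filterlim_ln_iter ytop])
  then have "\<forall>\<^sub>F k in sequentially. B + (ln ^^ Suc j) (y 0) + 1 <= (ln ^^ Suc j) (y k)" unfolding filterlim_at_top by blast
  then obtain k where "B + (ln ^^ Suc j) (y 0) + 1 <= (ln ^^ Suc j) (y k)"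
   unfolding eventually_sequentially by blast
  then show False using B[of k] by linarith
 qed
qed

section \<open>From hits at infinitely many scales to infinitely many solutions\<close>

lemma finite_bounded_int_vecs: "finite {x :: real^'a. x \<in> int_vecs & norm x <= B}"
proof -
 have "{x :: real^'a. x \<in> int_vecs & norm x <= B} \<subseteq> (%f. \<chi> i. real_of_int (f i)) ` ibox (nat \<lceil>B\<rceil>)"
 proof
  fix x :: "real^'a" assume x: "x \<in> {x. x \<in> int_vecs & norm x <= B}"
  have e: "real_of_int \<lfloor>x $ i\<rfloor> = x $ i" for i using x by (simp add: int_vecs_def)
  have "\<bar>\<lfloor>x $ i\<rfloor>\<bar> <= int (nat \<lceil>B\<rceil>)" for i
  proof -
   have "real_of_int \<bar>\<lfloor>x $ i\<rfloor>\<bar> <= B" 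
    using component_le_norm_cart[of x i] x unfolding of_int_abs e by simp
   then have "\<bar>\<lfloor>x $ i\<rfloor>\<bar> <= \<lceil>B\<rceil>" by linarith
   moreover have "0 <= \<bar>\<lfloor>x $ i\<rfloor>\<bar>" by simp
   ultimately show ?thesis by linarith
  qed
  then show "x \<in> (%f. \<chi> i. real_of_int (f i)) ` ibox (nat \<lceil>B\<rceil>)"
   by (intro image_eqI[of _ _ "%i. \<lfloor>x $ i\<rfloor>"]) (simp_all add: e vec_eq_iff ibox_iff)
 qed
 then show ?thesis by (rule finite_subset) (simp add: ibox_def finite_PiE)
qed

lemma countable_int_vecs: "countable (int_vecs :: (real^'a) set)"
proof -
 have "int_vecs = (\<Union>N. {x :: real^'a. x \<in> int_vecs & norm x <= real N})"
  by (auto intro: real_arch_simple)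
 also have "countable ..." by (intro countable_UN[OF countableI_type] countable_finite finite_bounded_int_vecs)
 finally show ?thesis .
qed

text \<open>Hits at infinitely many scales could all stem from one pair \<open>(p, q)\<close>. This
  is excluded because the distance in question is positive by \<open>nz\<close> while the radius
  tends to 0: if there were finitely many solutions, a hit closer than all of them and than all
  short pairs would be a contradiction.\<close>

lemma approx_targets_of_hits:
 fixes \<alpha> :: "real^'n^'m"
 assumes \<psi>: "evt t. h_fun CARD('m) CARD('n) j t <= \<psi> t"
  and hits: "!!K. \<exists>k\<ge>K. \<exists>q::'n => int. (ALL l. \<bar>q l\<bar> <= 2 ^ k) &
   (ALL i. \<exists>p::int. \<bar>lin \<alpha> q i + \<beta> $ i - of_int p\<bar> < h_fun CARD('m) CARD('n) j (real CARD('n) * 2 ^ k) / real CARD('m))"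
  and nz: "!!p q. p \<in> int_vecs ==> q \<in> int_vecs ==> \<alpha> *v q + \<beta> + p ~= 0"
 shows "\<beta> \<in> approx_targets \<psi> \<alpha>"
proof (rule ccontr)
 assume "\<beta> \<notin> approx_targets \<psi> \<alpha>"
 define m where "m = CARD('m)"
 define n where "n = CARD('n)"
 have mn: "1 <= m" "1 <= n" by (simp_all add: m_def n_def Suc_leI)
 define S where "S = {(p, q). p \<in> int_vecs & q \<in> int_vecs - {0} & norm (\<alpha> *v q + \<beta> + p) <= \<psi> (norm q)}"
 have fS: "finite S" using \<open>\<beta> \<notin> approx_targets \<psi> \<alpha>\<close> by (simp add: approx_targets_def S_def)
 obtain X where X: "1 <= X" "\<forall>x\<ge>X. \<forall>l\<le>Suc j. 1 <= (ln ^^ l) (x::real)" using ln_iter_ge_1[of "Suc j"] by blast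
 interpret ln_range j X by unfold_locales (use X in auto)
 obtain T0 where T0: "!!t. T0 <= t ==> h_fun m n j t <= \<psi> t"
  using \<psi> unfolding eventually_at_top_linorder m_def n_def by blast
 define T where "T = max X T0"
 define D where "D = {q :: real^'n. q \<in> int_vecs & norm q <= T}"
 have fD: "finite D" unfolding D_def by (rule finite_bounded_int_vecs)
 define W where "W = (SIGMA q:D. {p :: real^'m. p \<in> int_vecs & norm p <= 1 + norm (\<alpha> *v q + \<beta>)})"
 have fW: "finite W" unfolding W_def by (intro finite_SigmaI fD finite_bounded_int_vecs)
 define E where "E = insert 1 ((%(p, q). norm (\<alpha> *v q + \<beta> + p)) ` S \<union> (%(q, p). norm (\<alpha> *v q + \<beta> + p)) ` W)"
 have fE: "finite E" "E ~= {}" unfolding E_def using fS fW by auto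
 have pE: "0 < x" if "x \<in> E" for x using that nz by (auto simp: E_def S_def W_def D_def)
 define \<mu> where "\<mu> = Min E"
 have \<mu>: "0 < \<mu>" unfolding \<mu>_def using fE pE by simp
 have \<mu>E: "\<mu> <= x" if "x \<in> E" for x unfolding \<mu>_def using fE(1) that by (rule Min_le)
 define y where "y k = real n * 2 ^ k" for k :: nat
 have "evt x::real. x powr (- 1 / real m) < \<mu>"
 proof -
  have "0 < 1 / real m" using mn by simp
  then have "((%x::real. x powr (- (1 / real m))) \<longlongrightarrow> 0) at_top" by real_asymp
  from order_tendstoD(2)[OF this \<mu>] show ?thesis by simp
 qed
 moreover have ytop: "filterlim y at_top sequentially"
 proof -
  have "0 < real n" using mn by simp
  then show ?thesis unfolding y_def by real_asymp
 qed
 ultimately have "\<forall>\<^sub>F k in sequentially. y k powr (- 1 / real m) < \<mu>" by (rule eventually_compose_filterlim)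
 moreover have "\<forall>\<^sub>F k in sequentially. X <= y k" using ytop by (simp add: filterlim_at_top)
 ultimately have "\<forall>\<^sub>F k in sequentially. y k powr (- 1 / real m) < \<mu> & X <= y k" by eventually_elim simp
 then obtain K where K: "!!k. K <= k ==> y k powr (- 1 / real m) < \<mu> & X <= y k" unfolding eventually_sequentially by blast
 obtain k q where k: "K <= k" and q: "ALL l. \<bar>q l\<bar> <= 2 ^ k"
  and hit: "ALL i. \<exists>p::int. \<bar>lin \<alpha> q i + \<beta> $ i - of_int p\<bar> < h_fun m n j (y k) / real m"
  using hits[of K] unfolding m_def n_def y_def by (elim exE conjE)
 from choice[OF hit] obtain v where v: "ALL i. \<bar>lin \<alpha> q i + \<beta> $ i - of_int (v i)\<bar> < h_fun m n j (y k) / real m" by (elim exE)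
 define Q p where "Q = (\<chi> l. real_of_int (q l))" and "p = (\<chi> i. - real_of_int (v i))"
 have Qp: "Q \<in> int_vecs" "p \<in> int_vecs" by (simp_all add: Q_def p_def int_vecs_def)
 have nQ: "norm Q <= y k"
 proof -
  have "norm Q <= (\<Sum>l\<in>UNIV. \<bar>Q $ l\<bar>)" by (rule norm_le_l1_cart)
  also have "... <= (\<Sum>l\<in>(UNIV :: 'n set). 2 ^ k)"
  proof (rule sum_mono)
   fix l
   have "real_of_int \<bar>q l\<bar> <= real_of_int (2 ^ k)" using q by (simp only: of_int_le_iff)
   then show "\<bar>Q $ l\<bar> <= 2 ^ k" by (simp add: Q_def)
  qed
  finally show ?thesis by (simp add: y_def n_def)
 qed
 have "norm (\<alpha> *v Q + \<beta> + p) <= (\<Sum>i\<in>UNIV. \<bar>(\<alpha> *v Q + \<beta> + p) $ i\<bar>)" by (rule norm_le_l1_cart)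
 also have "... <= (\<Sum>i\<in>(UNIV :: 'm set). h_fun m n j (y k) / real m)"
 proof (rule sum_mono)
  fix i
  have "(\<alpha> *v Q + \<beta> + p) $ i = lin \<alpha> q i + \<beta> $ i - of_int (v i)"
   by (simp add: matrix_vector_mult_def lin_def Q_def p_def)
  then show "\<bar>(\<alpha> *v Q + \<beta> + p) $ i\<bar> <= h_fun m n j (y k) / real m" using v[rule_format, of i] by simp
 qed
 also have "... = h_fun m n j (y k)" using mn by (simp add: m_def)
 finally have le: "norm (\<alpha> *v Q + \<beta> + p) <= h_fun m n j (y k)" .
 have "h_fun m n j (y k) < \<mu>" using h_fun_le[of "y k" m n] K[OF k] mn by linarith
 then have lt: "norm (\<alpha> *v Q + \<beta> + p) < \<mu>" using le by simp
 show False
 proof (cases "norm Q <= T")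
  case True
  have "\<mu> <= 1" by (rule \<mu>E) (simp add: E_def)
  have "p = (\<alpha> *v Q + \<beta> + p) - (\<alpha> *v Q + \<beta>)" by simp
  then have "norm p <= norm (\<alpha> *v Q + \<beta> + p) + norm (\<alpha> *v Q + \<beta>)" by (metis norm_triangle_ineq4)
  then have "(Q, p) \<in> W" using True Qp lt \<open>\<mu> <= 1\<close> by (simp add: W_def D_def)
  then have "norm (\<alpha> *v Q + \<beta> + p) \<in> E" unfolding E_def by force
  then show False using \<mu>E lt by fastforce
 next
  case False
  then have T: "X <= norm Q" "T0 <= norm Q" by (simp_all add: T_def)
  have "h_fun m n j (y k) <= h_fun m n j (norm Q)" using T(1) nQ by (rule h_fun_mono)
  also have "... <= \<psi> (norm Q)" using T(2) by (rule T0)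
  finally have "(p, Q) \<in> S" using le Qp T X_ge_1 by (auto simp: S_def)
  then have "norm (\<alpha> *v Q + \<beta> + p) \<in> E" unfolding E_def by force
  then show False using \<mu>E lt by fastforce
 qed
qed

text \<open>The measure with density \<open>chi r\<close> has power Fourier decay after transport by
  \<open>G\<close>, so it can be fed into \<open>infinitely_many_hits\<close>; the density is
  positive on the ball, and there the result holds for Lebesgue measure.\<close>

lemma (in multi_series) approx_targets_AE:
 fixes \<alpha> :: "real^'n^'m"
 assumes nc: "!!u r. u ~= 0 ==> 0 < r ==> \<exists>y\<in>ball x0 r. u \<bullet> f y ~= u \<bullet> f x0"
  and inj: "inj_on f (ball x0 e)" and m: "2 <= CARD('m)"
  and na: "\<not> approximable (phi_fun CARD('m) CARD('n) i) \<alpha>" and ij: "i <= j"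
  and \<psi>: "evt t. h_fun CARD('m) CARD('n) j t <= \<psi> t"
 shows "\<exists>r>0. AE x in lborel. x \<in> ball x0 r --> f x \<in> approx_targets \<psi> \<alpha>"
proof -
 obtain r V \<delta> where r: "0 < r" "r < R" and V: "0 <= V" "0 < \<delta>"
  and decay: "!!w. 1 <= norm w ==> norm (\<integral>x. of_real (chi r x) * ee (w \<bullet> G x) \<partial>lborel) <= V * norm w powr (- \<delta>)"
  using fourier_decay[OF nc] by blast
 define \<nu> where "\<nu> = density lborel (%x. ennreal (chi r x))"
 define \<rho> where "\<rho> = (%k. h_fun CARD('m) CARD('n) j (real CARD('n) * 2 ^ k) / real CARD('m))"
 obtain t k0 A where tw: "twisted \<alpha> \<rho> t k0 A"
  using twisted_parameters(1)[OF m na ij] unfolding \<rho>_def by (elim exE)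
 have [measurable]: "G \<in> borel_measurable \<nu>" by (simp add: \<nu>_def)
 have "emeasure \<nu> (space \<nu>) = (\<integral>\<^sup>+x. ennreal (chi r x) \<partial>lborel)"
  by (simp add: \<nu>_def emeasure_density)
 also have "... <= (\<integral>\<^sup>+x. indicator (ball x0 r) x \<partial>lborel)"
 proof (rule nn_integral_mono)
  fix x
  show "ennreal (chi r x) <= indicator (ball x0 r) x"
   using chi_bounds[OF r(1), of x] by (cases "x \<in> ball x0 r") auto
 qed
 also have "... < \<infinity>" using emeasure_bounded_finite[OF bounded_ball, of x0 r] by simp
 finally have fin: "finite_measure \<nu>" by (intro finite_measureI) auto
 have "AE x in \<nu>. ALL K. \<exists>k\<ge>K. \<exists>q::'n => int. (ALL l. \<bar>q l\<bar> <= 2 ^ k) &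
   (ALL i. \<exists>p::int. \<bar>lin \<alpha> q i + G x $ i - of_int p\<bar> < \<rho> k)"
 proof (rule twisted.infinitely_many_hits[OF tw fin _ V(2)])
  fix xi :: "'m => int" and i Y assume Y: "0 < Y" "Y < \<bar>real_of_int (xi i)\<bar>"
  define w where "w = (\<chi> i. real_of_int (xi i))"
  have "\<bar>w $ i\<bar> <= norm w" by (rule component_le_norm_cart)
  then have w: "\<bar>real_of_int (xi i)\<bar> <= norm w" by (simp add: w_def)
  have "1 <= \<bar>xi i\<bar>" using Y by linarith
  then have "1 <= norm w" using w by linarith
  have "(\<integral>x. ee (idot xi (G x)) \<partial>\<nu>) = (\<integral>x. chi r x *\<^sub>R ee (idot xi (G x)) \<partial>lborel)"
   unfolding \<nu>_def
  proof (rule integral_density)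
   have "(%\<beta>. ee (idot xi \<beta>)) \<in> borel_measurable borel"
    unfolding idot_def by (intro borel_measurable_continuous_onI continuous_intros)
   from measurable_compose[OF G_measurable this]
   show "(%x. ee (idot xi (G x))) \<in> borel_measurable lborel" by simp
  qed (use chi_bounds(1)[OF r(1)] in auto)
  also have "... = (\<integral>x. of_real (chi r x) * ee (w \<bullet> G x) \<partial>lborel)"
   by (simp add: idot_def w_def inner_vec_def scaleR_conv_of_real)
  finally have "norm (\<integral>x. ee (idot xi (G x)) \<partial>\<nu>) <= V * norm w powr (- \<delta>)" using decay[OF \<open>1 <= norm w\<close>] by simp
  also have "... <= V * Y powr (- \<delta>)"
   using V Y w by (intro mult_left_mono powr_mono2') auto
  finally show "norm (\<integral>x. ee (idot xi (G x)) \<partial>\<nu>) <= V * Y powr (- \<delta>)" .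
 next
  show "\<not> summable (%k. \<rho> k ^ CARD('m) * 2 ^ (k * CARD('n)))"
   unfolding \<rho>_def by (rule twisted_parameters(2)[OF m na ij])
 qed measurable
 then have hits: "AE x in lborel. 0 < chi r x --> (ALL K. \<exists>k\<ge>K. \<exists>q::'n => int. (ALL l. \<bar>q l\<bar> <= 2 ^ k) &
   (ALL i. \<exists>p::int. \<bar>lin \<alpha> q i + G x $ i - of_int p\<bar> < \<rho> k))"
  unfolding \<nu>_def by (subst (asm) AE_density) (simp_all add: chi_measurable)
 \<comment> \<open>The values at which an exact hit occurs. There are countably many, and
   \<open>f\<close> is injective, so the parameters leading to them are null.\<close>
 define E where "E = (%(p, q). - (\<alpha> *v q + p)) ` ((int_vecs :: (real^'m) set) \<times> (int_vecs :: (real^'n) set))"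
 have "countable E" unfolding E_def by (intro countable_image countable_SIGMA countable_int_vecs)
 then have "countable (f ` (f -` E \<inter> ball x0 e))" by (rule countable_subset[rotated]) auto
 then have "countable (f -` E \<inter> ball x0 e)"
  by (rule countable_image_inj_on) (rule inj_on_subset[OF inj], simp)
 then have "AE x in lborel. x \<notin> f -` E \<inter> ball x0 e" by (intro AE_not_in countable_imp_null_set_lborel)
 with hits have "AE x in lborel. x \<in> ball x0 r --> f x \<in> approx_targets \<psi> \<alpha>"
 proof eventually_elim
  case (elim x)
  show ?case
  proof
   assume x: "x \<in> ball x0 r"
   have "1 <= 2 * real CARD('d)" using zero_less_card_finite[where 'a = 'd] by linarith
   then have "e * 1 <= e * (2 * real CARD('d))" using e_pos by (intro mult_left_mono) auto
   then have Re: "R <= e" unfolding R_def by (subst pos_divide_le_eq) auto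
   have xR: "x \<in> ball x0 R" "x \<in> ball x0 e" using x r Re by auto
   have h: "\<exists>k\<ge>K. \<exists>q::'n => int. (ALL l. \<bar>q l\<bar> <= 2 ^ k) & (ALL i. \<exists>p::int. \<bar>lin \<alpha> q i + f x $ i - of_int p\<bar> < \<rho> k)" for K
    using elim(1) chi_bounds(4)[OF r(1) x] xR by (simp add: G_def)
   have nE: "f x \<notin> E" using elim(2) xR by simp
   show "f x \<in> approx_targets \<psi> \<alpha>"
   proof (rule approx_targets_of_hits[OF \<psi> h[unfolded \<rho>_def]])
    fix p :: "real^'m" and q :: "real^'n" assume pq: "p \<in> int_vecs" "q \<in> int_vecs"
    show "\<alpha> *v q + f x + p ~= 0"
    proof
     assume "\<alpha> *v q + f x + p = 0"
     then have "f x = - (\<alpha> *v q + p)" by (simp add: eq_neg_iff_add_eq_0 algebra_simps)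
     then have "f x \<in> E" using pq unfolding E_def by force
     then show False using nE by simp
    qed
   qed
  qed
 qed
 then show ?thesis using r(1) by blast
qed

section \<open>Differentiability of charts and the use of nondegeneracy\<close>

lemma frechet_injective_lower_bound:
 fixes f :: "real^'d => real^'m"
 assumes "f differentiable (at x)" "inj (frechet_derivative f (at x))"
 shows "EX B r. 0 < B & 0 < r & (ALL y. norm (y - x) < r --> B * norm (y - x) <= norm (f y - f x))"
proof -
 define L where "L = frechet_derivative f (at x)"
 have d: "(f has_derivative L) (at x)" unfolding L_def using assms(1) frechet_derivative_works by blast
 obtain B where B: "0 < B" "!!v. B * norm v <= norm (L v)"
  using linear_inj_bounded_below_pos[OF has_derivative_linear[OF d]] assms(2) unfolding L_def by blast
 have "0 < B / 2" using B(1) by simp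
 with d obtain r where r: "0 < r" "ALL y. norm (y - x) < r --> norm (f y - f x - L (y - x)) <= B / 2 * norm (y - x)"
  unfolding has_derivative_at_alt by blast
 have "B / 2 * norm (y - x) <= norm (f y - f x)" if "norm (y - x) < r" for y
 proof -
  have "norm (f y - f x - L (y - x)) <= B / 2 * norm (y - x)" using r(2) that by blast
  moreover have "norm (L (y - x)) <= norm (f y - f x) + norm (f y - f x - L (y - x))"
   by (metis add.commute diff_add_cancel norm_minus_commute norm_triangle_sub)
  ultimately show ?thesis using B(2)[of "y - x"] by linarith
 qed
 then show ?thesis using B(1) r(1) by (intro exI[of _ "B / 2"] exI[of _ r]) simp
qed

lemma differentiable_upper_bound:
 fixes f :: "real^'d => real^'m"
 assumes "f differentiable (at x)"
 shows "EX B r. 0 < r & (ALL y. norm (y - x) < r --> norm (f y - f x) <= B * norm (y - x))"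
proof -
 obtain L where d: "(f has_derivative L) (at x)" using assms by (auto simp: differentiable_def)
 obtain B where B: "!!v. norm (L v) <= norm v * B"
  using bounded_linear.bounded[OF has_derivative_bounded_linear[OF d]] by blast
 from d obtain r where r: "0 < r" "ALL y. norm (y - x) < r --> norm (f y - f x - L (y - x)) <= 1 * norm (y - x)"
  unfolding has_derivative_at_alt using zero_less_one by blast
 have "norm (f y - f x) <= (B + 1) * norm (y - x)" if "norm (y - x) < r" for y
 proof -
  have "norm (f y - f x - L (y - x)) <= 1 * norm (y - x)" using r(2) that by blast
  moreover have "norm (f y - f x) <= norm (L (y - x)) + norm (f y - f x - L (y - x))"
   by (rule norm_triangle_sub)
  ultimately show ?thesis using B[of "y - x"] by (simp add: algebra_simps)
 qed
 then show ?thesis using r(1) by (intro exI[of _ "B + 1"] exI[of _ r]) simp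
qed

context multi_series
begin

lemma prod_power_unit:
 fixes k :: "'d => nat"
 assumes "(\<Sum>j\<in>UNIV. k j) = 1"
 shows "EX j. \<forall>d::real^'d. (\<Prod>l\<in>UNIV. (d $ l) ^ k l) = d $ j"
proof -
 obtain j where j: "k j ~= 0" using assms by (metis sum.neutral zero_neq_one)
 have "k j + (\<Sum>l\<in>UNIV - {j}. k l) = 1" using assms sum.remove[of UNIV j k] by simp
 then have "k j = 1" "(\<Sum>l\<in>UNIV - {j}. k l) = 0" using j by linarith+
 then have k: "k j = 1" "!!l. l ~= j ==> k l = 0" by auto
 have "(\<Prod>l\<in>UNIV. (d $ l) ^ k l) = d $ j" for d :: "real^'d"
  using prod.remove[of UNIV j "%l. (d $ l) ^ k l"] k by (simp add: prod.neutral)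
 then show ?thesis by blast
qed

text \<open>Terms of total degree at least 2 are bounded by \<open>(norm d / R)^2\<close> times the
  corresponding terms at radius \<open>R\<close>, so the remainder after the linear part is
  quadratic. The centre is enough because an analytic function has an expansion around every
  point.\<close>

lemma differentiable_center: "f differentiable (at x0)"
proof -
 define m where "m k d = (\<Prod>j\<in>UNIV. (d $ j) ^ k j)" for k and d :: "real^'d"
 define K where "K = {k :: 'd => nat. (\<Sum>j\<in>UNIV. k j) = 1}"
 have fin: "finite K"
 proof (rule finite_subset)
  show "K \<subseteq> PiE UNIV (%_. {..1})"
  proof
   fix k assume "k \<in> K"
   then have "k j <= 1" for j using member_le_sum[of j UNIV k] by (simp add: K_def)
   then show "k \<in> PiE UNIV (%_. {..1})" by auto
  qed
 qed (simp add: finite_PiE)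
 define L where "L d = (\<Sum>k\<in>K. m k d *\<^sub>R c k)" for d
 have "bounded_linear (%d. m k d *\<^sub>R c k)" if "k \<in> K" for k
 proof -
  from that have "(\<Sum>j\<in>UNIV. k j) = 1" by (simp add: K_def)
  from prod_power_unit[OF this] obtain j where "\<forall>d::real^'d. m k d = d $ j" unfolding m_def by (elim exE)
  then show ?thesis by (simp add: bounded_linear_scaleR_left bounded_linear_compose[OF bounded_linear_scaleR_left bounded_linear_vec_nth])
 qed
 then have L: "bounded_linear L" unfolding L_def[abs_def] by (rule bounded_linear_sum)
 define C where "C = (\<Sum>i\<in>UNIV. \<Sum>\<^sub>\<infinity>k. \<bar>c k $ i\<bar> * (\<Prod>j\<in>UNIV. R ^ k j)) / R ^ 2"
 have C: "0 <= C" unfolding C_def using R_pos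
  by (intro divide_nonneg_nonneg sum_nonneg infsum_nonneg mult_nonneg_nonneg prod_nonneg) auto
 have main: "norm (f (x0 + d) - f x0 - L d) <= C * norm d ^ 2" if d: "norm d <= R" for d
 proof -
  have dj: "\<bar>d $ j\<bar> <= R" for j using component_le_norm_cart[of d j] d by linarith
  have comp: "\<bar>(f (x0 + d) - f x0 - L d) $ i\<bar> <= (norm d / R) ^ 2 * (\<Sum>\<^sub>\<infinity>k. \<bar>c k $ i\<bar> * (\<Prod>j\<in>UNIV. R ^ k j))" for i
  proof -
   have hs: "((%k. m k d * c k $ i) has_sum f (x0 + d) $ i) UNIV"
    using has_sum_bounded_linear[OF bounded_linear_vec_nth expansion[OF in_ball_of_componentwise[of d, OF dj]], of i]
    by (simp add: m_def)
   have hs0: "((%k. m k 0 * c k $ i) has_sum f x0 $ i) UNIV"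
    using has_sum_bounded_linear[OF bounded_linear_vec_nth expansion[of x0], of i] e_pos
    by (simp add: m_def)
   have "((%k. if k \<in> K then m k d * c k $ i else 0) has_sum (\<Sum>k\<in>K. m k d * c k $ i)) UNIV"
    using has_sum_finite[OF fin, of "%k. m k d * c k $ i"] by (subst has_sum_cong_neutral[where T = K and g = "%k. m k d * c k $ i"]) auto
   moreover have "(\<Sum>k\<in>K. m k d * c k $ i) = L d $ i" by (simp add: L_def sum_component)
   ultimately have hsL: "((%k. if k \<in> K then m k d * c k $ i else 0) has_sum L d $ i) UNIV" by simp
   have sub: "((%k. u k - v k) has_sum (a - b)) UNIV" if "(u has_sum a) UNIV" "(v has_sum b) UNIV"
    for u v :: "('d => nat) => real" and a b
    using has_sum_add[OF that(1), of "%k. - v k" "- b"] that(2) by (simp add: has_sum_uminus)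
   have hd: "((%k. m k d * c k $ i - m k 0 * c k $ i - (if k \<in> K then m k d * c k $ i else 0)) has_sum (f (x0 + d) - f x0 - L d) $ i) UNIV"
    using sub[OF sub[OF hs hs0] hsL] by simp
   have sm: "(%k. (norm d / R) ^ 2 * (\<bar>c k $ i\<bar> * (\<Prod>j\<in>UNIV. R ^ k j))) summable_on UNIV"
    by (intro summable_on_cmult_right coeff_summable)
   have bd: "\<bar>m k d * c k $ i - m k 0 * c k $ i - (if k \<in> K then m k d * c k $ i else 0)\<bar> <= (norm d / R) ^ 2 * (\<bar>c k $ i\<bar> * (\<Prod>j\<in>UNIV. R ^ k j))" for k
   proof -
    define s where "s = (\<Sum>j\<in>UNIV. k j)"
    have nonneg: "0 <= (norm d / R) ^ 2 * (\<bar>c k $ i\<bar> * (\<Prod>j\<in>UNIV. R ^ k j))"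
     using R_pos by (intro mult_nonneg_nonneg prod_nonneg) auto
    consider "s = 0" | "s = 1" | "2 <= s" by linarith
    then show ?thesis
    proof cases
     case 1
     then have "k j = 0" for j by (simp add: s_def)
     then show ?thesis using nonneg by (simp add: m_def K_def)
    next
     case 2
     then have kK: "k \<in> K" by (simp add: K_def s_def)
     from 2 have "(\<Sum>j\<in>UNIV. k j) = 1" by (simp add: s_def)
     from prod_power_unit[OF this] obtain j where "\<forall>d::real^'d. m k d = d $ j" unfolding m_def by (elim exE)
     then have "m k 0 = 0" by simp
     then show ?thesis using kK nonneg by simp
    next
     case 3
     then have kK: "k \<notin> K" by (simp add: K_def s_def)
     obtain j where j: "k j ~= 0" using 3 unfolding s_def by (metis sum.neutral not_numeral_le_zero)
     have z: "m k 0 = 0" unfolding m_def using j by (intro prod_zero) auto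
     have "\<bar>m k d\<bar> <= (\<Prod>j\<in>UNIV. norm d ^ k j)"
      unfolding m_def abs_prod power_abs by (intro prod_mono conjI power_mono component_le_norm_cart) auto
     also have "... = norm d ^ s" by (simp add: s_def power_sum)
     also have "... = norm d ^ 2 * norm d ^ (s - 2)" using 3 by (simp only: power_add[symmetric] le_add_diff_inverse)
     also have "... <= norm d ^ 2 * R ^ (s - 2)" using d by (intro mult_left_mono power_mono) auto
     also have "... = (norm d / R) ^ 2 * R ^ s"
     proof -
      have "R ^ s = R ^ 2 * R ^ (s - 2)" using 3 by (simp only: power_add[symmetric] le_add_diff_inverse)
      then show ?thesis using R_pos by (simp add: power_divide)
     qed
     also have "R ^ s = (\<Prod>j\<in>UNIV. R ^ k j)" by (simp add: s_def power_sum)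
     finally have "\<bar>m k d\<bar> <= (norm d / R) ^ 2 * (\<Prod>j\<in>UNIV. R ^ k j)" .
     from mult_right_mono[OF this, of "\<bar>c k $ i\<bar>"] show ?thesis using z kK by (simp add: abs_mult mult_ac)
    qed
   qed
   have "(%k. norm (m k d * c k $ i - m k 0 * c k $ i - (if k \<in> K then m k d * c k $ i else 0))) summable_on UNIV"
    by (rule summable_on_comparison_test[OF sm]) (use bd in auto)
   from norm_infsum_bound[OF this] have "\<bar>(f (x0 + d) - f x0 - L d) $ i\<bar> <=
     (\<Sum>\<^sub>\<infinity>k. norm (m k d * c k $ i - m k 0 * c k $ i - (if k \<in> K then m k d * c k $ i else 0)))"
    using infsumI[OF hd] by simp
   also have "... <= (\<Sum>\<^sub>\<infinity>k. (norm d / R) ^ 2 * (\<bar>c k $ i\<bar> * (\<Prod>j\<in>UNIV. R ^ k j)))"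
    by (rule infsum_mono[OF \<open>(%k. norm _) summable_on UNIV\<close> sm]) (use bd in auto)
   also have "... = (norm d / R) ^ 2 * (\<Sum>\<^sub>\<infinity>k. \<bar>c k $ i\<bar> * (\<Prod>j\<in>UNIV. R ^ k j))"
    by (rule infsum_cmult_right) (intro coeff_summable)
   finally show ?thesis .
  qed
  have "norm (f (x0 + d) - f x0 - L d) <= (\<Sum>i\<in>UNIV. \<bar>(f (x0 + d) - f x0 - L d) $ i\<bar>)" by (rule norm_le_l1_cart)
  also have "... <= (\<Sum>i\<in>UNIV. (norm d / R) ^ 2 * (\<Sum>\<^sub>\<infinity>k. \<bar>c k $ i\<bar> * (\<Prod>j\<in>UNIV. R ^ k j)))" by (rule sum_mono) (rule comp)
  also have "... = C * norm d ^ 2" unfolding C_def sum_distrib_left[symmetric] by (simp add: power_divide)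
  finally show ?thesis .
 qed
 have "(f has_derivative L) (at x0)"
  unfolding has_derivative_at_alt
 proof (intro conjI allI impI L)
  fix \<epsilon> :: real assume \<epsilon>: "0 < \<epsilon>"
  define r where "r = min R (\<epsilon> / (C + 1))"
  have "0 < r" using R_pos \<epsilon> C by (simp add: r_def)
  moreover have "norm (f y - f x0 - L (y - x0)) <= \<epsilon> * norm (y - x0)" if "norm (y - x0) < r" for y
  proof -
   have "norm (y - x0) <= \<epsilon> / (C + 1)" using that by (simp add: r_def)
   then have "norm (y - x0) * (C + 1) <= \<epsilon>" using C by (simp add: pos_le_divide_eq)
   then have "C * norm (y - x0) <= \<epsilon>" 
   proof -
    have "C * norm (y - x0) = norm (y - x0) * (C + 1) - norm (y - x0)" by (simp add: algebra_simps)
    then show ?thesis using \<open>norm (y - x0) * (C + 1) <= \<epsilon>\<close> norm_ge_zero[of "y - x0"] by linarith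
   qed
   then have "C * norm (y - x0) * norm (y - x0) <= \<epsilon> * norm (y - x0)" by (intro mult_right_mono) auto
   then show ?thesis using main[of "y - x0"] that by (simp add: r_def power2_eq_square mult.assoc)
  qed
  ultimately show "\<exists>r>0. ALL y. norm (y - x0) < r --> norm (f y - f x0 - L (y - x0)) <= \<epsilon> * norm (y - x0)" by blast
 qed
 then show ?thesis by (rule differentiableI)
qed

end

lemma real_analytic_multi_series:
 assumes "real_analytic_on f U" "x \<in> U" "open U"
 shows "EX c e. multi_series f x c e & ball x e \<subseteq> U"
proof -
 obtain c e where c: "0 < e" "\<forall>y\<in>ball x e. ((%k. (\<Prod>j\<in>UNIV. (y $ j - x $ j) ^ k j) *\<^sub>R c k) has_sum f y) UNIV"
  using assms(1,2) unfolding real_analytic_on_def by meson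
 obtain e' where e': "0 < e'" "ball x e' \<subseteq> U" using assms(2,3) open_contains_ball by blast
 have "multi_series f x c (min e e')" by unfold_locales (use c e'(1) in auto)
 moreover have "ball x (min e e') \<subseteq> U" using e'(2) by auto
 ultimately show ?thesis by blast
qed

lemma real_analytic_differentiable:
 "real_analytic_on f U ==> open U ==> x \<in> U ==> f differentiable (at x)"
 using real_analytic_multi_series[of f U x] multi_series.differentiable_center by blast

text \<open>If \<open>u . f\<close> were constant near \<open>x\<close>, all partial derivatives of
  positive order would be orthogonal to \<open>u\<close> there, by induction on the order in a whole
  neighbourhood, and could not span.\<close>

lemma nondegenerate_param_not_constant:
 fixes f :: "real^'d => real^'m"
 assumes nd: "nondegenerate_param f x" and u: "u ~= 0" and r: "0 < r"
 shows "\<exists>y\<in>ball x r. u \<bullet> f y ~= u \<bullet> f x"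
proof (rule ccontr)
 assume "\<not> ?thesis"
 then have const: "u \<bullet> f y = u \<bullet> f x" if "y \<in> ball x r" for y using that by blast
 obtain k V where V: "open V" "x \<in> V" "C_k_on k f V"
  and sp: "span {iter_partial js f x | js. 1 <= length js & length js <= k} = UNIV"
  using nd unfolding nondegenerate_param_def by blast
 define B where "B = ball x r \<inter> V"
 have B: "open B" "x \<in> B" using V r by (auto simp: B_def)
 have "EX a. (js ~= [] --> a = 0) & (\<forall>y\<in>B. u \<bullet> iter_partial js f y = a)" if "length js <= k" for js
  using that
 proof (induction js)
  case Nil
  then show ?case using const by (intro exI[of _ "u \<bullet> f x"]) (auto simp: iter_partial_def B_def)
 next
  case (Cons j js)
  then obtain a where a: "!!y. y \<in> B ==> u \<bullet> iter_partial js f y = a" by auto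
  have "u \<bullet> iter_partial (j # js) f y = 0" if y: "y \<in> B" for y
  proof -
   define g where "g t = iter_partial js f (y + t *\<^sub>R axis j 1)" for t
   have "g differentiable (at 0)"
    using V(3) Cons.prems y unfolding C_k_on_def g_def B_def by auto
   then have "(g has_vector_derivative vector_derivative g (at 0)) (at 0)" by (simp add: vector_derivative_works)
   then have "((%t. u \<bullet> g t) has_vector_derivative u \<bullet> vector_derivative g (at 0)) (at 0)"
    by (rule bounded_linear.has_vector_derivative[OF bounded_linear_inner_right])
   moreover have "((%t. u \<bullet> g t) has_vector_derivative 0) (at 0)"
   proof (rule has_vector_derivative_transform_within_open[of "%_. a"])
    show "open ((%t. y + t *\<^sub>R axis j 1) -` B)"
     by (rule continuous_open_vimage[OF B(1)]) (intro continuous_intros)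
    show "0 \<in> (%t. y + t *\<^sub>R axis j 1) -` B" using y by simp
    show "a = u \<bullet> g t" if "t \<in> (%t. y + t *\<^sub>R axis j 1) -` B" for t
     using a that by (simp add: g_def)
   qed simp
   ultimately have "u \<bullet> vector_derivative g (at 0) = 0" by (rule vector_derivative_unique_at)
   then show ?thesis by (simp add: iter_partial_def partial_deriv_def g_def[abs_def])
  qed
  then show ?case by auto
 qed
 then have "u \<bullet> iter_partial js f x = 0" if "1 <= length js" "length js <= k" for js
  using that B(2) by fastforce
 then have "{iter_partial js f x | js. 1 <= length js & length js <= k} \<subseteq> {v. u \<bullet> v = 0}" by auto
 then have "span {iter_partial js f x | js. 1 <= length js & length js <= k} \<subseteq> {v. u \<bullet> v = 0}"
  by (rule span_minimal) (rule subspace_hyperplane)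
 then have "u \<bullet> u = 0" unfolding sp by blast
 then show False using u by simp
qed

section \<open>Null sets on the submanifold\<close>

lemma negligible_of_AE_lborel:
 assumes "AE x in lborel. P x" shows "negligible {x. \<not> P x}"
proof -
 obtain N where "N \<in> null_sets lborel" "{x. \<not> P x} \<subseteq> N" using assms by (auto simp: eventually_ae_filter)
 then have "{x. \<not> P x} \<in> null_sets (completion lborel)" unfolding null_sets_completion_iff2 by blast
 then show ?thesis by (simp add: negligible_iff_null_sets)
qed

lemma null_superset_of_negligible:
 "negligible S ==> \<exists>N\<in>null_sets lborel. S \<subseteq> N"
 by (simp add: negligible_iff_null_sets null_sets_completion_iff2)

text \<open>The transition map between two charts is locally Lipschitz at each point:
  \<open>f'\<close> is bounded above to first order, and \<open>f\<close> is bounded below because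
  its derivative is injective. Lipschitz maps preserve null sets, so differentiability of the
  inverse chart does not enter.\<close>

lemma local_param_transfer_negligible:
 fixes f f' :: "real^'d => real^'m"
 assumes p: "local_param M U f" and p': "local_param M U' f'" and N: "negligible N" "N \<subseteq> U'"
 shows "negligible {x \<in> U. f x \<in> f' ` N}"
proof -
 obtain g where g: "homeomorphism U (f ` U) f g" using p unfolding local_param_def by blast
 have o: "open U" "open U'" and an: "real_analytic_on f U" "real_analytic_on f' U'"
  and inj: "!!x. x \<in> U ==> inj (frechet_derivative f (at x))" using p p' unfolding local_param_def by blast+
 define S where "S = {z \<in> N. f' z \<in> f ` U}"
 have cg: "continuous_on (f ` U) g" and gf: "!!x. x \<in> U ==> g (f x) = x" and fg: "!!y. y \<in> f ` U ==> f (g y) = y"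
  using g unfolding homeomorphism_def by auto
 have gU: "g y \<in> U" if "y \<in> f ` U" for y using that gf by auto
 have cf': "continuous_on S f'"
  using real_analytic_differentiable[OF an(2) o(2)] N(2)
  by (intro continuous_at_imp_continuous_on ballI differentiable_imp_continuous_within) (auto simp: S_def)
 have cont: "continuous_on S (%z. g (f' z))"
  by (rule continuous_on_compose2[OF cg cf']) (auto simp: S_def)
 have "negligible ((%z. g (f' z)) ` S)"
 proof (rule negligible_locally_Lipschitz_image)
  show "negligible S" by (rule negligible_subset[OF N(1)]) (auto simp: S_def)
  fix z assume z: "z \<in> S"
  define w where "w = g (f' z)"
  have wU: "w \<in> U" "f w = f' z" using z gU fg by (auto simp: S_def w_def)
  obtain B r where B: "0 < B" "0 < r" "!!y. norm (y - w) < r ==> B * norm (y - w) <= norm (f y - f w)"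
   using frechet_injective_lower_bound[OF real_analytic_differentiable[OF an(1) o(1) wU(1)] inj[OF wU(1)]] by blast
  have "z \<in> U'" using z N(2) by (auto simp: S_def)
  then obtain B' r' where B': "0 < r'" "!!y. norm (y - z) < r' ==> norm (f' y - f' z) <= B' * norm (y - z)"
   using differentiable_upper_bound[OF real_analytic_differentiable[OF an(2) o(2)]] by blast
  obtain s where s: "0 < s" "!!y. y \<in> S ==> dist y z < s ==> dist (g (f' y)) (g (f' z)) < r"
   using cont z B(2) unfolding continuous_on_iff by blast
  have "norm (g (f' y) - g (f' z)) <= B' / B * norm (y - z)" if y: "y \<in> S \<inter> ball z (min s r')" for y
  proof -
   have fy: "f (g (f' y)) = f' y" using y fg by (auto simp: S_def)
   have "norm (g (f' y) - w) < r" using s(2)[of y] y by (simp add: w_def dist_norm norm_minus_commute)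
   from B(3)[OF this] have "B * norm (g (f' y) - w) <= norm (f' y - f' z)" by (simp add: fy wU)
   also have "... <= B' * norm (y - z)" using y by (intro B'(2)) (simp add: dist_norm norm_minus_commute)
   finally show ?thesis using B(1) by (simp add: w_def pos_le_divide_eq mult.commute)
  qed
  then show "EX T B. open T & z \<in> T & (\<forall>y\<in>S \<inter> T. norm (g (f' y) - g (f' z)) <= B * norm (y - z))"
   using s(1) B'(1) by (intro exI[of _ "ball z (min s r')"] exI[of _ "B' / B"]) simp
 qed simp
 then show ?thesis
 proof (rule negligible_subset)
  show "{x \<in> U. f x \<in> f' ` N} \<subseteq> (%z. g (f' z)) ` S"
  proof
   fix x assume "x \<in> {x \<in> U. f x \<in> f' ` N}"
   then obtain z where "x \<in> U" "z \<in> N" "f x = f' z" by auto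
   moreover from this have "z \<in> S" "g (f' z) = x" using gf[of x] unfolding S_def by force+
   ultimately show "x \<in> (%z. g (f' z)) ` S" by blast
  qed
 qed
qed

lemma local_param_image_openin:
 assumes p: "local_param M U f" and V: "open V" "V \<subseteq> U"
 shows "openin (top_of_set M) (f ` V)"
proof -
 obtain g where g: "homeomorphism U (f ` U) f g" using p unfolding local_param_def by blast
 have "openin (top_of_set U) V" using V by (simp add: openin_open_eq open_subset)
 from homeomorphism_imp_open_map[OF g this] show ?thesis
  using p openin_trans unfolding local_param_def by blast
qed

text \<open>By Lindelof countably many images of open balls cover \<open>M\<close>; replacing them
  by the images of the closed balls, which are compact and still inside \<open>M\<close>, writes
  \<open>M\<close> as a countable union of closed sets.\<close>

lemma submanifold_borel:
 fixes M :: "(real^'m) set"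
 assumes "analytic_submanifold TYPE('d::finite) M" shows "M \<in> sets borel"
proof -
 define \<F> where "\<F> = {f ` ball x r | (f :: real^'d => real^'m) x r. EX U. local_param M U f & 0 < r & cball x r \<subseteq> U}"
 obtain \<G> where \<G>: "\<G> \<subseteq> \<F>" "countable \<G>" "\<Union>\<G> = \<Union>\<F>"
 proof (rule Lindelof_openin[of \<F> M])
  fix W assume "W \<in> \<F>"
  then show "openin (top_of_set M) W" unfolding \<F>_def
   using local_param_image_openin ball_subset_cball by (blast intro: order_trans)
 qed
 have M: "M \<subseteq> \<Union>\<F>"
 proof
  fix y assume "y \<in> M"
  from bspec[OF assms[unfolded analytic_submanifold_def] this]
  obtain U and f :: "real^'d => real^'m" where p: "local_param M U f" and "y \<in> f ` U" by (elim exE conjE)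
  then obtain x where U: "local_param M U f" "x \<in> U" "f x = y" by blast
  then obtain r where "0 < r" "cball x r \<subseteq> U" using open_contains_cball unfolding local_param_def by blast
  then have "f ` ball x r \<in> \<F>" "y \<in> f ` ball x r" using U unfolding \<F>_def by force+
  then show "y \<in> \<Union>\<F>" by blast
 qed
 have "EX C. closed C & W \<subseteq> C & C \<subseteq> M" if WF: "W \<in> \<F>" for W
 proof -
  obtain U f x r where W: "W = f ` ball x r" "local_param M U (f :: real^'d => real^'m)" "cball x r \<subseteq> U"
   using WF unfolding \<F>_def mem_Collect_eq by (elim exE conjE)
  have "f ` U \<subseteq> M" using W(2) openin_imp_subset unfolding local_param_def by blast
  moreover have "continuous_on U f" using W(2) unfolding local_param_def homeomorphism_def by blast
  then have "compact (f ` cball x r)" by (intro compact_continuous_image continuous_on_subset[OF _ W(3)]) auto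
  ultimately show ?thesis using W by (intro exI[of _ "f ` cball x r"]) (auto intro: compact_imp_closed)
 qed
 then have "ALL W. EX C. W \<in> \<F> --> closed C & W \<subseteq> C & C \<subseteq> M" by blast
 from choice[OF this] obtain C where C: "ALL W. W \<in> \<F> --> closed (C W) & W \<subseteq> C W & C W \<subseteq> M" by (elim exE)
 have CG: "closed (C W)" "W \<subseteq> C W" "C W \<subseteq> M" if "W \<in> \<G>" for W using C \<G>(1) that by auto
 have "M \<subseteq> \<Union>\<G>" using M \<G>(3) by simp
 then have "M = (\<Union>W\<in>\<G>. C W)" using CG(2,3) by blast
 moreover have "(\<Union>W\<in>\<G>. C W) \<in> sets borel"
  by (intro sets.countable_UN' \<G>(2)) (auto intro: borel_closed CG(1))
 ultimately show ?thesis by simp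
qed

text \<open>A limsup set over a countable index set: a point lies in infinitely many of the closed
  sets \<open>C z\<close> iff no finite set of indices accounts for all of them, and there are only
  countably many finite sets.\<close>

lemma approx_targets_borel: "approx_targets \<psi> (\<alpha> :: real^'n^'m) \<in> sets borel"
proof -
 define P where "P = (int_vecs :: (real^'m) set) \<times> ((int_vecs :: (real^'n) set) - {0})"
 define C where "C = (%(p, q). {\<beta> :: real^'m. norm (\<alpha> *v q + \<beta> + p) <= \<psi> (norm q)})"
 have cP: "countable P" unfolding P_def by (intro countable_SIGMA countable_Diff countable_int_vecs)
 have "{(p, q). p \<in> int_vecs & q \<in> int_vecs - {0} & norm (\<alpha> *v q + \<beta> + p) <= \<psi> (norm q)} = {z \<in> P. \<beta> \<in> C z}" for \<beta>
  by (auto simp: P_def C_def)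
 then have "\<beta> \<in> approx_targets \<psi> \<alpha> \<longleftrightarrow> infinite {z \<in> P. \<beta> \<in> C z}" for \<beta>
  by (simp add: approx_targets_def)
 moreover have "infinite {z \<in> P. \<beta> \<in> C z} \<longleftrightarrow> (\<forall>F\<in>{F. finite F & F \<subseteq> P}. \<exists>z\<in>P - F. \<beta> \<in> C z)" for \<beta>
 proof
  assume inf: "infinite {z \<in> P. \<beta> \<in> C z}"
  show "\<forall>F\<in>{F. finite F & F \<subseteq> P}. \<exists>z\<in>P - F. \<beta> \<in> C z"
  proof
   fix F assume "F \<in> {F. finite F & F \<subseteq> P}"
   then have "\<not> {z \<in> P. \<beta> \<in> C z} \<subseteq> F" using inf finite_subset by blast
   then show "\<exists>z\<in>P - F. \<beta> \<in> C z" by blast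
  qed
 next
  assume all: "\<forall>F\<in>{F. finite F & F \<subseteq> P}. \<exists>z\<in>P - F. \<beta> \<in> C z"
  show "infinite {z \<in> P. \<beta> \<in> C z}"
  proof
   assume "finite {z \<in> P. \<beta> \<in> C z}"
   then have "{z \<in> P. \<beta> \<in> C z} \<in> {F. finite F & F \<subseteq> P}" by simp
   from bspec[OF all this] show False by simp
  qed
 qed
 ultimately have "approx_targets \<psi> \<alpha> = (\<Inter>F\<in>{F. finite F & F \<subseteq> P}. \<Union>z\<in>P - F. C z)"
  by (intro set_eqI) (simp only: INT_iff UN_iff)
 also have "... \<in> sets borel"
 proof (intro sets.countable_INT' sets.countable_UN')
  show "countable {F. finite F & F \<subseteq> P}" using cP by (rule countable_Collect_finite_subset)
  show "{F. finite F & F \<subseteq> P} ~= {}" by blast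
  show "(%F. \<Union>z\<in>P - F. C z) ` {F. finite F & F \<subseteq> P} \<subseteq> sets borel"
  proof clarify
   fix F
   have "closed (C z)" for z unfolding C_def case_prod_unfold by (intro closed_Collect_le continuous_intros)
   then show "(\<Union>z\<in>P - F. C z) \<in> sets borel"
    by (intro sets.countable_UN' countable_Diff cP) auto
  qed
 qed
 finally show ?thesis .
qed

text \<open>A supremum in the lattice of measures is not given by a formula on sets, so the
  universal property is used: restricting the supremum to the complement of \<open>X\<close> still
  gives an upper bound of the family, hence dominates the supremum, and it vanishes on
  \<open>X\<close>.\<close>

lemma null_set_SUP_measure:
 assumes sets: "!!i. i \<in> I ==> sets (P i) = sets N" and I: "I ~= {}" and X: "X \<in> sets N"
  and null: "!!i. i \<in> I ==> emeasure (P i) X = 0"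
 shows "X \<in> null_sets (SUP i\<in>I. P i)"
proof -
 define S where "S = (SUP i\<in>I. P i)"
 define D where "D = density S (indicator (space N - X))"
 have sS: "sets S = sets N" unfolding S_def by (rule sets_SUP[OF sets I])
 have sD: "sets D = sets N" by (simp add: D_def sS)
 have "P i <= D" if i: "i \<in> I" for i
 proof -
  have le: "P i <= S" unfolding S_def using i by (rule SUP_upper)
  have "emeasure (P i) A <= emeasure D A" for A
  proof (cases "A \<in> sets N")
   case A: True
   have sP: "A \<in> sets (P i)" "X \<in> sets (P i)" "A - X \<in> sets (P i)" "A \<inter> X \<in> sets (P i)"
    using A X by (auto simp: sets[OF i])
   have "emeasure (P i) A <= emeasure (P i) ((A - X) \<union> X)" using sP by (intro emeasure_mono) auto
   also have "... <= emeasure (P i) (A - X) + emeasure (P i) X" using sP by (intro emeasure_subadditive)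
   also have "... = emeasure (P i) (A - X)" by (simp add: null[OF i])
   also have "... <= emeasure S (A - X)" by (rule le_measureD3[OF le]) (simp add: sets[OF i] sS)
   also have "... = emeasure D A"
   proof -
    have "emeasure D A = (\<integral>\<^sup>+x. indicator (space N - X) x * indicator A x \<partial>S)"
     unfolding D_def using A X by (intro emeasure_density borel_measurable_indicator) (auto simp: sS intro: sets.compl_sets)
    also have "... = (\<integral>\<^sup>+x. indicator (A - X) x \<partial>S)"
     using sets.sets_into_space[OF A] by (intro nn_integral_cong) (auto simp: indicator_def)
    also have "... = emeasure S (A - X)" using A X by (intro nn_integral_indicator) (auto simp: sS)
    finally show ?thesis by simp
   qed
   finally show ?thesis .
  next
   case False
   then show ?thesis by (simp add: emeasure_notin_sets sets[OF i] sD)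
  qed
  then show ?thesis unfolding le_measure_iff using sets_eq_imp_space_eq[of "P i" D] by (auto simp: sets[OF i] sD le_fun_def)
 qed
 then have "S <= D" unfolding S_def by (rule SUP_least)
 then have "emeasure S X <= emeasure D X" by (rule le_measureD3) (simp add: sS sD)
 also have "... = (\<integral>\<^sup>+x. indicator (space N - X) x * indicator X x \<partial>S)"
  unfolding D_def using X by (intro emeasure_density borel_measurable_indicator) (auto simp: sS intro: sets.compl_sets)
 also have "... = (\<integral>\<^sup>+x. 0 \<partial>S)" by (intro nn_integral_cong) (auto simp: indicator_def)
 finally have "emeasure S X = 0" by simp
 then show ?thesis unfolding S_def[symmetric] using X by (auto simp: null_sets_def sS)
qed

text \<open>Stated for an arbitrary \<open>g\<close>, since it is applied to the Jacobian factor
  without a measurability proof: through \<open>measure_of\<close> the value on a null set is either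
  an integral over it or the default 0.\<close>

lemma null_sets_density_of_null:
 assumes "Z \<in> null_sets N" shows "Z \<in> null_sets (density N g)"
proof -
 have "emeasure (density N g) Z = 0"
  unfolding density_def emeasure_measure_of_conv using nn_integral_null_set[OF assms, of g] by simp
 then show ?thesis using assms by (auto simp: null_sets_def)
qed

text \<open>Each nondegenerate point has a chart ball on which the exceptional parameters are null,
  and by Lindelof countably many ball images cover these points. The exceptional sets are pulled
  back to any given chart by \<open>local_param_transfer_negligible\<close>. The degenerate points
  lie in a null set of the supremum, which is null for every single patch.\<close>

theorem full_measure_on_nondegenerate_submanifold:
 fixes M T :: "(real^'m) set"
 assumes M: "analytic_submanifold TYPE('d::finite) M" "nondegenerate TYPE('d) M" and T: "T \<in> sets borel"
  and loc: "!!f :: real^'d => real^'m. !!x c e. multi_series f x c e ==> inj_on f (ball x e) ==>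
   (!!u r. u ~= 0 ==> 0 < r ==> \<exists>y\<in>ball x r. u \<bullet> f y ~= u \<bullet> f x) ==>
   \<exists>r>0. AE y in lborel. y \<in> ball x r --> f y \<in> T"
 shows "M - T \<in> null_sets (induced_measure TYPE('d) M)"
proof -
 define I where "I = {(U :: (real^'d) set, f). local_param M U f}"
 define P where "P = (%(U, f :: real^'d => real^'m). patch_measure U f)"
 have ind: "induced_measure TYPE('d) M = (SUP i\<in>I. P i)" by (simp add: induced_measure_def I_def P_def)
 have setsP: "sets (P i) = sets borel" for i by (simp add: P_def patch_measure_def case_prod_unfold)
 \<comment> \<open>The empty chart always qualifies, so the family is nonempty even if
   \<open>M\<close> is empty, and its supremum carries the Borel sets.\<close>
 have "local_param M {} (f :: real^'d => real^'m)" for f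
  by (auto simp: local_param_def real_analytic_on_def homeomorphism_def)
 then have Ine: "I ~= {}" unfolding I_def by blast
 define \<F> where "\<F> = {f ` ball x r | (f :: real^'d => real^'m) x r. EX U. local_param M U f & ball x r \<subseteq> U &
   negligible {z \<in> ball x r. f z \<notin> T}}"
 obtain \<G> where \<G>: "\<G> \<subseteq> \<F>" "countable \<G>" "\<Union>\<G> = \<Union>\<F>"
 proof (rule Lindelof_openin[of \<F> M])
  fix W assume "W \<in> \<F>"
  then show "openin (top_of_set M) W" unfolding \<F>_def using local_param_image_openin by blast
 qed
 have ND: "y \<in> \<Union>\<F>" if nd: "nondegenerate_at TYPE('d) M y" for y
 proof -
  obtain U f x where U: "local_param M U (f :: real^'d => real^'m)" "x \<in> U" "f x = y" "nondegenerate_param f x"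
   using nd unfolding nondegenerate_at_def by (elim exE conjE)
  have oU: "open U" "real_analytic_on f U" and inj: "inj_on f U"
   using U(1) unfolding local_param_def homeomorphism_def by (blast, blast, auto intro: inj_on_inverseI)
  obtain c e where ms: "multi_series f x c e" "ball x e \<subseteq> U"
   using real_analytic_multi_series[OF oU(2) U(2) oU(1)] by blast
  obtain r where r: "0 < r" "AE y in lborel. y \<in> ball x r --> f y \<in> T"
   using loc[OF ms(1) inj_on_subset[OF inj ms(2)] nondegenerate_param_not_constant[OF U(4)]] by blast
  define s where "s = min r e"
  have s: "0 < s" "ball x s \<subseteq> U" using r(1) ms multi_series.e_pos[OF ms(1)] by (auto simp: s_def)
  have "negligible {z \<in> ball x s. f z \<notin> T}"
   by (rule negligible_subset[OF negligible_of_AE_lborel[OF r(2)]]) (auto simp: s_def)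
  then have "f ` ball x s \<in> \<F>" unfolding \<F>_def using U(1) s(2) by blast
  moreover have "y \<in> f ` ball x s" using U(3) s(1) by force
  ultimately show ?thesis by blast
 qed
 have Mb: "M \<in> sets borel" by (rule submanifold_borel[OF M(1)])
 obtain N0 where N0: "N0 \<in> null_sets (induced_measure TYPE('d) M)" "{y. \<not> (y \<in> M --> nondegenerate_at TYPE('d) M y)} \<subseteq> N0"
 proof -
  have "space (induced_measure TYPE('d) M) = UNIV"
   using sets_eq_imp_space_eq[OF sets_SUP[of I P borel, OF setsP Ine]] by (simp add: ind)
  then show ?thesis using M(2) that unfolding nondegenerate_def eventually_ae_filter by auto
 qed
 have "emeasure (P i) (M - T) = 0" if i: "i \<in> I" for i
 proof -
  obtain U f where Uf: "i = (U, f)" "local_param M U f" using i unfolding I_def by blast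
  have oU: "open U" and cf: "continuous_on U f" using Uf(2) unfolding local_param_def homeomorphism_def by blast+
  define D where "D = density (restrict_space lborel U)
   (%x. ennreal (sqrt (det (transpose (jacobian f (at x)) ** jacobian f (at x)))))"
  have Pi: "P i = distr D borel f" by (simp add: P_def Uf(1) patch_measure_def D_def)
  \<comment> \<open>The unspecified values of the density affect neither the space nor the
    measurable sets.\<close>
  have sp: "space D = U" "sets D = sets (restrict_space borel U)"
   by (simp_all add: D_def space_restrict_space sets_restrict_space)
  have fm: "f \<in> measurable D borel"
   using borel_measurable_continuous_on_restrict[OF cf] by (simp add: measurable_cong_sets[OF sp(2) refl])
  have "emeasure (P i) N0 <= emeasure (SUP i\<in>I. P i) N0"
   by (rule le_measureD3[OF SUP_upper[OF i]]) (simp add: setsP sets_SUP[of I P borel, OF setsP Ine])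
  then have "emeasure (P i) N0 = 0" using N0(1) by (simp add: ind null_sets_def)
  moreover have N0b: "N0 \<in> sets borel" using N0(1) by (simp add: ind null_sets_def sets_SUP[of I P borel, OF setsP Ine])
  ultimately have n1: "f -` N0 \<inter> U \<in> null_sets D"
   using measurable_sets[OF fm N0b] emeasure_distr[OF fm N0b] unfolding Pi sp(1) by (simp add: null_sets_def)
  have "negligible {x \<in> U. f x \<in> W - T}" if W: "W \<in> \<G>" for W
  proof -
   from W \<G>(1) have WF: "W \<in> \<F>" by (rule subsetD[rotated])
   obtain f' x r U' where W': "W = f' ` ball x r" "local_param M U' (f' :: real^'d => real^'m)" "ball x r \<subseteq> U'" "negligible {z \<in> ball x r. f' z \<notin> T}"
    using WF unfolding \<F>_def mem_Collect_eq by (elim exE conjE)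
   have "negligible {y \<in> U. f y \<in> f' ` {z \<in> ball x r. f' z \<notin> T}}"
    by (rule local_param_transfer_negligible[OF Uf(2) W'(2,4)]) (use W'(3) in auto)
   then show ?thesis by (rule negligible_subset) (auto simp: W'(1))
  qed
  then have "negligible (\<Union>W\<in>\<G>. {x \<in> U. f x \<in> W - T})"
   using \<G>(2) by (intro negligible_countable_Union countable_image) auto
  then obtain Z where Z: "Z \<in> null_sets lborel" "(\<Union>W\<in>\<G>. {x \<in> U. f x \<in> W - T}) \<subseteq> Z"
   using null_superset_of_negligible by blast
  have "Z \<inter> U \<in> null_sets (restrict_space lborel U)"
   using null_set_Int2[OF Z(1), of U] oU by (subst null_sets_restrict_space) auto
  then have n2: "Z \<inter> U \<in> null_sets D" unfolding D_def by (rule null_sets_density_of_null)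
  have "f -` (M - T) \<inter> U \<subseteq> (f -` N0 \<inter> U) \<union> (Z \<inter> U)"
  proof
   fix x assume x: "x \<in> f -` (M - T) \<inter> U"
   show "x \<in> (f -` N0 \<inter> U) \<union> (Z \<inter> U)"
   proof (cases "nondegenerate_at TYPE('d) M (f x)")
    case True
    then have "f x \<in> \<Union>\<G>" using ND \<G>(3) by simp
    then show ?thesis using x Z(2) by blast
   next
    case False
    then show ?thesis using x N0(2) by blast
   qed
  qed
  moreover have "f -` (M - T) \<inter> U \<in> sets D" using measurable_sets[OF fm, of "M - T"] Mb T by (simp only: sp(1) sets.Diff)
  ultimately have "f -` (M - T) \<inter> U \<in> null_sets D" using null_sets_subset[OF null_sets.Un[OF n1 n2]] by blast
  then show ?thesis unfolding Pi using Mb T by (simp add: emeasure_distr[OF fm] sp(1) null_sets_def)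
 qed
 then show ?thesis unfolding ind using Mb T by (intro null_set_SUP_measure[where N = borel] setsP Ine) auto
qed

theorem theorem1p3:
  fixes \<alpha> :: "real^'n^'m" and i :: nat and \<psi> :: "real \<Rightarrow> real" and M :: "(real^'m) set"
  assumes "CARD('m) \<ge> 2"
    and "i \<ge> 1"
    and "\<not> approximable (phi_fun CARD('m) CARD('n) i) \<alpha>"
    and "Hardy_L \<psi>"
    and "\<forall>\<^sub>F t in at_top. \<psi> t \<ge> 0"
    and "\<not> summable (\<lambda>q::nat. real q ^ (CARD('n) - 1) * \<psi> (real q) ^ CARD('m))"
    and "analytic_submanifold TYPE('d::finite) M"
    and "nondegenerate TYPE('d) M"
  shows "M - approx_targets \<psi> \<alpha> \<in> null_sets (induced_measure TYPE('d) M)"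
proof -
  \<comment> \<open>Only \<open>h_fun\<close> of some order \<open>j >= i\<close> is seen to lie
    below \<open>\<psi>\<close>; the hypothesis on \<open>\<alpha>\<close> is transferred to that
    order because \<open>phi_fun\<close> decreases in it eventually.\<close>
  obtain j where j: "i \<le> j" "\<forall>\<^sub>F t in at_top. h_fun CARD('m) CARD('n) j t \<le> \<psi> t"
    using Hardy_L_ge_h_fun[OF assms(4,5) _ _ assms(6), of i] by auto
  show ?thesis
  proof (rule full_measure_on_nondegenerate_submanifold[OF assms(7,8) approx_targets_borel])
    fix f :: "real^'d \<Rightarrow> real^'m" and x c e
    assume ms: "multi_series f x c e" and inj: "inj_on f (ball x e)"
      and nc: "\<And>u r. u \<noteq> 0 \<Longrightarrow> 0 < r \<Longrightarrow> \<exists>y\<in>ball x r. u \<bullet> f y \<noteq> u \<bullet> f x"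
    show "\<exists>r>0. AE y in lborel. y \<in> ball x r \<longrightarrow> f y \<in> approx_targets \<psi> \<alpha>"
      by (rule multi_series.approx_targets_AE[OF ms nc inj assms(1,3) j])
  qed
qed

end
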